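(* Let $\mathfrak g=\mathfrak{sp}(2n)$ with Chevalley generators $e_i,f_i,h_i$ ($1\le i\le n$), and let $\mathfrak h\subset\mathfrak g$ be the coisotropic subalgebra generated by (a) $h_1+\cdots+h_n$, and $e_1,\ [e_1,e_2],\ [[e_1,e_2],e_3],\ \dots,\ [[e_1,e_2]\dots,e_{n-1}]$; (b) $x_n=[[e_1,e_2]\dots,e_n],\ [x_n,e_{n-1}],\ [[x_n,e_{n-1}],e_{n-2}],\ \dots,\ [[x_n,e_{n-1}]\dots,e_1]$. Let $B_h$ be the subalgebra of $U_q(\mathfrak{sp}(2n))$ (identified with $U_h(\mathfrak{sp}(2n))$) generated by (a) $K_1\cdots K_n$, and $E_1,\ [E_1,E_2]_q,\ [[E_1,E_2]_q,E_3]_q,\ \dots,\ [[E_1,E_2]_q\dots,E_{n-1}]_q$; (b) $X=[\,[[E_1,E_2]_q\dots,E_{n-1}]_q,E_n]_{q^2},\ [X,E_{n-1}]_q,\ [[X,E_{n-1}]_q,E_{n-2}]_q,\ \dots,\ [[X,E_{n-1}]_q\dots,E_1]_q$. Then $B_h$ is a quantization of $\mathfrak h$.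
   Context: Quantum group. For a finite-dimensional complex semisimple Lie algebra $\mathfrak g$ with Cartan matrix $(a_{ij})_{1\le i,j\le n}$ and symmetrizing positive integers $d_i$ (so $(d_ia_{ij})$ is symmetric), $U_q(\mathfrak g)$ is the associative algebra over $\mathbb Q(q)$ with generators $X_i^+,X_i^-,K_i,K_i^{-1}$ ($1\le i\le n$) and relations $K_iK_j=K_jK_i$, $K_iK_i^{-1}=K_i^{-1}K_i=1$, $K_iX_j^{\pm}=q^{\pm d_ia_{ij}}X_j^{\pm}K_i$, $X_i^+X_j^--X_j^-X_i^+=\delta_{ij}\frac{K_i-K_i^{-1}}{q^{d_i}-q^{-d_i}}$, and the quantum Serre relations $\sum_{r=0}^{1-a_{ij}}(-1)^r\binom{1-a_{ij}}{r}_{q^{d_i}}(X_i^{\pm})^{1-a_{ij}-r}X_j^{\pm}(X_i^{\pm})^r=0$ for $i\ne j$. Its comultiplication is $\Delta(K_i)=K_i\otimes K_i$, $\Delta(X_i^+)=X_i^+\otimes K_i+1\otimes X_i^+$, $\Delta(X_i^-)=X_i^-\otimes1+K_i^{-1}\otimes X_i^-$. Write $E_i=X_i^+$ and $[A,B]_{q^k}=AB-q^kBA$, $[A,B]=AB-BA$; iterated brackets are nested to the left. $U_q(\mathfrak g)$ is identified with the Drinfeld–Jimbo algebra $U_h(\mathfrak g)$ over $\mathbb C[[h]]$ by $q=e^{h}$, $K_i=e^{d_ihH_i}$; $U_h(\mathfrak g)/hU_h(\mathfrak g)\cong U(\mathfrak g)$, and $\pi_{U_h}:U_h(\mathfrak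 g)\to U(\mathfrak g)$ is the specialization at $h=0$. For $\mathfrak{sp}(2n)$ (type $C_n$) the simple roots are $\alpha_i=L_i-L_{i+1}$ ($i\le n-1$) and $\alpha_n=2L_n$; $d_1=\dots=d_{n-1}=1$, $d_n=2$. (The subalgebra $\mathfrak h$ is the one attached to the root $2L_1$.) Coisotropic subalgebra. A coisotropic subalgebra of a Lie bialgebra $(\mathfrak g,[\,,],\delta)$ is a Lie subalgebra $\mathfrak h$ with $\delta(\mathfrak h)\subset\mathfrak h\wedge\mathfrak g$. Here $\mathfrak g$ carries the standard Lie bialgebra structure given by the $r$-matrix $\pi=\sum_{\alpha>0}\lambda_\alpha e_\alpha\wedge f_\alpha$, $\lambda_\alpha=1/K(e_\alpha,f_\alpha)$, $K$ the Killing form and $e_\alpha,f_\alpha$ root vectors for $\alpha$, $-\alpha$. Quantization. A quantization of a coisotropic subalgebra $\mathfrak h$ of $\mathfrak g$ is a subalgebra $B_h$ of $U_h(\mathfrak g)$ which is a left (or right) coideal ($\Delta(B_h)\subset B_h\otimes U_h(\mathfrak g)$ for left) such that $B_h/hB_h\cong\pi_{U_h}(B_h)=U(\mathfrak h)$; that is, the map $B_h/hB_h\to U(\mathfrak g)$ induced by $\pi_{U_h}$ is injective with image $U(\mathfrak h)$ (equivalently $B_h\cap hU_h(\mathfrak g)=hB_h$ and $\pi_{U_h}(B_h)=U(\mathfrak h)$).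
   Formalization: Here h_i means d_i times the coroot (so h_n is twice the coroot); with plain coroots the claim fails for n ≥ 2. B_h is the h-adically closed C[[h]]-subalgebra generated by the listed elements together with h^{-1} log(K_1⋯K_n), without which its classical limit has no Cartan element. *)

theory Defs
  imports
    Complex_Main
    "HOL-Library.FuncSet"
    "HOL-Library.Poly_Mapping"
    "HOL-Library.Product_Plus"
    "HOL-Computational_Algebra.Formal_Power_Series"
    "HOL-Algebra.QuotRing"
    "HOL-Algebra.Subrings"
    "Jordan_Normal_Form.Matrix"
begin

unbundle fps_syntax

section \<open>Free algebras and their completions\<close>

text \<open>
  The free monoid on a set of letters, written additively, so that
  \<open>'g fword \<Rightarrow>\<^sub>0 complex\<close> with the convolution product of
  \<^theory>\<open>HOL-Library.Poly_Mapping\<close> is the free associative complex algebra on the letters.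
  More generally, \<open>('m \<Rightarrow>\<^sub>0 complex) fps\<close> is the \<open>h\<close>-adically complete monoid algebra of \<open>'m\<close> over
  \<open>\<complex>[[h]]\<close>, the variable \<open>fps_X\<close> playing the role of \<open>h\<close>; the library metric on
  formal power series induces the \<open>h\<close>-adic topology, to which \<open>closed\<close> refers below.
\<close>

datatype 'g fword = FWord (letters: "'g list")

instantiation fword :: (type) monoid_add
begin
definition zero_fword :: "'a fword" where "zero_fword = FWord []"
definition plus_fword :: "'a fword \<Rightarrow> 'a fword \<Rightarrow> 'a fword"
  where "plus_fword u v = FWord (letters u @ letters v)"
instance by standard (auto simp: zero_fword_def plus_fword_def)
end

type_synonym 'g falg = "'g fword \<Rightarrow>\<^sub>0 complex"
type_synonym 'm ser = "('m \<Rightarrow>\<^sub>0 complex) fps"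

abbreviation cst :: "complex \<Rightarrow> ('m::monoid_add \<Rightarrow>\<^sub>0 complex)"
  where "cst c \<equiv> Poly_Mapping.single 0 c"

abbreviation letter :: "'g \<Rightarrow> 'g falg"
  where "letter x \<equiv> Poly_Mapping.single (FWord [x]) 1"

definition scal :: "complex fps \<Rightarrow> 'm::monoid_add ser"
  where "scal c = Abs_fps (\<lambda>k. cst (c $ k))"

definition falg_lift :: "(complex \<Rightarrow> 'b) \<Rightarrow> ('g \<Rightarrow> 'b::ring_1) \<Rightarrow> 'g falg \<Rightarrow> 'b"
  where "falg_lift s \<phi> p =
    (\<Sum>w\<in>Poly_Mapping.keys p. s (Poly_Mapping.lookup p w) * prod_list (map \<phi> (letters w)))"

text \<open>The continuous \<open>\<complex>[[h]]\<close>-linear algebra map \<open>\<Sum>\<^sub>k h\<^sup>k p\<^sub>k \<mapsto> \<Sum>\<^sub>k h\<^sup>k \<phi>(p\<^sub>k)\<close>.\<close>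

definition ser_lift :: "('g \<Rightarrow> 'm::monoid_add ser) \<Rightarrow> 'g fword ser \<Rightarrow> 'm ser"
  where "ser_lift \<phi> f =
    Abs_fps (\<lambda>m. \<Sum>k\<le>m. falg_lift (\<lambda>c. fps_const (cst c)) \<phi> (f $ k) $ (m - k))"

definition ring_on :: "'a::ring_1 set \<Rightarrow> 'a ring"
  where "ring_on C = \<lparr>carrier = C, monoid.mult = (*), one = 1, zero = 0, add = (+)\<rparr>"

definition words_over :: "'g set \<Rightarrow> 'g fword set"
  where "words_over G = {w. set (letters w) \<subseteq> G}"

definition falg_ring :: "'m::monoid_add set \<Rightarrow> ('m \<Rightarrow>\<^sub>0 complex) ring"
  where "falg_ring M = ring_on {p. Poly_Mapping.keys p \<subseteq> M}"

definition ser_ring :: "'m::monoid_add set \<Rightarrow> 'm ser ring"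
  where "ser_ring M = ring_on {f. \<forall>k. Poly_Mapping.keys (f $ k) \<subseteq> M}"

definition closed_ideal :: "('m::monoid_add ser) ring \<Rightarrow> 'm ser set \<Rightarrow> 'm ser set"
  where "closed_ideal R S = \<Inter>{I. ideal I R \<and> closed I \<and> S \<subseteq> I}"


section \<open>The Lie bialgebra \<open>sp(2n)\<close>\<close>

definition symp_J :: "nat \<Rightarrow> complex mat"
  where "symp_J n = four_block_mat (0\<^sub>m n n) (1\<^sub>m n) (- 1\<^sub>m n) (0\<^sub>m n n)"

definition sp :: "nat \<Rightarrow> complex mat set"
  where "sp n = {A \<in> carrier_mat (2*n) (2*n).
    transpose_mat A * symp_J n + symp_J n * A = 0\<^sub>m (2*n) (2*n)}"

definition lie :: "complex mat \<Rightarrow> complex mat \<Rightarrow> complex mat"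
  where "lie A B = A * B - B * A"

text \<open>Matrix units with indices starting from 1, as in the mathematical literature.\<close>

definition unit_mx :: "nat \<Rightarrow> nat \<Rightarrow> nat \<Rightarrow> complex mat"
  where "unit_mx n r s = mat (2*n) (2*n) (\<lambda>(a,b). if a + 1 = r \<and> b + 1 = s then 1 else 0)"

text \<open>The simple roots are \<open>\<alpha>\<^sub>i = L\<^sub>i - L\<^sub>i\<^sub>+\<^sub>1\<close> for \<open>i < n\<close> and \<open>\<alpha>\<^sub>n = 2L\<^sub>n\<close>.\<close>

definition chev_e :: "nat \<Rightarrow> nat \<Rightarrow> complex mat"
  where "chev_e n i = (if i < n then unit_mx n i (i+1) - unit_mx n (n+i+1) (n+i)
                       else unit_mx n n (2*n))"

definition chev_f :: "nat \<Rightarrow> nat \<Rightarrow> complex mat"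
  where "chev_f n i = transpose_mat (chev_e n i)"

definition coroot :: "nat \<Rightarrow> nat \<Rightarrow> complex mat"
  where "coroot n i = lie (chev_e n i) (chev_f n i)"

definition symd :: "nat \<Rightarrow> nat \<Rightarrow> nat"
  where "symd n i = (if i = n then 2 else 1)"

text \<open>
  The Cartan generators \<open>h\<^sub>i\<close> are normalised by \<open>K\<^sub>i = exp(h h\<^sub>i)\<close>, that is \<open>[h\<^sub>i, e\<^sub>j] = d\<^sub>i a\<^sub>i\<^sub>j e\<^sub>j\<close>:
  \<open>h\<^sub>i\<close> is \<open>d\<^sub>i\<close> times the coroot \<open>H\<^sub>i\<close>, so the two differ for \<open>i = n\<close> only. The classical limit of
  \<open>(K\<^sub>1\<cdots>K\<^sub>n - 1)/h\<close> is \<open>d\<^sub>1H\<^sub>1 + \<dots> + d\<^sub>nH\<^sub>n\<close>, which is \<open>h\<^sub>1 + \<dots> + h\<^sub>n\<close> in this normalisation but not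
  the sum of the coroots if \<open>n \<ge> 2\<close>.
\<close>

definition chev_h :: "nat \<Rightarrow> nat \<Rightarrow> complex mat"
  where "chev_h n i = of_nat (symd n i) \<cdot>\<^sub>m coroot n i"

definition cartan :: "nat \<Rightarrow> nat \<Rightarrow> nat \<Rightarrow> int"
  where "cartan n i j =
    (if i = j then 2
     else if i + 1 = j then (if j = n then - 2 else - 1)
     else if j + 1 = i then - 1
     else 0)"

definition lie_subalgebra :: "nat \<Rightarrow> complex mat set \<Rightarrow> bool"
  where "lie_subalgebra n L \<longleftrightarrow> L \<subseteq> sp n \<and> 0\<^sub>m (2*n) (2*n) \<in> L \<and>
    (\<forall>c. \<forall>x\<in>L. c \<cdot>\<^sub>m x \<in> L) \<and> (\<forall>x\<in>L. \<forall>y\<in>L. x + y \<in> L \<and> lie x y \<in> L)"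

definition lie_generated :: "nat \<Rightarrow> complex mat set \<Rightarrow> complex mat set"
  where "lie_generated n S = \<Inter>{L. lie_subalgebra n L \<and> S \<subseteq> L}"

text \<open>Traces of endomorphisms of a space \<open>V\<close> of \<open>N \<times> N\<close> matrices, and the Killing form.\<close>

definition lin_comb :: "nat \<Rightarrow> nat \<Rightarrow> (nat \<Rightarrow> complex) \<Rightarrow> (nat \<Rightarrow> complex mat) \<Rightarrow> complex mat"
  where "lin_comb N m c b = mat N N (\<lambda>ij. \<Sum>r<m. c r * (b r $$ ij))"

definition is_basis :: "nat \<Rightarrow> complex mat set \<Rightarrow> nat \<Rightarrow> (nat \<Rightarrow> complex mat) \<Rightarrow> bool"
  where "is_basis N V m b \<longleftrightarrow> (\<forall>r<m. b r \<in> V) \<and>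
    (\<forall>v\<in>V. \<exists>!c. c \<in> extensional {..<m} \<and> v = lin_comb N m c b)"

definition lin_trace :: "nat \<Rightarrow> complex mat set \<Rightarrow> (complex mat \<Rightarrow> complex mat) \<Rightarrow> complex"
  where "lin_trace N V T = (THE t. \<exists>m b M. is_basis N V m b \<and>
    (\<forall>s<m. T (b s) = lin_comb N m (\<lambda>r. M r s) b) \<and> t = (\<Sum>r<m. M r r))"

definition killing :: "nat \<Rightarrow> complex mat \<Rightarrow> complex mat \<Rightarrow> complex"
  where "killing n x y = lin_trace (2*n) (sp n) (\<lambda>z. lie x (lie y z))"

text \<open>
  Root vectors for the positive roots \<open>L\<^sub>i - L\<^sub>j\<close>, \<open>L\<^sub>i + L\<^sub>j\<close> (\<open>i < j\<close>) and \<open>2L\<^sub>i\<close>; the transpose of a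
  root vector for \<open>\<alpha>\<close> is one for \<open>-\<alpha>\<close>.
\<close>

definition pos_root_vectors :: "nat \<Rightarrow> complex mat set"
  where "pos_root_vectors n =
    {unit_mx n i j - unit_mx n (n+j) (n+i) | i j. 1 \<le> i \<and> i < j \<and> j \<le> n} \<union>
    {unit_mx n i (n+j) + unit_mx n j (n+i) | i j. 1 \<le> i \<and> i < j \<and> j \<le> n} \<union>
    {unit_mx n i (n+i) | i. 1 \<le> i \<and> i \<le> n}"

text \<open>Tensors in \<open>gl(N) \<otimes> gl(N)\<close> are given by their four-index arrays of coordinates.\<close>

type_synonym tensor2 = "nat \<times> nat \<times> nat \<times> nat \<Rightarrow> complex"

definition tens :: "nat \<Rightarrow> complex mat \<Rightarrow> complex mat \<Rightarrow> tensor2"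
  where "tens N a b = (\<lambda>(i,j,k,l).
    if i < N \<and> j < N \<and> k < N \<and> l < N then a $$ (i,j) * b $$ (k,l) else 0)"

definition wedge :: "nat \<Rightarrow> complex mat \<Rightarrow> complex mat \<Rightarrow> tensor2"
  where "wedge N a b = (\<lambda>t. tens N a b t - tens N b a t)"

definition wedge_space :: "nat \<Rightarrow> complex mat set \<Rightarrow> complex mat set \<Rightarrow> tensor2 set"
  where "wedge_space N A B = {(\<lambda>t. \<Sum>r<(m::nat). wedge N (a r) (b r) t) | m a b.
    (\<forall>r<m. a r \<in> A \<and> b r \<in> B)}"

text \<open>
  The cobracket \<open>\<delta>(x) = [x \<otimes> 1 + 1 \<otimes> x, \<pi>]\<close> of the \<open>r\<close>-matrix
  \<open>\<pi> = \<Sum>\<^sub>\<alpha> \<lambda>\<^sub>\<alpha> e\<^sub>\<alpha> \<and> f\<^sub>\<alpha>\<close>, \<open>\<lambda>\<^sub>\<alpha> = 1/K(e\<^sub>\<alpha>, f\<^sub>\<alpha>)\<close>.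
\<close>

definition cobracket :: "nat \<Rightarrow> complex mat \<Rightarrow> tensor2"
  where "cobracket n x = (\<lambda>t. \<Sum>e\<in>pos_root_vectors n. 1 / killing n e (transpose_mat e) *
    (wedge (2*n) (lie x e) (transpose_mat e) t + wedge (2*n) e (lie x (transpose_mat e)) t))"

definition coisotropic :: "nat \<Rightarrow> complex mat set \<Rightarrow> bool"
  where "coisotropic n L \<longleftrightarrow> lie_subalgebra n L \<and>
    (\<forall>x\<in>L. cobracket n x \<in> wedge_space (2*n) L (sp n))"


section \<open>The enveloping algebra \<open>U(sp(2n))\<close>\<close>

definition env_relators :: "nat \<Rightarrow> complex mat falg set"
  where "env_relators n =
    {letter (a \<cdot>\<^sub>m x + b \<cdot>\<^sub>m y) - cst a * letter x - cst b * letter y | a b x y. x \<in> sp n \<and> y \<in> sp n} \<union>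
    {letter x * letter y - letter y * letter x - letter (lie x y) | x y. x \<in> sp n \<and> y \<in> sp n}"

definition env_ideal :: "nat \<Rightarrow> complex mat falg set"
  where "env_ideal n = genideal (falg_ring (words_over (sp n))) (env_relators n)"

definition Uenv :: "nat \<Rightarrow> complex mat falg set ring"
  where "Uenv n = falg_ring (words_over (sp n)) Quot env_ideal n"

definition env_cls :: "nat \<Rightarrow> complex mat falg \<Rightarrow> complex mat falg set"
  where "env_cls n p = env_ideal n +>\<^bsub>falg_ring (words_over (sp n))\<^esub> p"

text \<open>\<open>U(L)\<close>, embedded in \<open>U(sp(2n))\<close> as the unital subalgebra generated by \<open>L\<close>.\<close>

definition Uenv_sub :: "nat \<Rightarrow> complex mat set \<Rightarrow> complex mat falg set set"
  where "Uenv_sub n L = \<Inter>{A. subring A (Uenv n) \<and> (\<forall>c. env_cls n (cst c) \<in> A) \<and>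
    (\<forall>x\<in>L. env_cls n (letter x) \<in> A)}"


section \<open>The Drinfeld--Jimbo algebra \<open>U\<^sub>h(sp(2n))\<close>\<close>

datatype qgen = Xp nat | Xm nat | Hh nat

definition qgens :: "nat \<Rightarrow> qgen set"
  where "qgens n = Xp ` {1..n} \<union> Xm ` {1..n} \<union> Hh ` {1..n}"

abbreviation gen :: "qgen \<Rightarrow> qgen fword ser"
  where "gen x \<equiv> fps_const (letter x)"

definition qpow :: "int \<Rightarrow> complex fps"  \<comment> \<open>\<open>q\<^sup>k = e\<^sup>k\<^sup>h\<close>\<close>
  where "qpow k = fps_exp (of_int k)"

text \<open>
  The symmetric quantum integers, factorials and binomials at \<open>q\<^sup>d\<close>. The quotients are exact:
  division of formal power series over a field cancels common powers of \<open>h\<close>.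
\<close>

definition qint :: "nat \<Rightarrow> nat \<Rightarrow> complex fps"
  where "qint d m = (qpow (int (d*m)) - qpow (- int (d*m))) / (qpow (int d) - qpow (- int d))"

definition qfact :: "nat \<Rightarrow> nat \<Rightarrow> complex fps"
  where "qfact d m = (\<Prod>k=1..m. qint d k)"

definition qbinom :: "nat \<Rightarrow> nat \<Rightarrow> nat \<Rightarrow> complex fps"
  where "qbinom d m r = qfact d m / (qfact d r * qfact d (m - r))"

definition exp_h :: "complex \<Rightarrow> 'g falg \<Rightarrow> 'g fword ser"  \<comment> \<open>\<open>e\<^sup>c\<^sup>h\<^sup>x\<close>\<close>
  where "exp_h c x = Abs_fps (\<lambda>k. cst (c ^ k / fact k) * x ^ k)"

definition Kgen :: "nat \<Rightarrow> nat \<Rightarrow> qgen fword ser"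
  where "Kgen n i = exp_h (of_nat (symd n i)) (letter (Hh i))"

definition Kinv :: "nat \<Rightarrow> nat \<Rightarrow> qgen fword ser"
  where "Kinv n i = exp_h (- of_nat (symd n i)) (letter (Hh i))"

text \<open>
  \<open>(K\<^sub>i - K\<^sub>i\<^sup>-\<^sup>1) / (q\<^sup>d - q\<^sup>-\<^sup>d)\<close> with \<open>d = d\<^sub>i\<close>, computed as
  \<open>h / (q\<^sup>d - q\<^sup>-\<^sup>d) \<cdot> (K\<^sub>i - K\<^sub>i\<^sup>-\<^sup>1) / h\<close>, both factors of which exist \<open>h\<close>-adically.
\<close>

definition Kquot :: "nat \<Rightarrow> nat \<Rightarrow> qgen fword ser"
  where "Kquot n i =
    scal (fps_X / (qpow (int (symd n i)) - qpow (- int (symd n i)))) *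
    fps_shift 1 (Kgen n i - Kinv n i)"

definition serre :: "nat \<Rightarrow> (nat \<Rightarrow> qgen) \<Rightarrow> nat \<Rightarrow> nat \<Rightarrow> qgen fword ser"
  where "serre n X i j = (let m = nat (1 - cartan n i j) in
    \<Sum>r\<le>m. (- 1) ^ r * scal (qbinom (symd n i) m r) *
      gen (X i) ^ (m - r) * gen (X j) * gen (X i) ^ r)"

definition Uh_relators :: "nat \<Rightarrow> qgen fword ser set"
  where "Uh_relators n =
    {gen (Hh i) * gen (Hh j) - gen (Hh j) * gen (Hh i) | i j. i \<in> {1..n} \<and> j \<in> {1..n}} \<union>
    {gen (Hh i) * gen (Xp j) - gen (Xp j) * gen (Hh i) - of_int (cartan n i j) * gen (Xp j)
      | i j. i \<in> {1..n} \<and> j \<in> {1..n}} \<union>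
    {gen (Hh i) * gen (Xm j) - gen (Xm j) * gen (Hh i) + of_int (cartan n i j) * gen (Xm j)
      | i j. i \<in> {1..n} \<and> j \<in> {1..n}} \<union>
    {gen (Xp i) * gen (Xm j) - gen (Xm j) * gen (Xp i) - (if i = j then Kquot n i else 0)
      | i j. i \<in> {1..n} \<and> j \<in> {1..n}} \<union>
    {serre n X i j | X i j. X \<in> {Xp, Xm} \<and> i \<in> {1..n} \<and> j \<in> {1..n} \<and> i \<noteq> j}"

abbreviation Fh :: "nat \<Rightarrow> qgen fword ser ring"
  where "Fh n \<equiv> ser_ring (words_over (qgens n))"

definition Uh_ideal :: "nat \<Rightarrow> qgen fword ser set"
  where "Uh_ideal n = closed_ideal (Fh n) (Uh_relators n)"

definition Uh :: "nat \<Rightarrow> qgen fword ser set ring"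
  where "Uh n = Fh n Quot Uh_ideal n"

definition Uh_cls :: "nat \<Rightarrow> qgen fword ser \<Rightarrow> qgen fword ser set"
  where "Uh_cls n f = Uh_ideal n +>\<^bsub>Fh n\<^esub> f"

text \<open>
  The completed tensor square of \<open>U\<^sub>h\<close>: a quotient of the complete monoid algebra of pairs of words.
\<close>

definition inl :: "qgen fword ser \<Rightarrow> (qgen fword \<times> qgen fword) ser"  \<comment> \<open>\<open>f \<mapsto> f \<otimes> 1\<close>\<close>
  where "inl = ser_lift (\<lambda>x. fps_const (Poly_Mapping.single (FWord [x], 0) 1))"

definition inr :: "qgen fword ser \<Rightarrow> (qgen fword \<times> qgen fword) ser"  \<comment> \<open>\<open>f \<mapsto> 1 \<otimes> f\<close>\<close>
  where "inr = ser_lift (\<lambda>x. fps_const (Poly_Mapping.single (0, FWord [x]) 1))"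

abbreviation Fh2 :: "nat \<Rightarrow> (qgen fword \<times> qgen fword) ser ring"
  where "Fh2 n \<equiv> ser_ring (words_over (qgens n) \<times> words_over (qgens n))"

definition Uh2_ideal :: "nat \<Rightarrow> (qgen fword \<times> qgen fword) ser set"
  where "Uh2_ideal n = closed_ideal (Fh2 n) (inl ` Uh_ideal n \<union> inr ` Uh_ideal n)"

definition Uh2 :: "nat \<Rightarrow> (qgen fword \<times> qgen fword) ser set ring"
  where "Uh2 n = Fh2 n Quot Uh2_ideal n"

definition Uh2_cls :: "nat \<Rightarrow> (qgen fword \<times> qgen fword) ser \<Rightarrow> (qgen fword \<times> qgen fword) ser set"
  where "Uh2_cls n f = Uh2_ideal n +>\<^bsub>Fh2 n\<^esub> f"

text \<open>
  \<open>A \<otimes> B\<close> inside the completed tensor square: the closed \<open>\<complex>[[h]]\<close>-submodule generated by the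
  \<open>a \<otimes> b\<close>. A set of cosets is closed for the quotient topology iff its union is closed.
\<close>

definition ctensor :: "nat \<Rightarrow> qgen fword ser set set \<Rightarrow> qgen fword ser set set
    \<Rightarrow> (qgen fword \<times> qgen fword) ser set set"
  where "ctensor n A B = \<Inter>{T. additive_subgroup T (Uh2 n) \<and>
      (\<forall>c. \<forall>t\<in>T. Uh2_cls n (scal c) \<otimes>\<^bsub>Uh2 n\<^esub> t \<in> T) \<and> closed (\<Union>T) \<and>
      (\<forall>f\<in>carrier (Fh n). \<forall>g\<in>carrier (Fh n).
        Uh_cls n f \<in> A \<longrightarrow> Uh_cls n g \<in> B \<longrightarrow> Uh2_cls n (inl f * inr g) \<in> T)}"

fun Delta_gen :: "nat \<Rightarrow> qgen \<Rightarrow> (qgen fword \<times> qgen fword) ser"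
  where
    "Delta_gen n (Hh i) = inl (gen (Hh i)) + inr (gen (Hh i))"
  | "Delta_gen n (Xp i) = inl (gen (Xp i)) * inr (Kgen n i) + inr (gen (Xp i))"
  | "Delta_gen n (Xm i) = inl (gen (Xm i)) + inl (Kinv n i) * inr (gen (Xm i))"

text \<open>
  Maps on quotients are given, as for quotient groups in the library, by \<open>the_elem\<close> of the image of
  a coset; their independence of representatives is the usual fact that the relations are preserved.
\<close>

definition Delta :: "nat \<Rightarrow> qgen fword ser set \<Rightarrow> (qgen fword \<times> qgen fword) ser set"
  where "Delta n u = the_elem ((\<lambda>f. Uh2_cls n (ser_lift (Delta_gen n) f)) ` u)"

fun spec_gen :: "nat \<Rightarrow> qgen \<Rightarrow> complex mat falg"
  where
    "spec_gen n (Hh i) = letter (coroot n i)"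
  | "spec_gen n (Xp i) = letter (chev_e n i)"
  | "spec_gen n (Xm i) = letter (chev_f n i)"

text \<open>The specialization \<open>\<pi>\<close> at \<open>h = 0\<close>.\<close>

definition specialization :: "nat \<Rightarrow> qgen fword ser set \<Rightarrow> complex mat falg set"
  where "specialization n u = the_elem ((\<lambda>f. env_cls n (falg_lift cst (spec_gen n) (f $ 0))) ` u)"


section \<open>Quantizations of coisotropic subalgebras\<close>

text \<open>Subalgebras of \<open>U\<^sub>h\<close> are unital, \<open>\<complex>[[h]]\<close>-linear and closed in the \<open>h\<close>-adic topology.\<close>

definition h_subalgebra :: "nat \<Rightarrow> qgen fword ser set set \<Rightarrow> bool"
  where "h_subalgebra n B \<longleftrightarrow> subring B (Uh n) \<and> (\<forall>c. Uh_cls n (scal c) \<in> B) \<and> closed (\<Union>B)"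

definition h_generated :: "nat \<Rightarrow> qgen fword ser set set \<Rightarrow> qgen fword ser set set"
  where "h_generated n S = \<Inter>{B. h_subalgebra n B \<and> S \<subseteq> B}"

definition left_coideal :: "nat \<Rightarrow> qgen fword ser set set \<Rightarrow> bool"
  where "left_coideal n B \<longleftrightarrow> Delta n ` B \<subseteq> ctensor n B (carrier (Uh n))"

definition right_coideal :: "nat \<Rightarrow> qgen fword ser set set \<Rightarrow> bool"
  where "right_coideal n B \<longleftrightarrow> Delta n ` B \<subseteq> ctensor n (carrier (Uh n)) B"

text \<open>
  The last two conditions say that the map \<open>B/hB \<rightarrow> U(sp(2n))\<close> induced by the specialization is
  injective with image \<open>U(L)\<close>.
\<close>

definition quantization :: "nat \<Rightarrow> complex mat set \<Rightarrow> qgen fword ser set set \<Rightarrow> bool"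
  where "quantization n L B \<longleftrightarrow> coisotropic n L \<and> h_subalgebra n B \<and>
    (left_coideal n B \<or> right_coideal n B) \<and>
    {b \<in> B. specialization n b = \<zero>\<^bsub>Uenv n\<^esub>} = (\<lambda>b. Uh_cls n (scal fps_X) \<otimes>\<^bsub>Uh n\<^esub> b) ` B \<and>
    specialization n ` B = Uenv_sub n L"


section \<open>The coisotropic subalgebra and its quantum analogue\<close>

text \<open>\<open>[[e\<^sub>1,e\<^sub>2]\<dots>,e\<^sub>k]\<close>, and \<open>[[x\<^sub>n,e\<^sub>n\<^sub>-\<^sub>1]\<dots>,e\<^sub>k]\<close> (which is \<open>x\<^sub>n\<close> for \<open>k = n\<close>).\<close>

definition up_cl :: "nat \<Rightarrow> nat \<Rightarrow> complex mat"
  where "up_cl n k = foldl lie (chev_e n 1) (map (chev_e n) [2..<Suc k])"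

definition down_cl :: "nat \<Rightarrow> nat \<Rightarrow> complex mat"
  where "down_cl n k = foldl lie (up_cl n n) (map (chev_e n) (rev [k..<n]))"

definition sub_h :: "nat \<Rightarrow> complex mat set"
  where "sub_h n = lie_generated n
    ({mat (2*n) (2*n) (\<lambda>ij. \<Sum>i=1..n. chev_h n i $$ ij)} \<union>
     {up_cl n k | k. 1 \<le> k \<and> k \<le> n - 1} \<union> {down_cl n k | k. 1 \<le> k \<and> k \<le> n})"

definition qbr :: "int \<Rightarrow> qgen fword ser \<Rightarrow> qgen fword ser \<Rightarrow> qgen fword ser"
  where "qbr k A B = A * B - scal (qpow k) * (B * A)"

definition up_q :: "nat \<Rightarrow> qgen fword ser"
  where "up_q k = foldl (qbr 1) (gen (Xp 1)) (map (\<lambda>i. gen (Xp i)) [2..<Suc k])"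

definition X_q :: "nat \<Rightarrow> qgen fword ser"
  where "X_q n = (if n = 1 then gen (Xp 1) else qbr 2 (up_q (n - 1)) (gen (Xp n)))"

definition down_q :: "nat \<Rightarrow> nat \<Rightarrow> qgen fword ser"
  where "down_q n k = foldl (qbr 1) (X_q n) (map (\<lambda>i. gen (Xp i)) (rev [k..<n]))"

text \<open>
  In \<open>U\<^sub>h\<close> the product of the \<open>K\<^sub>i\<close> is \<open>e\<^sup>h\<^sup>D\<close> with \<open>D = d\<^sub>1H\<^sub>1 + \<dots> + d\<^sub>nH\<^sub>n\<close>. Over \<open>\<rat>(q)\<close> the algebra
  generated by \<open>K = K\<^sub>1\<cdots>K\<^sub>n\<close> contains \<open>(K - 1)/(q - 1)\<close>, but the closed \<open>\<complex>[[h]]\<close>-algebra generated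
  by \<open>K\<close> does not. The generator \<open>K\<close> of \<open>B\<^sub>h\<close> is therefore accompanied by \<open>D\<close>, its logarithm divided
  by \<open>h\<close>, just as the \<open>H\<^sub>i\<close> accompany the \<open>K\<^sub>i\<close> in the identification of \<open>U\<^sub>q\<close> with \<open>U\<^sub>h\<close>. The closed
  subalgebra generated by \<open>K\<close> and \<open>(K - 1)/(q - 1)\<close> is the one generated by \<open>K\<close> and \<open>D\<close>.
\<close>

definition K_prod :: "nat \<Rightarrow> qgen fword ser"
  where "K_prod n = prod_list (map (Kgen n) [1..<Suc n])"

definition K_log :: "nat \<Rightarrow> qgen fword ser"
  where "K_log n = (\<Sum>i=1..n. of_nat (symd n i) * gen (Hh i))"

definition sub_B :: "nat \<Rightarrow> qgen fword ser set set"
  where "sub_B n = h_generated n (Uh_cls n `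
    ({K_prod n, K_log n} \<union>
     {up_q k | k. 1 \<le> k \<and> k \<le> n - 1} \<union> {down_q n k | k. 1 \<le> k \<and> k \<le> n}))"

end

theory Submission
  imports Defs "HOL-Computational_Algebra.Polynomial"
begin

text \<open>
  Let \<open>v\<^sub>1, \<dots>, v\<^sub>2\<^sub>n\<^sub>-\<^sub>1\<close> be the generators of \<open>B\<^sub>h\<close> other than \<open>K\<close> and its logarithm \<open>D\<close>; each is a \<open>q\<close>-bracket of its
  predecessor with a Chevalley generator. The quantum Serre relations express \<open>v\<^sub>i E\<^sub>k\<close> for \<open>k \<ge> 2\<close> by \<open>E\<^sub>k v\<^sub>i\<close> and
  \<open>v\<^sub>i\<^sub>+\<^sub>1\<close>. It follows that the coproduct of \<open>v\<^sub>i\<close>, \<open>i \<le> 2n - 2\<close>, is a sum of terms \<open>v\<^sub>j \<otimes> u\<close> and \<open>1 \<otimes> u\<close>, and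
  \<open>v\<^sub>2\<^sub>n\<^sub>-\<^sub>1\<close> lies in the algebra generated by the others, so \<open>B\<^sub>h\<close> is a left coideal. Twisting \<open>[v\<^sub>i, v\<^sub>j]\<close> by the \<open>E\<^sub>k\<close> shows
  inductively that it is a scalar multiple of \<open>v\<^sub>2\<^sub>n\<^sub>-\<^sub>1\<close> plus \<open>h\<close> times an element of the algebra generated by the \<open>v\<close>'s;
  hence ordered monomials in \<open>D\<close> and the \<open>v\<^sub>i\<close> span that algebra modulo \<open>h\<close>.

  The independence of these monomials modulo \<open>h\<close> is detected without the Poincare--Birkhoff--Witt theorem:
  convolution products of matrix coefficients of the vector representation are functionals on \<open>U\<^sub>h\<close> whose values at
  \<open>h = 0\<close> factor through \<open>U(sp(2n))\<close> and read off the leading coefficients. So an element of the algebra that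
  vanishes at \<open>h = 0\<close> is \<open>h\<close> times another one. This gives the quantization property, and also that the algebra
  is closed, hence equal to \<open>B\<^sub>h\<close>.

  For coisotropy no value of the Killing form matters: the span of the classical limits of the \<open>v\<^sub>i\<close> is normalised
  by a parabolic subalgebra, which contains every \<open>e\<^sub>\<alpha>\<close>, and \<open>f\<^sub>\<alpha>\<close> unless \<open>e\<^sub>\<alpha>\<close> lies in that span, and the
  two terms coming from \<open>D\<close> cancel.
\<close>

text \<open>The vector representation needs no deformation: there \<open>e_i\<close> and
  \<open>f_i\<close> square to zero and a coroot satisfies \<open>H^3 = H\<close>, so the classical
  matrices already satisfy the quantum relations. If a combination \<open>\<phi>\<close> of matrix
  entries vanishes on the empty word, its d-th convolution power at \<open>h = 0\<close> vanishes on
  words shorter than d and is \<open>d!\<close> times the product of the values of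
  \<open>\<phi>\<close> on words of length d. These values can be prescribed on the 2n generators,
  so the top layer of an element gives a polynomial function, which must vanish. The commutators
  follow the weights. For k >= 2 the twisted commutator with \<open>E_k\<close> is a skew derivation
  that sends \<open>v_i\<close>, i <= 2n - 2, to \<open>v_(i+1)\<close> or 0, so that a congruence
  for \<open>[v_1, v_j]\<close> propagates to the other \<open>[v_i, v_j]\<close>;
  \<open>E_1 = v_1\<close> itself is handled by Serre relations. Quotients and closures shape the
  presentation: subalgebras, ideals and tensor products are replaced by sets of representatives in
  complete monoid algebras, where closedness is a condition on coefficients, and identities modulo
  an ideal are computed in one ring type containing all quotients.\<close>

no_notation vec_index (infixl "$" 100)

section \<open>Linear extensions and power series\<close>

lemma pm_sum_singles: "(p :: _ \<Rightarrow>\<^sub>0 _::comm_monoid_add) = (\<Sum>w\<in>Poly_Mapping.keys p. Poly_Mapping.single w (Poly_Mapping.lookup p w))"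
  by (rule poly_mapping_eqI)
     (auto simp: lookup_sum lookup_single when_def in_keys_iff)

lemma pm_induct [consumes 1, case_names zero single add]:
  fixes p :: "_ \<Rightarrow>\<^sub>0 _::comm_monoid_add"
  assumes "Poly_Mapping.keys p \<subseteq> M" and "P 0"
    and "\<And>w c. w \<in> M \<Longrightarrow> P (Poly_Mapping.single w c)"
    and "\<And>p q. P p \<Longrightarrow> P q \<Longrightarrow> P (p + q)"
  shows "P p"
proof -
  have "A \<subseteq> M \<Longrightarrow> P (\<Sum>w\<in>A. Poly_Mapping.single w (Poly_Mapping.lookup p w))" if "finite A" for A
    using that by induction (auto intro: assms)
  from this[of "Poly_Mapping.keys p"] assms(1) show ?thesis
    using pm_sum_singles[of p] by simp
qed

definition pm_lin :: "(complex \<Rightarrow> 'b::ring_1) \<Rightarrow> ('m \<Rightarrow> 'b) \<Rightarrow> ('m \<Rightarrow>\<^sub>0 complex) \<Rightarrow> 'b"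
  where "pm_lin s \<chi> p = (\<Sum>w\<in>Poly_Mapping.keys p. s (Poly_Mapping.lookup p w) * \<chi> w)"

text \<open>Scalars enter through several maps (constants, constant series, \<open>scal\<close>,
  \<open>sc\<close>) into noncommutative rings; the locale provides one set of rules for moving them
  around.\<close>

locale central_hom =
  fixes s :: "'k::comm_ring_1 \<Rightarrow> 'b::ring_1"
  assumes add: "s (a + b) = s a + s b"
    and mult: "s (a * b) = s a * s b"
    and one: "s 1 = 1"
    and central: "s a * x = x * s a"
begin

lemma zero: "s 0 = 0"
  using add[of 0 0] by simp

lemma uminus: "s (- a) = - s a"
  using add[of a "- a"] zero by (simp add: eq_neg_iff_add_eq_0 add.commute)

lemma diff: "s (a - b) = s a - s b"
  using add[of a "- b"] uminus by simp

lemma left: "x * (s a * y) = s a * (x * y)"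
  by (metis central mult.assoc)

lemma power: "s (a ^ k) = s a ^ k"
  by (induction k) (auto simp: one mult)

end

lemma pm_lin_zero [simp]: "pm_lin s \<chi> 0 = 0"
  by (simp add: pm_lin_def)

context
  fixes s :: "complex \<Rightarrow> 'b::ring_1"
  assumes s: "central_hom s"
begin

interpretation central_hom s by (fact s)

lemma pm_lin_superset:
  assumes "finite A" "Poly_Mapping.keys p \<subseteq> A"
  shows "pm_lin s \<chi> p = (\<Sum>w\<in>A. s (Poly_Mapping.lookup p w) * \<chi> w)"
  unfolding pm_lin_def using assms
  by (intro sum.mono_neutral_left) (auto simp: in_keys_iff zero)

lemma pm_lin_single: "pm_lin s \<chi> (Poly_Mapping.single w c) = s c * \<chi> w"
  by (subst pm_lin_superset[of "{w}"]) auto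

lemma pm_lin_add: "pm_lin s \<chi> (p + q) = pm_lin s \<chi> p + pm_lin s \<chi> q"
proof -
  let ?A = "Poly_Mapping.keys p \<union> Poly_Mapping.keys q"
  have "finite ?A" "Poly_Mapping.keys (p + q) \<subseteq> ?A"
    using keys_add[of p q] by auto
  then show ?thesis
    by (simp add: pm_lin_superset[of ?A] lookup_add add distrib_right sum.distrib)
qed

lemma pm_lin_mult:
  assumes "\<And>u v. \<chi> (u + v) = \<chi> u * \<chi> v"
  shows "pm_lin s \<chi> (p * q) = pm_lin s \<chi> p * pm_lin s \<chi> q"
proof (induction p rule: pm_induct[OF subset_UNIV])
  case (2 u c)
  show ?case
  proof (induction q rule: pm_induct[OF subset_UNIV])
    case (2 v d)
    have "s (c * d) * (\<chi> u * \<chi> v) = s c * \<chi> u * (s d * \<chi> v)"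
      by (simp only: mult mult.assoc left[of "\<chi> u" d])
    then show ?case by (simp add: mult_single pm_lin_single assms)
  qed (auto simp: pm_lin_add algebra_simps)
qed (auto simp: pm_lin_add algebra_simps)

lemma pm_lin_cst_mult:
  fixes p :: "'m::monoid_add \<Rightarrow>\<^sub>0 complex"
  shows "pm_lin s \<chi> (cst c * p) = s c * pm_lin s \<chi> p"
  by (induction p rule: pm_induct[OF subset_UNIV])
     (auto simp: pm_lin_add distrib_left mult_single pm_lin_single mult mult.assoc)

end

lemma central_hom_cst: "central_hom (cst :: complex \<Rightarrow> ('m::monoid_add \<Rightarrow>\<^sub>0 complex))"
proof
  fix a and x :: "'m \<Rightarrow>\<^sub>0 complex"
  show "cst a * x = x * cst a"
    by (induction x rule: pm_induct[OF subset_UNIV]) (auto simp: mult_single algebra_simps)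
qed (auto simp: single_add mult_single)

lemma central_hom_fps_const:
  assumes "central_hom s"
  shows "central_hom (\<lambda>c. fps_const (s c))"
proof -
  interpret central_hom s by fact
  show ?thesis
    by standard (simp_all add: add mult one fps_eq_iff central[of _ "_ $ _"])
qed

lemmas central_hom_fps_cst = central_hom_fps_const[OF central_hom_cst]

lemma central_hom_complex_fps: "central_hom (fps_const :: complex \<Rightarrow> complex fps)"
  by standard (auto simp: mult.commute)

lemma central_hom_id: "central_hom (\<lambda>c::complex. c)"
  by standard auto

lemma cst_eq: "cst (c::complex) * p = p * cst c"
  using central_hom.central[OF central_hom_cst] .

lemma prod_list_letters_add:
  "prod_list (map \<phi> (letters (u + v))) =
    prod_list (map \<phi> (letters u)) * prod_list (map \<phi> (letters v))"
  by (simp add: plus_fword_def)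

lemma letters_0 [simp]: "letters 0 = []"
  by (simp add: zero_fword_def)

lemma falg_lift_pm_lin:
  "falg_lift s \<phi> = pm_lin s (\<lambda>w. prod_list (map \<phi> (letters w)))"
  by (rule ext) (simp add: falg_lift_def pm_lin_def)

lemma falg_lift_simps:
  assumes "central_hom s"
  shows "falg_lift s \<phi> (p + q) = falg_lift s \<phi> p + falg_lift s \<phi> q"
    and "falg_lift s \<phi> (p * q) = falg_lift s \<phi> p * falg_lift s \<phi> q"
    and "falg_lift s \<phi> (Poly_Mapping.single w c) = s c * prod_list (map \<phi> (letters w))"
    and "falg_lift s \<phi> 0 = 0"
    and "falg_lift s \<phi> 1 = 1"
proof -
  show 1: "falg_lift s \<phi> (Poly_Mapping.single w c) = s c * prod_list (map \<phi> (letters w))" for w c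
    by (simp add: falg_lift_pm_lin pm_lin_single[OF assms])
  show "falg_lift s \<phi> 1 = 1"
    using 1[of 0 1] central_hom.one[OF assms] by simp
qed (simp_all add: falg_lift_pm_lin pm_lin_add[OF assms]
      pm_lin_mult[OF assms prod_list_letters_add])

lemma additive_uminus:
  fixes L :: "'a::ab_group_add \<Rightarrow> 'b::ab_group_add"
  assumes "\<And>p q. L (p + q) = L p + L q"
  shows "L 0 = 0" and "L (- p) = - L p" and "L (p - q) = L p - L q"
    and "L (sum f A) = (\<Sum>x\<in>A. L (f x))"
proof -
  show 0: "L 0 = 0" using assms[of 0 0] by simp
  show m: "L (- p) = - L p" for p
    using assms[of p "- p"] 0 by (simp add: eq_neg_iff_add_eq_0 add.commute)
  show "L (p - q) = L p - L q" using assms[of p "- q"] m by simp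
  show "L (sum f A) = (\<Sum>x\<in>A. L (f x))"
    by (induction A rule: infinite_finite_induct) (auto simp: assms 0)
qed

text \<open>The common form of two constructions: \<open>ser_lift\<close>, which extends algebra
  maps, and the pairing of series with functionals, which are only linear.\<close>

definition ser_ext :: "('a \<Rightarrow> 'b fps) \<Rightarrow> 'a fps \<Rightarrow> 'b::comm_monoid_add fps"
  where "ser_ext L f = Abs_fps (\<lambda>m. \<Sum>k\<le>m. L (f $ k) $ (m - k))"

lemma ser_lift_ext: "ser_lift \<phi> = ser_ext (falg_lift (\<lambda>c. fps_const (cst c)) \<phi>)"
  by (rule ext) (simp add: ser_lift_def ser_ext_def)

lemma ser_ext_add:
  fixes L :: "'a::monoid_add \<Rightarrow> 'b::comm_monoid_add fps"
  assumes "\<And>p q. L (p + q) = L p + L q"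
  shows "ser_ext L (f + g) = ser_ext L f + ser_ext L g"
  by (rule fps_ext) (simp add: ser_ext_def assms sum.distrib)

text \<open>The map on the left factor is allowed to differ from \<open>L\<close>, so that the same
  rearrangement of coefficients also yields linearity over \<open>scal\<close> for maps that are not
  multiplicative.\<close>

lemma ser_ext_mult:
  fixes L L1 :: "'a::ring_1 \<Rightarrow> 'b::ring_1 fps"
  assumes add: "\<And>p q. L (p + q) = L p + L q"
    and mult: "\<And>i q. L (f $ i * q) = L1 (f $ i) * L q"
  shows "ser_ext L (f * g) = ser_ext L1 f * ser_ext L g"
proof (rule fps_ext)
  fix m
  have "ser_ext L (f * g) $ m =
      (\<Sum>k\<le>m. \<Sum>i\<le>k. \<Sum>j\<le>m-k. L1 (f $ i) $ j * L (g $ (k - i)) $ (m - k - j))"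
    by (simp add: ser_ext_def fps_mult_nth additive_uminus(4)[OF add] mult atLeast0AtMost
        fps_sum_nth)
  also have "\<dots> = (\<Sum>(k,i,j)\<in>(SIGMA k:{..m}. SIGMA i:{..k}. {..m-k}).
      L1 (f $ i) $ j * L (g $ (k - i)) $ (m - k - j))"
    by (simp add: sum.Sigma)
  \<comment> \<open>Regroups by the total order \<open>a = i + j\<close> contributed by the left
    factor and the index \<open>l = k - i\<close> of the coefficient of g.\<close>
  also have "\<dots> = (\<Sum>(a,i,l)\<in>(SIGMA a:{..m}. SIGMA i:{..a}. {..m-a}).
      L1 (f $ i) $ (a - i) * L (g $ l) $ (m - a - l))"
    by (rule sum.reindex_bij_witness[where i = "\<lambda>(a,i,l). (i+l,i,a-i)" and j = "\<lambda>(k,i,j). (i+j,i,k-i)"])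
       (auto simp: add.commute)
  also have "\<dots> = (\<Sum>a\<le>m. \<Sum>i\<le>a. \<Sum>l\<le>m-a. L1 (f $ i) $ (a - i) * L (g $ l) $ (m - a - l))"
    by (simp add: sum.Sigma)
  also have "\<dots> = (ser_ext L1 f * ser_ext L g) $ m"
    by (simp add: ser_ext_def fps_mult_nth atLeast0AtMost sum_product)
  finally show "ser_ext L (f * g) $ m = (ser_ext L1 f * ser_ext L g) $ m" .
qed

lemma ser_ext_const:
  fixes L :: "'a::zero \<Rightarrow> 'b::comm_monoid_add fps"
  assumes "L 0 = 0"
  shows "ser_ext L (fps_const p) = L p"
proof (rule fps_ext)
  fix m
  have "L (if k = 0 then p else 0) $ (m - k) = (if k = 0 then L p $ m else 0)" for k
    by (simp add: assms)
  then have "ser_ext L (fps_const p) $ m = (\<Sum>k\<le>m. if k = 0 then L p $ m else 0)"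
    by (simp add: ser_ext_def)
  then show "ser_ext L (fps_const p) $ m = L p $ m" by simp
qed

lemma ser_ext_nth0: "ser_ext L f $ 0 = L (f $ 0) $ 0"
  by (simp add: ser_ext_def)

lemma scal_nth [simp]: "scal c $ k = cst (c $ k)"
  by (simp add: scal_def)

lemma central_hom_scal: "central_hom (scal :: complex fps \<Rightarrow> 'm::monoid_add ser)"
proof
  fix a b :: "complex fps" and x :: "'m ser"
  show "scal (a + b) = (scal a + scal b :: 'm ser)"
    by (rule fps_ext) (simp add: single_add)
  show "scal (a * b) = (scal a * scal b :: 'm ser)"
    by (rule fps_ext)
       (simp add: fps_mult_nth mult_single additive_uminus(4)[of cst, OF single_add])
  show "scal 1 = (1 :: 'm ser)"
    by (rule fps_ext) auto
  show "scal a * x = x * scal a"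
  proof (rule fps_ext)
    fix m
    have "(\<Sum>i=0..m. cst (a $ i) * x $ (m - i)) = (\<Sum>i=0..m. cst (a $ (m - i)) * x $ i)"
      by (rule sum.reindex_bij_witness[where i = "\<lambda>i. m - i" and j = "\<lambda>i. m - i"]) auto
    then show "(scal a * x) $ m = (x * scal a) $ m"
      by (simp add: fps_mult_nth cst_eq)
  qed
qed

interpretation scal: central_hom "scal :: complex fps \<Rightarrow> 'm::monoid_add ser"
  by (rule central_hom_scal)

lemma scal_X: "scal fps_X = fps_X"
  by (rule fps_ext) (simp add: fps_X_def)

lemma scal_const: "scal (fps_const c) = fps_const (cst c)"
  by (rule fps_ext) simp

lemma ser_ext_scal_mult:
  fixes L :: "('m::monoid_add \<Rightarrow>\<^sub>0 complex) \<Rightarrow> 'b::ring_1 fps"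
  assumes s: "central_hom s" and add: "\<And>p q. L (p + q) = L p + L q"
    and c: "\<And>c q. L (cst c * q) = fps_const (s c) * L q"
  shows "ser_ext L (scal c * f) = Abs_fps (\<lambda>k. s (c $ k)) * ser_ext L f"
proof -
  \<comment> \<open>The coefficient of the neutral element serves as a left inverse of
    \<open>cst\<close>; the map is evaluated at constants only.\<close>
  define L1 :: "('m \<Rightarrow>\<^sub>0 complex) \<Rightarrow> 'b fps" where "L1 p = fps_const (s (Poly_Mapping.lookup p 0))" for p
  have "ser_ext L (scal c * f) = ser_ext L1 (scal c) * ser_ext L f"
    by (rule ser_ext_mult[OF add]) (simp add: L1_def c)
  moreover have "ser_ext L1 (scal c) = Abs_fps (\<lambda>k. s (c $ k))"
  proof (rule fps_ext)
    fix m
    have "ser_ext L1 (scal c) $ m = (\<Sum>k\<le>m. if k = m then s (c $ m) else 0)"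
      unfolding ser_ext_def by (auto simp: L1_def intro!: sum.cong)
    then show "ser_ext L1 (scal c) $ m = Abs_fps (\<lambda>k. s (c $ k)) $ m" by simp
  qed
  ultimately show ?thesis by simp
qed

lemma ser_lift_add: "ser_lift \<phi> (f + g) = ser_lift \<phi> f + ser_lift \<phi> g"
  unfolding ser_lift_ext by (rule ser_ext_add) (rule falg_lift_simps[OF central_hom_fps_cst])

lemma ser_lift_mult: "ser_lift \<phi> (f * g) = ser_lift \<phi> f * ser_lift \<phi> g"
  unfolding ser_lift_ext
  by (rule ser_ext_mult) (rule falg_lift_simps[OF central_hom_fps_cst])+

lemma ser_lift_scal: "ser_lift \<phi> (scal c) = scal c"
proof -
  have "ser_lift \<phi> (scal c * 1) = Abs_fps (\<lambda>k. cst (c $ k)) * ser_lift \<phi> (fps_const 1)"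
    unfolding ser_lift_ext fps_const_1_eq_1
    by (rule ser_ext_scal_mult[OF central_hom_cst])
       (simp_all add: falg_lift_simps[OF central_hom_fps_cst] zero_fword_def)
  moreover have "ser_lift \<phi> (fps_const 1) = 1"
    unfolding ser_lift_ext by (subst ser_ext_const) (simp_all add: falg_lift_simps[OF central_hom_fps_cst])
  ultimately show ?thesis by (simp add: scal_def)
qed

lemma ser_lift_const: "ser_lift \<phi> (fps_const p) = falg_lift (\<lambda>c. fps_const (cst c)) \<phi> p"
  unfolding ser_lift_ext by (rule ser_ext_const) (rule falg_lift_simps[OF central_hom_fps_cst])

lemma ser_lift_gen [simp]: "ser_lift \<phi> (fps_const (letter x)) = \<phi> x"
  by (simp add: ser_lift_const falg_lift_simps[OF central_hom_fps_cst])

lemma ser_lift_0 [simp]: "ser_lift \<phi> 0 = 0"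
  and ser_lift_uminus: "ser_lift \<phi> (- f) = - ser_lift \<phi> f"
  and ser_lift_diff: "ser_lift \<phi> (f - g) = ser_lift \<phi> f - ser_lift \<phi> g"
  and ser_lift_sum: "ser_lift \<phi> (sum F A) = (\<Sum>x\<in>A. ser_lift \<phi> (F x))"
  using additive_uminus[of "ser_lift \<phi>", OF ser_lift_add] by auto

lemma ser_lift_1 [simp]: "ser_lift \<phi> 1 = 1"
  using ser_lift_scal[of \<phi> 1] by (simp add: scal.one)

lemma ser_lift_power: "ser_lift \<phi> (f ^ k) = ser_lift \<phi> f ^ k"
  by (induction k) (simp_all add: ser_lift_mult)

lemma ser_lift_of_nat [simp]: "ser_lift \<phi> (of_nat k) = of_nat k"
  by (induction k) (simp_all add: ser_lift_add)

lemma ser_lift_of_int [simp]: "ser_lift \<phi> (of_int k) = of_int k"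
  by (cases k) (simp_all add: ser_lift_uminus ser_lift_diff ser_lift_add)

lemma ser_lift_X [simp]: "ser_lift \<phi> fps_X = fps_X"
  using ser_lift_scal[of \<phi> fps_X] by (simp add: scal_X)

lemma fps_X_eq_shift:
  fixes f :: "'a::ring_1 fps"
  shows "f $ 0 = 0 \<Longrightarrow> f = fps_X * fps_shift 1 f"
  by (rule fps_ext) (auto simp: gr0_conv_Suc split: nat.splits)

lemma fps_X_mult_cancel: "fps_X * f = fps_X * g \<Longrightarrow> f = (g :: 'a::ring_1 fps)"
proof (rule fps_ext)
  fix m assume "fps_X * f = fps_X * g"
  then have "(fps_X * f) $ Suc m = (fps_X * g) $ Suc m" by simp
  then show "f $ m = g $ m" by simp
qed

text \<open>\<open>Kquot\<close> contains a division by h, and its coproduct requires that algebra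
  maps commute with this division. Both sides agree after multiplication by h, which is
  injective.\<close>

lemma ser_lift_shift:
  assumes "f $ 0 = 0"
  shows "ser_lift \<phi> (fps_shift 1 f) = fps_shift 1 (ser_lift \<phi> f)"
proof -
  have "ser_lift \<phi> f $ 0 = 0"
    using assms unfolding ser_lift_ext ser_ext_nth0
    by (simp add: falg_lift_simps[OF central_hom_fps_cst])
  then have "fps_X * fps_shift 1 (ser_lift \<phi> f) = ser_lift \<phi> f"
    using fps_X_eq_shift by metis
  also have "\<dots> = fps_X * ser_lift \<phi> (fps_shift 1 f)"
    using fps_X_eq_shift[OF assms] ser_lift_mult[of \<phi> fps_X "fps_shift 1 f"] by simp
  finally show ?thesis by (simp add: fps_X_mult_cancel)
qed

text \<open>A \<open>\<complex>[[h]]\<close>-linear map into power series is automatically continuous, hence determined by words.\<close>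

lemma hlinear_eq_0:
  fixes T :: "'m::monoid_add ser \<Rightarrow> 'b::ring_1 fps"
  assumes add: "\<And>f g. T (f + g) = T f + T g"
    and X: "\<And>f. T (fps_X * f) = fps_X * T f"
    and w: "\<And>w c. w \<in> M \<Longrightarrow> T (fps_const (Poly_Mapping.single w c)) = 0"
    and f: "\<forall>k. Poly_Mapping.keys (f $ k) \<subseteq> M"
  shows "T f = 0"
proof -
  have T0: "T 0 = 0" using additive_uminus(1)[of T, OF add] .
  have const: "T (fps_const p) = 0" if "Poly_Mapping.keys p \<subseteq> M" for p
    using that by (induction p rule: pm_induct) (auto simp: w T0 add fps_const_add[symmetric]
        simp del: fps_const_add)
  have "T f $ m = 0" if "\<forall>k. Poly_Mapping.keys (f $ k) \<subseteq> M" for m f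
    using that
  proof (induction m arbitrary: f rule: less_induct)
    case (less m)
    \<comment> \<open>Without its constant term f is h times a series, so coefficient m of
      \<open>T f\<close> is coefficient m - 1 of the value at that series.\<close>
    have "f = fps_const (f $ 0) + fps_X * fps_shift 1 f"
      by (rule fps_ext) (auto simp: gr0_conv_Suc split: nat.splits)
    then have "T f = fps_X * T (fps_shift 1 f)"
      using add X const[of "f $ 0"] less.prems by (metis add_0)
    with less show ?case by (cases m) auto
  qed
  with f show ?thesis by (intro fps_ext) auto
qed

text \<open>The distance of two distinct series is 2 to the minus the order of their difference, so
  small balls are sets of series sharing an initial segment of coefficients.\<close>

lemma closed_fps_iff:
  fixes S :: "'a::ring_1 fps set"
  shows "closed S \<longleftrightarrow> (\<forall>f. (\<forall>m. \<exists>g\<in>S. \<forall>k<m. g $ k = f $ k) \<longrightarrow> f \<in> S)"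
proof -
  \<comment> \<open>The bound is \<open>2 ^ (1 - m)\<close>: strictly below it means agreement at
    all indices below m. For m = 0 it exceeds every distance.\<close>
  have agree: "(\<forall>k<m. g $ k = f $ k) \<longleftrightarrow> dist g f < 2 / 2 ^ m" for f g :: "'a fps" and m
  proof (cases "g = f")
    case False
    then have "g - f \<noteq> 0" by simp
    then have "(\<forall>k<m. g $ k = f $ k) \<longleftrightarrow> m \<le> subdegree (g - f)"
      using subdegree_geI[of "g - f" m] nth_less_subdegree_zero[of _ "g - f"]
      by (auto simp: less_le_trans)
    also have "\<dots> \<longleftrightarrow> (2::real) ^ m < 2 * 2 ^ subdegree (g - f)"
      using power_strict_increasing_iff[of "2::real" m "Suc (subdegree (g - f))"] by auto
    also have "\<dots> \<longleftrightarrow> dist g f < 2 / 2 ^ m"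
      using False by (simp add: dist_fps_def field_simps)
    finally show ?thesis .
  qed auto
  have small: "\<exists>m. 2 / 2 ^ m < e" if "e > 0" for e :: real
  proof -
    have "\<exists>m. (1/2::real) ^ m < e / 2"
      by (rule real_arch_pow_inv) (use that in auto)
    then obtain m where "(1/2::real) ^ m < e / 2" by blast
    then show ?thesis by (intro exI[of _ m]) (simp add: field_simps)
  qed
  show ?thesis
  proof
    assume "closed S"
    then have o: "open (- S)" by (simp add: closed_def)
    show "\<forall>f. (\<forall>m. \<exists>g\<in>S. \<forall>k<m. g $ k = f $ k) \<longrightarrow> f \<in> S"
    proof (intro allI impI, rule ccontr)
      fix f assume f: "\<forall>m. \<exists>g\<in>S. \<forall>k<m. g $ k = f $ k" "f \<notin> S"
      then have "\<exists>e>0. \<forall>y. dist y f < e \<longrightarrow> y \<in> - S"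
        using o unfolding open_dist by blast
      then obtain e where e: "e > 0" "\<And>y. dist y f < e \<Longrightarrow> y \<in> - S" by blast
      obtain m where "2 / 2 ^ m < e" using small[OF e(1)] by blast
      moreover obtain g where "g \<in> S" "\<forall>k<m. g $ k = f $ k" using f(1) by blast
      ultimately show False using e(2)[of g] unfolding agree by auto
    qed
  next
    assume *: "\<forall>f. (\<forall>m. \<exists>g\<in>S. \<forall>k<m. g $ k = f $ k) \<longrightarrow> f \<in> S"
    have "open (- S)"
      unfolding open_dist
    proof
      fix f assume "f \<in> - S"
      then have "\<not> (\<forall>m. \<exists>g\<in>S. \<forall>k<m. g $ k = f $ k)" using spec[OF *, of f] by blast
      then obtain m where "\<forall>g\<in>S. \<not> (\<forall>k<m. g $ k = f $ k)" by auto
      then have "\<forall>y. dist y f < 2 / 2 ^ m \<longrightarrow> y \<in> - S" unfolding agree by blast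
      moreover have "(2::real) / 2 ^ m > 0" by simp
      ultimately show "\<exists>e>0. \<forall>y. dist y f < e \<longrightarrow> y \<in> - S" by blast
    qed
    then show "closed S" by (simp add: closed_def)
  qed
qed

lemma closed_fpsD:
  fixes S :: "'a::ring_1 fps set"
  assumes "closed S" "\<And>m. \<exists>g\<in>S. \<forall>k<m. g $ k = f $ k"
  shows "f \<in> S"
  using assms unfolding closed_fps_iff by blast

text \<open>The preimage of a closed set under a map that is non-expanding for the \<open>h\<close>-adic metric.\<close>

lemma closed_fps_preimage:
  fixes S :: "'b::ring_1 fps set" and C :: "'a::ring_1 fps set"
  assumes "closed C" "closed S"
    and "\<And>f g m. f \<in> C \<Longrightarrow> g \<in> C \<Longrightarrow> \<forall>k<m. g $ k = f $ k \<Longrightarrow> \<forall>k<m. T g $ k = T f $ k"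
  shows "closed {f \<in> C. T f \<in> S}"
  unfolding closed_fps_iff
proof (intro allI impI)
  fix f assume *: "\<forall>m. \<exists>g\<in>{f \<in> C. T f \<in> S}. \<forall>k<m. g $ k = f $ k"
  then have f: "f \<in> C" by (intro closed_fpsD[OF assms(1)]) blast
  moreover have "T f \<in> S"
  proof (rule closed_fpsD[OF assms(2)])
    fix m
    from * obtain g where "g \<in> C" "T g \<in> S" "\<forall>k<m. g $ k = f $ k" by blast
    with assms(3)[OF f] show "\<exists>g\<in>S. \<forall>k<m. g $ k = T f $ k" by blast
  qed
  ultimately show "f \<in> {f \<in> C. T f \<in> S}" by blast
qed

lemma ser_lift_cong_nth: "\<forall>k<m. g $ k = f $ k \<Longrightarrow> \<forall>k<m. ser_lift \<phi> g $ k = ser_lift \<phi> f $ k"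
  by (auto simp: ser_lift_def)

lemma mult_cong_nth:
  fixes a :: "'a::ring_1 fps"
  shows "\<forall>k<m. g $ k = f $ k \<Longrightarrow> \<forall>k<m. (a * g) $ k = (a * f) $ k"
    and "\<forall>k<m. g $ k = f $ k \<Longrightarrow> \<forall>k<m. (g * a) $ k = (f * a) $ k"
  by (auto simp: fps_mult_nth intro!: sum.cong)

section \<open>Quotients of subrings by ideals\<close>

text \<open>Subrings and ideals as sets inside a ring type, so that computations use the type class
  operations; \<open>ring_on\<close> links them to the record structures of the definitions.\<close>

locale subring_set =
  fixes C :: "'a::ring_1 set"
  assumes C_one: "1 \<in> C"
    and C_diff: "x \<in> C \<Longrightarrow> y \<in> C \<Longrightarrow> x - y \<in> C"
    and C_mult: "x \<in> C \<Longrightarrow> y \<in> C \<Longrightarrow> x * y \<in> C"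
begin

lemma C_zero: "0 \<in> C"
  using C_diff[OF C_one C_one] by simp

lemma C_uminus: "x \<in> C \<Longrightarrow> - x \<in> C"
  using C_diff[OF C_zero] by simp

lemma C_add: "x \<in> C \<Longrightarrow> y \<in> C \<Longrightarrow> x + y \<in> C"
  using C_diff[OF _ C_uminus[of y]] by simp

lemma C_sum: "(\<And>i. i \<in> A \<Longrightarrow> f i \<in> C) \<Longrightarrow> sum f A \<in> C"
  by (induction A rule: infinite_finite_induct) (auto simp: C_zero C_add)

lemma C_power: "x \<in> C \<Longrightarrow> x ^ k \<in> C"
  by (induction k) (auto simp: C_one C_mult)

lemma C_of_nat: "of_nat k \<in> C"
  by (induction k) (auto simp: C_zero C_one C_add)

lemma C_of_int: "of_int k \<in> C"
  by (cases k) (auto simp: C_of_nat C_uminus C_one C_diff)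

lemma C_prod_list: "(\<And>x. x \<in> set xs \<Longrightarrow> x \<in> C) \<Longrightarrow> prod_list xs \<in> C"
  by (induction xs) (auto simp: C_one C_mult)

lemmas C_closed = C_one C_zero C_diff C_uminus C_add C_mult C_sum C_power C_of_nat C_of_int

lemma ring_ring_on: "ring (ring_on C)"
proof (rule ringI)
  show "abelian_group (ring_on C)"
    by (rule abelian_groupI) (auto simp: ring_on_def C_zero C_add algebra_simps
        intro!: bexI[of _ "- _"] C_uminus)
  show "Group.monoid (ring_on C)"
    by (rule monoidI) (auto simp: ring_on_def C_one C_mult algebra_simps)
qed (auto simp: ring_on_def algebra_simps)

lemma ring_on_a_inv: "x \<in> C \<Longrightarrow> \<ominus>\<^bsub>ring_on C\<^esub> x = - x"
  using abelian_group.minus_equality[OF ring.is_abelian_group[OF ring_ring_on], of "- x" x]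
  by (simp add: ring_on_def C_uminus)

end

locale ideal_set = subring_set +
  fixes J :: "'a::ring_1 set"
  assumes J_sub: "J \<subseteq> C"
    and J_zero: "0 \<in> J"
    and J_diff: "x \<in> J \<Longrightarrow> y \<in> J \<Longrightarrow> x - y \<in> J"
    and J_l: "c \<in> C \<Longrightarrow> x \<in> J \<Longrightarrow> c * x \<in> J"
    and J_r: "c \<in> C \<Longrightarrow> x \<in> J \<Longrightarrow> x * c \<in> J"
begin

lemma J_uminus: "x \<in> J \<Longrightarrow> - x \<in> J"
  using J_diff[OF J_zero] by simp

lemma J_add: "x \<in> J \<Longrightarrow> y \<in> J \<Longrightarrow> x + y \<in> J"
  using J_diff[OF _ J_uminus[of y]] by simp

lemma J_sum: "(\<And>i. i \<in> A \<Longrightarrow> f i \<in> J) \<Longrightarrow> sum f A \<in> J"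
  by (induction A rule: infinite_finite_induct) (auto simp: J_zero J_add)

lemma J_C: "x \<in> J \<Longrightarrow> x \<in> C"
  using J_sub by auto

lemma J_trans: "x - y \<in> J \<Longrightarrow> y - z \<in> J \<Longrightarrow> x - z \<in> J"
  using J_add[of "x - y" "y - z"] by simp

lemma J_sym: "x - y \<in> J \<Longrightarrow> y - x \<in> J"
  using J_uminus[of "x - y"] by simp

lemma J_mult_cong:
  assumes "x - x' \<in> J" "y - y' \<in> J" "x \<in> C" "y' \<in> C"
  shows "x * y - x' * y' \<in> J"
proof -
  have "x * y - x' * y' = x * (y - y') + (x - x') * y'" by (simp add: algebra_simps)
  with assms show ?thesis by (simp add: J_add J_l J_r)
qed

lemma J_power_commute:
  assumes "x \<in> C" "y \<in> C" "x * y - y * x \<in> J"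
  shows "x ^ k * y - y * x ^ k \<in> J"
proof (induction k)
  case (Suc k)
  have "x ^ Suc k * y - y * x ^ Suc k = x * (x ^ k * y - y * x ^ k) + (x * y - y * x) * x ^ k"
    by (simp add: algebra_simps)
  with Suc assms show ?case by (simp add: J_add J_l J_r C_power)
qed (simp add: J_zero)

text \<open>Induction as in the commutative case, with errors in the ideal. The purpose is to
  multiply exponentials of elements that commute only modulo an ideal.\<close>

lemma J_binomial:
  assumes "x \<in> C" "y \<in> C" "x * y - y * x \<in> J"
  shows "(x + y) ^ k - (\<Sum>i\<le>k. of_nat (k choose i) * (x ^ i * y ^ (k - i))) \<in> J"
proof (induction k)
  case (Suc k)
  let ?P = "\<lambda>k. \<Sum>i\<le>k. of_nat (k choose i) * (x ^ i * y ^ (k - i))"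
  have "?P (Suc k) = y ^ Suc k + (\<Sum>i\<le>k. of_nat (k choose i) * (x ^ Suc i * y ^ (k - i))
      + of_nat (k choose Suc i) * (x ^ Suc i * y ^ (k - i)))"
    unfolding sum.atMost_Suc_shift by (simp add: algebra_simps)
  also have "\<dots> = x * ?P k + (\<Sum>i\<le>Suc k. of_nat (k choose i) * (x ^ i * y ^ (Suc k - i)))"
    unfolding sum.atMost_Suc_shift sum.distrib sum_distrib_left
    by (simp add: mult.assoc mult_of_nat_commute[symmetric] algebra_simps binomial_eq_0)
       (metis (no_types, lifting) mult.assoc mult_of_nat_commute)
  finally have P: "?P (Suc k) = x * ?P k + (\<Sum>i\<le>k. of_nat (k choose i) * (x ^ i * (y * y ^ (k - i))))"
    by (simp add: Suc_diff_le binomial_eq_0)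
  \<comment> \<open>The new error is \<open>x + y\<close> times the old one, minus the commutators
    that arise when y is moved past \<open>x ^ i\<close>.\<close>
  have "(x + y) ^ Suc k - ?P (Suc k) = (x + y) * ((x + y) ^ k - ?P k)
      - (\<Sum>i\<le>k. of_nat (k choose i) * ((x ^ i * y - y * x ^ i) * y ^ (k - i)))"
  proof -
    have "y * ?P k = (\<Sum>i\<le>k. of_nat (k choose i) * (y * x ^ i * y ^ (k - i)))"
      unfolding sum_distrib_left
      by (rule sum.cong) (simp_all only: mult.assoc[symmetric] mult_of_nat_commute[of _ y])
    moreover have "(\<Sum>i\<le>k. of_nat (k choose i) * ((x ^ i * y - y * x ^ i) * y ^ (k - i))) =
        (\<Sum>i\<le>k. of_nat (k choose i) * (x ^ i * (y * y ^ (k - i)))) -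
        (\<Sum>i\<le>k. of_nat (k choose i) * (y * x ^ i * y ^ (k - i)))"
      unfolding sum_subtractf[symmetric]
      by (rule sum.cong) (simp_all only: left_diff_distrib right_diff_distrib mult.assoc)
    ultimately show ?thesis
      unfolding P by (simp add: right_diff_distrib distrib_right)
  qed
  also have "\<dots> \<in> J"
    using Suc assms J_power_commute[OF assms]
    by (intro J_diff[OF J_l J_sum[OF J_l[OF C_of_nat J_r]]]) (auto intro: C_add C_power)
  finally show ?case .
qed (simp add: J_zero)

abbreviation cl :: "'a \<Rightarrow> 'a set" where "cl f \<equiv> J +>\<^bsub>ring_on C\<^esub> f"
abbreviation Q :: "'a set ring" where "Q \<equiv> ring_on C Quot J"

lemma ideal_ring_on: "ideal J (ring_on C)"
proof (rule idealI)
  show "subgroup J (add_monoid (ring_on C))"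
  proof -
    interpret R: ring "ring_on C" by (rule ring_ring_on)
    show ?thesis
      by (rule R.add.subgroupI)
         (use J_zero J_sub in \<open>auto simp: ring_on_def J_add dest: J_C\<close>,
          metis J_C J_uminus a_inv_def ring_on_a_inv ring_on_def)
  qed
qed (auto simp: ring_on_def ring_ring_on[unfolded ring_on_def] J_l J_r)

sublocale I: ideal J "ring_on C"
  by (rule ideal_ring_on)

lemma mem_cl: "g \<in> cl f \<longleftrightarrow> g - f \<in> J"
proof -
  have "g \<in> cl f \<longleftrightarrow> (\<exists>h\<in>J. h + f = g)"
    unfolding a_r_coset_def r_coset_def by (auto simp: ring_on_def)
  also have "\<dots> \<longleftrightarrow> (\<exists>h\<in>J. h = g - f)"
    unfolding eq_diff_eq ..
  finally show ?thesis by auto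
qed

lemma cl_eq_iff: "cl f = cl g \<longleftrightarrow> f - g \<in> J"
proof
  show "cl f = cl g \<Longrightarrow> f - g \<in> J" using mem_cl[of f f] mem_cl[of f g] by (simp add: J_zero)
next
  assume "f - g \<in> J"
  then show "cl f = cl g"
    unfolding set_eq_iff mem_cl using J_trans J_sym by blast
qed

lemma carrier_Q: "carrier Q = cl ` C"
  by (auto simp: FactRing_def A_RCOSETS_def' ring_on_def a_r_coset_def r_coset_def)

lemma Q_mult: "f \<in> C \<Longrightarrow> g \<in> C \<Longrightarrow> cl f \<otimes>\<^bsub>Q\<^esub> cl g = cl (f * g)"
  using I.rcoset_mult_add[of f g] by (simp add: FactRing_def ring_on_def)

lemma Q_add: "f \<in> C \<Longrightarrow> g \<in> C \<Longrightarrow> cl f \<oplus>\<^bsub>Q\<^esub> cl g = cl (f + g)"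
  using I.a_rcos_sum[of f g] by (simp add: FactRing_def ring_on_def)

lemma Q_one: "\<one>\<^bsub>Q\<^esub> = cl 1"
  by (simp add: FactRing_def ring_on_def)

lemma Q_zero: "\<zero>\<^bsub>Q\<^esub> = cl 0"
  by (auto simp: FactRing_def mem_cl)

lemma cl_zero_iff: "cl f = \<zero>\<^bsub>Q\<^esub> \<longleftrightarrow> f \<in> J"
  by (simp add: Q_zero cl_eq_iff)

lemma ring_Q: "ring Q"
  by (rule I.quotient_is_ring)

lemma Q_uminus: "f \<in> C \<Longrightarrow> \<ominus>\<^bsub>Q\<^esub> cl f = cl (- f)"
  using abelian_group.minus_equality[OF ring.is_abelian_group[OF ring_Q], of "cl (- f)" "cl f"]
  by (simp add: carrier_Q Q_add Q_zero C_uminus)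

text \<open>The definitions state closedness of a set of cosets through its union; the union is
  recognized here as the full set of representatives.\<close>

lemma Union_Q:
  assumes "B \<subseteq> carrier Q"
  shows "\<Union>B = {f \<in> C. cl f \<in> B}"
proof -
  have "f \<in> C \<and> cl f = u" if "u \<in> B" "f \<in> u" for f u
  proof -
    from that assms obtain g where g: "g \<in> C" "u = cl g" by (auto simp: carrier_Q)
    with that have "f - g \<in> J" by (simp add: mem_cl)
    with g show ?thesis using C_add[OF J_C[of "f - g"] g(1)] by (simp add: cl_eq_iff)
  qed
  moreover have "f \<in> \<Union>B" if "cl f \<in> B" for f
    using that mem_cl[of f f] J_zero by auto
  ultimately show ?thesis by auto
qed

lemma subring_Q_iff:
  assumes "B \<subseteq> carrier Q"
  shows "subring B Q \<longleftrightarrow> subring_set {f \<in> C. cl f \<in> B}"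
proof
  assume B: "subring B Q"
  show "subring_set {f \<in> C. cl f \<in> B}"
  proof
    show "1 \<in> {f \<in> C. cl f \<in> B}" using subringE(3)[OF B] by (simp add: Q_one C_one)
    fix x y assume *: "x \<in> {f \<in> C. cl f \<in> B}" "y \<in> {f \<in> C. cl f \<in> B}"
    then show "x * y \<in> {f \<in> C. cl f \<in> B}"
      using subringE(6)[OF B, of "cl x" "cl y"] by (simp add: Q_mult C_mult)
    show "x - y \<in> {f \<in> C. cl f \<in> B}"
      using * subringE(7)[OF B, of "cl x" "cl (- y)"] subringE(5)[OF B, of "cl y"]
      by (simp add: Q_uminus Q_add C_uminus C_diff)
  qed
next
  assume "subring_set {f \<in> C. cl f \<in> B}"
  then interpret B: subring_set "{f \<in> C. cl f \<in> B}" .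
  show "subring B Q"
  proof (rule ring.subringI[OF ring_Q assms])
    show "\<one>\<^bsub>Q\<^esub> \<in> B" using B.C_one by (simp add: Q_one)
  next
    fix h assume "h \<in> B"
    with assms obtain f where "f \<in> C" "h = cl f" by (auto simp: carrier_Q)
    then show "\<ominus>\<^bsub>Q\<^esub> h \<in> B" using B.C_uminus[of f] \<open>h \<in> B\<close> by (simp add: Q_uminus)
  next
    fix h1 h2 assume "h1 \<in> B" "h2 \<in> B"
    moreover obtain f where "f \<in> C" "h1 = cl f" using assms \<open>h1 \<in> B\<close> by (auto simp: carrier_Q)
    moreover obtain g where "g \<in> C" "h2 = cl g" using assms \<open>h2 \<in> B\<close> by (auto simp: carrier_Q)
    ultimately
    show "h1 \<otimes>\<^bsub>Q\<^esub> h2 \<in> B" "h1 \<oplus>\<^bsub>Q\<^esub> h2 \<in> B"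
      using B.C_mult[of f g] B.C_add[of f g] \<open>h1 \<in> B\<close> \<open>h2 \<in> B\<close> by (simp_all add: Q_mult Q_add)
  qed
qed

text \<open>\<open>Delta\<close> and \<open>specialization\<close> are given by
  \<open>the_elem\<close> of an image, which is a singleton once the map is constant on the
  coset.\<close>

lemma the_elem_cl:
  assumes "f \<in> C" "\<And>g. g \<in> C \<Longrightarrow> g - f \<in> J \<Longrightarrow> T g = T f"
  shows "the_elem (T ` cl f) = T f"
proof -
  have "T ` cl f = {T f}"
  proof -
    have "f \<in> cl f" by (simp add: mem_cl J_zero)
    moreover have "T g = T f" if "g \<in> cl f" for g
    proof -
      have "g - f \<in> J" using that by (simp add: mem_cl)
      then show ?thesis using assms(2)[of g] C_add[OF J_C[of "g - f"] assms(1)] by simp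
    qed
    ultimately show ?thesis by blast
  qed
  then show ?thesis by simp
qed

end

lemma ideal_setI:
  assumes "subring_set C" "ideal J (ring_on C)"
  shows "ideal_set C J"
proof -
  interpret subring_set C by fact
  interpret I: ideal J "ring_on C" by fact
  have neg: "- x \<in> J" if "x \<in> J" for x
    using I.I_l_closed[of x "- 1"] that C_uminus[OF C_one] by (simp add: ring_on_def)
  show ?thesis
  proof
    show "J \<subseteq> C" using I.a_subset by (simp add: ring_on_def)
    show "0 \<in> J"
      using additive_subgroup.zero_closed[OF I.additive_subgroup_axioms] by (simp add: ring_on_def)
    show "x - y \<in> J" if "x \<in> J" "y \<in> J" for x y
      using additive_subgroup.a_closed[OF I.additive_subgroup_axioms that(1) neg[OF that(2)]]
      by (simp add: ring_on_def)
    show "c * x \<in> J" "x * c \<in> J" if "c \<in> C" "x \<in> J" for c x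
      using I.I_l_closed[of x c] I.I_r_closed[of x c] that by (auto simp: ring_on_def)
  qed
qed

lemma ideal_ring_on_iff: "subring_set C \<Longrightarrow> ideal J (ring_on C) \<longleftrightarrow> ideal_set C J"
  using ideal_setI ideal_set.ideal_ring_on by blast


section \<open>Complete monoid algebras and closed ideals\<close>

definition ser_set :: "'m set \<Rightarrow> 'm::monoid_add ser set"
  where "ser_set M = {f. \<forall>k. Poly_Mapping.keys (f $ k) \<subseteq> M}"

definition falg_set :: "'m set \<Rightarrow> ('m::monoid_add \<Rightarrow>\<^sub>0 complex) set"
  where "falg_set M = {p. Poly_Mapping.keys p \<subseteq> M}"

lemma ser_ring_eq: "ser_ring M = ring_on (ser_set M)"
  by (simp add: ser_ring_def ser_set_def)

lemma falg_ring_eq: "falg_ring M = ring_on (falg_set M)"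
  by (simp add: falg_ring_def falg_set_def)

definition submon :: "'m::monoid_add set \<Rightarrow> bool"
  where "submon M \<longleftrightarrow> 0 \<in> M \<and> (\<forall>u\<in>M. \<forall>v\<in>M. u + v \<in> M)"

lemma submon_UNIV: "submon UNIV"
  by (simp add: submon_def)

lemma submon_words_over: "submon (words_over G)"
  by (auto simp: submon_def words_over_def plus_fword_def)

lemma submon_Times: "submon M \<Longrightarrow> submon N \<Longrightarrow> submon (M \<times> N)"
  by (auto simp: submon_def zero_prod_def)

lemma subring_falg_set: "submon M \<Longrightarrow> subring_set (falg_set M)"
proof
  assume M: "submon M"
  fix x y :: "'a \<Rightarrow>\<^sub>0 complex" assume x: "x \<in> falg_set M" "y \<in> falg_set M"
  show "x - y \<in> falg_set M"
    using x keys_diff[of x y] by (auto simp: falg_set_def)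
  show "x * y \<in> falg_set M"
  proof -
    have "w \<in> M" if "w \<in> Poly_Mapping.keys (x * y)" for w
    proof -
      from that keys_mult[of x y] obtain u v
        where "w = u + v" "u \<in> Poly_Mapping.keys x" "v \<in> Poly_Mapping.keys y" by blast
      with x M show ?thesis unfolding falg_set_def submon_def by blast
    qed
    then show ?thesis by (auto simp: falg_set_def)
  qed
qed (auto simp: falg_set_def submon_def)

lemma ser_set_iff: "f \<in> ser_set M \<longleftrightarrow> (\<forall>k. f $ k \<in> falg_set M)"
  by (simp add: ser_set_def falg_set_def)

lemma subring_ser_set:
  assumes "submon M"
  shows "subring_set (ser_set M)"
proof -
  interpret subring_set "falg_set M" by (rule subring_falg_set[OF assms])
  show ?thesis
    by standard (auto simp: ser_set_iff fps_mult_nth C_closed fps_one_nth)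
qed

lemma closed_ser_set: "closed (ser_set M)"
  unfolding closed_fps_iff
proof (intro allI impI)
  fix f :: "'a ser" assume *: "\<forall>m. \<exists>g\<in>ser_set M. \<forall>k<m. g $ k = f $ k"
  show "f \<in> ser_set M"
    unfolding ser_set_iff
  proof
    fix k
    from * obtain g where "g \<in> ser_set M" "\<forall>j<Suc k. g $ j = f $ j" by blast
    then show "f $ k \<in> falg_set M" by (metis ser_set_iff lessI)
  qed
qed

lemma const_ser_set: "p \<in> falg_set M \<Longrightarrow> fps_const p \<in> ser_set M"
  by (auto simp: ser_set_iff fps_const_def falg_set_def)

lemma scal_ser_set: "submon M \<Longrightarrow> scal c \<in> ser_set M"
  by (auto simp: ser_set_iff falg_set_def submon_def split: if_splits)

lemma X_ser_set: "submon M \<Longrightarrow> fps_X \<in> ser_set M"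
  using scal_ser_set[of M fps_X] by (simp add: scal_X)

lemma letter_falg_set: "x \<in> G \<Longrightarrow> letter x \<in> falg_set (words_over G)"
  by (auto simp: falg_set_def words_over_def)

lemma cst_falg_set: "submon M \<Longrightarrow> cst c \<in> falg_set M"
  by (auto simp: falg_set_def submon_def split: if_splits)

lemma gen_ser_set: "x \<in> G \<Longrightarrow> fps_const (letter x) \<in> ser_set (words_over G)"
  by (intro const_ser_set letter_falg_set)

lemma ser_lift_closed:
  assumes M: "submon M" and "\<And>x. x \<in> G \<Longrightarrow> \<phi> x \<in> ser_set M" and f: "f \<in> ser_set (words_over G)"
  shows "ser_lift \<phi> f \<in> ser_set M"
proof -
  interpret subring_set "ser_set M" by (rule subring_ser_set[OF M])
  interpret F: subring_set "falg_set M" by (rule subring_falg_set[OF M])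
  have "falg_lift (\<lambda>c. fps_const (cst c)) \<phi> p \<in> ser_set M" if "p \<in> falg_set (words_over G)" for p
    unfolding falg_lift_def using that assms(2)
    by (intro C_sum C_mult C_prod_list const_ser_set cst_falg_set M)
       (auto simp: falg_set_def words_over_def)
  then have "falg_lift (\<lambda>c. fps_const (cst c)) \<phi> (f $ k) $ j \<in> falg_set M" for k j
    using f by (simp add: ser_set_iff)
  then show ?thesis
    by (simp add: ser_set_iff ser_lift_def F.C_sum)
qed

locale closed_ideal_set =
  fixes M :: "'m::monoid_add set" and J
  assumes M: "submon M" and ideal: "ideal_set (ser_set M) J" and closed: "closed J"
begin

sublocale ideal_set "ser_set M" J by (fact ideal)

lemma C_scal: "scal c \<in> ser_set M" by (rule scal_ser_set[OF M])
lemma C_X: "fps_X \<in> ser_set M" by (rule X_ser_set[OF M])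

lemma J_scal: "x \<in> J \<Longrightarrow> scal c * x \<in> J"
  by (rule J_l[OF C_scal])

lemma J_series:
  assumes "\<And>k. fps_const (f $ k) \<in> J"
  shows "f \<in> J"
proof (rule closed_fpsD[OF closed])
  fix m
  let ?g = "\<Sum>k<m. fps_X ^ k * fps_const (f $ k)"
  have "?g $ j = f $ j" if "j < m" for j
  proof -
    have "?g $ j = (\<Sum>k<m. if k = j then f $ j else 0)"
      unfolding fps_sum_nth by (intro sum.cong) (auto simp: fps_X_power_mult_nth)
    with that show ?thesis by simp
  qed
  moreover have "?g \<in> J" using assms by (intro J_sum J_l C_power C_X)
  ultimately show "\<exists>g\<in>J. \<forall>k<m. g $ k = f $ k" by blast
qed

text \<open>Serves where the single coefficients of f are not known to lie in the ideal, for
  instance for a commutator of two exponentials.\<close>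

lemma J_limit:
  assumes "\<And>m. \<exists>g\<in>J. \<exists>r. f - g = fps_X ^ m * r"
  shows "f \<in> J"
proof (rule closed_fpsD[OF closed])
  fix m
  from assms[of m] obtain g r where g: "g \<in> J" "f - g = fps_X ^ m * r" by blast
  have "g $ k = f $ k" if "k < m" for k
  proof -
    have "(f - g) $ k = 0" unfolding g(2) using that by (simp add: fps_X_power_mult_nth)
    then show ?thesis by simp
  qed
  with g(1) show "\<exists>g\<in>J. \<forall>k<m. g $ k = f $ k" by blast
qed

end

lemma closed_ideal_closed_ideal_set:
  assumes M: "submon M" and S: "S \<subseteq> ser_set M"
  shows "closed_ideal_set M (closed_ideal (ser_ring M) S)" and "S \<subseteq> closed_ideal (ser_ring M) S"
proof -
  let ?F = "{I. ideal I (ser_ring M) \<and> closed I \<and> S \<subseteq> I}"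
  interpret C: subring_set "ser_set M" by (rule subring_ser_set[OF M])
  have I: "ideal_set (ser_set M) I" if "I \<in> ?F" for I
    using that ideal_setI[OF C.subring_set_axioms] by (simp add: ser_ring_eq)
  \<comment> \<open>The whole algebra belongs to the intersected family; this keeps the intersection
    inside \<open>ser_set M\<close>.\<close>
  have "ideal_set (ser_set M) (ser_set M)"
    by standard (auto simp: C.C_closed)
  then have "ser_set M \<in> ?F"
    using S closed_ser_set by (simp add: ser_ring_eq ideal_ring_on_iff[OF C.subring_set_axioms])
  then have sub: "closed_ideal (ser_ring M) S \<subseteq> ser_set M"
    unfolding closed_ideal_def by blast
  show "closed_ideal_set M (closed_ideal (ser_ring M) S)"
  proof (rule closed_ideal_set.intro)
    show "closed (closed_ideal (ser_ring M) S)"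
      unfolding closed_ideal_def by (rule closed_Inter) simp
    show "ideal_set (ser_set M) (closed_ideal (ser_ring M) S)"
    proof
      show "closed_ideal (ser_ring M) S \<subseteq> ser_set M" by (fact sub)
      show "0 \<in> closed_ideal (ser_ring M) S"
        unfolding closed_ideal_def using I ideal_set.J_zero by blast
      show "x - y \<in> closed_ideal (ser_ring M) S"
        if "x \<in> closed_ideal (ser_ring M) S" "y \<in> closed_ideal (ser_ring M) S" for x y
        using that I ideal_set.J_diff unfolding closed_ideal_def by blast
      show "c * x \<in> closed_ideal (ser_ring M) S" "x * c \<in> closed_ideal (ser_ring M) S"
        if "c \<in> ser_set M" "x \<in> closed_ideal (ser_ring M) S" for c x
        using that I ideal_set.J_l ideal_set.J_r unfolding closed_ideal_def by blast+
    qed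
  qed (fact M)
  show "S \<subseteq> closed_ideal (ser_ring M) S" unfolding closed_ideal_def by blast
qed

lemma closed_ideal_least:
  assumes "closed_ideal_set M J" "S \<subseteq> J"
  shows "closed_ideal (ser_ring M) S \<subseteq> J"
proof -
  interpret closed_ideal_set M J by fact
  show ?thesis
    unfolding closed_ideal_def using assms(2) closed ideal_ring_on by (auto simp: ser_ring_eq)
qed

text \<open>The series of \<open>exp_h\<close> over an arbitrary monoid: the coproduct of
  \<open>K_i\<close> needs exponentials in the algebra of pairs of words.\<close>

definition exp_ser :: "complex \<Rightarrow> ('m::monoid_add \<Rightarrow>\<^sub>0 complex) \<Rightarrow> 'm ser"
  where "exp_ser c x = Abs_fps (\<lambda>k. cst (c ^ k / fact k) * x ^ k)"

lemma exp_h_exp_ser: "exp_h c x = exp_ser c x"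
  by (simp add: exp_h_def exp_ser_def)

lemma (in closed_ideal_set) exp_ser_add:
  assumes x: "fps_const x \<in> ser_set M" and y: "fps_const y \<in> ser_set M"
    and xy: "fps_const (x * y - y * x) \<in> J"
  shows "exp_ser c (x + y) - exp_ser c x * exp_ser c y \<in> J"
proof (rule J_series)
  fix k
  have "(exp_ser c x * exp_ser c y) $ k =
      (\<Sum>i\<le>k. cst (c ^ i / fact i) * x ^ i * (cst (c ^ (k - i) / fact (k - i)) * y ^ (k - i)))"
    by (simp add: exp_ser_def fps_mult_nth atLeast0AtMost)
  also have "\<dots> = (\<Sum>i\<le>k. cst (c ^ k / fact k) * (of_nat (k choose i) * (x ^ i * y ^ (k - i))))"
  proof (rule sum.cong)
    fix i assume "i \<in> {..k}"
    then have "c ^ i / fact i * (c ^ (k - i) / fact (k - i)) = c ^ k / fact k * of_nat (k choose i)"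
      by (simp add: binomial_fact power_add[symmetric])
    moreover have "cst (c ^ i / fact i) * x ^ i * (cst (c ^ (k - i) / fact (k - i)) * y ^ (k - i)) =
        cst (c ^ i / fact i) * cst (c ^ (k - i) / fact (k - i)) * (x ^ i * y ^ (k - i))"
      by (simp only: mult.assoc central_hom.left[OF central_hom_cst, of "x ^ i"])
    moreover have "cst (c ^ k / fact k * of_nat (k choose i)) =
        cst (c ^ k / fact k) * (of_nat (k choose i) :: 'm \<Rightarrow>\<^sub>0 complex)"
      by (simp add: mult_single flip: single_of_nat del: single_of_nat)
    ultimately show "cst (c ^ i / fact i) * x ^ i * (cst (c ^ (k - i) / fact (k - i)) * y ^ (k - i)) =
        cst (c ^ k / fact k) * (of_nat (k choose i) * (x ^ i * y ^ (k - i)))"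
      by (simp only: mult_single add_0_left mult.assoc[symmetric])
  qed simp
  finally have eq: "(exp_ser c (x + y) - exp_ser c x * exp_ser c y) $ k =
      cst (c ^ k / fact k) * ((x + y) ^ k - (\<Sum>i\<le>k. of_nat (k choose i) * (x ^ i * y ^ (k - i))))"
    by (simp add: exp_ser_def right_diff_distrib sum_distrib_left)
  have pw: "fps_const (p ^ j) = fps_const p ^ j" for p :: "'m \<Rightarrow>\<^sub>0 complex" and j
    by (induction j) (simp_all flip: fps_const_mult)
  have sm: "fps_const (sum f A) = (\<Sum>i\<in>A. fps_const (f i))" for f :: "nat \<Rightarrow> 'm \<Rightarrow>\<^sub>0 complex" and A
    by (rule additive_uminus(4)) (simp flip: fps_const_add)
  have "fps_const ((x + y) ^ k - (\<Sum>i\<le>k. of_nat (k choose i) * (x ^ i * y ^ (k - i)))) =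
      (fps_const x + fps_const y) ^ k -
      (\<Sum>i\<le>k. of_nat (k choose i) * (fps_const x ^ i * fps_const y ^ (k - i)))"
    by (simp only: fps_const_sub[symmetric] sm fps_const_mult[symmetric] pw fps_const_add[symmetric]
        fps_of_nat)
  also have "\<dots> \<in> J"
    by (rule J_binomial[OF x y]) (use xy in simp)
  finally show "fps_const ((exp_ser c (x + y) - exp_ser c x * exp_ser c y) $ k) \<in> J"
    unfolding eq using J_scal[of _ "fps_const (c ^ k / fact k)"]
    by (simp add: scal_const flip: fps_const_mult)
qed

lemma closed_ideal_set_0: "closed_ideal_set (UNIV :: 'm::monoid_add set) {0 :: 'm ser}"
proof
  show "closed {0 :: 'm ser}"
    unfolding closed_fps_iff
  proof (intro allI impI)
    fix f :: "'m ser" assume *: "\<forall>m. \<exists>g\<in>{0}. \<forall>k<m. g $ k = f $ k"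
    have "f $ k = 0" for k using *[rule_format, of "Suc k"] by auto
    then show "f \<in> {0}" by (auto intro: fps_ext)
  qed
qed (auto simp: submon_UNIV ser_set_def ideal_set_def subring_set_def ideal_set_axioms_def)

text \<open>The case of the zero ideal.\<close>

lemma exp_ser_add_commute:
  assumes "x * y = y * x"
  shows "exp_ser c (x + y) = exp_ser c x * exp_ser c y"
  using closed_ideal_set.exp_ser_add[OF closed_ideal_set_0, of x y c] assms
  by (auto simp: ser_set_def)

lemma exp_ser_cst: "exp_ser c (cst a :: 'm::monoid_add \<Rightarrow>\<^sub>0 complex) = scal (fps_exp (c * a))"
proof (rule fps_ext)
  fix k
  have pow: "cst a ^ j = (cst (a ^ j) :: 'm \<Rightarrow>\<^sub>0 complex)" for j
    by (induction j) (simp_all add: mult_single)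
  have "cst (c ^ k / fact k) * cst a ^ k = (cst (c ^ k / fact k * a ^ k) :: 'm \<Rightarrow>\<^sub>0 complex)"
    by (simp only: pow mult_single add_0_left)
  then show "exp_ser c (cst a :: 'm \<Rightarrow>\<^sub>0 complex) $ k = scal (fps_exp (c * a)) $ k"
    by (simp add: exp_ser_def power_mult_distrib)
qed

lemma ser_lift_exp_h:
  assumes "falg_lift (\<lambda>c. fps_const (cst c)) \<phi> x = fps_const y"
  shows "ser_lift \<phi> (exp_h c x) = exp_ser c y"
proof (rule fps_ext)
  fix m
  have "falg_lift (\<lambda>c. fps_const (cst c)) \<phi> (cst a * x ^ k) = fps_const (cst a * y ^ k)" for a k
  proof -
    have "falg_lift (\<lambda>c. fps_const (cst c)) \<phi> (x ^ k) = fps_const (y ^ k)"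
      by (induction k)
         (simp_all add: falg_lift_simps[OF central_hom_fps_cst] assms)
    then show ?thesis by (simp add: falg_lift_simps[OF central_hom_fps_cst] )
  qed
  then have "ser_lift \<phi> (exp_h c x) $ m =
      (\<Sum>k\<le>m. if k = m then cst (c ^ m / fact m) * y ^ m else 0)"
    unfolding ser_lift_def exp_h_def by (auto intro!: sum.cong)
  then show "ser_lift \<phi> (exp_h c x) $ m = exp_ser c y $ m"
    by (simp add: exp_ser_def)
qed


section \<open>A ring type containing all quotients\<close>

text \<open>
  The product of all quotients of subrings of the series ring by ideals. Identities between elements
  of one quotient can thereby be derived as equations in a type of class \<open>ring_1\<close>.
\<close>

definition qser_rel :: "('m::monoid_add ser set \<times> 'm ser set \<Rightarrow> 'm ser) \<Rightarrow>
    ('m ser set \<times> 'm ser set \<Rightarrow> 'm ser) \<Rightarrow> bool"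
  where "qser_rel x y \<longleftrightarrow> (\<forall>C J. ideal_set C J \<and> range scal \<subseteq> C \<longrightarrow>
    x (C, J) \<in> C \<and> y (C, J) \<in> C \<and> x (C, J) - y (C, J) \<in> J)"

quotient_type (overloaded) 'm qser =
  "'m::monoid_add ser set \<times> 'm ser set \<Rightarrow> 'm ser" / partial: qser_rel
proof (rule part_equivpI)
  show "\<exists>x. qser_rel (x :: 'm::monoid_add ser set \<times> 'm ser set \<Rightarrow> 'm ser) x"
    by (rule exI[of _ "\<lambda>_. 0"])
       (auto simp: qser_rel_def ideal_set.J_zero intro: subring_set.C_zero ideal_set.axioms(1))
  show "symp (qser_rel :: ('m::monoid_add ser set \<times> 'm ser set \<Rightarrow> 'm ser) \<Rightarrow> _)"
    by (rule sympI) (auto simp: qser_rel_def intro: ideal_set.J_sym)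
  show "transp (qser_rel :: ('m::monoid_add ser set \<times> 'm ser set \<Rightarrow> 'm ser) \<Rightarrow> _)"
    by (rule transpI) (unfold qser_rel_def, meson ideal_set.J_trans)
qed

instantiation qser :: (monoid_add) ring_1
begin

lift_definition zero_qser :: "'a qser" is "\<lambda>_. 0"
  by (auto simp: qser_rel_def ideal_set.J_zero intro: subring_set.C_zero ideal_set.axioms(1))

lift_definition one_qser :: "'a qser" is "\<lambda>_. 1"
  by (auto simp: qser_rel_def ideal_set.J_zero intro: subring_set.C_one ideal_set.axioms(1))

lift_definition plus_qser :: "'a qser \<Rightarrow> 'a qser \<Rightarrow> 'a qser" is "\<lambda>x y p. x p + y p"
  unfolding qser_rel_def
proof (intro allI impI)
  fix x x' y y' :: "'a ser set \<times> 'a ser set \<Rightarrow> 'a ser" and C J :: "'a ser set"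
  assume *: "\<forall>C J. ideal_set C J \<and> range scal \<subseteq> C \<longrightarrow> x (C, J) \<in> C \<and> x' (C, J) \<in> C \<and> x (C, J) - x' (C, J) \<in> J"
    "\<forall>C J. ideal_set C J \<and> range scal \<subseteq> C \<longrightarrow> y (C, J) \<in> C \<and> y' (C, J) \<in> C \<and> y (C, J) - y' (C, J) \<in> J"
    and CJ: "ideal_set C J \<and> range scal \<subseteq> C"
  interpret ideal_set C J using CJ by blast
  have "x (C, J) + y (C, J) - (x' (C, J) + y' (C, J)) = (x (C, J) - x' (C, J)) + (y (C, J) - y' (C, J))"
    by simp
  then show "x (C, J) + y (C, J) \<in> C \<and> x' (C, J) + y' (C, J) \<in> C \<and>
      x (C, J) + y (C, J) - (x' (C, J) + y' (C, J)) \<in> J"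
    using *[rule_format, OF CJ] by (metis C_add J_add)
qed

lift_definition minus_qser :: "'a qser \<Rightarrow> 'a qser \<Rightarrow> 'a qser" is "\<lambda>x y p. x p - y p"
  unfolding qser_rel_def
proof (intro allI impI)
  fix x x' y y' :: "'a ser set \<times> 'a ser set \<Rightarrow> 'a ser" and C J :: "'a ser set"
  assume *: "\<forall>C J. ideal_set C J \<and> range scal \<subseteq> C \<longrightarrow> x (C, J) \<in> C \<and> x' (C, J) \<in> C \<and> x (C, J) - x' (C, J) \<in> J"
    "\<forall>C J. ideal_set C J \<and> range scal \<subseteq> C \<longrightarrow> y (C, J) \<in> C \<and> y' (C, J) \<in> C \<and> y (C, J) - y' (C, J) \<in> J"
    and CJ: "ideal_set C J \<and> range scal \<subseteq> C"
  interpret ideal_set C J using CJ by blast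
  have "x (C, J) - y (C, J) - (x' (C, J) - y' (C, J)) = (x (C, J) - x' (C, J)) - (y (C, J) - y' (C, J))"
    by simp
  then show "x (C, J) - y (C, J) \<in> C \<and> x' (C, J) - y' (C, J) \<in> C \<and>
      x (C, J) - y (C, J) - (x' (C, J) - y' (C, J)) \<in> J"
    using *[rule_format, OF CJ] by (metis C_diff J_diff)
qed

lift_definition uminus_qser :: "'a qser \<Rightarrow> 'a qser" is "\<lambda>x p. - x p"
  unfolding qser_rel_def
proof (intro allI impI)
  fix x x' :: "'a ser set \<times> 'a ser set \<Rightarrow> 'a ser" and C J :: "'a ser set"
  assume *: "\<forall>C J. ideal_set C J \<and> range scal \<subseteq> C \<longrightarrow> x (C, J) \<in> C \<and> x' (C, J) \<in> C \<and> x (C, J) - x' (C, J) \<in> J"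
    and CJ: "ideal_set C J \<and> range scal \<subseteq> C"
  interpret ideal_set C J using CJ by blast
  have "- x (C, J) - - x' (C, J) = - (x (C, J) - x' (C, J))" by simp
  then show "- x (C, J) \<in> C \<and> - x' (C, J) \<in> C \<and> - x (C, J) - - x' (C, J) \<in> J"
    using *[rule_format, OF CJ] by (metis C_uminus J_uminus)
qed

lift_definition times_qser :: "'a qser \<Rightarrow> 'a qser \<Rightarrow> 'a qser" is "\<lambda>x y p. x p * y p"
  unfolding qser_rel_def
proof (intro allI impI)
  fix x x' y y' :: "'a ser set \<times> 'a ser set \<Rightarrow> 'a ser" and C J :: "'a ser set"
  assume *: "\<forall>C J. ideal_set C J \<and> range scal \<subseteq> C \<longrightarrow> x (C, J) \<in> C \<and> x' (C, J) \<in> C \<and> x (C, J) - x' (C, J) \<in> J"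
    "\<forall>C J. ideal_set C J \<and> range scal \<subseteq> C \<longrightarrow> y (C, J) \<in> C \<and> y' (C, J) \<in> C \<and> y (C, J) - y' (C, J) \<in> J"
    and CJ: "ideal_set C J \<and> range scal \<subseteq> C"
  interpret ideal_set C J using CJ by blast
  show "x (C, J) * y (C, J) \<in> C \<and> x' (C, J) * y' (C, J) \<in> C \<and>
      x (C, J) * y (C, J) - x' (C, J) * y' (C, J) \<in> J"
    using *[rule_format, OF CJ] by (auto intro: C_mult J_mult_cong)
qed

instance
proof
  have cases: "\<exists>y. a = abs_qser y \<and> qser_rel y y" for a :: "'a qser"
    by (induction a rule: qser.abs_induct) blast
  have rel: "qser_rel (\<lambda>_. 0) (\<lambda>_. 0 :: 'a ser)" "qser_rel (\<lambda>_. 1) (\<lambda>_. 1 :: 'a ser)"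
    using Quotient_to_left_total zero_qser.rsp one_qser.rsp by blast+
  note rels = rel plus_qser.rsp[THEN rel_funD, THEN rel_funD] minus_qser.rsp[THEN rel_funD, THEN rel_funD]
    times_qser.rsp[THEN rel_funD, THEN rel_funD] uminus_qser.rsp[THEN rel_funD]
  note eqs = zero_qser_def one_qser_def plus_qser.abs_eq minus_qser.abs_eq times_qser.abs_eq
    uminus_qser.abs_eq
  fix a b c :: "'a qser"
  obtain x where x: "a = abs_qser x" "qser_rel x x" using cases by blast
  obtain y where y: "b = abs_qser y" "qser_rel y y" using cases by blast
  obtain z where z: "c = abs_qser z" "qser_rel z z" using cases by blast
  show "a + b + c = a + (b + c)" "a + b = b + a" "0 + a = a" "- a + a = 0" "a - b = a + - b"
    "a * b * c = a * (b * c)" "1 * a = a" "a * 1 = a" "(a + b) * c = a * c + b * c"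
    "a * (b + c) = a * b + a * c"
    using x y z by (simp_all add: eqs rels algebra_simps)
next
  show "(0 :: 'a qser) \<noteq> 1"
  proof (transfer, unfold qser_rel_def, safe)
    assume *: "\<forall>C J. ideal_set C J \<and> range scal \<subseteq> C \<longrightarrow>
      (0::'a ser) \<in> C \<and> 1 \<in> C \<and> 0 - 1 \<in> J"
    have "ideal_set UNIV {0 :: 'a ser}"
      by standard auto
    with * show False by (metis diff_0 neg_equal_0_iff_equal singletonD top_greatest zero_neq_one)
  qed
qed

end

text \<open>Scalars are constant families, hence live in all quotients at once. This is why the
  relation only looks at subrings that contain the range of \<open>scal\<close>.\<close>

definition sc :: "complex fps \<Rightarrow> 'm::monoid_add qser"
  where "sc c = abs_qser (\<lambda>_. scal c)"

lemma scal_rel: "qser_rel (\<lambda>_. scal c) (\<lambda>_. scal c)"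
  by (auto simp: qser_rel_def ideal_set.J_zero)

lemma abs_qser_eqI: "qser_rel x y \<Longrightarrow> abs_qser x = abs_qser y"
  using Quotient_rel[OF Quotient_qser] by blast

lemma central_hom_sc: "central_hom (sc :: complex fps \<Rightarrow> 'm::monoid_add qser)"
proof
  show "sc (a + b) = (sc a + sc b :: 'm qser)" for a b
    unfolding sc_def plus_qser.abs_eq[OF scal_rel scal_rel]
    by (simp add: scal.add)
  show "sc (a * b) = (sc a * sc b :: 'm qser)" for a b
    unfolding sc_def times_qser.abs_eq[OF scal_rel scal_rel]
    by (simp add: scal.mult)
  show "sc 1 = (1 :: 'm qser)"
    unfolding sc_def one_qser_def by (simp add: scal.one)
  show "sc a * x = x * sc a" for a and x :: "'m qser"
  proof (induction x rule: qser.abs_induct)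
    case (1 y)
    show ?case
      unfolding sc_def times_qser.abs_eq[OF scal_rel 1] times_qser.abs_eq[OF 1 scal_rel]
      by (simp add: scal.central)
  qed
qed

text \<open>An element of one quotient is extended by 0 to all others. The embedding is therefore
  not unital: 1 becomes an idempotent, and scalars have to be pulled out by
  \<open>qemb_scal\<close>.\<close>

definition qemb_fun :: "'m::monoid_add ser set \<Rightarrow> 'm ser set \<Rightarrow> 'm ser \<Rightarrow>
    'm ser set \<times> 'm ser set \<Rightarrow> 'm ser"
  where "qemb_fun C J f p = (if p = (C, J) \<and> f \<in> C then f else 0)"

definition qemb :: "'m::monoid_add ser set \<Rightarrow> 'm ser set \<Rightarrow> 'm ser \<Rightarrow> 'm qser"
  where "qemb C J f = abs_qser (qemb_fun C J f)"

lemma qemb_fun_rel: "qser_rel (qemb_fun C J f) (qemb_fun C J f)"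
  by (auto simp: qemb_fun_def qser_rel_def ideal_set.J_zero
      intro: subring_set.C_zero ideal_set.axioms(1))

context
  fixes C :: "'m::monoid_add ser set" and J :: "'m ser set"
  assumes CJ: "ideal_set C J" and scal: "range scal \<subseteq> C"
begin

interpretation ideal_set C J by (fact CJ)

lemma qemb_eq_iff: "f \<in> C \<Longrightarrow> g \<in> C \<Longrightarrow> qemb C J f = qemb C J g \<longleftrightarrow> f - g \<in> J"
proof -
  assume fg: "f \<in> C" "g \<in> C"
  have "qemb C J f = qemb C J g \<longleftrightarrow> qser_rel (qemb_fun C J f) (qemb_fun C J g)"
    unfolding qemb_def using Quotient_rel[OF Quotient_qser] qemb_fun_rel by blast
  also have "\<dots> \<longleftrightarrow> f - g \<in> J"
    using fg CJ scal by (auto simp: qser_rel_def qemb_fun_def ideal_set.J_zero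
        intro: subring_set.C_zero ideal_set.axioms(1))
  finally show ?thesis .
qed

lemma qemb_add: "f \<in> C \<Longrightarrow> g \<in> C \<Longrightarrow> qemb C J (f + g) = qemb C J f + qemb C J g"
  unfolding qemb_def plus_qser.abs_eq[OF qemb_fun_rel qemb_fun_rel]
  by (rule abs_qser_eqI) (auto simp: qser_rel_def qemb_fun_def ideal_set.J_zero C_add
      intro: subring_set.C_zero ideal_set.axioms(1))

lemma qemb_diff: "f \<in> C \<Longrightarrow> g \<in> C \<Longrightarrow> qemb C J (f - g) = qemb C J f - qemb C J g"
  unfolding qemb_def minus_qser.abs_eq[OF qemb_fun_rel qemb_fun_rel]
  by (rule abs_qser_eqI) (auto simp: qser_rel_def qemb_fun_def ideal_set.J_zero C_diff
      intro: subring_set.C_zero ideal_set.axioms(1))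

lemma qemb_mult: "f \<in> C \<Longrightarrow> g \<in> C \<Longrightarrow> qemb C J (f * g) = qemb C J f * qemb C J g"
  unfolding qemb_def times_qser.abs_eq[OF qemb_fun_rel qemb_fun_rel]
  by (rule abs_qser_eqI) (auto simp: qser_rel_def qemb_fun_def ideal_set.J_zero C_mult
      intro: subring_set.C_zero ideal_set.axioms(1))

lemma qemb_scal: "f \<in> C \<Longrightarrow> qemb C J (scal c * f) = sc c * qemb C J f"
  unfolding qemb_def sc_def times_qser.abs_eq[OF scal_rel qemb_fun_rel]
  using scal by (intro abs_qser_eqI) (auto simp: qser_rel_def qemb_fun_def ideal_set.J_zero C_mult
      image_subset_iff intro: subring_set.C_zero ideal_set.axioms(1))

lemma qemb_zero: "qemb C J 0 = 0"
  using qemb_diff[OF C_zero C_zero] by simp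

end

section \<open>Quantum Serre relations of rank two and three\<close>

lemma assoc_rule: "x * y = z \<Longrightarrow> x * (y * w) = z * (w :: 'a::semigroup_mult)"
  by (simp add: mult.assoc[symmetric])

context
  fixes q qi :: "'a::ring_1"
  assumes cq: "\<And>x. x * q = q * x" and cqi: "\<And>x. x * qi = qi * x" and qqi: "q * qi = 1"
begin

lemma qiq: "qi * q = 1"
  using qqi cq by metis

lemma qq1: "q * (qi * x) = x" "qi * (q * x) = x"
  by (simp_all add: mult.assoc[symmetric] qqi qiq)

lemma cqs: "x * (q * y) = q * (x * y)" "x * (qi * y) = qi * (x * y)"
  by (metis cq mult.assoc) (metis cqi mult.assoc)

lemmas cmv = cq cqi cqs

text \<open>The Serre expression is itself a twisted commutator: \<open>Y a - q^-1 a Y\<close>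
  expands to exactly its left side.\<close>

lemma serre_lin_qcomm:
  assumes "A * a * a - (q + qi) * (a * A * a) + a * a * A = 0"
    and Y: "Y = A * a - q * (a * A)"
  shows "Y * a = qi * (a * Y)"
proof -
  have "Y * a - qi * (a * Y) = A * a * a - (q + qi) * (a * A * a) + a * a * A"
    unfolding Y by (simp add: algebra_simps cmv[of a] cmv[of A] qq1)
  with assms(1) show ?thesis by simp
qed

text \<open>The Serre expression is linear in its inner argument and B commutes with a, so the
  relation for c is inherited by the bracket of B with c.\<close>

lemma serre_lin_step:
  assumes S: "a * a * c - (q + qi) * (a * c * a) + c * a * a = 0"
    and B: "B * a = a * B" and A: "A = B * c - t * (c * B)" and t: "\<And>x. x * t = t * x"
  shows "A * a * a - (q + qi) * (a * A * a) + a * a * A = 0"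
proof -
  note ts = t[of a] t[of A] t[of B] t[of c] t[of q] t[of qi]
  have tl: "x * (t * y) = t * (x * y)" for x y by (metis t mult.assoc)
  note r = cmv[of a] cmv[of B] cmv[of c] ts tl[of a] tl[of B] tl[of c] tl[of q] tl[of qi] B assoc_rule[OF B]
  have "A * a * a - (q + qi) * (a * A * a) + a * a * A =
      B * (a * a * c - (q + qi) * (a * c * a) + c * a * a) -
      t * ((a * a * c - (q + qi) * (a * c * a) + c * a * a) * B)"
    unfolding A by (simp add: algebra_simps r)
  also have "\<dots> = 0" unfolding S by simp
  finally show ?thesis .
qed

text \<open>A chain A, a, b of type A: the double bracket commutes with the middle element. Its
  commutator with a equals that of Y with \<open>b' = b a - q a b\<close>. Expanding
  \<open>Y b'\<close> gives back \<open>b' Y - q^2 Y b' + q^2 b' Y\<close>, so invertibility of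
  \<open>1 + q^2\<close> makes Y and \<open>b'\<close> commute.\<close>

lemma serre_A3:
  assumes Ab: "A * b = b * A" and Y: "Y = A * a - q * (a * A)" and Ya: "Y * a = qi * (a * Y)"
    and S: "a * a * b - (q + qi) * (a * b * a) + b * a * a = 0"
    and u: "u * (1 + q * q) = 1"
    and W: "W = Y * b - q * (b * Y)"
  shows "W * a = a * W"
proof -
  define b' where "b' = b * a - q * (a * b)"
  have aY: "a * Y = q * (Y * a)" by (simp add: Ya qq1)
  have Aa: "A * a = Y + q * (a * A)" by (simp add: Y)
  have ab': "a * b' = q * (b' * a)"
  proof -
    have "a * b' - q * (b' * a) = - (q * (a * a * b - (q + qi) * (a * b * a) + b * a * a))"
      unfolding b'_def by (simp add: algebra_simps cmv[of a] cmv[of b] qq1)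
    then show ?thesis by (simp add: S)
  qed
  have Ab': "A * b' = b * Y - q * (Y * b) + q * (b' * A)"
  proof -
    have "A * b' = b * (A * a) - q * ((A * a) * b)"
      unfolding b'_def by (simp add: algebra_simps cmv[of A] Ab assoc_rule[OF Ab])
    also have "\<dots> = b * Y - q * (Y * b) + q * (b' * A)"
      unfolding Aa b'_def by (simp add: algebra_simps cmv[of b] Ab)
    finally show ?thesis .
  qed
  have "Y * b' = A * (a * b') - q * (a * (A * b'))"
    by (subst Y) (simp add: algebra_simps)
  also have "\<dots> = q * ((A * b') * a) - q * (a * (A * b'))"
    by (simp add: ab' cmv[of A] mult.assoc)
  also have "\<dots> = q * (b * (Y * a)) - q * q * (Y * b * a) + q * q * (b' * (A * a))
      - (q * (a * b * Y) - q * q * ((a * Y) * b) + q * q * ((a * b') * A))"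
    unfolding Ab' by (simp add: algebra_simps cmv[of a])
  also have "\<dots> = b * (a * Y) - q * (a * b * Y) - q * q * (Y * (b * a - q * (a * b)))
      + q * q * (b' * (A * a - q * (a * A)))"
    unfolding ab' aY by (simp add: algebra_simps cmv[of b] cmv[of Y] cmv[of b'])
  also have "\<dots> = b' * Y - q * q * (Y * b') + q * q * (b' * Y)"
    unfolding Y[symmetric] b'_def by (simp add: algebra_simps)
  finally have "(1 + q * q) * (Y * b') = (1 + q * q) * (b' * Y)"
    by (simp add: algebra_simps)
  then have "u * (1 + q * q) * (Y * b') = u * (1 + q * q) * (b' * Y)"
    by (simp only: mult.assoc)
  then have Yb': "Y * b' = b' * Y" by (simp add: u)
  have "W * a - a * W = Y * b * a - q * (b * (Y * a)) - (a * Y) * b + q * (a * b * Y)"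
    unfolding W by (simp add: algebra_simps cmv[of a])
  also have "\<dots> = Y * b' - b' * Y"
    unfolding b'_def
    by (simp add: algebra_simps cmv[of b] cmv[of Y] qq1 aY assoc_rule[OF aY])
  finally show ?thesis using Yb' by simp
qed

text \<open>The passage through the long root b. The cubic relation says that the double bracket c
  of b with a satisfies \<open>a c = q^2 c a\<close>. The Serre expression of Z equals the
  commutator of Y with c, and that commutator is annihilated by
  \<open>1 + q^2 + q^4\<close>.\<close>

lemma serre_C3a:
  assumes Ab: "A * b = b * A" and Y: "Y = A * a - q * (a * A)" and Ya: "Y * a = qi * (a * Y)"
    and S: "a * a * a * b - (q * q + 1 + qi * qi) * (a * a * b * a)
      + (q * q + 1 + qi * qi) * (a * b * a * a) - b * a * a * a = 0"
    and u: "u * (1 + q * q + q * q * q * q) = 1"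
    and Z: "Z = Y * b - q * q * (b * Y)"
  shows "Z * a * a - (q + qi) * (a * Z * a) + a * a * Z = 0"
proof -
  define c where "c = b * a * a - (q * q + 1) * (a * b * a) + q * q * (a * a * b)"
  define b2 where "b2 = b * a - q * q * (a * b)"
  have aY: "a * Y = q * (Y * a)" by (simp add: Ya qq1)
  have Aa: "A * a = Y + q * (a * A)" by (simp add: Y)
  have ac: "a * c = q * q * (c * a)"
  proof -
    have "a * c - q * q * (c * a) = q * q * (a * a * a * b - (q * q + 1 + qi * qi) * (a * a * b * a)
      + (q * q + 1 + qi * qi) * (a * b * a * a) - b * a * a * a)"
      unfolding c_def by (simp add: algebra_simps cmv[of a] cmv[of b] qq1)
    then show ?thesis by (simp add: S)
  qed
  have cb2: "b2 * a - a * b2 = c"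
    unfolding b2_def c_def by (simp add: algebra_simps cmv[of a] cmv[of b])
  have Ac: "A * c = q * q * (c * A) + (q + qi) * (b2 * Y - q * (Y * b2))"
    unfolding b2_def c_def
    by (simp add: algebra_simps cmv[of a] cmv[of b] cmv[of A] cmv[of Y] qq1 Ab assoc_rule[OF Ab]
        Aa assoc_rule[OF Aa] aY assoc_rule[OF aY])
  have "Y * c = A * (a * c) - q * (a * (A * c))"
    by (subst Y) (simp add: algebra_simps)
  also have "\<dots> = q * q * ((A * c) * a) - q * (a * (A * c))"
    by (simp add: ac cmv[of A] mult.assoc)
  also have "\<dots> = q * q * q * q * (c * (A * a - q * (a * A)))
      + (q + qi) * (q * (q * ((b2 * Y - q * (Y * b2)) * a)) - q * (a * (b2 * Y - q * (Y * b2))))"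
    unfolding Ac by (simp add: algebra_simps cmv[of a] cmv[of A] cmv[of c] ac assoc_rule[OF ac] qq1)
  also have "q * (q * ((b2 * Y - q * (Y * b2)) * a)) - q * (a * (b2 * Y - q * (Y * b2))) =
      q * ((b2 * a - a * b2) * Y) - q * (q * (q * (Y * (b2 * a - a * b2))))"
    by (simp add: algebra_simps cmv[of a] cmv[of b2] cmv[of Y] aY assoc_rule[OF aY] qq1)
  finally have "Y * c = q * q * q * q * (c * Y) + (q + qi) * (q * (c * Y) - q * (q * (q * (Y * c))))"
    unfolding cb2 Y[symmetric] .
  then have "(1 + q * q + q * q * q * q) * (Y * c) = (1 + q * q + q * q * q * q) * (c * Y)"
    by (simp add: algebra_simps qq1)
  then have "u * (1 + q * q + q * q * q * q) * (Y * c) = u * (1 + q * q + q * q * q * q) * (c * Y)"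
    by (simp only: mult.assoc)
  then have Yc: "Y * c = c * Y" by (simp add: u)
  have "Z * a * a - (q + qi) * (a * Z * a) + a * a * Z = Y * c - c * Y"
    unfolding Z c_def
    by (simp add: algebra_simps cmv[of a] cmv[of b] cmv[of Y] aY assoc_rule[OF aY] qq1)
  then show ?thesis using Yc by simp
qed

text \<open>With \<open>f = a b - q^2 b a\<close> one has \<open>Z = A f - q f A\<close>, and the
  commutator of V with b equals \<open>Z f - q^-1 f Z\<close>. This vanishes by a Serre relation
  between A and f.\<close>

lemma serre_C3b:
  assumes Ab: "A * b = b * A" and Y: "Y = A * a - q * (a * A)"
    and Sb: "b * b * a - (q * q + qi * qi) * (b * a * b) + a * b * b = 0"
    and SA: "A * a * a - (q + qi) * (a * A * a) + a * a * A = 0"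
    and Z: "Z = Y * b - q * q * (b * Y)" and Zb: "Z * b = qi * qi * (b * Z)"
    and u: "u * (q * q + qi * qi) = 1"
    and V: "V = Z * a - q * (a * Z)"
  shows "V * b = b * V"
proof -
  define f where "f = a * b - q * q * (b * a)"
  have ab: "a * b = f + q * (q * (b * a))" by (simp add: f_def mult.assoc)
  have fb: "f * b = qi * (qi * (b * f))"
  proof -
    have "f * b - qi * (qi * (b * f)) = b * b * a - (q * q + qi * qi) * (b * a * b) + a * b * b"
      unfolding f_def by (simp add: algebra_simps cmv[of a] cmv[of b] qq1)
    then show ?thesis by (simp add: Sb)
  qed
  have ZA: "Z = A * f - q * (f * A)"
    unfolding Z Y f_def
    by (simp add: algebra_simps cmv[of a] cmv[of b] cmv[of A] Ab assoc_rule[OF Ab])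
  note r = cmv[of a] cmv[of b] cmv[of A] cmv[of f] Ab assoc_rule[OF Ab] ab assoc_rule[OF ab]
    fb assoc_rule[OF fb] qq1 qqi qiq
  \<comment> \<open>A polarization of the Serre expression of A from a towards f. The twisted
    bracket with b of the relation for a is D, so \<open>D = 0\<close>; the commutator of D with b
    is \<open>q^2 + q^-2\<close> times the relation for f.\<close>
  define D where "D = A * (a * f + q * q * (f * a)) - (q + qi) * (a * A * f + q * q * (f * A * a))
      + (a * f + q * q * (f * a)) * A"
  have "D = (A * a * a - (q + qi) * (a * A * a) + a * a * A) * b
      - q * q * q * q * (b * (A * a * a - (q + qi) * (a * A * a) + a * a * A))"
    unfolding D_def by (simp add: algebra_simps r)
  then have D0: "D = 0" by (simp add: SA)
  have "(q * q + qi * qi) * (A * f * f - (q + qi) * (f * A * f) + f * f * A) = D * b - b * D"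
    unfolding D_def by (simp add: algebra_simps r)
  then have "u * (q * q + qi * qi) * (A * f * f - (q + qi) * (f * A * f) + f * f * A) = 0"
    by (simp add: D0 mult.assoc)
  then have SAf: "A * f * f - (q + qi) * (f * A * f) + f * f * A = 0" by (simp add: u)
  have Zf: "Z * f = qi * (f * Z)"
    by (rule serre_lin_qcomm[OF SAf ZA])
  have bZ: "b * Z = q * (q * (Z * b))" by (simp add: Zb mult.assoc qq1)
  have "V * b - b * V = Z * (a * b) - q * (a * (Z * b)) - (b * Z) * a + q * (b * (a * Z))"
    unfolding V by (simp add: algebra_simps cmv[of b])
  also have "\<dots> = Z * f - qi * (f * Z)"
    unfolding f_def
    by (simp add: algebra_simps cmv[of a] cmv[of b] cmv[of Z] qq1 bZ assoc_rule[OF bZ])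
  finally show ?thesis using Zf by simp
qed

end

section \<open>The quantum nilradical\<close>

lemma qpow_add: "qpow (a + b) = qpow a * qpow b"
  by (simp add: qpow_def fps_exp_add_mult)

lemma qpow_0 [simp]: "qpow 0 = 1"
  by (simp add: qpow_def)

lemma qpow_nth_0 [simp]: "qpow k $ 0 = 1"
  by (simp add: qpow_def)

lemma qpow_minus_1: "\<exists>g. qpow k - 1 = fps_X * g"
  using fps_X_eq_shift[of "qpow k - 1"] by auto

text \<open>
  The generators of \<open>B\<^sub>h\<close> other than \<open>K\<close> are numbered as \<open>v\<^sub>1, \<dots>, v\<^sub>2\<^sub>n\<^sub>-\<^sub>1\<close>, of weights
  \<open>L\<^sub>1 - L\<^sub>i\<^sub>+\<^sub>1\<close> for \<open>i < n\<close> and \<open>L\<^sub>1 + L\<^sub>2\<^sub>n\<^sub>-\<^sub>i\<close> for \<open>i \<ge> n\<close>; \<open>v\<^sub>i\<^sub>+\<^sub>1\<close> is the bracket of \<open>v\<^sub>i\<close> with the root vector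
  numbered \<open>st n i\<close>. The numbers \<open>wt n i k\<close> and \<open>al n l k\<close> are the pairings of \<open>\<alpha>\<^sub>k\<close>, \<open>k \<ge> 2\<close>, with the weight of
  \<open>v\<^sub>i\<close> and with \<open>\<alpha>\<^sub>l\<close>.
\<close>

definition st :: "nat \<Rightarrow> nat \<Rightarrow> nat"
  where "st n i = (if i < n then i + 1 else 2 * n - 1 - i)"

definition ex :: "nat \<Rightarrow> nat \<Rightarrow> int"
  where "ex n i = (if i + 1 = n then 2 else 1)"

definition wt :: "nat \<Rightarrow> nat \<Rightarrow> nat \<Rightarrow> int"
  where "wt n i k = (if i < n then (if k = i then 1 else if k = i + 1 then - int (symd n k) else 0)
    else (if k = 2 * n - i then int (symd n k) else if k + 1 = 2 * n - i then - 1 else 0))"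

definition al :: "nat \<Rightarrow> nat \<Rightarrow> nat \<Rightarrow> int"
  where "al n l k = int (symd n k) * cartan n k l"

lemma wt_step:
  assumes "1 \<le> i" "i \<le> 2 * n - 2" "2 \<le> l" "l \<le> n"
  shows "wt n (Suc i) l = wt n i l + al n (st n i) l"
proof (cases "i < n")
  case True
  with assms show ?thesis
    by (auto simp: wt_def al_def st_def symd_def cartan_def)
next
  case False
  define j where "j = 2 * n - 1 - i"
  have j: "2 * n - i = Suc j" "2 * n - Suc i = j" "st n i = j" "\<not> i < n" "\<not> Suc i < n" "j < n"
    using False assms by (auto simp: j_def st_def)
  show ?thesis
  proof -
    have w: "wt n i l = (if l = Suc j then int (symd n l) else if l = j then - 1 else 0)"
      "wt n (Suc i) l = (if l = j then int (symd n l) else if Suc l = j then - 1 else 0)"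
      by (simp_all add: wt_def j)
    consider "l = j" | "l = Suc j" | "Suc l = j" | "l \<noteq> j" "l \<noteq> Suc j" "Suc l \<noteq> j" by blast
    then show ?thesis
      unfolding w al_def j(3) using j(6) by cases (auto simp: symd_def cartan_def)
  qed
qed

text \<open>The positive part in any ring with central scalars, independent of the coset
  construction. The pair (n - 1, n) is exempt from the quadratic relation because the cubic one
  takes its place.\<close>

locale qnil =
  fixes n :: nat and s :: "complex fps \<Rightarrow> 'a::ring_1" and E :: "nat \<Rightarrow> 'a"
  assumes n: "n \<ge> 1" and s: "central_hom s"
    and comm: "\<And>i j. i \<in> {1..n} \<Longrightarrow> j \<in> {1..n} \<Longrightarrow> i + 1 < j \<Longrightarrow> E i * E j = E j * E i"
    and serre2: "\<And>i j. i \<in> {1..n} \<Longrightarrow> j \<in> {1..n} \<Longrightarrow> i + 1 = j \<or> j + 1 = i \<Longrightarrow> \<not> (i + 1 = n \<and> j = n) \<Longrightarrow>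
      E i * E i * E j - (s (qpow (int (symd n i))) + s (qpow (- int (symd n i)))) * (E i * E j * E i)
        + E j * E i * E i = 0"
    and serre3: "\<And>i. i \<in> {1..n} \<Longrightarrow> i + 1 = n \<Longrightarrow>
      E i * E i * E i * E n - (s (qpow 2) + 1 + s (qpow (- 2))) * (E i * E i * E n * E i)
        + (s (qpow 2) + 1 + s (qpow (- 2))) * (E i * E n * E i * E i) - E n * E i * E i * E i = 0"
begin

interpretation s: central_hom s by (fact s)

definition Q :: "int \<Rightarrow> 'a" where "Q k = s (qpow k)"

lemma QQ: "Q a * Q b = Q (a + b)" and Q0 [simp]: "Q 0 = 1"
  by (simp_all add: Q_def qpow_add s.mult s.one)

lemma Q_cent: "x * Q k = Q k * x" and Q_cent2: "x * (Q k * y) = Q k * (x * y)"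
  by (simp_all only: Q_def s.left) (rule s.central[symmetric])

lemma Q_inv: "Q k * Q (- k) = 1" "Q (- k) * Q k = 1" "Q k * (Q (- k) * x) = x" "Q (- k) * (Q k * x) = x"
  using QQ[of k "- k"] QQ[of "- k" k] by (simp_all add: mult.assoc[symmetric])

lemma Q_unit: "f $ 0 \<noteq> 0 \<Longrightarrow> \<exists>u. u * s f = 1"
  by (rule exI[of _ "s (inverse f)"]) (simp add: s.mult[symmetric] inverse_mult_eq_1 s.one)

lemma comm': "i \<in> {1..n} \<Longrightarrow> j \<in> {1..n} \<Longrightarrow> i + 1 < j \<or> j + 1 < i \<Longrightarrow> E i * E j = E j * E i"
  using comm[of i j] comm[of j i] by auto

text \<open>Index 0 is a dummy; the indices with a meaning are 1 to 2n - 1.\<close>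

primrec v :: "nat \<Rightarrow> 'a" where
  "v 0 = 0"
| "v (Suc i) = (if i = 0 then E 1 else v i * E (st n i) - Q (ex n i) * (E (st n i) * v i))"

lemma vu: "1 \<le> i \<Longrightarrow> i < n \<Longrightarrow>
    v (Suc i) = v i * E (Suc i) - Q (int (symd n (Suc i))) * (E (Suc i) * v i)"
  by (auto simp: st_def ex_def symd_def)

lemma vd: "1 \<le> j \<Longrightarrow> j < n \<Longrightarrow>
    v (2 * n - j) = v (2 * n - Suc j) * E j - Q 1 * (E j * v (2 * n - Suc j))"
proof -
  assume j: "1 \<le> j" "j < n"
  then have "2 * n - j = Suc (2 * n - Suc j)" by simp
  with j show ?thesis by (auto simp: st_def ex_def)
qed

lemma comm_bracket:
  assumes "x * e = e * x" "f * e = e * f"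
  shows "(x * f - Q t * (f * x)) * e = e * (x * f - Q t * (f * x))"
proof -
  have "x * (f * e) = e * (x * f)" "f * (x * e) = e * (f * x)"
    using assms by (metis mult.assoc)+
  then show ?thesis by (simp add: algebra_simps Q_cent2[of e])
qed

lemmas lin_qcomm = serre_lin_qcomm[of "Q d" "Q (- d)" for d, OF Q_cent Q_cent Q_inv(1)]
lemmas lin_step = serre_lin_step[of "Q d" "Q (- d)" for d, OF Q_cent Q_cent Q_inv(1)]
lemmas A3 = serre_A3[of "Q 1" "Q (- 1)", OF Q_cent Q_cent Q_inv(1)]
lemmas C3a = serre_C3a[of "Q 1" "Q (- 1)", OF Q_cent Q_cent Q_inv(1)]
lemmas C3b = serre_C3b[of "Q 1" "Q (- 1)", OF Q_cent Q_cent Q_inv(1)]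

lemma serre2Q:
  assumes "i \<in> {1..n}" "j \<in> {1..n}" "i + 1 = j \<or> j + 1 = i" "\<not> (i + 1 = n \<and> j = n)" "d = int (symd n i)"
  shows "E i * E i * E j - (Q d + Q (- d)) * (E i * E j * E i) + E j * E i * E i = 0"
  using serre2[OF assms(1-4)] assms(5) by (simp add: Q_def)

lemma unit1: "\<exists>u. u * (1 + Q 1 * Q 1) = 1"
  using Q_unit[of "1 + qpow 2"] unfolding QQ by (simp add: Q_def s.add s.one)

lemma unit2: "\<exists>u. u * (1 + Q 1 * Q 1 + Q 1 * Q 1 * Q 1 * Q 1) = 1"
  using Q_unit[of "1 + qpow 2 + qpow 4"] unfolding QQ by (simp add: Q_def s.add s.one)

lemma unit3: "\<exists>u. u * (Q 1 * Q 1 + Q (- 1) * Q (- 1)) = 1"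
  using Q_unit[of "qpow 2 + qpow (- 2)"] unfolding QQ by (simp add: Q_def s.add s.one)

section \<open>Commutation of the \<open>v_i\<close> with the \<open>E_k\<close> for k >= 2\<close>

lemma U1: "1 \<le> i \<Longrightarrow> i + 2 \<le> k \<Longrightarrow> k \<le> n \<Longrightarrow> v i * E k = E k * v i"
proof (induction i rule: nat_induct_at_least)
  case base
  then show ?case using comm'[of 1 k] by simp
next
  case (Suc i)
  then show ?case
    by (subst (1 2) vu) (auto intro!: comm_bracket comm' simp del: v.simps)
qed

text \<open>For i > 1 the element \<open>v_i\<close> is a bracket of \<open>v_(i-1)\<close>, which
  commutes with \<open>E_(i+1)\<close>, and of \<open>E_i\<close>, whose Serre relation with
  \<open>E_(i+1)\<close> is inherited.\<close>

lemma SLu: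
  assumes "1 \<le> i" "i < n" and d: "d = int (symd n (Suc i))"
  shows "v i * E (Suc i) * E (Suc i) - (Q d + Q (- d)) * (E (Suc i) * v i * E (Suc i))
    + E (Suc i) * E (Suc i) * v i = 0"
proof (cases "i = 1")
  case True
  have "E (Suc i) * E (Suc i) * E i - (Q d + Q (- d)) * (E (Suc i) * E i * E (Suc i))
    + E i * E (Suc i) * E (Suc i) = 0"
    using assms by (intro serre2Q) auto
  with True show ?thesis by (simp add: algebra_simps)
next
  case False
  then obtain k where k: "i = Suc k" "1 \<le> k" using assms by (cases i) auto
  show ?thesis
    by (rule lin_step[where d = d and a = "E (Suc i)" and c = "E i" and B = "v k" and A = "v i"
        and t = "Q (int (symd n i))"])
       (use assms k vu[of k] in \<open>auto intro!: serre2Q U1 simp del: v.simps simp: Q_cent\<close>)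
qed

lemma U3:
  assumes "1 \<le> i" "i < n"
  shows "v (Suc i) * E (Suc i) = Q (- int (symd n (Suc i))) * (E (Suc i) * v (Suc i))"
  by (rule lin_qcomm[OF SLu[OF assms refl] vu[OF assms]])

lemma U3': "1 \<le> i \<Longrightarrow> Suc i < n \<Longrightarrow> v (Suc i) * E (Suc i) = Q (- 1) * (E (Suc i) * v (Suc i))"
  using U3[of i] by (simp add: symd_def del: v.simps)

lemma vu': "1 \<le> i \<Longrightarrow> Suc i < n \<Longrightarrow> v (Suc i) = v i * E (Suc i) - Q 1 * (E (Suc i) * v i)"
  using vu[of i] by (simp add: symd_def del: v.simps)

text \<open>The content is the case k = i - 1, the type A fact for the chain \<open>v_(k-1)\<close>,
  \<open>E_k\<close>, \<open>E_(k+1)\<close>. Later brackets involve only elements commuting with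
  \<open>E_k\<close>.\<close>

lemma U4: "Suc k \<le> i \<Longrightarrow> 2 \<le> k \<Longrightarrow> i < n \<Longrightarrow> v i * E k = E k * v i"
proof (induction i rule: nat_induct_at_least)
  case base
  obtain m where m: "k = Suc m" "1 \<le> m" using base by (cases k) auto
  obtain u where u: "u * (1 + Q 1 * Q 1) = 1" using unit1 by blast
  show ?case
  proof (rule A3[of "v m" "E (Suc k)" "v k" "E k" u "v (Suc k)"])
    show "v m * E (Suc k) = E (Suc k) * v m" using m base by (intro U1) auto
    show "v k = v m * E k - Q 1 * (E k * v m)" "v k * E k = Q (- 1) * (E k * v k)"
      using vu'[of m] U3'[of m] m base by (simp_all del: v.simps)
    show "E k * E k * E (Suc k) - (Q 1 + Q (- 1)) * (E k * E (Suc k) * E k) + E (Suc k) * E k * E k = 0"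
      using base by (intro serre2Q) (auto simp: symd_def)
    show "v (Suc k) = v k * E (Suc k) - Q 1 * (E (Suc k) * v k)"
      using base by (intro vu') auto
  qed (fact u)
next
  case (Suc i)
  then show ?case
    by (subst (1 2) vu) (auto intro!: comm_bracket comm' simp del: v.simps)
qed

lemma Da: "k + 2 \<le> j \<Longrightarrow> j \<le> n \<Longrightarrow> 2 \<le> k \<Longrightarrow> v (2 * n - j) * E k = E k * v (2 * n - j)"
proof -
  have "k + 2 \<le> n \<Longrightarrow> 2 \<le> k \<Longrightarrow> v (2 * n - j) * E k = E k * v (2 * n - j)" if "j \<le> n" "k + 2 \<le> j"
    using that
  proof (induction j rule: inc_induct)
    case base
    then obtain m where m: "n = Suc m" by (cases n) auto
    then have vn: "v n = v m * E n - Q (int (symd n n)) * (E n * v m)"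
      using vu[of m] base by (simp del: v.simps)
    have "v n * E k = E k * v n"
      unfolding vn using m base by (intro comm_bracket comm' U4) auto
    then show ?case by simp
  next
    case (step j)
    then show ?case
      by (subst (1 2) vd) (auto intro!: comm_bracket comm' simp del: v.simps)
  qed
  then show "k + 2 \<le> j \<Longrightarrow> j \<le> n \<Longrightarrow> 2 \<le> k \<Longrightarrow> v (2 * n - j) * E k = E k * v (2 * n - j)" by auto
qed

text \<open>At j = n - 1 the predecessor is \<open>v_n\<close>, a bracket with the long root vector,
  and the cubic relation enters. For smaller j the argument is that of \<open>SLu\<close>.\<close>

lemma SLd:
  assumes "2 \<le> j" "j < n"
  shows "v (2 * n - Suc j) * E j * E j - (Q 1 + Q (- 1)) * (E j * v (2 * n - Suc j) * E j)
    + E j * E j * v (2 * n - Suc j) = 0"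
proof (cases "Suc j = n")
  case True
  obtain m where m: "j = Suc m" "1 \<le> m" using assms by (cases j) auto
  obtain u where u: "u * (1 + Q 1 * Q 1 + Q 1 * Q 1 * Q 1 * Q 1) = 1" using unit2 by blast
  have "v n * E j * E j - (Q 1 + Q (- 1)) * (E j * v n * E j) + E j * E j * v n = 0"
  proof (rule C3a[of "v m" "E n" "v j" "E j" u])
    show "v m * E n = E n * v m" using m assms True by (intro U1) auto
    show "v j = v m * E j - Q 1 * (E j * v m)" "v j * E j = Q (- 1) * (E j * v j)"
      using m assms by (auto intro!: vu' U3' simp del: v.simps)
    show "E j * E j * E j * E n - (Q 1 * Q 1 + 1 + Q (- 1) * Q (- 1)) * (E j * E j * E n * E j)
      + (Q 1 * Q 1 + 1 + Q (- 1) * Q (- 1)) * (E j * E n * E j * E j) - E n * E j * E j * E j = 0"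
      using serre3[of j] assms True by (simp add: QQ) (simp add: Q_def)
    show "v n = v j * E n - Q 1 * Q 1 * (E n * v j)"
      using vu[of j] assms True by (simp add: QQ symd_def del: v.simps)
  qed (fact u)
  with True assms show ?thesis by (simp add: numeral_2_eq_2 del: v.simps)
next
  case False
  show ?thesis
    by (rule lin_step[where d = 1 and a = "E j" and c = "E (Suc j)" and B = "v (2 * n - Suc (Suc j))"
        and A = "v (2 * n - Suc j)" and t = "Q 1"])
       (use assms False in \<open>auto intro!: serre2Q Da vd simp del: v.simps simp: Q_cent symd_def\<close>)
qed

lemma Db: "2 \<le> j \<Longrightarrow> j < n \<Longrightarrow> v (2 * n - j) * E j = Q (- 1) * (E j * v (2 * n - j))"
  by (rule lin_qcomm[OF SLd vd]) auto

text \<open>The content is the case k = j + 1: the type C fact if \<open>E_k\<close> is the long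
  root vector, otherwise the type A fact for the chain \<open>v_(2n-k-1)\<close>,
  \<open>E_k\<close>, \<open>E_(k-1)\<close>. Smaller j follow by brackets with elements commuting
  with \<open>E_k\<close>.\<close>

lemma Dc: "2 \<le> j \<Longrightarrow> j < k \<Longrightarrow> k \<le> n \<Longrightarrow> v (2 * n - j) * E k = E k * v (2 * n - j)"
proof -
  have "v (2 * n - j) * E k = E k * v (2 * n - j)" if "j \<le> i" "2 \<le> j" "k = Suc i" "k \<le> n" for i
    using that
  proof (induction j rule: inc_induct)
    case base
    show ?case
    proof (cases "k = n")
      case True
      obtain m where m: "i = Suc m" "1 \<le> m" using base by (cases i) auto
      obtain u where u: "u * (Q 1 * Q 1 + Q (- 1) * Q (- 1)) = 1" using unit3 by blast
      have vn: "v (2 * n - i) = v n * E i - Q 1 * (E i * v n)"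
        using vd[of i] base True by (simp del: v.simps)
      show ?thesis
      proof (rule C3b[of "v m" "E k" "v i" "E i" "v n" u])
        show "v m * E k = E k * v m" using m base True by (intro U1) auto
        show "v i = v m * E i - Q 1 * (E i * v m)"
          using vu'[of m] m base True by (simp del: v.simps)
        show "E k * E k * E i - (Q 1 * Q 1 + Q (- 1) * Q (- 1)) * (E k * E i * E k) + E i * E k * E k = 0"
          using serre2Q[of k i 2] base True by (simp add: QQ symd_def)
        show "v m * E i * E i - (Q 1 + Q (- 1)) * (E i * v m * E i) + E i * E i * v m = 0"
          using SLu[of m 1] m base True by (simp add: symd_def del: v.simps)
        show "v n = v i * E k - Q 1 * Q 1 * (E k * v i)"
          using vu[of i] base True by (simp add: QQ symd_def del: v.simps)
        show "v n * E k = Q (- 1) * Q (- 1) * (E k * v n)"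
          using U3[of i] base True by (simp add: QQ symd_def del: v.simps)
      qed (fact u vn)+
    next
      case False
      obtain u where u: "u * (1 + Q 1 * Q 1) = 1" using unit1 by blast
      show ?thesis
      proof (rule A3[of "v (2 * n - Suc k)" "E i" "v (2 * n - k)" "E k" u "v (2 * n - i)"])
        show "v (2 * n - Suc k) * E i = E i * v (2 * n - Suc k)" using base False by (intro Da) auto
        show "v (2 * n - k) = v (2 * n - Suc k) * E k - Q 1 * (E k * v (2 * n - Suc k))"
          using base False by (intro vd) auto
        show "v (2 * n - k) * E k = Q (- 1) * (E k * v (2 * n - k))"
          using base False by (intro Db) auto
        show "E k * E k * E i - (Q 1 + Q (- 1)) * (E k * E i * E k) + E i * E k * E k = 0"
          using base False by (intro serre2Q) (auto simp: symd_def)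
        show "v (2 * n - i) = v (2 * n - k) * E i - Q 1 * (E i * v (2 * n - k))"
          using vd[of i] base by (simp del: v.simps)
      qed (fact u)
    qed
  next
    case (step j)
    then show ?case
      by (subst (1 2) vd) (auto intro!: comm_bracket comm' simp del: v.simps)
  qed
  then show "2 \<le> j \<Longrightarrow> j < k \<Longrightarrow> k \<le> n \<Longrightarrow> v (2 * n - j) * E k = E k * v (2 * n - j)"
    by (cases k) auto
qed

text \<open>Collects the case analysis in terms of weights. It is the input both for the commutators
  of the \<open>v_i\<close> and for their coproducts.\<close>

lemma R1:
  assumes i: "1 \<le> i" "i \<le> 2 * n - 2" and k: "2 \<le> k" "k \<le> n"
  shows "v i * E k - Q (- wt n i k) * (E k * v i) = (if st n i = k then v (Suc i) else 0)"
proof (cases "i < n")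
  case True
  consider "k = Suc i" | "k = i" | "k < i" | "i + 2 \<le> k" by linarith
  then show ?thesis
  proof cases
    case 1
    then show ?thesis using vu[of i] i k True by (simp add: wt_def st_def del: v.simps)
  next
    case 2
    then obtain m where "i = Suc m" "1 \<le> m" using k by (cases i) auto
    then show ?thesis using U3'[of m] 2 True by (simp add: wt_def st_def del: v.simps)
  next
    case 3
    then show ?thesis using U4[of k i] k True by (simp add: wt_def st_def del: v.simps)
  next
    case 4
    then show ?thesis using U1[of i k] i k True by (simp add: wt_def st_def del: v.simps)
  qed
next
  case False
  define j where "j = 2 * n - i"
  have j: "i = 2 * n - j" "2 \<le> j" "j \<le> n" using False i n by (auto simp: j_def)
  have w: "wt n i k = (if k = j then int (symd n k) else if k + 1 = j then - 1 else 0)"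
    using False by (simp add: wt_def j_def)
  have stj: "st n i = j - 1" using False by (simp add: st_def j_def)
  consider "k + 1 = j" | "k = j" | "j < k" | "k + 2 \<le> j" by linarith
  then show ?thesis
  proof cases
    case 1
    then have "Suc i = 2 * n - k" using j by simp
    then show ?thesis using vd[of k] w stj 1 j k by (auto simp del: v.simps)
  next
    case 2
    show ?thesis
    proof (cases "j = n")
      case True
      then obtain m where "n = Suc m" "1 \<le> m" using j by (cases n) auto
      then show ?thesis using U3[of m] 2 True w stj j by (simp add: symd_def del: v.simps)
    next
      case False
      then show ?thesis using Db[of j] 2 w stj j by (auto simp: symd_def simp del: v.simps)
    qed
  next
    case 3
    then show ?thesis using Dc[of j k] w stj j k by (auto simp del: v.simps)
  next
    case 4
    then show ?thesis using Da[of k j] w stj j k by (auto simp del: v.simps)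
  qed
qed

section \<open>Twisted derivations of the algebra generated by the \<open>v_i\<close>\<close>

declare v.simps [simp del]
declare One_nat_def [simp del]

text \<open>A skew derivation, the twist c being the weight of the argument.\<close>

definition del :: "nat \<Rightarrow> (nat \<Rightarrow> int) \<Rightarrow> 'a \<Rightarrow> 'a"
  where "del k c x = x * E k - Q (- c k) * (E k * x)"

definition br :: "'a \<Rightarrow> 'a \<Rightarrow> 'a"
  where "br x y = x * y - y * x"

text \<open>
  \<open>W c x\<close>: the element \<open>x\<close> of the algebra without unit generated by the \<open>v\<^sub>i\<close> is homogeneous of weight \<open>c\<close>.
\<close>

inductive W :: "(nat \<Rightarrow> int) \<Rightarrow> 'a \<Rightarrow> bool" where
  W_v: "1 \<le> i \<Longrightarrow> i \<le> 2 * n - 1 \<Longrightarrow> W (wt n i) (v i)"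
| W_zero: "W c 0"
| W_add: "W c x \<Longrightarrow> W c y \<Longrightarrow> W c (x + y)"
| W_mult: "W a x \<Longrightarrow> W b y \<Longrightarrow> W (\<lambda>k. a k + b k) (x * y)"
| W_scale: "W c x \<Longrightarrow> W c (s t * x)"
| W_cong: "W c x \<Longrightarrow> \<forall>k\<in>{2..n}. c' k = c k \<Longrightarrow> W c' x"

lemma W_Q: "W c x \<Longrightarrow> W c (Q k * x)"
  unfolding Q_def by (rule W_scale)

lemma W_uminus: "W c x \<Longrightarrow> W c (- x)"
  using W_scale[of c x "- 1"] by (simp add: s.uminus s.one)

lemma W_diff: "W c x \<Longrightarrow> W c y \<Longrightarrow> W c (x - y)"
  using W_add[OF _ W_uminus, of c x y] by simp

lemma W_br: "W a x \<Longrightarrow> W b y \<Longrightarrow> W (\<lambda>k. a k + b k) (br x y)"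
  unfolding br_def by (rule W_diff[OF W_mult W_cong[OF W_mult]]) (auto simp: add.commute)

lemma W_v': "1 \<le> i \<Longrightarrow> i \<le> 2 * n - 1 \<Longrightarrow> \<forall>k\<in>{2..n}. c k = wt n i k \<Longrightarrow> W c (v i)"
  by (rule W_cong[OF W_v])

lemma del_v:
  assumes "1 \<le> i" "i \<le> 2 * n - 2" "2 \<le> k" "k \<le> n"
  shows "del k (wt n i) (v i) = (if st n i = k then v (Suc i) else 0)"
  using R1[OF assms] by (simp add: del_def)

lemma vtop: "n \<ge> 2 \<Longrightarrow> v (2 * n - 1) = v (2 * n - 2) * E 1 - Q 1 * (E 1 * v (2 * n - 2))"
  using vd[of 1] by (simp add: numeral_2_eq_2)

lemma v1: "v 1 = E 1" "v (Suc 0) = E (Suc 0)"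
  by (simp_all add: v.simps One_nat_def)

text \<open>The two weights add up to \<open>2 L_1 + \<alpha>_2\<close>, and \<open>2 L_1\<close>
  pairs to zero with every simple root except the first.\<close>

lemma wt_sum:
  assumes "2 \<le> l" "l \<le> n"
  shows "wt n 2 l + wt n (2 * n - 2) l = al n 2 l" "wt n (2 * n - 2) l + wt n 2 l = al n 2 l"
proof -
  have "wt n 2 l + wt n (2 * n - 2) l = al n 2 l"
  proof (cases "n = 2")
    case True
    then show ?thesis using assms by (simp add: wt_def al_def symd_def cartan_def)
  next
    case False
    then have n3: "2 < n" using assms by simp
    then have "wt n 2 l = (if l = 2 then 1 else if l = 3 then - int (symd n l) else 0)"
      "wt n (2 * n - 2) l = (if l = 2 then 1 else 0)"
      using assms by (auto simp: wt_def symd_def)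
    then show ?thesis using assms n3 by (auto simp: al_def symd_def cartan_def)
  qed
  then show "wt n 2 l + wt n (2 * n - 2) l = al n 2 l" "wt n (2 * n - 2) l + wt n 2 l = al n 2 l"
    by simp_all
qed

lemma wt_top: "2 \<le> k \<Longrightarrow> k \<le> n \<Longrightarrow> wt n (2 * n - 1) k = 0"
  by (auto simp: wt_def)

lemma wt_top2: "2 \<le> k \<Longrightarrow> k \<le> n \<Longrightarrow> wt n (2 * n - 2) k = (if k = 2 then int (symd n 2) else 0)"
  by (auto simp: wt_def)

lemma QQ2: "Q a * (Q b * z) = Q (a + b) * z"
  by (simp add: QQ mult.assoc[symmetric])

lemma top_aux:
  assumes "w * b = Q (- d) * (b * w)" "a * b = x + Q d * (b * a)"
  shows "(w * a - Q 1 * (a * w)) * b - b * (w * a - Q 1 * (a * w)) = w * x - Q (1 - d) * (x * w)"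
  by (simp add: algebra_simps Q_cent2[of w] Q_cent2[of a] Q_cent2[of b] assms
      assoc_rule[OF assms(1)] assoc_rule[OF assms(2)] QQ2)

text \<open>\<open>v_(2n-1)\<close> arises by a bracket with \<open>E_1\<close>, whose only
  neighbour is \<open>E_2\<close>. The result is quadratic in the generators, unlike for the other
  \<open>v_i\<close>.\<close>

lemma del_top:
  assumes k: "2 \<le> k" "k \<le> n"
  shows "del k (wt n (2 * n - 1)) (v (2 * n - 1)) =
    (if k = 2 then v (2 * n - 2) * v 2 - Q (1 - int (symd n 2)) * (v 2 * v (2 * n - 2)) else 0)"
proof -
  let ?w = "v (2 * n - 2)"
  have n2: "n \<ge> 2" using k by simp
  have dk: "del k (wt n (2 * n - 1)) (v (2 * n - 1)) = v (2 * n - 1) * E k - E k * v (2 * n - 1)"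
    using wt_top[OF k] by (simp add: del_def)
  have st2: "st n (2 * n - 2) = 1" using n2 by (auto simp: st_def)
  have wE: "?w * E k = Q (- wt n (2 * n - 2) k) * (E k * ?w)"
    using R1[of "2 * n - 2" k] st2 k n2 by simp
  show ?thesis
  proof (cases "k = 2")
    case False
    then have 1: "?w * E k = E k * ?w" using wE wt_top2[OF k] by simp
    moreover have "E 1 * E k = E k * E 1" using False k by (intro comm') auto
    ultimately show ?thesis
      unfolding dk unfolding vtop[OF n2] using comm_bracket[of ?w "E k" "E 1" 1] False by simp
  next
    case True
    define d where "d = int (symd n 2)"
    have wE: "?w * E 2 = Q (- d) * (E 2 * ?w)" using wE wt_top2[OF k] True by (simp add: d_def)
    have E12: "E 1 * E 2 = v 2 + Q d * (E 2 * E 1)"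
      using vu[of 1] n2 by (simp add: v1 d_def numeral_2_eq_2)
    have "v (2 * n - 1) * E 2 - E 2 * v (2 * n - 1) = ?w * v 2 - Q (1 - d) * (v 2 * ?w)"
      unfolding vtop[OF n2] by (rule top_aux[OF wE E12])
    then show ?thesis using True dk by (simp add: d_def)
  qed
qed

lemma W_del_v:
  assumes i: "1 \<le> i" "i \<le> 2 * n - 1" and k: "2 \<le> k" "k \<le> n"
  shows "W (\<lambda>l. wt n i l + al n k l) (del k (wt n i) (v i))"
proof (cases "i \<le> 2 * n - 2")
  case True
  show ?thesis
    unfolding del_v[OF i(1) True k] using True i wt_step[OF i(1) True]
    by (auto intro: W_zero W_v')
next
  case False
  then have i': "i = 2 * n - 1" using i by simp
  show ?thesis
  proof (cases "k = 2")
    case True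
    have "W (\<lambda>l. wt n (2 * n - 2) l + wt n 2 l) (v (2 * n - 2) * v 2)"
      "W (\<lambda>l. wt n 2 l + wt n (2 * n - 2) l) (v 2 * v (2 * n - 2))"
      using k by (auto intro!: W_mult W_v)
    then show ?thesis
      unfolding i' del_top[OF k] using True wt_sum wt_top
      by (auto intro!: W_diff W_Q elim!: W_cong)
  qed (use del_top[OF k] i' in \<open>simp add: W_zero\<close>)
qed

lemma del_add: "del k c (x + y) = del k c x + del k c y"
  and del_zero: "del k c 0 = 0"
  by (simp_all add: del_def algebra_simps)

lemma del_scale: "del k c (s t * x) = s t * del k c x"
  by (simp only: del_def Q_def s.left[of "E k"] s.left[of "s (qpow _)"] right_diff_distrib mult.assoc)

lemma del_diff: "del k c (x - y) = del k c x - del k c y"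
  using del_add[of k c x "- y"] del_scale[of k c "- 1" y] by (simp add: s.uminus s.one)

lemma del_mult: "del k (\<lambda>k. a k + b k) (x * y) = x * del k b y + Q (- b k) * (del k a x * y)"
proof -
  have "- (a k + b k) = - b k + - a k" by simp
  then have "Q (- (a k + b k)) = Q (- b k) * Q (- a k)" by (simp only: QQ)
  then show ?thesis
    by (simp add: del_def algebra_simps Q_cent2[of x])
qed

lemma del_cong: "c k = c' k \<Longrightarrow> del k c x = del k c' x"
  by (simp add: del_def)

lemma W_del:
  assumes "W c x" and k: "2 \<le> k" "k \<le> n"
  shows "W (\<lambda>l. c l + al n k l) (del k c x)"
  using assms(1)
proof induction
  case (W_v i)
  then show ?case by (rule W_del_v[OF _ _ k])
next
  case (W_mult a x b y)
  have "W (\<lambda>l. a l + (b l + al n k l)) (x * del k b y)"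
    by (intro W.W_mult W_mult)
  moreover have "W (\<lambda>l. (a l + al n k l) + b l) (Q (- b k) * (del k a x * y))"
    by (intro W_Q W.W_mult W_mult)
  ultimately show ?case
    unfolding del_mult by (intro W_add) (auto elim!: W.W_cong)
next
  case (W_cong c x c')
  then have "del k c' x = del k c x" using k by (intro del_cong) auto
  with W_cong show ?case by (auto intro: W.W_cong[OF W_cong.IH])
qed (auto simp: del_zero del_add del_scale intro: W.intros)

text \<open>The quotient by h has to lie in the algebra generated by the \<open>v_i\<close> again,
  not just in the ambient ring.\<close>

definition H :: "(nat \<Rightarrow> int) \<Rightarrow> 'a \<Rightarrow> bool"
  where "H c x \<longleftrightarrow> (\<exists>y. W c y \<and> x = s fps_X * y)"

lemma H_zero: "H c 0"
  unfolding H_def by (intro exI[of _ 0]) (auto intro: W_zero)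

lemma HI: "W c y \<Longrightarrow> x = s fps_X * y \<Longrightarrow> H c x"
  by (auto simp: H_def)

lemma HE: "H c x \<Longrightarrow> (\<And>y. W c y \<Longrightarrow> x = s fps_X * y \<Longrightarrow> P) \<Longrightarrow> P"
  by (auto simp: H_def)

lemma H_add: "H c x \<Longrightarrow> H c y \<Longrightarrow> H c (x + y)"
proof (elim HE)
  fix x' y' assume "W c x'" "x = s fps_X * x'" "W c y'" "y = s fps_X * y'"
  then show "H c (x + y)" by (intro HI[of c "x' + y'"] W_add) (simp_all only: distrib_left)
qed

lemma H_scale: "H c x \<Longrightarrow> H c (s t * x)"
  by (elim HE, rule HI, erule W_scale[of _ _ t]) (simp, rule s.left)

lemma H_uminus: "H c x \<Longrightarrow> H c (- x)"
  using H_scale[of c x "- 1"] by (simp add: s.uminus s.one)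

lemma H_diff: "H c x \<Longrightarrow> H c y \<Longrightarrow> H c (x - y)"
  using H_add[OF _ H_uminus, of c x y] by simp

lemma H_cong: "H c x \<Longrightarrow> \<forall>k\<in>{2..n}. c' k = c k \<Longrightarrow> H c' x"
  by (elim HE, rule HI, erule W_cong)

lemma H_multL: "W a x \<Longrightarrow> H b y \<Longrightarrow> H (\<lambda>k. a k + b k) (x * y)"
  by (elim HE, rule HI, erule (1) W_mult) (simp, rule s.left)

lemma H_multR: "H a x \<Longrightarrow> W b y \<Longrightarrow> H (\<lambda>k. a k + b k) (x * y)"
  by (elim HE, rule HI, erule (1) W_mult) (simp only: mult.assoc)

lemma H_br: "W a x \<Longrightarrow> H b y \<Longrightarrow> H (\<lambda>k. a k + b k) (br x y)"
  unfolding br_def by (rule H_diff[OF H_multL H_cong[OF H_multR]]) (auto simp: add.commute)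

lemma H_X: "W c x \<Longrightarrow> H c (s (fps_X * t) * x)"
  unfolding H_def by (intro exI[of _ "s t * x"]) (auto intro: W_scale simp: s.mult mult.assoc)

lemma H_Q: "W c x \<Longrightarrow> H c (Q k * x - x)"
proof -
  assume x: "W c x"
  obtain t where t: "qpow k - 1 = fps_X * t" using qpow_minus_1 by blast
  have "Q k * x - x = s (qpow k - 1) * x" by (simp add: Q_def s.diff s.one algebra_simps)
  then show ?thesis unfolding t using H_X[OF x] by simp
qed

lemma H_del: "H c x \<Longrightarrow> 2 \<le> k \<Longrightarrow> k \<le> n \<Longrightarrow> H (\<lambda>l. c l + al n k l) (del k c x)"
  by (elim HE, rule HI, erule (2) W_del) (simp only: del_scale)

text \<open>The Leibniz rule for commutators holds up to factors \<open>q^k - 1\<close>, which are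
  divisible by h.\<close>

lemma del_br:
  assumes x: "W a x" and y: "W b y" and k: "2 \<le> k" "k \<le> n"
  shows "H (\<lambda>l. a l + b l + al n k l)
    (del k (\<lambda>k. a k + b k) (br x y) - (br x (del k b y) + br (del k a x) y))"
proof -
  have "del k (\<lambda>k. a k + b k) (y * x) = y * del k a x + Q (- a k) * (del k b y * x)"
    using del_mult[of k b a y x] by (simp add: add.commute)
  then have eq: "del k (\<lambda>k. a k + b k) (br x y) - (br x (del k b y) + br (del k a x) y) =
      (Q (- b k) * (del k a x * y) - del k a x * y) - (Q (- a k) * (del k b y * x) - del k b y * x)"
    unfolding br_def del_diff del_mult by (simp add: algebra_simps)
  have "W (\<lambda>l. a l + b l + al n k l) (del k a x * y)"
    by (rule W_cong[OF W_mult[OF W_del[OF x k] y]]) auto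
  moreover have "W (\<lambda>l. a l + b l + al n k l) (del k b y * x)"
    by (rule W_cong[OF W_mult[OF W_del[OF y k] x]]) auto
  ultimately show ?thesis unfolding eq by (intro H_diff H_Q)
qed

lemma H_br_step:
  assumes x: "W a x" and y: "W b y" and k: "2 \<le> k" "k \<le> n"
    and H: "H (\<lambda>l. a l + b l + al n k l) (del k (\<lambda>k. a k + b k) (br x y))"
  shows "H (\<lambda>l. a l + b l + al n k l) (br x (del k b y) + br (del k a x) y)"
  using H_diff[OF H del_br[OF x y k]] by (simp add: add.commute)

lemma br_zero [simp]: "br x 0 = 0" "br 0 x = 0" "br x x = 0"
  by (simp_all add: br_def)

text \<open>At j = 2 this is the Serre relation of \<open>E_1\<close> with \<open>E_2\<close>; the
  later brackets up to \<open>v_(2n-3)\<close> only involve \<open>E_k\<close> with k >= 3, which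
  commute with \<open>E_1\<close>.\<close>

lemma E1v:
  assumes "n \<ge> 3" "2 \<le> j" "j \<le> 2 * n - 3"
  shows "v j * E 1 = Q 1 * (E 1 * v j)"
  using assms(2,3)
proof (induction j rule: nat_induct_at_least)
  case base
  have v2: "v 2 = E 1 * E 2 - Q 1 * (E 2 * E 1)"
    using vu[of 1] assms(1) by (simp add: v1 symd_def numeral_2_eq_2)
  have S: "E 1 * E 1 * E 2 - (Q 1 + Q (- 1)) * (E 1 * E 2 * E 1) + E 2 * E 1 * E 1 = 0"
    using assms(1) by (intro serre2Q) (auto simp: symd_def)
  have "v 2 * E 1 - Q 1 * (E 1 * v 2) =
      - (Q 1 * (E 1 * E 1 * E 2 - (Q 1 + Q (- 1)) * (E 1 * E 2 * E 1) + E 2 * E 1 * E 1))"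
    unfolding v2 by (simp add: algebra_simps Q_cent2[of "E 1"] Q_inv)
  then show ?case unfolding S by simp
next
  case (Suc j)
  let ?k = "st n j"
  have k: "?k \<in> {1..n}" "?k \<ge> 3" using Suc assms(1) by (auto simp: st_def)
  have EE: "E ?k * E 1 = E 1 * E ?k" using k by (intro comm') auto
  have IH: "v j * E 1 = Q 1 * (E 1 * v j)" using Suc by simp
  have vS: "v (Suc j) = v j * E ?k - Q (ex n j) * (E ?k * v j)" using Suc by (simp add: v.simps)
  show ?case
    unfolding vS by (simp add: algebra_simps Q_cent2[of "E 1"] EE assoc_rule[OF EE] IH assoc_rule[OF IH]
        Q_cent2[of "E ?k"] Q_cent2[of "Q (ex n j)"])
qed

text \<open>In rank two this is the cubic relation. In higher rank it is a twisted bracket of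
  \<open>v_(2n-3)\<close> with the quadratic relation of \<open>E_1\<close> and
  \<open>E_2\<close>.\<close>

lemma E1top:
  assumes "n \<ge> 2"
  shows "Q 2 * (E 1 * (E 1 * v (2 * n - 2))) - (Q 2 + 1) * (E 1 * (v (2 * n - 2) * E 1))
    + v (2 * n - 2) * E 1 * E 1 = 0"
proof (cases "n = 2")
  case True
  have "symd n 2 = 2" using True by (simp add: symd_def)
  then have v2: "v 2 = E 1 * E 2 - Q 2 * (E 2 * E 1)"
    using vu[of 1] assms by (simp add: v1)
  have S: "E 1 * E 1 * E 1 * E 2 - (Q 2 + 1 + Q (- 2)) * (E 1 * E 1 * E 2 * E 1)
      + (Q 2 + 1 + Q (- 2)) * (E 1 * E 2 * E 1 * E 1) - E 2 * E 1 * E 1 * E 1 = 0"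
    using serre3[of 1] True by (simp add: Q_def)
  have "Q 2 * (E 1 * (E 1 * v 2)) - (Q 2 + 1) * (E 1 * (v 2 * E 1)) + v 2 * E 1 * E 1 =
     Q 2 * (E 1 * E 1 * E 1 * E 2 - (Q 2 + 1 + Q (- 2)) * (E 1 * E 1 * E 2 * E 1)
      + (Q 2 + 1 + Q (- 2)) * (E 1 * E 2 * E 1 * E 1) - E 2 * E 1 * E 1 * E 1)"
    unfolding v2 by (simp add: algebra_simps Q_cent2[of "E 1"] Q_inv)
  also have "\<dots> = 0" unfolding S by simp
  finally show ?thesis using True by simp
next
  case False
  then have n3: "n \<ge> 3" using assms by simp
  define z where "z = v (2 * n - 3)"
  have w: "v (2 * n - 2) = z * E 2 - Q 1 * (E 2 * z)"
    using vd[of 2] n3 by (simp add: numeral_2_eq_2 numeral_3_eq_3 z_def)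
  have S: "E 1 * E 1 * E 2 - (Q 1 + Q (- 1)) * (E 1 * E 2 * E 1) + E 2 * E 1 * E 1 = 0"
    using n3 by (intro serre2Q) (auto simp: symd_def)
  let ?S = "E 1 * E 1 * E 2 - (Q 1 + Q (- 1)) * (E 1 * E 2 * E 1) + E 2 * E 1 * E 1"
  have Ez: "z * E 1 = Q 1 * (E 1 * z)" unfolding z_def by (rule E1v[OF n3]) (use n3 in auto)
  have "Q 2 * (E 1 * (E 1 * v (2 * n - 2))) - (Q 2 + 1) * (E 1 * (v (2 * n - 2) * E 1))
    + v (2 * n - 2) * E 1 * E 1 = z * ?S - Q 3 * (?S * z)"
    unfolding w
    by (simp add: algebra_simps Q_cent2[of "E 1"] Q_cent2[of "E 2"] Q_cent2[of z] QQ2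
        Ez assoc_rule[OF Ez])
  then show ?thesis unfolding S by simp
qed

section \<open>Commutators of the \<open>v_i\<close> modulo h\<close>

definition P0 :: "nat \<Rightarrow> nat \<Rightarrow> bool"
  where "P0 i j \<longleftrightarrow> H (\<lambda>l. wt n i l + wt n j l) (br (v i) (v j))"

text \<open>The weight clause makes both sides homogeneous of one weight, so that the same twisted
  derivation applies to both; the weight of \<open>v_(2n-1)\<close> pairs to zero with all simple
  roots from the second on.\<close>

definition G :: "nat \<Rightarrow> nat \<Rightarrow> bool"
  where "G i j \<longleftrightarrow> (\<exists>c0 y. H (\<lambda>l. wt n i l + wt n j l) y \<and> br (v i) (v j) = s (fps_const c0) * v (2 * n - 1) + y \<and>
    (c0 = 0 \<or> (\<forall>l\<in>{2..n}. wt n i l + wt n j l = 0)))"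

lemma P0_1:
  assumes "n \<ge> 3" "2 \<le> j" "j \<le> 2 * n - 3"
  shows "P0 1 j"
proof -
  have "br (v 1) (v j) = - (Q 1 * (v 1 * v j) - v 1 * v j)"
    using E1v[OF assms] by (simp add: br_def v1)
  then show ?thesis
    unfolding P0_def by (simp only:) (intro H_uminus H_Q W_mult W_v; use assms in auto)
qed

text \<open>Deriving the congruence for \<open>[v_1, v_(2n-3)]\<close> twice along
  \<open>E_2\<close> produces \<open>[v_2, v_(2n-2)]\<close> from both terms of the Leibniz rule,
  and the resulting factor 2 is invertible.\<close>

lemma P0_top2:
  assumes "n \<ge> 2"
  shows "H (\<lambda>l. wt n 2 l + wt n (2 * n - 2) l) (br (v 2) (v (2 * n - 2)))"
proof (cases "n = 2")
  case True
  then have "br (v 2) (v (2 * n - 2)) = 0" by simp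
  then show ?thesis by (simp add: H_zero)
next
  case False
  then have n3: "n \<ge> 3" using assms by simp
  let ?a = "wt n 1" and ?b = "wt n (2 * n - 3)" and ?w = "v (2 * n - 2)"
  have W: "W ?a (v 1)" "W ?b (v (2 * n - 3))" "W (wt n 2) (v 2)" "W (wt n (2 * n - 2)) ?w"
    using n3 by (auto intro!: W_v)
  have st: "st n 1 = 2" "st n (2 * n - 3) = 2" "st n 2 \<noteq> 2" "st n (2 * n - 2) = 1"
    using n3 by (auto simp: st_def)
  have S: "Suc (2 * n - 3) = 2 * n - 2" using n3 by simp
  have d: "del 2 ?a (v 1) = v 2" "del 2 ?b (v (2 * n - 3)) = ?w" "del 2 (wt n 2) (v 2) = 0"
    "del 2 (wt n (2 * n - 2)) ?w = 0"
    using n3 st S by (simp_all add: del_v numeral_2_eq_2[symmetric])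
  have wS: "wt n 2 l = ?a l + al n 2 l" "wt n (2 * n - 2) l = ?b l + al n 2 l" if "l \<in> {2..n}" for l
    using that n3 wt_step[of 1 n l] wt_step[of "2 * n - 3" n l] st S by (auto simp: numeral_2_eq_2)
  have "H (\<lambda>l. ?a l + ?b l + al n 2 l) (del 2 (\<lambda>l. ?a l + ?b l) (br (v 1) (v (2 * n - 3))))"
    using P0_1[OF n3, of "2 * n - 3"] n3 unfolding P0_def by (intro H_del) auto
  from H_br_step[OF W(1,2) _ _ this]
  have H1: "H (\<lambda>l. ?a l + ?b l + al n 2 l) (br (v 1) ?w + br (v 2) (v (2 * n - 3)))"
    using n3 by (simp add: d)
  let ?c = "\<lambda>l. ?a l + ?b l + al n 2 l"
  have H2: "H (\<lambda>l. ?c l + al n 2 l) (del 2 ?c (br (v 1) ?w) + del 2 ?c (br (v 2) (v (2 * n - 3))))"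
    using H_del[OF H1, of 2] n3 by (simp add: del_add)
  have c1: "del 2 ?c x = del 2 (\<lambda>l. ?a l + wt n (2 * n - 2) l) x"
    and c2: "del 2 ?c x = del 2 (\<lambda>l. wt n 2 l + ?b l) x" for x
    using wS[of 2] n3 by (auto intro!: del_cong)
  have "H (\<lambda>l. ?a l + wt n (2 * n - 2) l + al n 2 l)
      (del 2 ?c (br (v 1) ?w) - br (v 2) ?w)"
    using del_br[OF W(1,4), of 2] n3 by (simp add: d c1)
  moreover have "H (\<lambda>l. wt n 2 l + ?b l + al n 2 l)
      (del 2 ?c (br (v 2) (v (2 * n - 3))) - br (v 2) ?w)"
    using del_br[OF W(3,2), of 2] n3 by (simp add: d c2)
  ultimately have "H (\<lambda>l. ?c l + al n 2 l) ((del 2 ?c (br (v 1) ?w) - br (v 2) ?w) +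
      (del 2 ?c (br (v 2) (v (2 * n - 3))) - br (v 2) ?w))"
    by (intro H_add) (auto elim!: H_cong simp: wS)
  from H_diff[OF H2 this] have "H (\<lambda>l. ?c l + al n 2 l) (br (v 2) ?w + br (v 2) ?w)"
    by (simp add: algebra_simps)
  then have "H (\<lambda>l. ?c l + al n 2 l) (s (fps_const (1/2)) * (br (v 2) ?w + br (v 2) ?w))"
    by (rule H_scale)
  moreover have "s (fps_const (1/2)) * (x + x) = x" for x
  proof -
    have "s (fps_const (1/2)) * (x + x) = s (fps_const (1/2) + fps_const (1/2)) * x"
      by (simp only: s.add distrib_left distrib_right)
    then show ?thesis by (simp add: s.one)
  qed
  ultimately show ?thesis by (auto elim!: H_cong simp: wS)
qed

text \<open>Up to a power of q the quadratic expression of \<open>del_top\<close> is the commutator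
  treated in \<open>P0_top2\<close>.\<close>

lemma H_del_top:
  assumes k: "2 \<le> k" "k \<le> n"
  shows "H (\<lambda>l. wt n (2 * n - 1) l + al n k l) (del k (wt n (2 * n - 1)) (v (2 * n - 1)))"
proof (cases "k = 2")
  case True
  have n2: "n \<ge> 2" using k by simp
  have w: "wt n 2 l + wt n (2 * n - 2) l = wt n (2 * n - 1) l + al n 2 l" if "l \<in> {2..n}" for l
    using that wt_top[of l] wt_sum[of l] by simp
  have "W (\<lambda>l. wt n 2 l + wt n (2 * n - 2) l) (v 2 * v (2 * n - 2))"
    using k by (intro W_mult W_v) auto
  from H_diff[OF H_uminus[OF P0_top2[OF n2]] H_Q[OF this, of "1 - int (symd n 2)"]]
  have "H (\<lambda>l. wt n 2 l + wt n (2 * n - 2) l) (del 2 (wt n (2 * n - 1)) (v (2 * n - 1)))"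
    unfolding del_top[OF k[unfolded True]] by (simp add: br_def)
  then show ?thesis unfolding True by (rule H_cong) (use w in auto)
qed (simp add: del_top[OF k] H_zero)

lemma G_del:
  assumes G: "G i j" and i: "1 \<le> i" "i \<le> 2 * n - 2" and j: "1 \<le> j" "j \<le> 2 * n - 2"
    and k: "2 \<le> k" "k \<le> n"
  shows "H (\<lambda>l. wt n i l + wt n j l + al n k l)
    (br (v i) (if st n j = k then v (Suc j) else 0) + br (if st n i = k then v (Suc i) else 0) (v j))"
proof -
  obtain c0 y where y: "H (\<lambda>l. wt n i l + wt n j l) y"
    and eq: "br (v i) (v j) = s (fps_const c0) * v (2 * n - 1) + y"
    and c0: "c0 = 0 \<or> (\<forall>l\<in>{2..n}. wt n i l + wt n j l = 0)"
    using G unfolding G_def by blast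
  let ?c = "\<lambda>l. wt n i l + wt n j l"
  have "H (\<lambda>l. ?c l + al n k l) (del k ?c (s (fps_const c0) * v (2 * n - 1)))"
  proof (cases "c0 = 0")
    case True
    then show ?thesis by (simp add: del_zero H_zero s.zero)
  next
    case False
    with c0 have c: "?c l = wt n (2 * n - 1) l" if "l \<in> {2..n}" for l using that wt_top by simp
    have "del k ?c (v (2 * n - 1)) = del k (wt n (2 * n - 1)) (v (2 * n - 1))"
      using k by (intro del_cong c) auto
    then show ?thesis
      unfolding del_scale by (simp only:) (rule H_scale, rule H_cong[OF H_del_top[OF k]], use c in auto)
  qed
  then have "H (\<lambda>l. ?c l + al n k l) (del k ?c (br (v i) (v j)))"
    unfolding eq del_add by (rule H_add) (rule H_del[OF y k])
  from H_br_step[OF W_v W_v k this] show ?thesis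
    using i j by (simp add: del_v[OF i k] del_v[OF j k])
qed

lemma G_add_H:
  assumes "G i' j'" and H: "H (\<lambda>l. wt n i l + wt n j l) (br (v i) (v j) + br (v i') (v j'))"
    and w: "\<forall>l\<in>{2..n}. wt n i l + wt n j l = wt n i' l + wt n j' l"
  shows "G i j"
proof -
  obtain c0 y where y: "H (\<lambda>l. wt n i' l + wt n j' l) y"
    and eq: "br (v i') (v j') = s (fps_const c0) * v (2 * n - 1) + y"
    and c0: "c0 = 0 \<or> (\<forall>l\<in>{2..n}. wt n i' l + wt n j' l = 0)"
    using assms(1) unfolding G_def by blast
  let ?y = "br (v i) (v j) + br (v i') (v j') - y"
  have "H (\<lambda>l. wt n i l + wt n j l) ?y"
    by (rule H_diff[OF H H_cong[OF y]]) (use w in auto)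
  moreover have "br (v i) (v j) = s (fps_const (- c0)) * v (2 * n - 1) + ?y"
    by (simp add: eq s.uminus flip: fps_const_neg)
  moreover have "- c0 = 0 \<or> (\<forall>l\<in>{2..n}. wt n i l + wt n j l = 0)" using c0 w by auto
  ultimately show ?thesis unfolding G_def by blast
qed

lemma G_H: "H (\<lambda>l. wt n i l + wt n j l) (br (v i) (v j)) \<Longrightarrow> G i j"
  unfolding G_def by (rule exI[of _ 0]) (auto simp: s.zero)

text \<open>A multiple of \<open>v_(2n-1)\<close> appears only at j = 2n - 2, with coefficient -1,
  because \<open>v_(2n-1)\<close> is the \<open>q\<close>-bracket of \<open>v_(2n-2)\<close> with
  \<open>v_1\<close>.\<close>

lemma G_1:
  assumes "2 \<le> j" "j \<le> 2 * n - 2"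
  shows "G 1 j"
proof (cases "j = 2 * n - 2")
  case True
  have n2: "n \<ge> 2" using assms by simp
  let ?w = "v (2 * n - 2)"
  let ?y = "- (Q 1 * (v 1 * ?w) - v 1 * ?w)"
  have eq: "br (v 1) ?w = s (fps_const (- 1)) * v (2 * n - 1) + ?y"
    unfolding vtop[OF n2] by (simp add: br_def v1 s.uminus s.one flip: fps_const_neg)
  moreover have "H (\<lambda>l. wt n 1 l + wt n (2 * n - 2) l) ?y"
    using n2 by (intro H_uminus H_Q W_mult W_v) auto
  moreover have "\<forall>l\<in>{2..n}. wt n 1 l + wt n (2 * n - 2) l = 0"
    using n2 by (auto simp: wt_top2) (auto simp: wt_def)
  ultimately show ?thesis unfolding G_def True by blast
next
  case False
  then show ?thesis using P0_1[of j] assms unfolding P0_def by (intro G_H) auto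
qed

text \<open>Deriving along the step from \<open>v_i\<close> to \<open>v_(i+1)\<close> expresses
  \<open>[v_(i+1), v_j]\<close> by \<open>-[v_i, v_(j+1)]\<close> modulo h, or shows that it is
  divisible by h if this derivation kills \<open>v_j\<close>.\<close>

lemma G_less: "1 \<le> i \<Longrightarrow> i < j \<Longrightarrow> j \<le> 2 * n - 2 \<Longrightarrow> G i j"
proof (induction i arbitrary: j rule: nat_induct_at_least)
  case base
  then show ?case using G_1 by simp
next
  case (Suc i)
  define k where "k = st n i"
  have k: "2 \<le> k" "k \<le> n" using Suc by (auto simp: k_def st_def)
  have i: "1 \<le> i" "i \<le> 2 * n - 2" and j: "1 \<le> j" "j \<le> 2 * n - 2" using Suc by auto
  have Gij: "G i j" using Suc by simp
  have wi: "wt n (Suc i) l = wt n i l + al n k l" if "l \<in> {2..n}" for l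
    using wt_step[OF i, of l] that by (simp add: k_def)
  have H: "H (\<lambda>l. wt n (Suc i) l + wt n j l)
      (br (v i) (if st n j = k then v (Suc j) else 0) + br (v (Suc i)) (v j))"
    using G_del[OF Gij i j k] wi by (auto elim!: H_cong simp: k_def)
  show ?case
  proof (cases "st n j = k")
    case True
    \<comment> \<open>The step out of \<open>v_(2n-2)\<close> is along \<open>E_1\<close>, whereas k
      >= 2; so \<open>v_(j+1)\<close> is not yet the last generator.\<close>
    then have "Suc j \<le> 2 * n - 2" using Suc j by (auto simp: k_def st_def split: if_splits)
    then have "G i (Suc j)" using Suc by simp
    moreover have "\<forall>l\<in>{2..n}. wt n (Suc i) l + wt n j l = wt n i l + wt n (Suc j) l"
      using wt_step[OF j] True wi by auto
    ultimately show ?thesis using G_add_H[of i "Suc j" "Suc i" j] H True by (simp add: add.commute)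
  next
    case False
    then show ?thesis using H by (intro G_H) simp
  qed
qed

text \<open>The start rests on \<open>E1top\<close>, whose coefficients q and \<open>q^2\<close> are
  both 1 modulo h. A derivation along the way also hits \<open>v_(2n-1)\<close>, with a result
  divisible by h.\<close>

lemma H_top: "1 \<le> i \<Longrightarrow> i \<le> 2 * n - 2 \<Longrightarrow> H (\<lambda>l. wt n i l + wt n (2 * n - 1) l) (br (v i) (v (2 * n - 1)))"
proof (induction i rule: nat_induct_at_least)
  case base
  then have n2: "n \<ge> 2" by simp
  let ?w = "v (2 * n - 2)"
  have 1: "?w * E 1 * E 1 = (Q 2 + 1) * (E 1 * (?w * E 1)) - Q 2 * (E 1 * (E 1 * ?w))"
    using E1top[OF n2] by (simp add: algebra_simps)
  have "br (v 1) (v (2 * n - 1)) = E 1 * (?w * E 1) - Q 1 * (E 1 * (E 1 * ?w))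
      - (?w * E 1 * E 1 - Q 1 * (E 1 * (?w * E 1)))"
    unfolding vtop[OF n2] v1 br_def
    by (simp add: algebra_simps Q_cent2[of "E 1"] Q_cent2[of "E (Suc 0)"])
  also have "\<dots> = (Q 1 - Q 2) * (E 1 * br ?w (E 1))"
    unfolding 1 br_def by (simp add: algebra_simps)
  also have "\<dots> = (Q 1 * (v 1 * br ?w (v 1)) - v 1 * br ?w (v 1))
      - (Q 2 * (v 1 * br ?w (v 1)) - v 1 * br ?w (v 1))"
    by (simp add: algebra_simps v1)
  finally have eq: "br (v 1) (v (2 * n - 1)) = \<dots>" .
  have "W (\<lambda>l. wt n 1 l + (wt n (2 * n - 2) l + wt n 1 l)) (v 1 * br ?w (v 1))"
    using n2 by (intro W_mult W_br W_v) auto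
  then have "W (\<lambda>l. wt n 1 l + wt n (2 * n - 1) l) (v 1 * br ?w (v 1))"
    using n2 by (elim W_cong) (auto simp: wt_top wt_top2, auto simp: wt_def)
  then show ?case unfolding eq by (intro H_diff H_Q)
next
  case (Suc i)
  define k where "k = st n i"
  have k: "2 \<le> k" "k \<le> n" using Suc by (auto simp: k_def st_def)
  have i: "1 \<le> i" "i \<le> 2 * n - 2" using Suc by auto
  have W: "W (wt n i) (v i)" "W (wt n (2 * n - 1)) (v (2 * n - 1))" using i by (auto intro!: W_v)
  have wi: "wt n (Suc i) l = wt n i l + al n k l" if "l \<in> {2..n}" for l
    using wt_step[OF i, of l] that by (simp add: k_def)
  have "H (\<lambda>l. wt n i l + wt n (2 * n - 1) l + al n k l)
      (br (v i) (del k (wt n (2 * n - 1)) (v (2 * n - 1))) + br (v (Suc i)) (v (2 * n - 1)))"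
    using H_br_step[OF W k H_del[OF Suc.IH k]] Suc.prems del_v[OF i k] by (simp add: k_def)
  moreover have "H (\<lambda>l. wt n i l + (wt n (2 * n - 1) l + al n k l))
      (br (v i) (del k (wt n (2 * n - 1)) (v (2 * n - 1))))"
    by (rule H_br[OF W(1) H_del_top[OF k]])
  ultimately have "H (\<lambda>l. wt n i l + wt n (2 * n - 1) l + al n k l) (br (v (Suc i)) (v (2 * n - 1)))"
    using H_diff by (fastforce simp: add.assoc)
  then show ?case by (elim H_cong) (simp add: wi)
qed

theorem v_commute:
  assumes "1 \<le> i" "i \<le> 2 * n - 1" "1 \<le> j" "j \<le> 2 * n - 1"
  shows "\<exists>c0 c y. W c y \<and> br (v i) (v j) = s (fps_const c0) * v (2 * n - 1) + s fps_X * y"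
proof -
  have less: "\<exists>c0 c y. W c y \<and> br (v i) (v j) = s (fps_const c0) * v (2 * n - 1) + s fps_X * y"
    if "1 \<le> i" "i < j" "j \<le> 2 * n - 1" for i j
  proof (cases "j = 2 * n - 1")
    case True
    then have "i \<le> 2 * n - 2" using that by simp
    then show ?thesis using H_top[of i] that True unfolding H_def
      by (intro exI[of _ 0]) (auto simp: s.zero)
  next
    case False
    then have "G i j" using that by (intro G_less) auto
    then show ?thesis unfolding G_def H_def by blast
  qed
  have swap: "\<exists>c0 c y. W c y \<and> br x z = s (fps_const c0) * v (2 * n - 1) + s fps_X * y"
    if ex: "\<exists>c0 c y. W c y \<and> br z x = s (fps_const c0) * v (2 * n - 1) + s fps_X * y" for x z
  proof -
    from ex obtain c0 c y where y: "W c y" "br z x = s (fps_const c0) * v (2 * n - 1) + s fps_X * y"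
      by blast
    have "br x z = - br z x" by (simp add: br_def)
    also have "\<dots> = s (fps_const (- c0)) * v (2 * n - 1) + s fps_X * (- y)"
      unfolding y(2) by (simp add: s.uminus flip: fps_const_neg)
    finally show ?thesis using W_uminus[OF y(1)] by blast
  qed
  consider "i < j" | "j < i" | "i = j" by linarith
  then show ?thesis
  proof cases
    case 3
    then show ?thesis
      by (intro exI[of _ 0] exI[of _ "\<lambda>_. 0"]) (auto simp: s.zero W_zero)
  qed (use less swap assms in blast)+
qed

end

section \<open>Relations of the Drinfeld--Jimbo algebra\<close>

lemma FWord_Nil: "FWord [] = 0"
  by (simp add: zero_fword_def)

lemma prod_list_singleL:
  "prod_list (map (\<lambda>x. fps_const (Poly_Mapping.single (FWord [x], 0) 1)) xs) =
    fps_const (Poly_Mapping.single (FWord xs, 0) 1 :: 'g fword \<times> 'g fword \<Rightarrow>\<^sub>0 complex)"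
proof (induction xs)
  case Nil
  have z: "(0 :: 'g fword, 0 :: 'g fword) = 0" by (simp add: zero_prod_def)
  show ?case by (simp only: list.map prod_list.Nil FWord_Nil z single_one fps_const_1_eq_1)
next
  case (Cons x xs)
  have "(FWord [x], 0) + (FWord xs, 0) = (FWord (x # xs), 0 :: 'g fword)" by (simp add: plus_fword_def zero_fword_def)
  with Cons show ?case by (simp add: mult_single)
qed

lemma prod_list_singleR:
  "prod_list (map (\<lambda>x. fps_const (Poly_Mapping.single (0, FWord [x]) 1)) xs) =
    fps_const (Poly_Mapping.single (0, FWord xs) 1 :: 'g fword \<times> 'g fword \<Rightarrow>\<^sub>0 complex)"
proof (induction xs)
  case Nil
  have z: "(0 :: 'g fword, 0 :: 'g fword) = 0" by (simp add: zero_prod_def)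
  show ?case by (simp only: list.map prod_list.Nil FWord_Nil z single_one fps_const_1_eq_1)
next
  case (Cons x xs)
  have "(0, FWord [x]) + (0, FWord xs) = (0 :: 'g fword, FWord (x # xs))" by (simp add: plus_fword_def zero_fword_def)
  with Cons show ?case by (simp add: mult_single)
qed

lemma inl_single: "inl (fps_const (Poly_Mapping.single w c)) = fps_const (Poly_Mapping.single (w, 0) c)"
proof -
  have "fps_const (cst c) * fps_const (Poly_Mapping.single (w, 0) (1::complex)) =
      fps_const (Poly_Mapping.single (w, 0 :: qgen fword) c)"
    by (simp add: mult_single zero_prod_def[symmetric])
  then show ?thesis
    by (simp add: inl_def ser_lift_const falg_lift_simps[OF central_hom_fps_cst] prod_list_singleL del: fps_const_mult)
qed

lemma inr_single: "inr (fps_const (Poly_Mapping.single w c)) = fps_const (Poly_Mapping.single (0, w) c)"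
proof -
  have "fps_const (cst c) * fps_const (Poly_Mapping.single (0, w) (1::complex)) =
      fps_const (Poly_Mapping.single (0 :: qgen fword, w) c)"
    by (simp add: mult_single zero_prod_def[symmetric])
  then show ?thesis
    by (simp add: inr_def ser_lift_const falg_lift_simps[OF central_hom_fps_cst] prod_list_singleR del: fps_const_mult)
qed

lemma inl_simps: "inl (f + g) = inl f + inl g" "inl (f * g) = inl f * inl g" "inl (f - g) = inl f - inl g"
  "inl (- f) = - inl f" "inl 0 = 0" "inl 1 = 1" "inl (scal c) = scal c" "inl fps_X = fps_X"
  "inl (of_int k) = of_int k" "inl (of_nat m) = of_nat m" "inl (f ^ j) = inl f ^ j"
  and inr_simps: "inr (f + g) = inr f + inr g" "inr (f * g) = inr f * inr g" "inr (f - g) = inr f - inr g"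
  "inr (- f) = - inr f" "inr 0 = 0" "inr 1 = 1" "inr (scal c) = scal c" "inr fps_X = fps_X"
  "inr (of_int k) = of_int k" "inr (of_nat m) = of_nat m" "inr (f ^ j) = inr f ^ j"
  by (simp_all add: inl_def inr_def ser_lift_add ser_lift_mult ser_lift_diff ser_lift_uminus
      ser_lift_scal ser_lift_power)

lemma hlinear_eq:
  fixes T T' :: "'m::monoid_add ser \<Rightarrow> 'b::ring_1 fps"
  assumes "\<And>f g. T (f + g) = T f + T g" "\<And>f. T (fps_X * f) = fps_X * T f"
    and "\<And>f g. T' (f + g) = T' f + T' g" "\<And>f. T' (fps_X * f) = fps_X * T' f"
    and "\<And>w c. w \<in> M \<Longrightarrow> T (fps_const (Poly_Mapping.single w c)) = T' (fps_const (Poly_Mapping.single w c))"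
    and "f \<in> ser_set M"
  shows "T f = T' f"
proof -
  have "T f - T' f = 0"
  proof (rule hlinear_eq_0[where T = "\<lambda>f. T f - T' f" and M = M])
    show "T (f + g) - T' (f + g) = T f - T' f + (T g - T' g)" for f g by (simp add: assms(1,3))
    show "T (fps_X * f) - T' (fps_X * f) = fps_X * (T f - T' f)" for f
      by (simp only: assms(2,4) right_diff_distrib)
    show "T (fps_const (Poly_Mapping.single w c)) - T' (fps_const (Poly_Mapping.single w c)) = 0"
      if "w \<in> M" for w c using assms(5)[OF that] by simp
    show "\<forall>k. Poly_Mapping.keys (f $ k) \<subseteq> M" using assms(6) by (simp add: ser_set_def)
  qed
  then show ?thesis by simp
qed

lemma X_left: "x * (fps_X * y) = fps_X * (x * (y :: 'm::monoid_add ser))"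
  using scal.left[of x fps_X y] unfolding scal_X .

text \<open>Both sides are h-linear in each argument, so the claim reduces to words, where the two
  products are the same pair.\<close>

lemma inl_inr_commute: "inr g * inl f = inl f * inr g"
proof -
  have 1: "inr (fps_const (Poly_Mapping.single w c)) * inl f = inl f * inr (fps_const (Poly_Mapping.single w c))"
    for w c
  proof (rule hlinear_eq[where M = UNIV and f = f])
    fix u d
    show "inr (fps_const (Poly_Mapping.single w c)) * inl (fps_const (Poly_Mapping.single u d)) =
      inl (fps_const (Poly_Mapping.single u d)) * inr (fps_const (Poly_Mapping.single w c))"
      by (simp add: inl_single inr_single mult_single mult.commute)
  qed (auto simp: inl_simps inr_simps algebra_simps X_left ser_set_def)
  show ?thesis
    by (rule hlinear_eq[where M = UNIV and f = g])
       (auto simp: 1 inl_simps inr_simps algebra_simps X_left ser_set_def)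
qed

lemma inl_inr_commute2: "inr g * (inl f * x) = inl f * (inr g * x)"
  by (simp only: mult.assoc[symmetric] inl_inr_commute)

lemma symd_cartan: "i \<le> n \<Longrightarrow> j \<le> n \<Longrightarrow> int (symd n i) * cartan n i j = int (symd n j) * cartan n j i"
  by (auto simp: symd_def cartan_def)

text \<open>Products and sums of constant series stay unevaluated from here on, so that relators
  keep their form as expressions in \<open>gen\<close>.\<close>

declare fps_const_mult [simp del] fps_const_add [simp del] fps_const_sub [simp del]
  fps_const_neg [simp del] fps_const_power [simp del]

lemma qgens_mem: "i \<in> {1..n} \<Longrightarrow> Xp i \<in> qgens n" "i \<in> {1..n} \<Longrightarrow> Xm i \<in> qgens n" "i \<in> {1..n} \<Longrightarrow> Hh i \<in> qgens n"
  by (auto simp: qgens_def)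

lemma words_over_mem: "x \<in> G \<Longrightarrow> FWord [x] \<in> words_over G" "0 \<in> words_over G"
  by (auto simp: words_over_def)

locale Uh_loc =
  fixes n :: nat
begin

abbreviation M where "M \<equiv> words_over (qgens n)"
abbreviation C where "C \<equiv> ser_set M"
abbreviation C2 where "C2 \<equiv> ser_set (M \<times> M)"

sublocale C: subring_set C
  by (rule subring_ser_set[OF submon_words_over])

sublocale C2: subring_set C2
  by (rule subring_ser_set[OF submon_Times[OF submon_words_over submon_words_over]])

lemma gen_C: "i \<in> {1..n} \<Longrightarrow> gen (Xp i) \<in> C" "i \<in> {1..n} \<Longrightarrow> gen (Xm i) \<in> C" "i \<in> {1..n} \<Longrightarrow> gen (Hh i) \<in> C"
  by (intro gen_ser_set qgens_mem; assumption)+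

lemma scal_C: "scal c \<in> C" and scal_C2: "scal c \<in> C2"
  by (intro scal_ser_set submon_words_over submon_Times)+

lemma shift_C: "f \<in> C \<Longrightarrow> fps_shift k f \<in> C"
  by (simp add: ser_set_def)

lemma exp_ser_C: "x \<in> falg_set M \<Longrightarrow> exp_ser c x \<in> C"
proof -
  interpret F: subring_set "falg_set M" by (rule subring_falg_set[OF submon_words_over])
  assume "x \<in> falg_set M"
  then show ?thesis
    by (auto simp: ser_set_iff exp_ser_def intro!: F.C_mult F.C_power cst_falg_set submon_words_over)
qed

lemma K_C: "i \<in> {1..n} \<Longrightarrow> Kgen n i \<in> C" "i \<in> {1..n} \<Longrightarrow> Kinv n i \<in> C"
  by (auto simp: Kgen_def Kinv_def exp_h_exp_ser intro!: exp_ser_C letter_falg_set qgens_mem)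

lemma Kquot_C: "i \<in> {1..n} \<Longrightarrow> Kquot n i \<in> C"
  by (auto simp: Kquot_def intro!: C.C_mult scal_C shift_C C.C_diff K_C)

lemma serre_C: "gen (X i) \<in> C \<Longrightarrow> gen (X j) \<in> C \<Longrightarrow> serre n X i j \<in> C"
  by (auto simp: serre_def Let_def intro!: C.C_closed scal_C)

lemma relators_C: "Uh_relators n \<subseteq> C"
  unfolding Uh_relators_def
  by (auto intro!: C.C_closed gen_C Kquot_C serre_C)

sublocale U: closed_ideal_set M "Uh_ideal n"
  unfolding Uh_ideal_def by (rule closed_ideal_closed_ideal_set[OF submon_words_over relators_C])

lemma relators_I: "r \<in> Uh_relators n \<Longrightarrow> r \<in> Uh_ideal n"
  using closed_ideal_closed_ideal_set(2)[OF submon_words_over relators_C] by (auto simp: Uh_ideal_def)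

lemma inl_C2: "f \<in> C \<Longrightarrow> inl f \<in> C2" and inr_C2: "f \<in> C \<Longrightarrow> inr f \<in> C2"
  unfolding inl_def inr_def
  by (auto intro!: ser_lift_closed[of _ "qgens n"] const_ser_set submon_Times submon_words_over
      words_over_mem simp: falg_set_def)

sublocale U2: closed_ideal_set "M \<times> M" "Uh2_ideal n"
  unfolding Uh2_ideal_def
  by (rule closed_ideal_closed_ideal_set)
     (auto intro!: submon_Times submon_words_over inl_C2 inr_C2 U.J_C)

lemma inl_I: "f \<in> Uh_ideal n \<Longrightarrow> inl f \<in> Uh2_ideal n" and inr_I: "f \<in> Uh_ideal n \<Longrightarrow> inr f \<in> Uh2_ideal n"
  using closed_ideal_closed_ideal_set(2)[of "M \<times> M" "inl ` Uh_ideal n \<union> inr ` Uh_ideal n"]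
  by (auto simp: Uh2_ideal_def intro!: submon_Times submon_words_over inl_C2 inr_C2 U.J_C)

lemma Uh_eq: "Uh n = U.Q" and Uh_cls_eq: "Uh_cls n f = U.cl f"
  by (simp_all add: Uh_def Uh_cls_def ser_ring_eq)

lemma Uh2_eq: "Uh2 n = U2.Q" and Uh2_cls_eq: "Uh2_cls n f = U2.cl f"
  by (simp_all add: Uh2_def Uh2_cls_def ser_ring_eq)

end

text \<open>From \<open>[x, y] = a y\<close> follows \<open>x^k y = y (x + a)^k\<close> modulo the
  ideal, hence \<open>e^(chx) y = y e^(chx) e^(cha)\<close>.\<close>

lemma (in closed_ideal_set) exp_ser_eigen:
  assumes x: "fps_const x \<in> ser_set M" and y: "fps_const y \<in> ser_set M"
    and xy: "fps_const (x * y - y * x - cst a * y) \<in> J"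
  shows "exp_ser c x * fps_const y - scal (fps_exp (c * a)) * (fps_const y * exp_ser c x) \<in> J"
proof -
  let ?z = "x + cst a"
  have z: "fps_const ?z \<in> ser_set M"
    using C_add[OF x C_scal[of "fps_const a"]] by (simp add: scal_const fps_const_add)
  have k: "fps_const (x ^ k * y - y * ?z ^ k) \<in> J" for k
  proof (induction k)
    case (Suc k)
    have "x ^ Suc k * y - y * ?z ^ Suc k = x ^ k * (x * y - y * x - cst a * y)
        + (x ^ k * y - y * ?z ^ k) * ?z"
      by (simp add: power_Suc2 algebra_simps cst_eq[of a] del: power_Suc)
    moreover have "fps_const (x ^ k) \<in> ser_set M"
      by (induction k) (auto intro!: C_mult x simp: C_one simp flip: fps_const_mult)
    ultimately show ?case
      using J_add[OF J_l[OF _ xy] J_r[OF z Suc]] by (simp flip: fps_const_add fps_const_mult)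
  qed (simp add: J_zero)
  have "exp_ser c x * fps_const y - fps_const y * exp_ser c ?z \<in> J"
  proof (rule J_series)
    fix k
    have "(exp_ser c x * fps_const y - fps_const y * exp_ser c ?z) $ k =
        cst (c ^ k / fact k) * (x ^ k * y - y * ?z ^ k)"
      by (simp add: exp_ser_def right_diff_distrib mult.assoc)
         (simp only: mult.assoc[symmetric] cst_eq[of _ y])
    then show "fps_const ((exp_ser c x * fps_const y - fps_const y * exp_ser c ?z) $ k) \<in> J"
      using J_scal[OF k, of "fps_const (c ^ k / fact k)"] by (simp add: scal_const fps_const_mult)
  qed
  moreover have "exp_ser c ?z = exp_ser c x * scal (fps_exp (c * a))"
    using exp_ser_add_commute[of x "cst a" c] by (simp add: cst_eq[of a] exp_ser_cst)
  moreover have "fps_const y * (exp_ser c x * scal t) = scal t * (fps_const y * exp_ser c x)" for t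
    using scal.left[of "fps_const y * exp_ser c x" t 1] by (simp add: mult.assoc)
  ultimately show ?thesis by simp
qed

context Uh_loc
begin

lemma HX_rel:
  assumes "i \<in> {1..n}" "j \<in> {1..n}"
  shows "gen (Hh i) * gen (Hh j) - gen (Hh j) * gen (Hh i) \<in> Uh_ideal n"
    and "gen (Hh i) * gen (Xp j) - gen (Xp j) * gen (Hh i) - of_int (cartan n i j) * gen (Xp j) \<in> Uh_ideal n"
    and "gen (Hh i) * gen (Xm j) - gen (Xm j) * gen (Hh i) + of_int (cartan n i j) * gen (Xm j) \<in> Uh_ideal n"
    and "gen (Xp i) * gen (Xm j) - gen (Xm j) * gen (Xp i) - (if i = j then Kquot n i else 0) \<in> Uh_ideal n"
proof -
  show "gen (Hh i) * gen (Hh j) - gen (Hh j) * gen (Hh i) \<in> Uh_ideal n"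
    by (rule relators_I) (unfold Uh_relators_def, use assms in blast)
  show "gen (Hh i) * gen (Xp j) - gen (Xp j) * gen (Hh i) - of_int (cartan n i j) * gen (Xp j) \<in> Uh_ideal n"
    by (rule relators_I) (unfold Uh_relators_def, use assms in blast)
  show "gen (Hh i) * gen (Xm j) - gen (Xm j) * gen (Hh i) + of_int (cartan n i j) * gen (Xm j) \<in> Uh_ideal n"
    by (rule relators_I) (unfold Uh_relators_def, use assms in blast)
  show "gen (Xp i) * gen (Xm j) - gen (Xm j) * gen (Xp i) - (if i = j then Kquot n i else 0) \<in> Uh_ideal n"
    by (rule relators_I) (unfold Uh_relators_def, use assms in blast)
qed

lemma serre_I: "X \<in> {Xp, Xm} \<Longrightarrow> i \<in> {1..n} \<Longrightarrow> j \<in> {1..n} \<Longrightarrow> i \<noteq> j \<Longrightarrow> serre n X i j \<in> Uh_ideal n"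
  by (rule relators_I) (unfold Uh_relators_def, blast)

lemma of_int_fps_cst: "of_int k = (fps_const (cst (of_int k)) :: 'm::monoid_add ser)"
  by (simp add: fps_of_int[symmetric])

lemma exp_gen_rel:
  assumes i: "i \<in> {1..n}" and j: "j \<in> {1..n}"
  shows "exp_h c (letter (Hh i)) * gen (Xp j) -
      scal (fps_exp (c * of_int (cartan n i j))) * (gen (Xp j) * exp_h c (letter (Hh i))) \<in> Uh_ideal n"
    and "exp_h c (letter (Hh i)) * gen (Xm j) -
      scal (fps_exp (c * - of_int (cartan n i j))) * (gen (Xm j) * exp_h c (letter (Hh i))) \<in> Uh_ideal n"
    and "exp_h c (letter (Hh i)) * gen (Hh j) - gen (Hh j) * exp_h c (letter (Hh i)) \<in> Uh_ideal n"
proof -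
  show "exp_h c (letter (Hh i)) * gen (Xp j) -
      scal (fps_exp (c * of_int (cartan n i j))) * (gen (Xp j) * exp_h c (letter (Hh i))) \<in> Uh_ideal n"
    unfolding exp_h_exp_ser using HX_rel(2)[OF i j]
    by (intro U.exp_ser_eigen gen_C i j) (simp add: of_int_fps_cst fps_const_mult fps_const_sub)
  show "exp_h c (letter (Hh i)) * gen (Xm j) -
      scal (fps_exp (c * - of_int (cartan n i j))) * (gen (Xm j) * exp_h c (letter (Hh i))) \<in> Uh_ideal n"
    unfolding exp_h_exp_ser using HX_rel(3)[OF i j]
    by (intro U.exp_ser_eigen gen_C i j) (simp add: of_int_fps_cst single_uminus fps_const_mult fps_const_sub fps_const_add)
  show "exp_h c (letter (Hh i)) * gen (Hh j) - gen (Hh j) * exp_h c (letter (Hh i)) \<in> Uh_ideal n"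
    using U.exp_ser_eigen[of "letter (Hh i)" "letter (Hh j)" 0 c] HX_rel(1)[OF i j] gen_C i j
    by (simp add: exp_h_exp_ser scal.one fps_const_mult fps_const_sub)
qed

lemma K_rel:
  assumes i: "i \<in> {1..n}" and j: "j \<in> {1..n}"
  shows "Kgen n i * gen (Xp j) - scal (qpow (int (symd n i) * cartan n i j)) * (gen (Xp j) * Kgen n i) \<in> Uh_ideal n"
    and "Kinv n i * gen (Xp j) - scal (qpow (- (int (symd n i) * cartan n i j))) * (gen (Xp j) * Kinv n i) \<in> Uh_ideal n"
    and "Kgen n i * gen (Xm j) - scal (qpow (- (int (symd n i) * cartan n i j))) * (gen (Xm j) * Kgen n i) \<in> Uh_ideal n"
    and "Kinv n i * gen (Xm j) - scal (qpow (int (symd n i) * cartan n i j)) * (gen (Xm j) * Kinv n i) \<in> Uh_ideal n"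
    and "gen (Hh j) * Kgen n i - Kgen n i * gen (Hh j) \<in> Uh_ideal n"
    and "gen (Hh j) * Kinv n i - Kinv n i * gen (Hh j) \<in> Uh_ideal n"
  using exp_gen_rel[OF i j, of "of_nat (symd n i)"] exp_gen_rel[OF i j, of "- of_nat (symd n i)"]
  by (auto simp: Kgen_def Kinv_def qpow_def intro: U.J_sym)

lemma KK_rel:
  assumes i: "i \<in> {1..n}" and j: "j \<in> {1..n}"
  shows "exp_h c (letter (Hh i)) * exp_h d (letter (Hh j)) - exp_h d (letter (Hh j)) * exp_h c (letter (Hh i)) \<in> Uh_ideal n"
proof -
  let ?K = "exp_h c (letter (Hh i))"
  have K: "?K \<in> C" using i by (auto simp: exp_h_exp_ser intro!: exp_ser_C letter_falg_set qgens_mem)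
  have "?K * fps_const (letter (Hh j) ^ k) - fps_const (letter (Hh j) ^ k) * ?K \<in> Uh_ideal n" for k
  proof -
    have "fps_const (letter (Hh j) ^ k) = gen (Hh j) ^ k"
      by (induction k) (simp_all flip: fps_const_mult)
    then show ?thesis
      using U.J_sym[OF U.J_power_commute[OF gen_C(3)[OF j] K U.J_sym[OF exp_gen_rel(3)[OF i j]]]] by simp
  qed
  then have k: "?K * fps_const (exp_h d (letter (Hh j)) $ k) - fps_const (exp_h d (letter (Hh j)) $ k) * ?K
      \<in> Uh_ideal n" for k
  proof -
    assume *: "\<And>k. ?K * fps_const (letter (Hh j) ^ k) - fps_const (letter (Hh j) ^ k) * ?K \<in> Uh_ideal n"
    have "?K * (scal t * x) - scal t * x * ?K = scal t * (?K * x - x * ?K)" for t and x :: "qgen fword ser"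
      by (simp add: right_diff_distrib mult.assoc scal.left)
    from this[of "fps_const (d ^ k / fact k)" "fps_const (letter (Hh j) ^ k)"]
    show ?thesis using U.J_scal[OF *, of "fps_const (d ^ k / fact k)" k]
      by (simp add: exp_h_def scal_const flip: fps_const_mult)
  qed
  let ?L = "exp_h d (letter (Hh j))"
  show ?thesis
  proof (rule U.J_limit)
    fix m
    \<comment> \<open>A truncation of the second exponential: it commutes with the first one modulo
      the ideal term by term, and the remainder is divisible by \<open>h^m\<close>.\<close>
    let ?g = "\<Sum>k<m. fps_X ^ k * fps_const (?L $ k)" and ?r = "Abs_fps (\<lambda>k. ?L $ (k + m))"
    have L: "?L = ?g + fps_X ^ m * ?r"
    proof (rule fps_ext)
      fix j
      have "?g $ j = (\<Sum>k<m. if k = j then ?L $ j else 0)"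
        unfolding fps_sum_nth by (intro sum.cong) (auto simp: fps_X_power_mult_nth)
      then show "?L $ j = (?g + fps_X ^ m * ?r) $ j"
        by (auto simp: fps_X_power_mult_nth)
    qed
    have Xm: "x * (fps_X ^ m * y) = fps_X ^ m * (x * (y :: qgen fword ser))" for x y
      using scal.left[of x "fps_X ^ m" y] unfolding scal.power scal_X .
    have "?K * ?g - ?g * ?K = (\<Sum>k<m. fps_X ^ k * (?K * fps_const (?L $ k) - fps_const (?L $ k) * ?K))"
    proof -
      have Xk: "x * (fps_X ^ k * y) = fps_X ^ k * (x * (y :: qgen fword ser))" for x y k
        using scal.left[of x "fps_X ^ k" y] unfolding scal.power scal_X .
      show ?thesis
        by (simp only: sum_distrib_left sum_distrib_right sum_subtractf[symmetric] Xk mult.assoc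
            right_diff_distrib)
    qed
    also have "\<dots> \<in> Uh_ideal n" by (intro U.J_sum U.J_l C.C_power U.C_X k)
    finally have "?K * ?g - ?g * ?K \<in> Uh_ideal n" .
    moreover have "?K * ?L - ?L * ?K - (?K * ?g - ?g * ?K) = fps_X ^ m * (?K * ?r - ?r * ?K)"
      by (subst (1 2) L) (simp only: distrib_left distrib_right Xm mult.assoc right_diff_distrib, simp)
    ultimately show "\<exists>g\<in>Uh_ideal n. \<exists>r. ?K * ?L - ?L * ?K - g = fps_X ^ m * r" by blast
  qed
qed

lemma K_nth_0: "Kgen n i $ 0 = 1" "Kinv n i $ 0 = 1"
  by (simp_all add: Kgen_def Kinv_def exp_h_def)

end

section \<open>Quantum binomials and the Serre relators in explicit form\<close>

lemma qpow_diff_nz: "d \<ge> 1 \<Longrightarrow> qpow (int d) - qpow (- int d) \<noteq> 0"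
proof
  assume d: "d \<ge> 1" and "qpow (int d) - qpow (- int d) = 0"
  then have "(qpow (int d) - qpow (- int d)) $ 1 = 0" by simp
  with d show False by (simp add: qpow_def)
qed

lemma qint_eq:
  assumes "d \<ge> 1"
  shows "qint d 1 = 1" "qint d 2 = qpow (int d) + qpow (- int d)"
    "qint d 3 = qpow (2 * int d) + 1 + qpow (- (2 * int d))"
proof -
  let ?b = "qpow (int d) - qpow (- int d)"
  have div: "qint d m = c" if "qpow (int (d * m)) - qpow (- int (d * m)) = c * ?b" for m c
    unfolding qint_def that using qpow_diff_nz[OF assms] by simp
  show "qint d 1 = 1" by (rule div) simp
  show "qint d 2 = qpow (int d) + qpow (- int d)"
    by (rule div) (simp add: algebra_simps qpow_add[symmetric])
  show "qint d 3 = qpow (2 * int d) + 1 + qpow (- (2 * int d))"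
    by (rule div) (simp add: algebra_simps qpow_add[symmetric])
qed

lemma qint_nz: "d \<ge> 1 \<Longrightarrow> m \<in> {1,2,3} \<Longrightarrow> qint d m \<noteq> 0"
proof -
  assume "d \<ge> 1" "m \<in> {1,2,3}"
  then have "qint d m $ 0 \<noteq> 0" by (auto simp: qint_eq simp del: One_nat_def)
  then show ?thesis by auto
qed

text \<open>Off-diagonal Cartan entries are at least -2, so upper indices up to 3 suffice.\<close>

lemma qbinom_eq:
  assumes d: "d \<ge> 1"
  shows "qbinom d 1 0 = 1" "qbinom d 1 1 = 1"
    "qbinom d 2 0 = 1" "qbinom d 2 1 = qint d 2" "qbinom d 2 2 = 1"
    "qbinom d 3 0 = 1" "qbinom d 3 1 = qint d 3" "qbinom d 3 2 = qint d 3" "qbinom d 3 3 = 1"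
proof -
  have f: "qfact d 0 = 1" "qfact d 1 = 1" "qfact d 2 = qint d 2" "qfact d 3 = qint d 2 * qint d 3"
    using qint_eq[OF d] by (simp_all add: qfact_def numeral_2_eq_2 numeral_3_eq_3 mult.commute)
  have nz: "qint d 2 \<noteq> 0" "qint d 3 \<noteq> 0" using qint_nz[OF d] by auto
  have s: "Suc 0 = 1" "3 - 1 = (2::nat)" "3 - 2 = (1::nat)" "2 - 1 = (1::nat)" by simp_all
  show "qbinom d 1 0 = 1" "qbinom d 1 1 = 1"
    "qbinom d 2 0 = 1" "qbinom d 2 1 = qint d 2" "qbinom d 2 2 = 1"
    "qbinom d 3 0 = 1" "qbinom d 3 3 = 1"
    using nz by (simp_all add: qbinom_def f s del: One_nat_def)
  show "qbinom d 3 1 = qint d 3" "qbinom d 3 2 = qint d 3"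
    using nz by (simp_all add: qbinom_def f s mult.commute[of "qint d 2"] del: One_nat_def)
qed

lemma symd_pos: "symd n i \<ge> 1"
  by (simp add: symd_def)

lemma serre_eq1:
  assumes "cartan n i j = 0"
  shows "serre n X i j = gen (X i) * gen (X j) - gen (X j) * gen (X i)"
proof -
  have "{..Suc 0} = {0, 1}" by auto
  then show ?thesis
    using qbinom_eq(1,2)[OF symd_pos[of n i]] assms by (simp add: serre_def scal.one)
qed

lemma serre_eq2:
  assumes "cartan n i j = -1" "d = int (symd n i)"
  shows "serre n X i j = gen (X i) * gen (X i) * gen (X j)
    - (scal (qpow d) + scal (qpow (- d))) * (gen (X i) * gen (X j) * gen (X i)) + gen (X j) * gen (X i) * gen (X i)"
proof -
  have "{..2::nat} = {0, 1, 2}" by auto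
  then show ?thesis
    using qbinom_eq(3-5)[OF symd_pos[of n i]] qint_eq(2)[OF symd_pos[of n i]] assms
    by (simp add: serre_def Let_def scal.one scal.add power2_eq_square algebra_simps del: fps_const_mult)
qed

lemma serre_eq3:
  assumes "cartan n i j = -2" "d = int (symd n i)"
  shows "serre n X i j = gen (X i) * gen (X i) * gen (X i) * gen (X j)
    - (scal (qpow (2 * d)) + 1 + scal (qpow (- (2 * d)))) * (gen (X i) * gen (X i) * gen (X j) * gen (X i))
    + (scal (qpow (2 * d)) + 1 + scal (qpow (- (2 * d)))) * (gen (X i) * gen (X j) * gen (X i) * gen (X i))
    - gen (X j) * gen (X i) * gen (X i) * gen (X i)"
proof -
  have "{..3::nat} = {0, 1, 2, 3}" by auto
  then show ?thesis
    using qbinom_eq(6-9)[OF symd_pos[of n i]] qint_eq(3)[OF symd_pos[of n i]] assms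
    by (simp add: serre_def Let_def scal.one scal.add power2_eq_square power3_eq_cube algebra_simps
        del: fps_const_mult)
qed

lemma cartan_cases: "i \<noteq> j \<Longrightarrow> cartan n i j \<in> {0, -1, -2}"
  by (auto simp: cartan_def)

section \<open>The symplectic Lie algebra\<close>

text \<open>
  Up to sign, the Chevalley generators permute the standard basis: \<open>e\<^sub>i\<close> maps the \<open>b\<close>-th basis vector to
  \<open>ce n i b\<close> times the \<open>sg n i b\<close>-th one, where indices start from 0.
\<close>

definition monom_mx :: "nat \<Rightarrow> (nat \<Rightarrow> nat) \<Rightarrow> (nat \<Rightarrow> complex) \<Rightarrow> complex mat"
  where "monom_mx n t c = mat (2*n) (2*n) (\<lambda>(a,b). if a = t b then c b else 0)"

definition sg :: "nat \<Rightarrow> nat \<Rightarrow> nat \<Rightarrow> nat"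
  where "sg n i b = (if i < n
    then (if b = i then i - 1 else if b + 1 = i then i else if b + 1 = n + i then n + i
      else if b = n + i then n + i - 1 else b)
    else (if b + 1 = 2 * n then n - 1 else if b + 1 = n then 2 * n - 1 else b))"

definition ce :: "nat \<Rightarrow> nat \<Rightarrow> nat \<Rightarrow> complex"
  where "ce n i b = (if i < n then (if b = i then 1 else if b + 1 = n + i then -1 else 0)
    else (if b + 1 = 2 * n then 1 else 0))"

definition cf :: "nat \<Rightarrow> nat \<Rightarrow> nat \<Rightarrow> complex"
  where "cf n i b = (if i < n then (if b + 1 = i then 1 else if b = n + i then -1 else 0)
    else (if b + 1 = n then 1 else 0))"

definition hh :: "nat \<Rightarrow> nat \<Rightarrow> nat \<Rightarrow> complex"
  where "hh n i b = (if i < n then (if b + 1 = i then 1 else if b = i then -1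
      else if b + 1 = n + i then -1 else if b = n + i then 1 else 0)
    else (if b + 1 = n then 1 else if b + 1 = 2 * n then -1 else 0))"

section \<open>Products and brackets of the Chevalley generators in the vector
  representation\<close>

lemma mono_carrier [simp]: "monom_mx n t c \<in> carrier_mat (2*n) (2*n)"
  by (simp add: monom_mx_def)

lemma mono_dim [simp]: "dim_row (monom_mx n t c) = 2*n" "dim_col (monom_mx n t c) = 2*n"
  by (simp_all add: monom_mx_def)

lemma mono_entry [simp]: "a < 2*n \<Longrightarrow> b < 2*n \<Longrightarrow> monom_mx n t c $$ (a,b) = (if a = t b then c b else 0)"
  by (simp add: monom_mx_def)

lemma mult_entry:
  assumes "A \<in> carrier_mat N N" "B \<in> carrier_mat N N" "a < N" "b < N"
  shows "(A * B) $$ (a,b) = (\<Sum>k<N. A $$ (a,k) * B $$ (k,b))"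
  using assms by (auto simp: scalar_prod_def atLeast0LessThan)

declare index_mult_mat(1) [simp del]

lemma lie_carrier [simp]: "A \<in> carrier_mat N N \<Longrightarrow> B \<in> carrier_mat N N \<Longrightarrow> lie A B \<in> carrier_mat N N"
  by (auto simp: lie_def)

lemma lie_entry:
  assumes "A \<in> carrier_mat N N" "B \<in> carrier_mat N N" "a < N" "b < N"
  shows "lie A B $$ (a,b) = (A * B) $$ (a,b) - (B * A) $$ (a,b)"
  using assms by (auto simp: lie_def)

lemma mult_mono:
  assumes "R \<in> carrier_mat (2*n) (2*n)" "a < 2*n" "b < 2*n" "t b < 2*n"
  shows "(R * monom_mx n t c) $$ (a,b) = R $$ (a, t b) * c b"
proof -
  have "(R * monom_mx n t c) $$ (a,b) = (\<Sum>k<2*n. if k = t b then R $$ (a, t b) * c b else 0)"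
    unfolding mult_entry[OF assms(1) mono_carrier assms(2,3)] using assms by (intro sum.cong) auto
  with assms show ?thesis by simp
qed

lemma mono_mult:
  assumes "R \<in> carrier_mat (2*n) (2*n)" "a < 2*n" "b < 2*n" "t a < 2*n" "\<And>x. x < 2*n \<Longrightarrow> t (t x) = x"
  shows "(monom_mx n t c * R) $$ (a,b) = c (t a) * R $$ (t a, b)"
proof -
  have "a = t k \<longleftrightarrow> k = t a" if "k < 2*n" for k
    using assms(5)[OF that] assms(5)[OF assms(2)] by auto
  then have "(monom_mx n t c * R) $$ (a,b) = (\<Sum>k<2*n. if k = t a then c (t a) * R $$ (t a, b) else 0)"
    unfolding mult_entry[OF mono_carrier assms(1) assms(2,3)] using assms by (intro sum.cong) auto
  with assms show ?thesis by simp
qed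

text \<open>Writing i as \<open>Suc j\<close> keeps subtraction of natural numbers out of the case
  analysis. The last two cases are the fixed points.\<close>

lemma sg_cases:
  assumes "i \<in> {1..n}" "b < 2*n"
  obtains j where "i = Suc j" "Suc j < n" "b = Suc j" "sg n i b = j"
  | j where "i = Suc j" "Suc j < n" "b = j" "sg n i b = Suc j"
  | j where "i = Suc j" "Suc j < n" "b = n + j" "sg n i b = Suc (n + j)"
  | j where "i = Suc j" "Suc j < n" "b = Suc (n + j)" "sg n i b = n + j"
  | j where "i = Suc j" "n = Suc j" "b = Suc (2 * j)" "sg n i b = j"
  | j where "i = Suc j" "n = Suc j" "b = j" "sg n i b = Suc (2 * j)"
  | j where "i = Suc j" "sg n i b = b" "Suc j < n" "b \<noteq> Suc j" "b \<noteq> j" "b \<noteq> n + j" "b \<noteq> Suc (n + j)"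
  | j where "i = Suc j" "sg n i b = b" "n = Suc j" "b \<noteq> Suc (2 * j)" "b \<noteq> j"
proof -
  obtain j where j: "i = Suc j" using assms by (cases i) auto
  show thesis
  proof (cases "Suc j < n")
    case True
    have sg: "sg n i b = (if b = Suc j then j else if b = j then Suc j else if b = n + j then Suc (n + j)
        else if b = Suc (n + j) then n + j else b)"
      using True by (simp add: sg_def j)
    consider "b = Suc j" | "b = j" | "b = n + j" | "b = Suc (n + j)"
      | "b \<noteq> Suc j" "b \<noteq> j" "b \<noteq> n + j" "b \<noteq> Suc (n + j)" by blast
    then show ?thesis
    proof cases
      case 1 then show ?thesis using that(1)[of j] j True sg by simp
    next
      case 2 then show ?thesis using that(2)[of j] j True sg by simp
    next
      case 3 then show ?thesis using that(3)[of j] j True sg by simp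
    next
      case 4 then show ?thesis using that(4)[of j] j True sg by simp
    next
      case 5 then show ?thesis using that(7)[of j] j True sg by simp
    qed
  next
    case False
    then have n: "n = Suc j" using assms j by auto
    have sg: "sg n i b = (if b = Suc (2 * j) then j else if b = j then Suc (2 * j) else b)"
      by (simp add: sg_def j n)
    consider "b = Suc (2 * j)" | "b = j" | "b \<noteq> Suc (2 * j)" "b \<noteq> j" by blast
    then show ?thesis
    proof cases
      case 1 then show ?thesis using that(5)[of j] j n sg by simp
    next
      case 2 then show ?thesis using that(6)[of j] j n sg by simp
    next
      case 3 then show ?thesis using that(8)[of j] j n sg by simp
    qed
  qed
qed

lemma sg_less: "i \<in> {1..n} \<Longrightarrow> b < 2*n \<Longrightarrow> sg n i b < 2*n"
  by (erule (1) sg_cases) auto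

lemma sg_sg: "i \<in> {1..n} \<Longrightarrow> b < 2*n \<Longrightarrow> sg n i (sg n i b) = b"
  by (erule (1) sg_cases) (auto simp: sg_def)

lemma chev_e_mono:
  assumes "i \<in> {1..n}"
  shows "chev_e n i = monom_mx n (sg n i) (ce n i)"
proof (rule eq_matI)
  fix a b assume "a < dim_row (monom_mx n (sg n i) (ce n i))" "b < dim_col (monom_mx n (sg n i) (ce n i))"
  then have ab: "a < 2*n" "b < 2*n" by auto
  have e: "chev_e n i $$ (a,b) = (if i < n then (if a + 1 = i \<and> b = i then 1 else 0) -
      (if a = n + i \<and> b + 1 = n + i then 1 else 0) else if a + 1 = n \<and> b + 1 = 2 * n then 1 else 0)"
    using ab by (auto simp: chev_e_def unit_mx_def)
  show "chev_e n i $$ (a,b) = monom_mx n (sg n i) (ce n i) $$ (a,b)"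
    unfolding e mono_entry[OF ab] using assms ab(2)
    by (rule sg_cases) (auto simp: ce_def)
qed (auto simp: chev_e_def unit_mx_def)

lemma chev_f_mono:
  assumes "i \<in> {1..n}"
  shows "chev_f n i = monom_mx n (sg n i) (cf n i)"
proof (rule eq_matI)
  fix a b assume "a < dim_row (monom_mx n (sg n i) (cf n i))" "b < dim_col (monom_mx n (sg n i) (cf n i))"
  then have ab: "a < 2*n" "b < 2*n" by auto
  have e: "chev_f n i $$ (a,b) = (if i < n then (if b + 1 = i \<and> a = i then 1 else 0) -
      (if b = n + i \<and> a + 1 = n + i then 1 else 0) else if b + 1 = n \<and> a + 1 = 2 * n then 1 else 0)"
    using ab by (auto simp: chev_f_def chev_e_def unit_mx_def)
  show "chev_f n i $$ (a,b) = monom_mx n (sg n i) (cf n i) $$ (a,b)"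
    unfolding e mono_entry[OF ab] using assms ab(2)
    by (rule sg_cases) (auto simp: cf_def)
qed (auto simp: chev_f_def chev_e_def unit_mx_def)

lemma lie_mono:
  assumes "R \<in> carrier_mat (2*n) (2*n)" "a < 2*n" "b < 2*n" "i \<in> {1..n}"
  shows "lie R (monom_mx n (sg n i) c) $$ (a,b) = R $$ (a, sg n i b) * c b - c (sg n i a) * R $$ (sg n i a, b)"
  using assms by (simp add: lie_entry[of _ "2*n"] mult_mono mono_mult sg_less sg_sg)

lemma hh_eq: "i \<in> {1..n} \<Longrightarrow> b < 2*n \<Longrightarrow> hh n i b = ce n i (sg n i b) * cf n i b - cf n i (sg n i b) * ce n i b"
  by (erule (1) sg_cases) (auto simp: hh_def ce_def cf_def)

lemma unit_mx_carrier [simp]: "unit_mx n r s \<in> carrier_mat (2*n) (2*n)"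
  by (simp add: unit_mx_def)

lemma chev_carrier [simp]: "chev_e n i \<in> carrier_mat (2*n) (2*n)" "chev_f n i \<in> carrier_mat (2*n) (2*n)"
  by (auto simp: chev_e_def chev_f_def intro!: minus_carrier_mat)

lemma coroot_carrier [simp]: "coroot n i \<in> carrier_mat (2*n) (2*n)"
  by (simp add: coroot_def)

lemma eq_matI_c:
  "A \<in> carrier_mat N N \<Longrightarrow> B \<in> carrier_mat N N \<Longrightarrow> (\<And>a b. a < N \<Longrightarrow> b < N \<Longrightarrow> A $$ (a,b) = B $$ (a,b)) \<Longrightarrow> A = B"
  by (rule eq_matI) auto

lemma coroot_mono:
  assumes "i \<in> {1..n}"
  shows "coroot n i = monom_mx n (\<lambda>b. b) (hh n i)"
proof (rule eq_matI_c[of _ "2*n"])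
  fix a b assume ab: "a < 2*n" "b < 2*n"
  have "a = sg n i (sg n i b) \<longleftrightarrow> a = b" using sg_sg[OF assms ab(2)] by simp
  moreover have "sg n i a = sg n i b \<longleftrightarrow> a = b"
    using sg_sg[OF assms] ab by metis
  ultimately show "coroot n i $$ (a,b) = monom_mx n (\<lambda>b. b) (hh n i) $$ (a,b)"
    using ab assms by (auto simp: coroot_def chev_e_mono chev_f_mono lie_mono sg_less hh_eq)
qed simp_all

lemma lie_diag:
  assumes "R \<in> carrier_mat (2*n) (2*n)" "a < 2*n" "b < 2*n"
  shows "lie (monom_mx n (\<lambda>b. b) h) R $$ (a,b) = (h a - h b) * R $$ (a,b)"
  using assms by (simp add: lie_entry[of _ "2*n"] mult_mono mono_mult left_diff_distrib mult.commute[of "R $$ _"])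

lemma lie_H_H: "i \<in> {1..n} \<Longrightarrow> j \<in> {1..n} \<Longrightarrow> lie (coroot n i) (coroot n j) = 0\<^sub>m (2*n) (2*n)"
  by (rule eq_matI_c[of _ "2*n"]) (auto simp: coroot_mono lie_diag)

lemma ce_cases:
  assumes "i \<in> {1..n}" "ce n i b \<noteq> 0"
  obtains j where "i = Suc j" "Suc j < n" "b = Suc j" "sg n i b = j" "ce n i b = 1"
  | j where "i = Suc j" "Suc j < n" "b = n + j" "sg n i b = Suc (n + j)" "ce n i b = -1"
  | j where "i = Suc j" "n = Suc j" "b = Suc (2 * j)" "sg n i b = j" "ce n i b = 1"
proof -
  obtain j where j: "i = Suc j" using assms by (cases i) auto
  show thesis
  proof (cases "Suc j < n")
    case True
    then have "b = Suc j \<or> b = n + j" using assms(2) by (auto simp: ce_def j split: if_splits)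
    then show ?thesis
    proof
      assume "b = Suc j" then show ?thesis using True j by (intro that(1)) (auto simp: sg_def ce_def)
    next
      assume "b = n + j" then show ?thesis using True j by (intro that(2)) (auto simp: sg_def ce_def)
    qed
  next
    case False
    then have n: "n = Suc j" using assms j by auto
    then have "b = Suc (2 * j)" using assms(2) by (auto simp: ce_def j split: if_splits)
    then show ?thesis using n j by (intro that(3)) (auto simp: sg_def ce_def)
  qed
qed

lemma cf_cases:
  assumes "i \<in> {1..n}" "cf n i b \<noteq> 0"
  obtains j where "i = Suc j" "Suc j < n" "b = j" "sg n i b = Suc j" "cf n i b = 1"
  | j where "i = Suc j" "Suc j < n" "b = Suc (n + j)" "sg n i b = n + j" "cf n i b = -1"
  | j where "i = Suc j" "n = Suc j" "b = j" "sg n i b = Suc (2 * j)" "cf n i b = 1"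
proof -
  obtain j where j: "i = Suc j" using assms by (cases i) auto
  show thesis
  proof (cases "Suc j < n")
    case True
    then have "b = j \<or> b = Suc (n + j)" using assms(2) by (auto simp: cf_def j split: if_splits)
    then show ?thesis
    proof
      assume "b = j" then show ?thesis using True j by (intro that(1)) (auto simp: sg_def cf_def)
    next
      assume "b = Suc (n + j)" then show ?thesis using True j by (intro that(2)) (auto simp: sg_def cf_def)
    qed
  next
    case False
    then have n: "n = Suc j" using assms j by auto
    then have "b = j" using assms(2) by (auto simp: cf_def j split: if_splits)
    then show ?thesis using n j by (intro that(3)) (auto simp: sg_def cf_def)
  qed
qed

lemma hh_Suc: "hh n (Suc m) b = (if Suc m < n then (if b = m then 1 else if b = Suc m then -1
      else if b = n + m then -1 else if b = Suc (n + m) then 1 else 0)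
    else (if Suc b = n then 1 else if Suc b = 2 * n then -1 else 0))"
  by (simp add: hh_def)

lemma ce_Suc: "ce n (Suc m) b = (if Suc m < n then (if b = Suc m then 1 else if b = n + m then -1 else 0)
    else (if Suc b = 2 * n then 1 else 0))"
  by (simp add: ce_def)

lemma cf_Suc: "cf n (Suc m) b = (if Suc m < n then (if b = m then 1 else if b = Suc (n + m) then -1 else 0)
    else (if Suc b = n then 1 else 0))"
  by (simp add: cf_def)

lemma hh_ce:
  assumes "i \<in> {1..n}" "j \<in> {1..n}"
  shows "(hh n i (sg n j b) - hh n i b) * ce n j b = of_int (cartan n i j) * ce n j b"
proof (cases "ce n j b = 0")
  case False
  obtain m where m: "i = Suc m" "m < n" using assms by (cases i) auto
  show ?thesis
    using assms(2) False
    by (cases rule: ce_cases) (use m(2) in \<open>auto simp: m(1) hh_Suc cartan_def\<close>)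
qed simp

lemma hh_cf:
  assumes "i \<in> {1..n}" "j \<in> {1..n}"
  shows "(hh n i (sg n j b) - hh n i b) * cf n j b = - of_int (cartan n i j) * cf n j b"
proof (cases "cf n j b = 0")
  case False
  obtain m where m: "i = Suc m" "m < n" using assms by (cases i) auto
  show ?thesis
    using assms(2) False
    by (cases rule: cf_cases) (use m(2) in \<open>auto simp: m(1) hh_Suc cartan_def\<close>)
qed simp

lemma lie_H_e:
  assumes "i \<in> {1..n}" "j \<in> {1..n}"
  shows "lie (coroot n i) (chev_e n j) = (of_int (cartan n i j)) \<cdot>\<^sub>m chev_e n j"
proof (rule eq_matI_c[of _ "2*n"])
  fix a b assume ab: "a < 2*n" "b < 2*n"
  show "lie (coroot n i) (chev_e n j) $$ (a,b) = ((of_int (cartan n i j)) \<cdot>\<^sub>m chev_e n j) $$ (a,b)"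
  proof (cases "a = sg n j b")
    case True
    have "lie (coroot n i) (chev_e n j) $$ (a,b) = (hh n i (sg n j b) - hh n i b) * ce n j b"
      unfolding coroot_mono[OF assms(1)] chev_e_mono[OF assms(2)] lie_diag[OF mono_carrier ab]
      using ab True by simp
    also have "\<dots> = of_int (cartan n i j) * ce n j b" by (rule hh_ce[OF assms])
    finally show ?thesis using ab True by (simp add: chev_e_mono[OF assms(2)])
  next
    case False
    then show ?thesis using ab
      by (simp add: coroot_mono[OF assms(1)] chev_e_mono[OF assms(2)] lie_diag)
  qed
qed simp_all

lemma lie_H_f:
  assumes "i \<in> {1..n}" "j \<in> {1..n}"
  shows "lie (coroot n i) (chev_f n j) = (- of_int (cartan n i j)) \<cdot>\<^sub>m chev_f n j"
proof (rule eq_matI_c[of _ "2*n"])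
  fix a b assume ab: "a < 2*n" "b < 2*n"
  show "lie (coroot n i) (chev_f n j) $$ (a,b) = ((- of_int (cartan n i j)) \<cdot>\<^sub>m chev_f n j) $$ (a,b)"
  proof (cases "a = sg n j b")
    case True
    have "lie (coroot n i) (chev_f n j) $$ (a,b) = (hh n i (sg n j b) - hh n i b) * cf n j b"
      unfolding coroot_mono[OF assms(1)] chev_f_mono[OF assms(2)] lie_diag[OF mono_carrier ab]
      using ab True by simp
    also have "\<dots> = - of_int (cartan n i j) * cf n j b" by (rule hh_cf[OF assms])
    finally show ?thesis using ab True by (simp add: chev_f_mono[OF assms(2)])
  next
    case False
    then show ?thesis using ab
      by (simp add: coroot_mono[OF assms(1)] chev_f_mono[OF assms(2)] lie_diag)
  qed
qed simp_all

lemma mono_0I: "(\<And>b. b < 2*n \<Longrightarrow> c b = 0) \<Longrightarrow> monom_mx n t c = 0\<^sub>m (2*n) (2*n)"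
  by (rule eq_matI_c[of _ "2*n"]) auto

lemma mono_mono:
  assumes "\<And>b. b < 2*n \<Longrightarrow> t' b < 2*n"
  shows "monom_mx n t c * monom_mx n t' c' = monom_mx n (\<lambda>b. t (t' b)) (\<lambda>b. c (t' b) * c' b)"
  by (rule eq_matI_c[of _ "2*n"]) (auto simp: mult_mono assms intro!: mult_carrier_mat[of _ _ "2*n"])

lemma ce_cf_disjoint:
  assumes "i \<in> {1..n}" "j \<in> {1..n}" "i \<noteq> j" "b < 2*n"
  shows "ce n i (sg n j b) * cf n j b = 0" "cf n j (sg n i b) * ce n i b = 0"
proof -
  obtain m where m: "i = Suc m" "m < n" using assms by (cases i) auto
  obtain l where l: "j = Suc l" "l < n" using assms by (cases j) auto
  show "ce n i (sg n j b) * cf n j b = 0"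
  proof (cases "cf n j b = 0")
    case False
    show ?thesis
      using assms(2) False
      by (cases rule: cf_cases) (use m assms(3) in \<open>auto simp: ce_Suc\<close>)
  qed simp
  show "cf n j (sg n i b) * ce n i b = 0"
  proof (cases "ce n i b = 0")
    case False
    show ?thesis
      using assms(1) False
      by (cases rule: ce_cases) (use l assms(3) in \<open>auto simp: cf_Suc\<close>)
  qed simp
qed

lemma lie_e_f:
  assumes "i \<in> {1..n}" "j \<in> {1..n}" "i \<noteq> j"
  shows "lie (chev_e n i) (chev_f n j) = 0\<^sub>m (2*n) (2*n)"
proof -
  have "chev_e n i * chev_f n j = 0\<^sub>m (2*n) (2*n)"
    unfolding chev_e_mono[OF assms(1)] chev_f_mono[OF assms(2)]
    by (subst mono_mono) (simp_all add: sg_less[OF assms(1)] sg_less[OF assms(2)] ce_cf_disjoint[OF assms] mono_0I del: mult_eq_0_iff)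
  moreover have "chev_f n j * chev_e n i = 0\<^sub>m (2*n) (2*n)"
    unfolding chev_e_mono[OF assms(1)] chev_f_mono[OF assms(2)]
    by (subst mono_mono) (simp_all add: sg_less[OF assms(1)] sg_less[OF assms(2)] ce_cf_disjoint[OF assms] mono_0I del: mult_eq_0_iff)
  ultimately show ?thesis by (auto simp: lie_def)
qed

lemma chev_sq:
  assumes "i \<in> {1..n}"
  shows "chev_e n i * chev_e n i = 0\<^sub>m (2*n) (2*n)"
proof -
  have "ce n i (sg n i b) * ce n i b = 0" for b
  proof (cases "ce n i b = 0")
    case False
    show ?thesis using assms False by (cases rule: ce_cases) (auto simp: ce_Suc)
  qed simp
  then show ?thesis
    unfolding chev_e_mono[OF assms] by (subst mono_mono) (simp_all add: sg_less[OF assms] mono_0I del: mult_eq_0_iff)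
qed

text \<open>Together with \<open>e_i^2 = 0\<close> this kills every monomial of the quadratic Serre
  relation, whatever its coefficient. For the excluded pair the relation is cubic, and each of its
  monomials contains \<open>e_i^2\<close>.\<close>

lemma chev_eee:
  assumes "i \<in> {1..n}" "j \<in> {1..n}" "i \<noteq> j" "\<not> (i + 1 = n \<and> j = n)"
  shows "chev_e n i * chev_e n j * chev_e n i = 0\<^sub>m (2*n) (2*n)"
proof -
  have "ce n i (sg n j (sg n i b)) * ce n j (sg n i b) * ce n i b = 0" for b
  proof (cases "ce n i b = 0 \<or> ce n j (sg n i b) = 0")
    case False
    obtain c where c: "c = sg n i b" by simp
    with False have nz: "ce n i b \<noteq> 0" "ce n j c \<noteq> 0" by auto
    have "ce n i (sg n j c) = 0"
      using assms(1) nz(1)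
    proof (cases rule: ce_cases)
      case (1 k)
      show ?thesis using assms(2) nz(2) by (cases rule: ce_cases) (use 1 c in \<open>auto simp: ce_Suc\<close>)
    next
      case (2 k)
      show ?thesis using assms(2) nz(2) by (cases rule: ce_cases) (use 2 c assms(3,4) in \<open>auto simp: ce_Suc\<close>)
    next
      case (3 k)
      show ?thesis using assms(2) nz(2) by (cases rule: ce_cases) (use 3 c in \<open>auto simp: ce_Suc\<close>)
    qed
    then show ?thesis by (simp add: c)
  qed auto
  then show ?thesis
    unfolding chev_e_mono[OF assms(1)] chev_e_mono[OF assms(2)]
    by (subst mono_mono, simp add: sg_less[OF assms(2)], subst mono_mono)
       (simp_all add: sg_less[OF assms(1)] mono_0I del: mult_eq_0_iff)
qed

lemma ce_ce:
  assumes "i \<in> {1..n}" "j \<in> {1..n}" "i + 1 < j \<or> j + 1 < i"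
  shows "ce n i (sg n j b) * ce n j b = 0"
proof (cases "ce n j b = 0")
  case False
  obtain m where m: "i = Suc m" "m < n" using assms by (cases i) auto
  show ?thesis
    using assms(2) False by (cases rule: ce_cases) (use m assms(3) in \<open>auto simp: ce_Suc\<close>)
qed simp

lemma chev_comm:
  assumes "i \<in> {1..n}" "j \<in> {1..n}" "i + 1 < j \<or> j + 1 < i"
  shows "chev_e n i * chev_e n j = chev_e n j * chev_e n i"
proof -
  have "chev_e n i * chev_e n j = 0\<^sub>m (2*n) (2*n)" if "i \<in> {1..n}" "j \<in> {1..n}" "i + 1 < j \<or> j + 1 < i" for i j
    unfolding chev_e_mono[OF that(1)] chev_e_mono[OF that(2)]
    by (subst mono_mono) (simp_all add: sg_less[OF that(2)] ce_ce[OF that] mono_0I del: mult_eq_0_iff)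
  then show ?thesis using assms by metis
qed

lemma chev_f_transpose: "transpose_mat (chev_e n i) = chev_f n i"
  by (simp add: chev_f_def)

lemma transpose_mult2:
  "(A :: complex mat) \<in> carrier_mat N N \<Longrightarrow> B \<in> carrier_mat N N \<Longrightarrow> transpose_mat (A * B) = transpose_mat B * transpose_mat A"
  by (rule transpose_mult)

lemma chev_f_sq: "i \<in> {1..n} \<Longrightarrow> chev_f n i * chev_f n i = 0\<^sub>m (2*n) (2*n)"
  using arg_cong[OF chev_sq[of i n], of transpose_mat]
  by (simp add: transpose_mult2[of _ "2*n"] chev_f_transpose)

lemma chev_fff:
  assumes "i \<in> {1..n}" "j \<in> {1..n}" "i \<noteq> j" "\<not> (i + 1 = n \<and> j = n)"
  shows "chev_f n i * chev_f n j * chev_f n i = 0\<^sub>m (2*n) (2*n)"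
  using arg_cong[OF chev_eee[OF assms], of transpose_mat]
  by (simp add: transpose_mult2[of _ "2*n"] chev_f_transpose mult_carrier_mat[of _ _ "2*n"]
      assoc_mult_mat[of _ "2*n" "2*n" _ "2*n" _ "2*n"])

lemma chev_f_comm:
  assumes "i \<in> {1..n}" "j \<in> {1..n}" "i + 1 < j \<or> j + 1 < i"
  shows "chev_f n i * chev_f n j = chev_f n j * chev_f n i"
  using arg_cong[OF chev_comm[OF assms], of transpose_mat]
  by (simp add: transpose_mult2[of _ "2*n"] chev_f_transpose)

text \<open>The eigenvalues of a coroot in the vector representation are among 0, 1 and -1. This is
  what makes the undeformed matrices satisfy the quantum relation for
  \<open>[E_i, F_i]\<close>.\<close>

lemma coroot_cube: "i \<in> {1..n} \<Longrightarrow> coroot n i * coroot n i * coroot n i = coroot n i"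
proof -
  assume i: "i \<in> {1..n}"
  have "hh n i b * hh n i b * hh n i b = hh n i b" for b by (simp add: hh_def)
  then have "(\<lambda>b. hh n i b * hh n i b * hh n i b) = hh n i" by blast
  then show ?thesis unfolding coroot_mono[OF i] by (simp add: mono_mono)
qed


subsection \<open>Membership in \<open>sp(2n)\<close>\<close>

text \<open>The symplectic form as a signed permutation, the signs being carried by
  \<open>ep\<close>.\<close>

definition dual :: "nat \<Rightarrow> nat \<Rightarrow> nat" where "dual n b = (if b < n then b + n else b - n)"
definition ep :: "nat \<Rightarrow> nat \<Rightarrow> complex" where "ep n b = (if b < n then -1 else 1)"

lemma symp_J_carrier [simp]: "symp_J n \<in> carrier_mat (2*n) (2*n)"
proof -
  have "symp_J n \<in> carrier_mat (n + n) (n + n)" unfolding symp_J_def by (rule four_block_carrier_mat) auto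
  then show ?thesis by (simp add: mult_2)
qed

lemma symp_J_dim [simp]: "dim_row (symp_J n) = 2*n" "dim_col (symp_J n) = 2*n"
  by (rule carrier_matD[OF symp_J_carrier])+

lemma dual_less: "b < 2*n \<Longrightarrow> dual n b < 2*n" and dual_dual: "b < 2*n \<Longrightarrow> dual n (dual n b) = b"
  by (auto simp: dual_def)

lemma symp_J_mono: "symp_J n = monom_mx n (dual n) (ep n)"
  by (rule eq_matI_c[of _ "2*n"]) (auto simp: symp_J_def ep_def dual_def mult_2)

text \<open>The defining equation says that the matrix \<open>J A\<close> is symmetric.\<close>

lemma sp_iff: "A \<in> sp n \<longleftrightarrow> A \<in> carrier_mat (2*n) (2*n) \<and>
    (\<forall>a<2*n. \<forall>b<2*n. ep n b * A $$ (dual n b, a) = ep n a * A $$ (dual n a, b))"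
proof (cases "A \<in> carrier_mat (2*n) (2*n)")
  case True
  have e: "(transpose_mat A * symp_J n + symp_J n * A) $$ (a,b) =
      ep n b * A $$ (dual n b, a) - ep n a * A $$ (dual n a, b)" if "a < 2*n" "b < 2*n" for a b
  proof -
    have "ep n (dual n a) = - ep n a" using that by (auto simp: ep_def dual_def)
    then show ?thesis
      using that True unfolding symp_J_mono
      by (simp add: mult_mono mono_mult dual_less dual_dual)
  qed
  have "transpose_mat A * symp_J n + symp_J n * A = 0\<^sub>m (2*n) (2*n) \<longleftrightarrow>
      (\<forall>a<2*n. \<forall>b<2*n. (transpose_mat A * symp_J n + symp_J n * A) $$ (a,b) = 0)"
  proof
    assume *: "\<forall>a<2*n. \<forall>b<2*n. (transpose_mat A * symp_J n + symp_J n * A) $$ (a,b) = 0"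
    show "transpose_mat A * symp_J n + symp_J n * A = 0\<^sub>m (2*n) (2*n)"
      by (rule eq_matI_c[of _ "2*n"]) (use * True in \<open>auto intro!: add_carrier_mat mult_carrier_mat[of _ _ "2*n"]\<close>)
  qed simp
  with True e show ?thesis by (simp add: sp_def)
qed (simp add: sp_def)

lemma sp_carrier: "A \<in> sp n \<Longrightarrow> A \<in> carrier_mat (2*n) (2*n)"
  by (simp add: sp_def)

lemma sp_lin: "A \<in> sp n \<Longrightarrow> B \<in> sp n \<Longrightarrow> x \<cdot>\<^sub>m A + y \<cdot>\<^sub>m B \<in> sp n"
  unfolding sp_iff by (auto simp: dual_less distrib_left mult.left_commute[of "ep n _"])

lemma sp_smult: "A \<in> sp n \<Longrightarrow> x \<cdot>\<^sub>m A \<in> sp n"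
  unfolding sp_iff by (auto simp: dual_less mult.left_commute[of "ep n _"])

lemma sp_add: "A \<in> sp n \<Longrightarrow> B \<in> sp n \<Longrightarrow> A + B \<in> sp n"
proof -
  assume AB: "A \<in> sp n" "B \<in> sp n"
  have "1 \<cdot>\<^sub>m X = X" for X :: "complex mat" by (rule eq_matI) auto
  then show ?thesis using sp_lin[OF AB, of 1 1] by simp
qed

lemma sp_zero: "0\<^sub>m (2*n) (2*n) \<in> sp n"
  unfolding sp_iff by (auto simp: dual_less)

lemma sp_mult_J: "A \<in> sp n \<Longrightarrow> transpose_mat A * symp_J n = - (symp_J n * A)"
proof -
  assume A: "A \<in> sp n"
  then have c: "A \<in> carrier_mat (2*n) (2*n)" and e: "transpose_mat A * symp_J n + symp_J n * A = 0\<^sub>m (2*n) (2*n)"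
    by (auto simp: sp_def)
  show ?thesis
  proof (rule eq_matI_c[of _ "2*n"])
    fix a b assume ab: "a < 2*n" "b < 2*n"
    have "(transpose_mat A * symp_J n + symp_J n * A) $$ (a,b) = 0" using e ab by simp
    then show "(transpose_mat A * symp_J n) $$ (a,b) = (- (symp_J n * A)) $$ (a,b)"
      using ab c by (simp add: eq_neg_iff_add_eq_0)
  qed (use c in \<open>auto intro!: mult_carrier_mat[of _ _ "2*n"]\<close>)
qed

lemma sp_lie:
  assumes A: "A \<in> sp n" and B: "B \<in> sp n"
  shows "lie A B \<in> sp n"
proof -
  let ?J = "symp_J n"
  have c: "A \<in> carrier_mat (2*n) (2*n)" "B \<in> carrier_mat (2*n) (2*n)" using A B by (auto dest: sp_carrier)
  note ca = c symp_J_carrier[of n]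
  have t: "transpose_mat (A * B) * ?J = ?J * (B * A)" if "A \<in> sp n" "B \<in> sp n" for A B
  proof -
    have c: "A \<in> carrier_mat (2*n) (2*n)" "B \<in> carrier_mat (2*n) (2*n)" using that by (auto dest: sp_carrier)
    have "transpose_mat (A * B) * ?J = transpose_mat B * (transpose_mat A * ?J)"
      using c by (simp add: transpose_mult2[of _ "2*n"] assoc_mult_mat[of _ "2*n" "2*n" _ "2*n" _ "2*n"])
    also have "\<dots> = - (transpose_mat B * (?J * A))"
      unfolding sp_mult_J[OF that(1)] using c
      by (subst uminus_mult_right_mat) (auto intro!: mult_carrier_mat[of _ _ "2*n"])
    also have "\<dots> = - ((transpose_mat B * ?J) * A)"
      using c by (simp add: assoc_mult_mat[of _ "2*n" "2*n" _ "2*n" _ "2*n"])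
    also have "\<dots> = ?J * B * A"
      unfolding sp_mult_J[OF that(2)] using c
      by (subst uminus_mult_left_mat) (auto intro!: mult_carrier_mat[of _ _ "2*n"])
    finally show ?thesis using c by (simp add: assoc_mult_mat[of _ "2*n" "2*n" _ "2*n" _ "2*n"])
  qed
  have "transpose_mat (lie A B) * ?J + ?J * lie A B =
      (transpose_mat (A * B) * ?J - transpose_mat (B * A) * ?J) + (?J * (A * B) - ?J * (B * A))"
  proof -
    have "transpose_mat (lie A B) = transpose_mat (A * B) - transpose_mat (B * A)"
      using c by (auto simp: lie_def intro!: eq_matI)
    moreover have "(transpose_mat (A * B) - transpose_mat (B * A)) * ?J =
        transpose_mat (A * B) * ?J - transpose_mat (B * A) * ?J"
      using c by (intro minus_mult_distrib_mat[of _ "2*n" "2*n" _ _ "2*n"]) auto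
    moreover have "?J * lie A B = ?J * (A * B) - ?J * (B * A)"
      unfolding lie_def using c by (intro mult_minus_distrib_mat[of _ "2*n" "2*n" _ "2*n"]) auto
    ultimately show ?thesis by simp
  qed
  also have "\<dots> = 0\<^sub>m (2*n) (2*n)"
    unfolding t[OF A B] t[OF B A] using ca
    by (intro eq_matI_c[of _ "2*n"]) (auto intro!: mult_carrier_mat[of _ _ "2*n"] add_carrier_mat minus_carrier_mat)
  finally show ?thesis using c by (simp add: sp_def)
qed

lemma chev_e_sp:
  assumes "i \<in> {1..n}"
  shows "chev_e n i \<in> sp n"
  unfolding chev_e_mono[OF assms] sp_iff
proof (intro conjI allI impI)
  obtain j where j: "i = Suc j" "j < n" using assms by (cases i) auto
  have 1: "ep n b * monom_mx n (sg n i) (ce n i) $$ (dual n b, a) =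
      (if Suc j < n then if a = Suc j \<and> b = n + j \<or> b = Suc j \<and> a = n + j then 1 else 0
       else if a = Suc (2 * j) \<and> b = Suc (2 * j) then 1 else 0)"
    if ab: "a < 2*n" "b < 2*n" for a b
  proof (cases "ce n i a = 0")
    case True
    then have "Suc j < n \<Longrightarrow> a \<noteq> Suc j \<and> a \<noteq> n + j" "\<not> Suc j < n \<Longrightarrow> Suc a \<noteq> 2 * n"
      using j by (simp_all add: ce_Suc split: if_splits)
    moreover have "monom_mx n (sg n i) (ce n i) $$ (dual n b, a) = 0"
      using True ab by (simp add: dual_less)
    ultimately show ?thesis using j by (cases "Suc j < n") auto
  next
    case False
    show ?thesis using assms False
      by (cases rule: ce_cases) (use ab j in \<open>auto simp: dual_less dual_def ep_def\<close>)
  qed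
  fix a b assume ab: "a < 2*n" "b < 2*n"
  show "ep n b * monom_mx n (sg n i) (ce n i) $$ (dual n b, a) = ep n a * monom_mx n (sg n i) (ce n i) $$ (dual n a, b)"
    unfolding 1[OF ab] 1[OF ab(2,1)] by auto
qed simp

lemma sp_transpose:
  assumes "A \<in> sp n"
  shows "transpose_mat A \<in> sp n"
  unfolding sp_iff
proof (intro conjI allI impI)
  fix a b assume ab: "a < 2*n" "b < 2*n"
  have c: "A \<in> carrier_mat (2*n) (2*n)" using assms by (rule sp_carrier)
  have e: "ep n (dual n a) = - ep n a" "ep n (dual n b) = - ep n b" "ep n a * ep n a = 1" "ep n b * ep n b = 1"
    using ab by (auto simp: ep_def dual_def)
  have "ep n (dual n b) * A $$ (dual n (dual n b), dual n a) = ep n (dual n a) * A $$ (dual n (dual n a), dual n b)"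
    using assms ab unfolding sp_iff by (simp add: dual_less)
  then have "ep n b * A $$ (b, dual n a) = ep n a * A $$ (a, dual n b)"
    using ab by (simp add: dual_dual e)
  then have "ep n a * (ep n b * (ep n b * A $$ (b, dual n a))) = ep n b * (ep n a * (ep n a * A $$ (a, dual n b)))"
    by simp
  then have "ep n a * A $$ (b, dual n a) = ep n b * A $$ (a, dual n b)"
    using e by (simp add: mult.assoc[symmetric])
  then show "ep n b * transpose_mat A $$ (dual n b, a) = ep n a * transpose_mat A $$ (dual n a, b)"
    using ab c by (simp add: dual_less)
qed (use assms sp_carrier in auto)

lemma chev_f_sp: "i \<in> {1..n} \<Longrightarrow> chev_f n i \<in> sp n"
  unfolding chev_f_def by (intro sp_transpose chev_e_sp)

lemma coroot_sp: "i \<in> {1..n} \<Longrightarrow> coroot n i \<in> sp n"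
  unfolding coroot_def by (intro sp_lie chev_e_sp chev_f_sp)

section \<open>The comultiplication respects the relations\<close>

context
  fixes q qi :: "'a::ring_1"
  assumes cq: "\<And>x. x * q = q * x" and cqi: "\<And>x. x * qi = qi * x" and qqi: "q * qi = 1"
begin

context
  fixes x x' y y' k k' r :: 'a
  assumes yx: "y * x = x * y" "y * x' = x' * y" "y' * x = x * y'" "y' * x' = x' * y'"
    and kx: "k * x = x * k" "k * x' = x' * k" "k' * x = x * k'" "k' * x' = x' * k'"
    and kk: "k' * k = k * k'"
    and ky: "k * y = q * (q * (y * k))" "k * y' = r * (y' * k)" "k' * y = r * (y * k')"
begin

private lemmas rules = yx kx kk ky yx[THEN assoc_rule] kx[THEN assoc_rule] kk[THEN assoc_rule] ky[THEN assoc_rule]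
  cmv[OF cq cqi qqi, of x] cmv[OF cq cqi qqi, of x'] cmv[OF cq cqi qqi, of y] cmv[OF cq cqi qqi, of y']
  cmv[OF cq cqi qqi, of k] cmv[OF cq cqi qqi, of k'] qq1[OF cq cqi qqi] qqi qiq[OF cq cqi qqi]

text \<open>The setting covers both signs: x, x' belong to the tensor factor accompanied by the
  group-like k, k', and y, y' to the other one. Once all monomials are sorted by the commutation
  rules, the mixed terms cancel and the two Serre expressions remain.\<close>

lemma coproduct_serre1:
  assumes "r = 1" "x * x' - x' * x = 0" "y * y' - y' * y = 0"
  shows "(x * k + y) * (x' * k' + y') - (x' * k' + y') * (x * k + y) = 0"
proof -
  have "(x * k + y) * (x' * k' + y') - (x' * k' + y') * (x * k + y) =
      (x * x' - x' * x) * (k * k') + (y * y' - y' * y)"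
    by (simp add: algebra_simps rules assms(1))
  then show ?thesis by (simp add: assms)
qed

lemma coproduct_serre2:
  assumes r: "r = qi"
    and x: "x * x * x' - (q + qi) * (x * x' * x) + x' * x * x = 0"
    and y: "y * y * y' - (q + qi) * (y * y' * y) + y' * y * y = 0"
    and a: "a = x * k + y" and c: "c = x' * k' + y'"
  shows "a * a * c - (q + qi) * (a * c * a) + c * a * a = 0"
proof -
  have "a * a * c - (q + qi) * (a * c * a) + c * a * a =
      (x * x * x' - (q + qi) * (x * x' * x) + x' * x * x) * (k * (k * k')) +
      (y * y * y' - (q + qi) * (y * y' * y) + y' * y * y)"
    unfolding a c by (simp add: algebra_simps rules r)
  then show ?thesis by (simp add: x y)
qed

lemma coproduct_serre3:
  assumes r: "r = qi * qi"
    and x: "x * x * x * x' - (q * q + 1 + qi * qi) * (x * x * x' * x)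
      + (q * q + 1 + qi * qi) * (x * x' * x * x) - x' * x * x * x = 0"
    and y: "y * y * y * y' - (q * q + 1 + qi * qi) * (y * y * y' * y)
      + (q * q + 1 + qi * qi) * (y * y' * y * y) - y' * y * y * y = 0"
    and a: "a = x * k + y" and c: "c = x' * k' + y'"
  shows "a * a * a * c - (q * q + 1 + qi * qi) * (a * a * c * a)
      + (q * q + 1 + qi * qi) * (a * c * a * a) - c * a * a * a = 0"
proof -
  have "a * a * a * c - (q * q + 1 + qi * qi) * (a * a * c * a)
      + (q * q + 1 + qi * qi) * (a * c * a * a) - c * a * a * a =
      (x * x * x * x' - (q * q + 1 + qi * qi) * (x * x * x' * x)
        + (q * q + 1 + qi * qi) * (x * x' * x * x) - x' * x * x * x) * (k * (k * (k * k'))) +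
      (y * y * y * y' - (q * q + 1 + qi * qi) * (y * y * y' * y)
        + (q * q + 1 + qi * qi) * (y * y' * y * y) - y' * y * y * y)"
    unfolding a c by (simp add: algebra_simps rules r)
  then show ?thesis by (simp add: x y)
qed

end

end

text \<open>Reduces compatibility with a closed ideal to its generators, by minimality of the
  ideal.\<close>

lemma closed_ideal_comap:
  assumes J: "closed_ideal_set N J" and \<phi>: "\<And>x. x \<in> G \<Longrightarrow> \<phi> x \<in> ser_set N"
  shows "closed_ideal_set (words_over G) {f \<in> ser_set (words_over G). ser_lift \<phi> f \<in> J}"
proof -
  interpret J: closed_ideal_set N J by fact
  interpret C: subring_set "ser_set (words_over G)" by (rule subring_ser_set[OF submon_words_over])
  have l: "ser_lift \<phi> f \<in> ser_set N" if "f \<in> ser_set (words_over G)" for f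
    by (rule ser_lift_closed[OF J.M \<phi> that])
  show ?thesis
  proof (rule closed_ideal_set.intro)
    show "ideal_set (ser_set (words_over G)) {f \<in> ser_set (words_over G). ser_lift \<phi> f \<in> J}"
      by standard (auto simp: ser_lift_diff ser_lift_mult l C.C_closed intro: J.J_zero J.J_diff J.J_l J.J_r)
    show "closed {f \<in> ser_set (words_over G). ser_lift \<phi> f \<in> J}"
      by (rule closed_fps_preimage[OF closed_ser_set J.closed]) (rule ser_lift_cong_nth)
  qed (rule submon_words_over)
qed

lemma scal_of_int: "scal (of_int k) = of_int k"
proof -
  have "scal (of_nat m) = of_nat m" for m
    by (induction m) (simp_all add: scal.zero scal.one scal.add)
  then show ?thesis by (cases k) (simp_all add: scal.uminus scal.diff scal.one scal.add)
qed

context Uh_loc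
begin

lemma range_scal: "range scal \<subseteq> C" "range scal \<subseteq> C2"
  using scal_C scal_C2 by auto

definition em :: "qgen fword ser \<Rightarrow> qgen fword qser" where "em f = qemb C (Uh_ideal n) f"
definition em2 :: "(qgen fword \<times> qgen fword) ser \<Rightarrow> (qgen fword \<times> qgen fword) qser"
  where "em2 f = qemb C2 (Uh2_ideal n) f"

text \<open>The guards keep scalar factors out: since the embedding is not unital, a scalar has to
  become \<open>sc c\<close> through the scaling rule and must not be embedded itself.\<close>

lemma em_mult: "NO_MATCH (scal c) f \<Longrightarrow> NO_MATCH (of_int k) f \<Longrightarrow> f \<in> C \<Longrightarrow> g \<in> C \<Longrightarrow> em (f * g) = em f * em g"
  using qemb_mult[OF U.ideal_set_axioms range_scal(1), folded em_def] .

lemmas em_simps = qemb_add[OF U.ideal_set_axioms range_scal(1), folded em_def]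
  qemb_diff[OF U.ideal_set_axioms range_scal(1), folded em_def]
  em_mult
  qemb_scal[OF U.ideal_set_axioms range_scal(1), folded em_def]
  qemb_zero[OF U.ideal_set_axioms range_scal(1), folded em_def]

lemma em2_mult: "NO_MATCH (scal c) f \<Longrightarrow> NO_MATCH (of_int k) f \<Longrightarrow> f \<in> C2 \<Longrightarrow> g \<in> C2 \<Longrightarrow> em2 (f * g) = em2 f * em2 g"
  using qemb_mult[OF U2.ideal_set_axioms range_scal(2), folded em2_def] .

lemmas em2_simps = qemb_add[OF U2.ideal_set_axioms range_scal(2), folded em2_def]
  qemb_diff[OF U2.ideal_set_axioms range_scal(2), folded em2_def]
  em2_mult
  qemb_scal[OF U2.ideal_set_axioms range_scal(2), folded em2_def]
  qemb_zero[OF U2.ideal_set_axioms range_scal(2), folded em2_def]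

lemmas em_eq_iff = qemb_eq_iff[OF U.ideal_set_axioms range_scal(1), folded em_def]
lemmas em2_eq_iff = qemb_eq_iff[OF U2.ideal_set_axioms range_scal(2), folded em2_def]

lemma em_0: "f \<in> C \<Longrightarrow> em f = 0 \<longleftrightarrow> f \<in> Uh_ideal n"
  using em_eq_iff[of f 0] by (simp add: em_simps C.C_zero)

lemma em2_0: "f \<in> C2 \<Longrightarrow> em2 f = 0 \<longleftrightarrow> f \<in> Uh2_ideal n"
  using em2_eq_iff[of f 0] by (simp add: em2_simps C2.C_zero)

lemma em_of_int: "f \<in> C \<Longrightarrow> em (of_int k * f) = sc (of_int k) * em f"
  using em_simps(4)[of f "of_int k"] by (simp add: scal_of_int)

lemma em2_of_int: "f \<in> C2 \<Longrightarrow> em2 (of_int k * f) = sc (of_int k) * em2 f"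
  using em2_simps(4)[of f "of_int k"] by (simp add: scal_of_int)

lemma em_serre2:
  assumes "a \<in> C" "c \<in> C"
  shows "em (a * a * c - (scal s + scal t) * (a * c * a) + c * a * a) =
    em a * em a * em c - (sc s + sc t) * (em a * em c * em a) + em c * em a * em a"
  using assms by (simp add: distrib_right em_simps C.C_closed scal_C)

lemma em2_serre2:
  assumes "a \<in> C2" "c \<in> C2"
  shows "em2 (a * a * c - (scal s + scal t) * (a * c * a) + c * a * a) =
    em2 a * em2 a * em2 c - (sc s + sc t) * (em2 a * em2 c * em2 a) + em2 c * em2 a * em2 a"
  using assms by (simp add: distrib_right em2_simps C2.C_closed scal_C2)

lemma em_serre3:
  assumes "a \<in> C" "c \<in> C"
  shows "em (a * a * a * c - (scal s + 1 + scal t) * (a * a * c * a) + (scal s + 1 + scal t) * (a * c * a * a) - c * a * a * a) =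
    em a * em a * em a * em c - (sc s + 1 + sc t) * (em a * em a * em c * em a)
      + (sc s + 1 + sc t) * (em a * em c * em a * em a) - em c * em a * em a * em a"
  using assms by (simp add: distrib_right em_simps C.C_closed scal_C)

lemma em2_serre3:
  assumes "a \<in> C2" "c \<in> C2"
  shows "em2 (a * a * a * c - (scal s + 1 + scal t) * (a * a * c * a) + (scal s + 1 + scal t) * (a * c * a * a) - c * a * a * a) =
    em2 a * em2 a * em2 a * em2 c - (sc s + 1 + sc t) * (em2 a * em2 a * em2 c * em2 a)
      + (sc s + 1 + sc t) * (em2 a * em2 c * em2 a * em2 a) - em2 c * em2 a * em2 a * em2 a"
  using assms by (simp add: distrib_right em2_simps C2.C_closed scal_C2)

lemma em2_inl: "f \<in> Uh_ideal n \<Longrightarrow> em2 (inl f) = 0" and em2_inr: "f \<in> Uh_ideal n \<Longrightarrow> em2 (inr f) = 0"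
  by (simp_all add: em2_0 inl_C2 inr_C2 U.J_C inl_I inr_I)

lemma em2_lr: "f \<in> C \<Longrightarrow> g \<in> C \<Longrightarrow> em2 (inr g) * em2 (inl f) = em2 (inl f) * em2 (inr g)"
  using inl_inr_commute[of g f] by (simp add: em2_mult[symmetric] inl_C2 inr_C2)

interpretation sc: central_hom "sc :: complex fps \<Rightarrow> (qgen fword \<times> qgen fword) qser" by (rule central_hom_sc)
interpretation sc1: central_hom "sc :: complex fps \<Rightarrow> qgen fword qser" by (rule central_hom_sc)

lemma em2_rel:
  assumes "f * g - scal t * (g * f) \<in> Uh_ideal n" "f \<in> C" "g \<in> C"
  shows "em2 (inl f) * em2 (inl g) = sc t * (em2 (inl g) * em2 (inl f))"
    and "em2 (inr f) * em2 (inr g) = sc t * (em2 (inr g) * em2 (inr f))"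
  using em2_inl[OF assms(1)] em2_inr[OF assms(1)] assms(2,3)
  by (simp_all add: inl_simps inr_simps em2_simps inl_C2 inr_C2 C2.C_closed scal_C2)

lemma em2_comm:
  assumes "f * g - g * f \<in> Uh_ideal n" "f \<in> C" "g \<in> C"
  shows "em2 (inl f) * em2 (inl g) = em2 (inl g) * em2 (inl f)"
    and "em2 (inr f) * em2 (inr g) = em2 (inr g) * em2 (inr f)"
  using em2_inl[OF assms(1)] em2_inr[OF assms(1)] assms(2,3)
  by (simp_all add: inl_simps inr_simps em2_simps inl_C2 inr_C2 C2.C_closed scal_C2)

lemma sc_qpow: "sc (qpow a) * sc (qpow (- a)) = (1 :: 'm::monoid_add qser)"
  by (simp add: qpow_add[symmetric] central_hom.one[OF central_hom_sc] flip: central_hom.mult[OF central_hom_sc])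

lemma sc_qpow2: "sc (qpow (2 * a)) = (sc (qpow a) * sc (qpow a) :: 'm::monoid_add qser)"
  "sc (qpow (- (2 * a))) = (sc (qpow (- a)) * sc (qpow (- a)) :: 'm::monoid_add qser)"
  by (simp_all add: qpow_add[symmetric] flip: central_hom.mult[OF central_hom_sc])

text \<open>For \<open>E_i\<close> the group-like factor is \<open>1 \<otimes> K_i\<close>, for
  \<open>F_i\<close> it is \<open>K_i^-1 \<otimes> 1\<close> and the tensor factors change roles.
  The power of q in the commutation of k with y is the same, since both signs change.\<close>

lemma Delta_serre_aux:
  assumes X: "X \<in> {Xp, Xm}" and i: "i \<in> {1..n}" and j: "j \<in> {1..n}" and ij: "i \<noteq> j"
    and A: "A \<in> C2" "B \<in> C2" and eA: "em2 A = x * k + y" and eB: "em2 B = x' * k' + y'"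
    and yx: "y * x = x * y" "y * x' = x' * y" "y' * x = x * y'" "y' * x' = x' * y'"
    and kx: "k * x = x * k" "k * x' = x' * k" "k' * x = x * k'" "k' * x' = x' * k'"
    and kk: "k' * k = k * k'"
    and ky: "k * y = sc (qpow (2 * int (symd n i))) * (y * k)"
      "k * y' = sc (qpow (int (symd n i) * cartan n i j)) * (y' * k)"
      "k' * y = sc (qpow (int (symd n i) * cartan n i j)) * (y * k')"
    and \<phi>: "\<phi> \<in> {inl, inr}" "\<psi> \<in> {inl, inr}"
    and x: "x = em2 (\<phi> (gen (X i)))" "x' = em2 (\<phi> (gen (X j)))"
    and y: "y = em2 (\<psi> (gen (X i)))" "y' = em2 (\<psi> (gen (X j)))"
    and L: "ser_lift (Delta_gen n) (gen (X i)) = A" "ser_lift (Delta_gen n) (gen (X j)) = B"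
  shows "ser_lift (Delta_gen n) (serre n X i j) \<in> Uh2_ideal n"
proof -
  let ?d = "int (symd n i)"
  let ?q = "sc (qpow ?d) :: (qgen fword \<times> qgen fword) qser" and ?qi = "sc (qpow (- ?d)) :: (qgen fword \<times> qgen fword) qser"
  have cq: "u * ?q = ?q * u" "u * ?qi = ?qi * u" for u using sc.central by simp_all
  have ky1: "k * y = ?q * (?q * (y * k))" unfolding ky(1) sc_qpow2 by (simp only: mult.assoc)
  have gC: "gen (X i) \<in> C" "gen (X j) \<in> C" using X i j gen_C by auto
  have S: "serre n X i j \<in> Uh_ideal n" by (rule serre_I[OF X i j ij])
  have xy: "em2 (\<phi> (serre n X i j)) = 0" "em2 (\<psi> (serre n X i j)) = 0"
    using \<phi> em2_inl[OF S] em2_inr[OF S] by auto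
  have hom: "\<theta> (f - g) = \<theta> f - \<theta> g" "\<theta> (f + g) = \<theta> f + \<theta> g" "\<theta> (f * g) = \<theta> f * \<theta> g" "\<theta> (scal c) = scal c" "\<theta> 1 = 1"
    if "\<theta> \<in> {inl, inr}" for \<theta> f g c using that by (auto simp: inl_simps inr_simps)
  have inC: "\<phi> (gen (X i)) \<in> C2" "\<phi> (gen (X j)) \<in> C2" "\<psi> (gen (X i)) \<in> C2" "\<psi> (gen (X j)) \<in> C2"
    using \<phi> gC inl_C2 inr_C2 by auto
  note hs = hom[OF \<phi>(1)] hom[OF \<phi>(2)]
  note sl = ser_lift_add ser_lift_diff ser_lift_mult ser_lift_scal ser_lift_1 L
  let ?r = "sc (qpow (?d * cartan n i j)) :: (qgen fword \<times> qgen fword) qser"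
  note ident = cq sc_qpow yx kx kk ky1 ky(2,3)
  consider "cartan n i j = 0" | "cartan n i j = -1" | "cartan n i j = -2"
    using cartan_cases[OF ij] by auto
  then show ?thesis
  proof cases
    case 1
    have "x * x' - x' * x = 0" "y * y' - y' * y = 0"
      using xy inC unfolding serre_eq1[OF 1] hs x y by (simp_all add: em2_simps C2.C_closed)
    moreover have "?r = 1" by (simp add: 1 sc.one)
    ultimately have "(x * k + y) * (x' * k' + y') - (x' * k' + y') * (x * k + y) = 0"
      by (intro coproduct_serre1[OF ident])
    then have "em2 (A * B - B * A) = 0" using A eA eB by (simp add: em2_simps C2.C_closed)
    then show ?thesis unfolding serre_eq1[OF 1] sl using A by (subst em2_0[symmetric]) (simp_all add: C2.C_closed)
  next
    case 2
    have "x * x * x' - (?q + ?qi) * (x * x' * x) + x' * x * x = 0"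
      "y * y * y' - (?q + ?qi) * (y * y' * y) + y' * y * y = 0"
      using xy inC unfolding serre_eq2[OF 2 refl] hs x y by (simp_all add: em2_serre2)
    moreover have "?r = ?qi" by (simp add: 2)
    ultimately have "em2 A * em2 A * em2 B - (?q + ?qi) * (em2 A * em2 B * em2 A) + em2 B * em2 A * em2 A = 0"
      by (intro coproduct_serre2[OF ident _ _ _ eA eB])
    then have "em2 (A * A * B - (scal (qpow ?d) + scal (qpow (- ?d))) * (A * B * A) + B * A * A) = 0"
      using em2_serre2[OF A] by simp
    then show ?thesis unfolding serre_eq2[OF 2 refl] sl using A
      by (subst em2_0[symmetric]) (simp_all add: C2.C_closed scal_C2)
  next
    case 3
    have "x * x * x * x' - (?q * ?q + 1 + ?qi * ?qi) * (x * x * x' * x)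
      + (?q * ?q + 1 + ?qi * ?qi) * (x * x' * x * x) - x' * x * x * x = 0"
      "y * y * y * y' - (?q * ?q + 1 + ?qi * ?qi) * (y * y * y' * y)
      + (?q * ?q + 1 + ?qi * ?qi) * (y * y' * y * y) - y' * y * y * y = 0"
      using xy inC unfolding serre_eq3[OF 3 refl] hs x y by (simp_all add: em2_serre3 sc_qpow2)
    moreover have "?r = ?qi * ?qi" using sc_qpow2(2)[of ?d] by (simp add: 3 mult.commute[of ?d])
    ultimately have "em2 A * em2 A * em2 A * em2 B - (?q * ?q + 1 + ?qi * ?qi) * (em2 A * em2 A * em2 B * em2 A)
      + (?q * ?q + 1 + ?qi * ?qi) * (em2 A * em2 B * em2 A * em2 A) - em2 B * em2 A * em2 A * em2 A = 0"
      by (intro coproduct_serre3[OF ident _ _ _ eA eB])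
    then have "em2 (A * A * A * B - (scal (qpow (2 * ?d)) + 1 + scal (qpow (- (2 * ?d)))) * (A * A * B * A)
      + (scal (qpow (2 * ?d)) + 1 + scal (qpow (- (2 * ?d)))) * (A * B * A * A) - B * A * A * A) = 0"
      using em2_serre3[OF A] by (simp add: sc_qpow2)
    then show ?thesis unfolding serre_eq3[OF 3 refl] sl using A
      by (subst em2_0[symmetric]) (simp_all add: C2.C_closed scal_C2)
  qed
qed

lemma KK_comm:
  assumes "i \<in> {1..n}" "j \<in> {1..n}"
  shows "Kgen n i * Kgen n j - Kgen n j * Kgen n i \<in> Uh_ideal n" "Kinv n i * Kinv n j - Kinv n j * Kinv n i \<in> Uh_ideal n"
  unfolding Kgen_def Kinv_def by (rule KK_rel[OF assms])+

lemma Delta_serre: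
  assumes X: "X \<in> {Xp, Xm}" and i: "i \<in> {1..n}" and j: "j \<in> {1..n}" and ij: "i \<noteq> j"
  shows "ser_lift (Delta_gen n) (serre n X i j) \<in> Uh2_ideal n"
proof -
  have ji: "int (symd n j) * cartan n j i = int (symd n i) * cartan n i j"
    using symd_cartan[of i n j] i j by simp
  have ii: "int (symd n i) * cartan n i i = 2 * int (symd n i)" by (simp add: cartan_def)
  note mem = gen_C(1,2)[OF i] gen_C(1,2)[OF j] K_C[OF i] K_C[OF j]
  note mem2 = inl_C2 inr_C2 mem C2.C_closed
  show ?thesis
  proof (cases "X = Xp")
    case True
    show ?thesis
      by (rule Delta_serre_aux[OF X i j ij, where x = "em2 (inl (gen (X i)))" and x' = "em2 (inl (gen (X j)))"
            and y = "em2 (inr (gen (X i)))" and y' = "em2 (inr (gen (X j)))"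
            and k = "em2 (inr (Kgen n i))" and k' = "em2 (inr (Kgen n j))" and \<phi> = inl and \<psi> = inr
            and A = "inl (gen (X i)) * inr (Kgen n i) + inr (gen (X i))"
            and B = "inl (gen (X j)) * inr (Kgen n j) + inr (gen (X j))"])
         (use True in \<open>simp_all add: em2_simps mem2 em2_lr em2_comm(2)[OF KK_comm(1)[OF j i]]
            em2_rel(2)[OF K_rel(1)[OF i i]] em2_rel(2)[OF K_rel(1)[OF i j]]
            em2_rel(2)[OF K_rel(1)[OF j i]] ii ji\<close>)
  next
    case False
    then have Xm: "X = Xm" using X by simp
    show ?thesis
      by (rule Delta_serre_aux[OF X i j ij, where x = "em2 (inr (gen (X i)))" and x' = "em2 (inr (gen (X j)))"
            and y = "em2 (inl (gen (X i)))" and y' = "em2 (inl (gen (X j)))"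
            and k = "em2 (inl (Kinv n i))" and k' = "em2 (inl (Kinv n j))" and \<phi> = inr and \<psi> = inl
            and A = "inl (gen (X i)) + inl (Kinv n i) * inr (gen (X i))"
            and B = "inl (gen (X j)) + inl (Kinv n j) * inr (gen (X j))"])
         (use Xm in \<open>simp_all add: em2_simps mem2 em2_lr em2_comm(1)[OF KK_comm(2)[OF j i]]
            em2_rel(1)[OF K_rel(4)[OF i i]] em2_rel(1)[OF K_rel(4)[OF i j]]
            em2_rel(1)[OF K_rel(4)[OF j i]] ii ji\<close>)
  qed
qed

section \<open>The coproduct on the Cartan part and on all relators\<close>

lemma Delta_exp: "ser_lift (Delta_gen n) (exp_h c (letter (Hh i))) =
    inl (exp_h c (letter (Hh i))) * inr (exp_h c (letter (Hh i)))"
proof -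
  let ?l = "Poly_Mapping.single (FWord [Hh i], 0) 1 :: qgen fword \<times> qgen fword \<Rightarrow>\<^sub>0 complex"
  let ?r = "Poly_Mapping.single (0, FWord [Hh i]) 1 :: qgen fword \<times> qgen fword \<Rightarrow>\<^sub>0 complex"
  have g: "inl (gen (Hh i)) = fps_const ?l" "inr (gen (Hh i)) = fps_const ?r"
    by (simp_all add: inl_single inr_single)
  have "ser_lift (Delta_gen n) (exp_h c (letter (Hh i))) = exp_ser c (?l + ?r)"
    by (rule ser_lift_exp_h) (simp add: ser_lift_const[symmetric] g fps_const_add)
  also have "\<dots> = exp_ser c ?l * exp_ser c ?r"
    by (rule exp_ser_add_commute) (simp add: mult_single)
  also have "exp_ser c ?l = inl (exp_h c (letter (Hh i)))"
    unfolding inl_def by (rule ser_lift_exp_h[symmetric]) (simp add: ser_lift_const[symmetric])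
  also have "exp_ser c ?r = inr (exp_h c (letter (Hh i)))"
    unfolding inr_def by (rule ser_lift_exp_h[symmetric]) (simp add: ser_lift_const[symmetric])
  finally show ?thesis .
qed

lemma Delta_K: "ser_lift (Delta_gen n) (Kgen n i) = inl (Kgen n i) * inr (Kgen n i)"
  "ser_lift (Delta_gen n) (Kinv n i) = inl (Kinv n i) * inr (Kinv n i)"
  by (simp_all add: Kgen_def Kinv_def Delta_exp)

text \<open>With \<open>L = K^-1\<close>, the difference
  \<open>K \<otimes> K - L \<otimes> L\<close> is written as
  \<open>(K - L) \<otimes> K + L \<otimes> (K - L)\<close> before dividing by h.\<close>

lemma Delta_Kquot:
  "ser_lift (Delta_gen n) (Kquot n i) = inl (Kquot n i) * inr (Kgen n i) + inl (Kinv n i) * inr (Kquot n i)"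
proof -
  let ?K = "Kgen n i" and ?L = "Kinv n i"
  let ?t = "scal (fps_X / (qpow (int (symd n i)) - qpow (- int (symd n i)))) :: (qgen fword \<times> qgen fword) ser"
  have 0: "(?K - ?L) $ 0 = 0" by (simp add: K_nth_0)
  have "(inl ?K * inr ?K - inl ?L * inr ?L) $ 0 = 0"
    using 0 unfolding inl_def inr_def
    by (simp add: ser_lift_ext ser_ext_nth0 K_nth_0 falg_lift_simps[OF central_hom_fps_cst])
  then have "fps_X * fps_shift 1 (inl ?K * inr ?K - inl ?L * inr ?L) = inl ?K * inr ?K - inl ?L * inr ?L"
    using fps_X_eq_shift by metis
  also have "\<dots> = inl (?K - ?L) * inr ?K + inl ?L * inr (?K - ?L)"
    by (simp add: inl_simps inr_simps algebra_simps)
  also have "\<dots> = inl (fps_X * fps_shift 1 (?K - ?L)) * inr ?K + inl ?L * inr (fps_X * fps_shift 1 (?K - ?L))"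
    using fps_X_eq_shift[OF 0] by metis
  also have "\<dots> = fps_X * (inl (fps_shift 1 (?K - ?L)) * inr ?K + inl ?L * inr (fps_shift 1 (?K - ?L)))"
    by (simp only: inl_simps inr_simps distrib_left X_left mult.assoc)
  finally have sh: "fps_shift 1 (inl ?K * inr ?K - inl ?L * inr ?L) =
      inl (fps_shift 1 (?K - ?L)) * inr ?K + inl ?L * inr (fps_shift 1 (?K - ?L))"
    by (rule fps_X_mult_cancel)
  have "ser_lift (Delta_gen n) (Kquot n i) = ?t * fps_shift 1 (inl ?K * inr ?K - inl ?L * inr ?L)"
    unfolding Kquot_def ser_lift_mult ser_lift_scal ser_lift_shift[OF 0] ser_lift_diff Delta_K ..
  also have "\<dots> = inl (Kquot n i) * inr ?K + inl ?L * inr (Kquot n i)"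
    unfolding sh Kquot_def inl_simps inr_simps distrib_left
    by (simp only: mult.assoc scal.left[of "inl ?L"])
  finally show ?thesis .
qed

lemma Delta_gen_C2: "x \<in> qgens n \<Longrightarrow> Delta_gen n x \<in> C2"
proof -
  assume "x \<in> qgens n"
  then obtain i where "i \<in> {1..n}" "x = Xp i \<or> x = Xm i \<or> x = Hh i" by (auto simp: qgens_def)
  then show ?thesis by (auto intro!: C2.C_add C2.C_mult inl_C2 inr_C2 gen_C K_C)
qed

lemma Delta_C2: "f \<in> C \<Longrightarrow> ser_lift (Delta_gen n) f \<in> C2"
  by (rule ser_lift_closed[OF submon_Times[OF submon_words_over submon_words_over] Delta_gen_C2])

lemma Delta_relator:
  assumes "r \<in> Uh_relators n"
  shows "ser_lift (Delta_gen n) r \<in> Uh2_ideal n"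
proof -
  have rC: "ser_lift (Delta_gen n) r \<in> C2" using assms relators_C by (intro Delta_C2) auto
  note sl = ser_lift_add ser_lift_diff ser_lift_mult ser_lift_of_int ser_lift_gen Delta_gen.simps
  note cl = inl_C2 inr_C2 gen_C K_C Kquot_C C2.C_closed
  have rel: "em2 (inl f) = 0 \<and> em2 (inr f) = 0" if "f \<in> Uh_ideal n" for f
    using that em2_inl em2_inr by simp
  from assms consider
      (HH) i j where "i \<in> {1..n}" "j \<in> {1..n}" "r = gen (Hh i) * gen (Hh j) - gen (Hh j) * gen (Hh i)"
    | (HE) i j where "i \<in> {1..n}" "j \<in> {1..n}"
        "r = gen (Hh i) * gen (Xp j) - gen (Xp j) * gen (Hh i) - of_int (cartan n i j) * gen (Xp j)"
    | (HF) i j where "i \<in> {1..n}" "j \<in> {1..n}"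
        "r = gen (Hh i) * gen (Xm j) - gen (Xm j) * gen (Hh i) + of_int (cartan n i j) * gen (Xm j)"
    | (EF) i j where "i \<in> {1..n}" "j \<in> {1..n}"
        "r = gen (Xp i) * gen (Xm j) - gen (Xm j) * gen (Xp i) - (if i = j then Kquot n i else 0)"
    | (S) X i j where "X \<in> {Xp, Xm}" "i \<in> {1..n}" "j \<in> {1..n}" "i \<noteq> j" "r = serre n X i j"
    unfolding Uh_relators_def by blast
  then show ?thesis
  proof cases
    case HH
    have "ser_lift (Delta_gen n) r = inl r + inr r"
      unfolding HH(3) sl by (simp add: inl_simps inr_simps algebra_simps inl_inr_commute)
    then show ?thesis using relators_I[OF assms] by (simp add: U2.J_add inl_I inr_I)
  next
    case HE
    let ?hl = "em2 (inl (gen (Hh i)))" and ?hr = "em2 (inr (gen (Hh i)))"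
      and ?el = "em2 (inl (gen (Xp j)))" and ?er = "em2 (inr (gen (Xp j)))" and ?k = "em2 (inr (Kgen n j))"
    let ?a = "sc (of_int (cartan n i j)) :: (qgen fword \<times> qgen fword) qser"
    have 1: "?hl * ?el = ?el * ?hl + ?a * ?el" "?hr * ?er = ?er * ?hr + ?a * ?er"
      using rel[OF HX_rel(2)[OF HE(1,2)]] HE(1,2)
      by (simp_all add: inl_simps inr_simps em2_simps em2_of_int cl C.C_of_int[THEN inl_C2] C.C_of_int[THEN inr_C2] algebra_simps)
    have 2: "?hr * ?k = ?k * ?hr"
      using em2_comm(2)[OF K_rel(5)[OF HE(2,1)]] HE(1,2) by (simp add: cl)
    have 3: "?hr * ?el = ?el * ?hr" "?er * ?hl = ?hl * ?er" "?k * ?hl = ?hl * ?k"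
      using HE(1,2) by (simp_all add: em2_lr cl)
    have "em2 (ser_lift (Delta_gen n) r) = (?hl + ?hr) * (?el * ?k + ?er) - (?el * ?k + ?er) * (?hl + ?hr) - ?a * (?el * ?k + ?er)"
      unfolding HE(3) sl using HE(1,2) by (simp add: em2_simps em2_of_int cl)
    also have "\<dots> = 0"
      by (simp add: algebra_simps 1 2 3 1[THEN assoc_rule] 2[THEN assoc_rule] 3[THEN assoc_rule])
    finally show ?thesis by (simp add: em2_0 rC)
  next
    case HF
    let ?hl = "em2 (inl (gen (Hh i)))" and ?hr = "em2 (inr (gen (Hh i)))"
      and ?el = "em2 (inl (gen (Xm j)))" and ?er = "em2 (inr (gen (Xm j)))" and ?k = "em2 (inl (Kinv n j))"
    let ?a = "sc (of_int (cartan n i j)) :: (qgen fword \<times> qgen fword) qser"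
    have 1: "?hl * ?el = ?el * ?hl - ?a * ?el" "?hr * ?er = ?er * ?hr - ?a * ?er"
      using rel[OF HX_rel(3)[OF HF(1,2)]] HF(1,2)
      by (simp_all add: inl_simps inr_simps em2_simps em2_of_int cl C.C_of_int[THEN inl_C2] C.C_of_int[THEN inr_C2] algebra_simps)
    have 2: "?hl * ?k = ?k * ?hl"
      using em2_comm(1)[OF K_rel(6)[OF HF(2,1)]] HF(1,2) by (simp add: cl)
    have 3: "?hr * ?el = ?el * ?hr" "?er * ?hl = ?hl * ?er" "?hr * ?k = ?k * ?hr"
      using HF(1,2) by (simp_all add: em2_lr cl)
    have "em2 (ser_lift (Delta_gen n) r) = (?hl + ?hr) * (?el + ?k * ?er) - (?el + ?k * ?er) * (?hl + ?hr) + ?a * (?el + ?k * ?er)"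
      unfolding HF(3) sl using HF(1,2) by (simp add: em2_simps em2_of_int cl)
    also have "\<dots> = 0"
      by (simp add: algebra_simps 1 2 3 1[THEN assoc_rule] 2[THEN assoc_rule] 3[THEN assoc_rule]
          sc.left[of ?k])
    finally show ?thesis by (simp add: em2_0 rC)
  next
    case EF
    let ?el = "em2 (inl (gen (Xp i)))" and ?er = "em2 (inr (gen (Xp i)))" and ?k = "em2 (inr (Kgen n i))"
      and ?fl = "em2 (inl (gen (Xm j)))" and ?fr = "em2 (inr (gen (Xm j)))" and ?l = "em2 (inl (Kinv n j))"
    define ql where "ql = (if i = j then em2 (inl (Kquot n i)) else 0)"
    define qr where "qr = (if i = j then em2 (inr (Kquot n i)) else 0)"
    let ?b = "int (symd n i) * cartan n i j"
    \<comment> \<open>Symmetry of \<open>d_i a_ij\<close> makes the powers of q in the two mixed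
      products agree, so these products cancel in the commutator.\<close>
    have b: "int (symd n j) * cartan n j i = ?b" using symd_cartan[of i n j] EF(1,2) by simp
    have 1: "?el * ?fl = ?fl * ?el + ql" "?er * ?fr = ?fr * ?er + qr"
      using rel[OF HX_rel(4)[OF EF(1,2)]] EF(1,2)
      by (auto simp: inl_simps inr_simps em2_simps cl ql_def qr_def algebra_simps)
    have 2: "?l * ?el = sc (qpow (- ?b)) * (?el * ?l)" "?k * ?fr = sc (qpow (- ?b)) * (?fr * ?k)"
      using em2_rel(1)[OF K_rel(2)[OF EF(2,1)]] em2_rel(2)[OF K_rel(3)[OF EF(1,2)]] EF(1,2) b
      by (simp_all add: cl)
    have 3: "?er * ?fl = ?fl * ?er" "?k * ?fl = ?fl * ?k" "?k * ?l = ?l * ?k" "?er * ?l = ?l * ?er"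
      "?fr * ?el = ?el * ?fr" "?fr * ?l = ?l * ?fr" "?k * ?el = ?el * ?k"
      using EF(1,2) by (simp_all add: em2_lr cl)
    have q: "em2 (ser_lift (Delta_gen n) (if i = j then Kquot n i else 0)) = ql * ?k + ?l * qr"
      using EF(1,2) by (auto simp: Delta_Kquot em2_simps cl ql_def qr_def)
    have "em2 (ser_lift (Delta_gen n) r) = (?el * ?k + ?er) * (?fl + ?l * ?fr) - (?fl + ?l * ?fr) * (?el * ?k + ?er)
        - (ql * ?k + ?l * qr)"
      unfolding EF(3) q[symmetric] ser_lift_diff[of _ _ "if i = j then Kquot n i else 0"]
      using EF(1,2) Delta_C2[of "if i = j then Kquot n i else 0"] unfolding sl
      by (subst em2_simps(2)) (auto simp: em2_simps cl Kquot_C C.C_zero)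
    also have "\<dots> = 0"
      by (simp add: algebra_simps 1 2 3 1[THEN assoc_rule] 2[THEN assoc_rule] 3[THEN assoc_rule]
          sc.left[of ?el] sc.left[of ?fr] sc.left[of ?l])
    finally show ?thesis by (simp add: em2_0 rC)
  next
    case S
    then show ?thesis using Delta_serre by simp
  qed
qed

lemma Delta_I: "f \<in> Uh_ideal n \<Longrightarrow> ser_lift (Delta_gen n) f \<in> Uh2_ideal n"
  using closed_ideal_least[OF closed_ideal_comap[where G = "qgens n" and \<phi> = "Delta_gen n",
    OF U2.closed_ideal_set_axioms Delta_gen_C2], of "Uh_relators n"]
    Delta_relator relators_C
  unfolding Uh_ideal_def by blast

end

section \<open>The specialization\<close>

lemma falg_lift_letter: "falg_lift cst \<phi> (letter x) = \<phi> x"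
  by (simp add: falg_lift_simps[OF central_hom_cst])

lemma falg_lift_diff: "falg_lift cst \<phi> (p - q) = falg_lift cst \<phi> p - falg_lift cst \<phi> q"
  by (rule additive_uminus(3)) (rule falg_lift_simps[OF central_hom_cst])

lemma falg_lift_cst: "falg_lift cst \<phi> (cst c) = cst c"
  by (simp add: falg_lift_simps[OF central_hom_cst])

lemmas falg_lift_rules = falg_lift_simps(1,2,4,5)[OF central_hom_cst] falg_lift_letter falg_lift_diff falg_lift_cst

text \<open>Converts the products that vanish in the vector representation into Serre relations of
  the Lie algebra.\<close>

lemma lie_lie_square:
  assumes A: "A \<in> carrier_mat N N" and B: "B \<in> carrier_mat N N" and A2: "A * A = 0\<^sub>m N N"
  shows "lie A (lie A B) = (- 2) \<cdot>\<^sub>m (A * B * A)"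
proof -
  have c: "A * B \<in> carrier_mat N N" "B * A \<in> carrier_mat N N" "A * B * A \<in> carrier_mat N N" using A B by auto
  have 1: "A * (A * B) = 0\<^sub>m N N"
    using A B A2 by (simp flip: assoc_mult_mat[of A N N A N B N])
  have 2: "A * (B * A) = A * B * A" using A B by (simp add: assoc_mult_mat[of _ N N _ N _ N])
  have 3: "B * A * A = 0\<^sub>m N N" using A B A2 by (simp add: assoc_mult_mat[of _ N N _ N _ N])
  have "A * (A * B - B * A) = A * (A * B) - A * (B * A)"
    using A B by (intro mult_minus_distrib_mat[of _ N N _ N]) auto
  moreover have "(A * B - B * A) * A = A * B * A - B * A * A"
    using A B by (intro minus_mult_distrib_mat[of _ N N _ _ N]) auto
  ultimately have *: "lie A (lie A B) = (0\<^sub>m N N - A * B * A) - (A * B * A - 0\<^sub>m N N)"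
    unfolding lie_def 1 2 3 by simp
  have "dim_row (A * B * A) = N" "dim_col (A * B * A) = N" using A by auto
  then show ?thesis
    unfolding * by (intro eq_matI) (simp_all del: index_mult_mat)
qed

lemma lie_0I: "A * B = B * A \<Longrightarrow> A \<in> carrier_mat N N \<Longrightarrow> B \<in> carrier_mat N N \<Longrightarrow> lie A B = 0\<^sub>m N N"
  by (auto simp: lie_def intro!: eq_matI_c[of _ N])

lemma lie_smult:
  assumes "A \<in> carrier_mat N N" "B \<in> carrier_mat N N"
  shows "lie A (c \<cdot>\<^sub>m B) = c \<cdot>\<^sub>m lie A B" "lie (c \<cdot>\<^sub>m A) B = c \<cdot>\<^sub>m lie A B"
  using assms by (auto simp: lie_def mult_smult_distrib[of _ N N _ N] mult_smult_assoc_mat[of _ N N _ N]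
      right_diff_distrib intro!: eq_matI_c[of _ N])

lemma lie_antisym:
  assumes "A \<in> carrier_mat N N" "B \<in> carrier_mat N N"
  shows "lie A B = (-1) \<cdot>\<^sub>m lie B A"
  using assms by (auto simp: lie_def intro!: eq_matI_c[of _ N])

lemma lie_cube:
  assumes A: "A \<in> carrier_mat N N" and B: "B \<in> carrier_mat N N" and A2: "A * A = 0\<^sub>m N N"
  shows "lie A (lie A (lie A B)) = 0\<^sub>m N N"
proof -
  have c: "A * B * A \<in> carrier_mat N N" using A B by auto
  have "A * (A * B * A) = A * A * (B * A)" using A B by (simp add: assoc_mult_mat[of _ N N _ N _ N])
  then have 1: "A * (A * B * A) = 0\<^sub>m N N" using A B A2 by simp
  have "A * B * A * A = A * B * (A * A)" using A B by (simp add: assoc_mult_mat[of _ N N _ N _ N])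
  then have 2: "A * B * A * A = 0\<^sub>m N N" using A B A2 by simp
  show ?thesis
    unfolding lie_lie_square[OF assms] lie_smult(1)[OF A c]
    unfolding lie_def 1 2 by (rule eq_matI_c[of _ N]) (use A B in auto)
qed

context Uh_loc
begin

abbreviation EA where "EA \<equiv> falg_set (words_over (sp n))"

sublocale EA: subring_set EA
  by (rule subring_falg_set[OF submon_words_over])

lemma letter_EA: "x \<in> sp n \<Longrightarrow> letter x \<in> EA"
  by (rule letter_falg_set)

lemma cst_EA: "cst c \<in> EA"
  by (rule cst_falg_set[OF submon_words_over])

lemma env_relators_EA: "env_relators n \<subseteq> EA"
  unfolding env_relators_def
  by (auto intro!: EA.C_diff EA.C_mult letter_EA cst_EA sp_lin sp_lie)

sublocale E: ideal_set EA "env_ideal n"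
proof -
  interpret R: ring "ring_on EA" by (rule EA.ring_ring_on)
  have "ideal (env_ideal n) (ring_on EA)"
    unfolding env_ideal_def falg_ring_eq
    by (rule R.genideal_ideal) (use env_relators_EA in \<open>simp add: ring_on_def\<close>)
  then show "ideal_set EA (env_ideal n)" by (rule ideal_setI[OF EA.subring_set_axioms])
qed

lemma env_relators_I: "r \<in> env_relators n \<Longrightarrow> r \<in> env_ideal n"
proof -
  have "env_relators n \<subseteq> env_ideal n"
    unfolding env_ideal_def falg_ring_eq
    by (rule ring.genideal_self[OF EA.ring_ring_on]) (use env_relators_EA in \<open>simp add: ring_on_def\<close>)
  then show "r \<in> env_relators n \<Longrightarrow> r \<in> env_ideal n" by blast
qed

lemma env_ideal_least:
  assumes "ideal_set EA J" "env_relators n \<subseteq> J"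
  shows "env_ideal n \<subseteq> J"
  unfolding env_ideal_def falg_ring_eq
  by (rule ring.genideal_minimal[OF EA.ring_ring_on]) (use assms ideal_set.ideal_ring_on in auto)

lemma Uenv_eq: "Uenv n = E.Q" and env_cls_eq: "env_cls n p = E.cl p"
  by (simp_all add: Uenv_def env_cls_def falg_ring_eq)

lemma env_lin: "x \<in> sp n \<Longrightarrow> y \<in> sp n \<Longrightarrow> letter (a \<cdot>\<^sub>m x + b \<cdot>\<^sub>m y) - cst a * letter x - cst b * letter y \<in> env_ideal n"
  and env_lie: "x \<in> sp n \<Longrightarrow> y \<in> sp n \<Longrightarrow> letter x * letter y - letter y * letter x - letter (lie x y) \<in> env_ideal n"
  by (rule env_relators_I; unfold env_relators_def; blast)+

lemma env_smult:
  assumes "x \<in> sp n"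
  shows "letter (a \<cdot>\<^sub>m x) - cst a * letter x \<in> env_ideal n"
proof -
  have "a \<cdot>\<^sub>m x + 0 \<cdot>\<^sub>m x = a \<cdot>\<^sub>m x" by (rule eq_matI) auto
  then show ?thesis using env_lin[OF assms assms, of a 0] by simp
qed

lemma env_add:
  assumes "x \<in> sp n" "y \<in> sp n"
  shows "letter (x + y) - letter x - letter y \<in> env_ideal n"
proof -
  have "1 \<cdot>\<^sub>m z = z" for z :: "complex mat" by (rule eq_matI) auto
  then show ?thesis using env_lin[OF assms, of 1 1] by simp
qed

lemma env_zero: "letter (0\<^sub>m (2*n) (2*n)) \<in> env_ideal n"
proof -
  have "0 \<cdot>\<^sub>m 0\<^sub>m (2*n) (2*n) = (0\<^sub>m (2*n) (2*n) :: complex mat)" by (rule eq_matI) auto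
  then show ?thesis using env_smult[OF sp_zero, of 0] by simp
qed

abbreviation spl :: "qgen falg \<Rightarrow> complex mat falg" where "spl \<equiv> falg_lift cst (spec_gen n)"

lemma spec_gen_EA: "x \<in> qgens n \<Longrightarrow> spec_gen n x \<in> EA"
  by (auto simp: qgens_def intro!: letter_EA coroot_sp chev_e_sp chev_f_sp)

lemma spl_EA:
  assumes "p \<in> falg_set M"
  shows "spl p \<in> EA"
proof -
  have "Poly_Mapping.keys p \<subseteq> M" using assms by (simp add: falg_set_def)
  then show ?thesis
  proof (induction p rule: pm_induct)
    case (single w c)
    then show ?case
      unfolding falg_lift_simps(3)[OF central_hom_cst]
      by (intro EA.C_mult cst_EA EA.C_prod_list) (use single spec_gen_EA in \<open>auto simp: words_over_def\<close>)
  qed (auto simp: falg_lift_rules EA.C_closed)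
qed

text \<open>The numerator \<open>K_i - K_i^-1\<close> starts with \<open>2 d_i h H_i\<close> and the
  denominator with \<open>2 d_i h\<close>.\<close>

lemma Kquot_nth_0: "Kquot n i $ 0 = letter (Hh i)"
proof -
  let ?d = "of_nat (symd n i) :: complex"
  have d: "?d \<noteq> 0" using symd_pos[of n i] by simp
  have "fps_X / (qpow (int (symd n i)) - qpow (- int (symd n i))) =
      1 / fps_shift 1 (qpow (int (symd n i)) - qpow (- int (symd n i)))"
  proof -
    let ?b = "qpow (int (symd n i)) - qpow (- int (symd n i))"
    have b: "?b = fps_X * fps_shift 1 ?b" by (rule fps_X_eq_shift) simp
    have "fps_shift 1 ?b \<noteq> 0" using b qpow_diff_nz[OF symd_pos[of n i]] by auto
    then have "fps_X / (fps_X * fps_shift 1 ?b) = 1 / fps_shift 1 ?b"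
      using div_mult_mult1[of "fps_X :: complex fps" 1 "fps_shift 1 ?b"] by simp
    then show ?thesis unfolding b[symmetric] .
  qed
  moreover have "(1 / fps_shift 1 (qpow (int (symd n i)) - qpow (- int (symd n i)))) $ 0 = 1 / (2 * ?d)"
  proof -
    let ?c = "fps_shift 1 (qpow (int (symd n i)) - qpow (- int (symd n i)))"
    have c: "?c $ 0 = 2 * ?d" by (simp add: qpow_def)
    then have "1 / ?c = inverse ?c" using d fps_divide_unit[of ?c 1] by simp
    then show ?thesis using c by (simp add: inverse_eq_divide)
  qed
  moreover have "(fps_shift 1 (Kgen n i - Kinv n i)) $ 0 = cst (2 * ?d) * letter (Hh i)"
  proof -
    have "cst ?d * letter (Hh i) - cst (- ?d) * letter (Hh i) = cst (2 * ?d) * letter (Hh i)"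
      by (simp add: left_diff_distrib[symmetric] single_diff[symmetric] del: single_of_nat)
    then show ?thesis by (simp add: Kgen_def Kinv_def exp_h_def)
  qed
  ultimately show ?thesis
    using d by (simp add: Kquot_def mult.assoc[symmetric]) (simp add: mult_single)
qed

lemma ad_env:
  assumes "x \<in> sp n" "y \<in> sp n" "p - letter y \<in> env_ideal n" "p \<in> EA"
  shows "letter x * p - p * letter x - letter (lie x y) \<in> env_ideal n"
proof -
  have "letter x * p - p * letter x - letter (lie x y) = letter x * (p - letter y) - (p - letter y) * letter x
      + (letter x * letter y - letter y * letter x - letter (lie x y))"
    by (simp add: algebra_simps)
  then show ?thesis
    using E.J_add[OF E.J_diff[OF E.J_l[OF letter_EA[OF assms(1)] assms(3)] E.J_r[OF letter_EA[OF assms(1)] assms(3)]]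
        env_lie[OF assms(1,2)]] by metis
qed

lemma ad_env_0:
  assumes "x \<in> sp n" "y \<in> sp n" "p - letter y \<in> env_ideal n" "p \<in> EA" "lie x y = 0\<^sub>m (2*n) (2*n)"
  shows "letter x * p - p * letter x \<in> env_ideal n"
  using E.J_add[OF ad_env[OF assms(1-4)]] env_zero assms(5) by fastforce

text \<open>At q = 1 the Serre expression is an iterated commutator, hence congruent to the letter
  of an iterated Lie bracket, and that bracket is the zero matrix.\<close>

lemma serre_env:
  fixes e :: "nat \<Rightarrow> complex mat"
  assumes sp: "e i \<in> sp n" "e j \<in> sp n"
    and sq: "e i * e i = 0\<^sub>m (2*n) (2*n)"
    and c0: "cartan n i j = 0 \<Longrightarrow> lie (e i) (e j) = 0\<^sub>m (2*n) (2*n)"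
    and c1: "cartan n i j = -1 \<Longrightarrow> e i * e j * e i = 0\<^sub>m (2*n) (2*n)"
    and ij: "i \<noteq> j" and X: "\<And>k. spec_gen n (X k) = letter (e k)"
  shows "spl (serre n X i j $ 0) \<in> env_ideal n"
proof -
  let ?x = "letter (e i)" and ?y = "letter (e j)"
  have c: "e i \<in> carrier_mat (2*n) (2*n)" "e j \<in> carrier_mat (2*n) (2*n)" using sp sp_carrier by auto
  have EA: "?x \<in> EA" "?y \<in> EA" using sp letter_EA by auto
  note l1 = sp_lie[OF sp]
  note l2 = sp_lie[OF sp(1) l1]
  let ?p1 = "?x * ?y - ?y * ?x" and ?p2 = "?x * (?x * ?y - ?y * ?x) - (?x * ?y - ?y * ?x) * ?x"
  have p1: "?p1 - letter (lie (e i) (e j)) \<in> env_ideal n" by (rule env_lie[OF sp])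
  have p1E: "?p1 \<in> EA" and p2E: "?p2 \<in> EA" using EA by (auto intro!: EA.C_closed)
  have p2: "?p2 - letter (lie (e i) (lie (e i) (e j))) \<in> env_ideal n" by (rule ad_env[OF sp(1) l1 p1 p1E])
  have cst1: "cst 1 = (1 :: complex mat falg)" "cst 2 = (2 :: complex mat falg)" "cst 3 = (3 :: complex mat falg)"
    by (simp_all add: single_numeral)
  consider "cartan n i j = 0" | "cartan n i j = -1" | "cartan n i j = -2"
    using cartan_cases[OF ij] by auto
  then show ?thesis
  proof cases
    case 1
    then have "?p1 \<in> env_ideal n" using E.J_add[OF p1] env_zero c0 by fastforce
    then show ?thesis unfolding serre_eq1[OF 1] by (simp add: falg_lift_rules X)
  next
    case 2
    have "lie (e i) (lie (e i) (e j)) = 0\<^sub>m (2*n) (2*n)"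
      unfolding lie_lie_square[OF c sq] c1[OF 2] by (rule eq_matI) auto
    then have "?p2 \<in> env_ideal n" using E.J_add[OF p2] env_zero by fastforce
    moreover have "spl (serre n X i j $ 0) = ?p2"
      unfolding serre_eq2[OF 2 refl]
      by (simp add: falg_lift_rules X mult.assoc single_one cst1 algebra_simps del: single_numeral)
    ultimately show ?thesis by simp
  next
    case 3
    have "lie (e i) (lie (e i) (lie (e i) (e j))) = 0\<^sub>m (2*n) (2*n)" by (rule lie_cube[OF c sq])
    then have "?x * ?p2 - ?p2 * ?x \<in> env_ideal n" by (rule ad_env_0[OF sp(1) l2 p2 p2E])
    moreover have "spl (serre n X i j $ 0) = ?x * ?p2 - ?p2 * ?x"
      unfolding serre_eq3[OF 3 refl]
      by (simp add: falg_lift_rules X mult.assoc single_one algebra_simps)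
    ultimately show ?thesis by simp
  qed
qed

lemma of_int_nth_0: "(of_int k * f) $ 0 = cst (of_int k) * (f $ 0 :: qgen falg)"
  by (simp add: of_int_fps_cst)

lemma spec_relator:
  assumes "r \<in> Uh_relators n"
  shows "spl (r $ 0) \<in> env_ideal n"
proof -
  from assms consider
      (HH) i j where "i \<in> {1..n}" "j \<in> {1..n}" "r = gen (Hh i) * gen (Hh j) - gen (Hh j) * gen (Hh i)"
    | (HE) i j where "i \<in> {1..n}" "j \<in> {1..n}"
        "r = gen (Hh i) * gen (Xp j) - gen (Xp j) * gen (Hh i) - of_int (cartan n i j) * gen (Xp j)"
    | (HF) i j where "i \<in> {1..n}" "j \<in> {1..n}"
        "r = gen (Hh i) * gen (Xm j) - gen (Xm j) * gen (Hh i) + of_int (cartan n i j) * gen (Xm j)"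
    | (EF) i j where "i \<in> {1..n}" "j \<in> {1..n}"
        "r = gen (Xp i) * gen (Xm j) - gen (Xm j) * gen (Xp i) - (if i = j then Kquot n i else 0)"
    | (S) X i j where "X \<in> {Xp, Xm}" "i \<in> {1..n}" "j \<in> {1..n}" "i \<noteq> j" "r = serre n X i j"
    unfolding Uh_relators_def by blast
  then show ?thesis
  proof cases
    case HH
    have "spl (r $ 0) = letter (coroot n i) * letter (coroot n j) - letter (coroot n j) * letter (coroot n i)"
      unfolding HH(3) by (simp add: falg_lift_rules)
    then show ?thesis
      using E.J_add[OF env_lie[OF coroot_sp[OF HH(1)] coroot_sp[OF HH(2)]] env_zero]
      by (simp add: lie_H_H[OF HH(1,2)])
  next
    case HE
    let ?a = "of_int (cartan n i j) :: complex"
    have "spl (r $ 0) = letter (coroot n i) * letter (chev_e n j) - letter (chev_e n j) * letter (coroot n i)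
        - cst ?a * letter (chev_e n j)"
      unfolding HE(3) fps_sub_nth of_int_nth_0 by (simp add: falg_lift_rules del: single_of_int)
    then show ?thesis
      using E.J_add[OF env_lie[OF coroot_sp[OF HE(1)] chev_e_sp[OF HE(2)]] env_smult[OF chev_e_sp[OF HE(2)], of ?a]]
      by (simp add: lie_H_e[OF HE(1,2)] del: single_of_int)
  next
    case HF
    let ?a = "of_int (cartan n i j) :: complex"
    have "spl (r $ 0) = letter (coroot n i) * letter (chev_f n j) - letter (chev_f n j) * letter (coroot n i)
        - cst (- ?a) * letter (chev_f n j)"
      unfolding HF(3) fps_add_nth fps_sub_nth of_int_nth_0
      by (simp add: falg_lift_rules single_uminus del: single_of_int)
    then show ?thesis
      using E.J_add[OF env_lie[OF coroot_sp[OF HF(1)] chev_f_sp[OF HF(2)]] env_smult[OF chev_f_sp[OF HF(2)], of "- ?a"]]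
      by (simp add: lie_H_f[OF HF(1,2)] del: single_of_int)
  next
    case EF
    have "spl (r $ 0) = letter (chev_e n i) * letter (chev_f n j) - letter (chev_f n j) * letter (chev_e n i)
        - (if i = j then letter (coroot n i) else 0)"
      unfolding EF(3) by (simp add: falg_lift_rules Kquot_nth_0)
    moreover have "(if i = j then letter (coroot n i) else 0) - letter (lie (chev_e n i) (chev_f n j)) \<in> env_ideal n"
    proof (cases "i = j")
      case False
      then have "lie (chev_e n i) (chev_f n j) = 0\<^sub>m (2*n) (2*n)" using lie_e_f[OF EF(1,2)] by simp
      then show ?thesis using False E.J_diff[OF E.J_zero env_zero] by simp
    qed (simp add: coroot_def E.J_zero)
    ultimately show ?thesis
      using E.J_diff[OF env_lie[OF chev_e_sp[OF EF(1)] chev_f_sp[OF EF(2)]]] by fastforce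
  next
    case S
    have nadj: "i + 1 < j \<or> j + 1 < i" if "cartan n i j = 0" using that S(4) by (auto simp: cartan_def split: if_splits)
    have adj: "\<not> (i + 1 = n \<and> j = n)" if "cartan n i j = -1" using that S(4) by (auto simp: cartan_def split: if_splits)
    show ?thesis
    proof (cases "X = Xp")
      case True
      show ?thesis
        unfolding S(5)
        by (rule serre_env[where e = "chev_e n"])
           (use S True nadj adj in \<open>auto intro!: chev_e_sp chev_sq chev_eee lie_0I chev_comm\<close>)
    next
      case False
      then have "X = Xm" using S by simp
      then show ?thesis
        unfolding S(5)
        by (intro serre_env[where e = "chev_f n"])
           (use S nadj adj in \<open>auto intro!: chev_f_sp chev_f_sq chev_fff lie_0I chev_f_comm\<close>)
    qed
  qed
qed

text \<open>The series whose constant term specializes to zero form a closed ideal, because a single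
  coefficient decides membership.\<close>

lemma spec_I:
  assumes "f \<in> Uh_ideal n"
  shows "spl (f $ 0) \<in> env_ideal n"
proof -
  let ?S = "{f \<in> C. spl (f $ 0) \<in> env_ideal n}"
  have "closed_ideal_set M ?S"
  proof (rule closed_ideal_set.intro)
    show "ideal_set C ?S"
    proof
      fix x y c assume xc: "x \<in> ?S" "c \<in> C"
      then have "spl (c $ 0) \<in> EA" using ser_set_iff[of c M] by (auto intro: spl_EA)
      with xc show "c * x \<in> ?S" "x * c \<in> ?S"
        by (auto simp: C.C_mult falg_lift_rules E.J_l E.J_r)
    qed (auto simp: C.C_closed falg_lift_rules E.J_zero E.J_diff)
    show "closed ?S"
      unfolding closed_fps_iff
    proof (intro allI impI)
      fix f assume *: "\<forall>m. \<exists>g\<in>?S. \<forall>k<m. g $ k = f $ k"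
      have "f \<in> C" by (rule closed_fpsD[OF closed_ser_set]) (use * in blast)
      moreover obtain g where "g \<in> ?S" "\<forall>k<1. g $ k = f $ k" using * by blast
      ultimately show "f \<in> ?S" by auto
    qed
  qed (rule submon_words_over)
  then have "Uh_ideal n \<subseteq> ?S"
    unfolding Uh_ideal_def by (rule closed_ideal_least) (use relators_C spec_relator in auto)
  with assms show ?thesis by blast
qed

lemma specialization_cl:
  assumes "f \<in> C"
  shows "specialization n (U.cl f) = E.cl (spl (f $ 0))"
  unfolding specialization_def env_cls_eq
proof (rule U.the_elem_cl[OF assms])
  fix g assume "g \<in> C" "g - f \<in> Uh_ideal n"
  then show "E.cl (spl (g $ 0)) = E.cl (spl (f $ 0))"
    using spec_I[of "g - f"] by (simp add: E.cl_eq_iff falg_lift_rules)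
qed

lemma Delta_cl:
  assumes "f \<in> C"
  shows "Delta n (U.cl f) = U2.cl (ser_lift (Delta_gen n) f)"
  unfolding Delta_def Uh2_cls_eq
proof (rule U.the_elem_cl[OF assms])
  fix g assume "g \<in> C" "g - f \<in> Uh_ideal n"
  then show "U2.cl (ser_lift (Delta_gen n) g) = U2.cl (ser_lift (Delta_gen n) f)"
    using Delta_I[of "g - f"] by (simp add: U2.cl_eq_iff ser_lift_diff)
qed

end


section \<open>The subalgebra \<open>B\<^sub>h\<close>\<close>

locale Bh = Uh_loc +
  assumes n1: "n \<ge> 1"
begin

sublocale N: qnil n sc "\<lambda>i. em (gen (Xp i))"
proof (rule qnil.intro)
  show "central_hom (sc :: complex fps \<Rightarrow> qgen fword qser)" by (rule central_hom_sc)
  fix i j assume i: "i \<in> {1..n}" and j: "j \<in> {1..n}"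
  have S: "em (serre n Xp i j) = 0" if "i \<noteq> j"
    using em_0[OF serre_C[OF gen_C(1)[OF i] gen_C(1)[OF j]]] serre_I[of Xp i j] that i j by blast
  note mem = gen_C(1)[OF i] gen_C(1)[OF j]
  show "em (gen (Xp i)) * em (gen (Xp j)) = em (gen (Xp j)) * em (gen (Xp i))" if "i + 1 < j"
  proof -
    have "cartan n i j = 0" using that by (simp add: cartan_def)
    then show ?thesis using S that mem by (simp add: serre_eq1 em_simps C.C_mult)
  qed
  show "em (gen (Xp i)) * em (gen (Xp i)) * em (gen (Xp j)) -
      (sc (qpow (int (symd n i))) + sc (qpow (- int (symd n i)))) * (em (gen (Xp i)) * em (gen (Xp j)) * em (gen (Xp i)))
      + em (gen (Xp j)) * em (gen (Xp i)) * em (gen (Xp i)) = 0"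
    if "i + 1 = j \<or> j + 1 = i" "\<not> (i + 1 = n \<and> j = n)"
  proof -
    have "cartan n i j = -1" using that i j by (auto simp: cartan_def)
    then show ?thesis using S that em_serre2[OF mem] by (auto simp: serre_eq2)
  qed
next
  fix i assume i: "i \<in> {1..n}" "i + 1 = n"
  have n: "n \<in> {1..n}" using n1 by simp
  have c: "cartan n i n = -2" "symd n i = 1" using i by (auto simp: cartan_def symd_def)
  have "em (serre n Xp i n) = 0"
    using em_0[OF serre_C[OF gen_C(1)[OF i(1)] gen_C(1)[OF n]]] serre_I[of Xp i n] i n by auto
  then show "em (gen (Xp i)) * em (gen (Xp i)) * em (gen (Xp i)) * em (gen (Xp n)) -
      (sc (qpow 2) + 1 + sc (qpow (- 2))) * (em (gen (Xp i)) * em (gen (Xp i)) * em (gen (Xp n)) * em (gen (Xp i)))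
      + (sc (qpow 2) + 1 + sc (qpow (- 2))) * (em (gen (Xp i)) * em (gen (Xp n)) * em (gen (Xp i)) * em (gen (Xp i)))
      - em (gen (Xp n)) * em (gen (Xp i)) * em (gen (Xp i)) * em (gen (Xp i)) = 0"
    using em_serre3[OF gen_C(1)[OF i(1)] gen_C(1)[OF n]] c by (simp add: serre_eq3[OF c(1) refl])
qed (rule n1)

definition vq :: "nat \<Rightarrow> qgen fword ser"
  where "vq i = (if i < n then up_q i else down_q n (2 * n - i))"

lemma up_q_Suc: "1 \<le> k \<Longrightarrow> up_q (Suc k) = qbr 1 (up_q k) (gen (Xp (Suc k)))"
  by (simp add: up_q_def)

lemma down_q_step: "k < n \<Longrightarrow> down_q n k = qbr 1 (down_q n (Suc k)) (gen (Xp k))"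
  by (simp add: down_q_def upt_conv_Cons)

lemma vq_1: "vq 1 = gen (Xp 1)"
  unfolding vq_def using n1 by (cases "n = 1") (auto simp: up_q_def down_q_def X_q_def numeral_2_eq_2)

lemma vq_Suc:
  assumes "1 \<le> i" "i \<le> 2 * n - 2"
  shows "vq (Suc i) = vq i * gen (Xp (st n i)) - scal (qpow (ex n i)) * (gen (Xp (st n i)) * vq i)"
proof -
  consider "Suc i < n" | "Suc i = n" | "n \<le> i" by linarith
  then show ?thesis
  proof cases
    case 1
    then show ?thesis using assms up_q_Suc[of i] by (simp add: vq_def st_def ex_def qbr_def Suc_eq_plus1)
  next
    case 2
    then have "vq (Suc i) = X_q n" by (simp add: vq_def down_q_def)
    moreover have "n \<noteq> 1" "n - 1 = i" using 2 assms by auto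
    ultimately show ?thesis using 2 by (auto simp: vq_def st_def ex_def qbr_def X_q_def)
  next
    case 3
    define k where "k = 2 * n - 1 - i"
    have k: "2 * n - Suc i = k" "2 * n - i = Suc k" "k < n" using 3 assms by (auto simp: k_def)
    have "st n i = k" "ex n i = 1" using 3 assms by (auto simp: k_def st_def ex_def)
    then show ?thesis using 3 k down_q_step[of k] by (simp add: vq_def qbr_def)
  qed
qed

lemma st_mem: "1 \<le> i \<Longrightarrow> i \<le> 2 * n - 2 \<Longrightarrow> st n i \<in> {1..n}"
  by (auto simp: st_def)

lemma vq_C: "1 \<le> i \<Longrightarrow> i \<le> 2 * n - 1 \<Longrightarrow> vq i \<in> C"
proof (induction i rule: nat_induct_at_least)
  case base
  then show ?case using vq_1 gen_C(1)[of 1] n1 by simp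
next
  case (Suc i)
  then show ?case using vq_Suc[of i] st_mem[of i] by (simp add: C.C_closed scal_C gen_C)
qed

lemma em_vq: "1 \<le> i \<Longrightarrow> i \<le> 2 * n - 1 \<Longrightarrow> em (vq i) = N.v i"
proof (induction i rule: nat_induct_at_least)
  case base
  then show ?case using vq_1 N.v1 by simp
next
  case (Suc i)
  then have "vq i \<in> C" "gen (Xp (st n i)) \<in> C" using vq_C[of i] st_mem[of i] gen_C by auto
  with Suc show ?case using vq_Suc[of i]
    by (simp add: em_simps C.C_closed scal_C N.v.simps N.Q_def)
qed

lemma vq_R1:
  assumes i: "1 \<le> i" "i \<le> 2 * n - 2" and k: "2 \<le> k" "k \<le> n"
  shows "vq i * gen (Xp k) - scal (qpow (- wt n i k)) * (gen (Xp k) * vq i) -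
    (if st n i = k then vq (Suc i) else 0) \<in> Uh_ideal n"
proof -
  have mem: "vq i \<in> C" "gen (Xp k) \<in> C" "vq (Suc i) \<in> C" using i k vq_C gen_C by auto
  have "em (vq i * gen (Xp k) - scal (qpow (- wt n i k)) * (gen (Xp k) * vq i) - (if st n i = k then vq (Suc i) else 0)) = 0"
    using N.R1[OF i k] mem em_vq[of i] em_vq[of "Suc i"] i
    by (auto simp: em_simps C.C_closed scal_C N.Q_def)
  then show ?thesis using mem by (subst em_0[symmetric]) (auto simp: C.C_closed scal_C)
qed

end

section \<open>Subalgebras and the coideal property\<close>

text \<open>V and U are the two tensor factors of one summand, and \<open>A K + R\<close> is the
  coproduct of the next \<open>E_k\<close>. The condition \<open>a = t w\<close> balances the
  weights so that the terms \<open>V A\<close> and \<open>A V\<close> combine into the bracket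
  V'.\<close>

lemma (in central_hom) coideal_step:
  fixes V U A K R :: 'b
  assumes "U * A = A * U" "R * V = V * R" "K * V = V * K" "K * U = s w * (U * K)"
    and V': "V * A - s a * (A * V) = V'" and a: "a = t * w"
  shows "V * U * (A * K + R) - s t * ((A * K + R) * (V * U)) = V' * (U * K) + V * (U * R - s t * (R * U))"
proof -
  have 1: "V * U * (A * K) = V * A * (U * K)" using assms(1) by (metis mult.assoc)
  have "A * K * (V * U) = A * V * (K * U)" using assms(3) by (metis mult.assoc)
  also have "\<dots> = s w * (A * V * (U * K))" unfolding assms(4) by (rule left)
  finally have 2: "s t * (A * K * (V * U)) = s a * (A * V) * (U * K)" unfolding a by (simp add: mult mult.assoc)
  have "R * (V * U) = V * (R * U)" using assms(2) by (metis mult.assoc)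
  then have 3: "s t * (R * (V * U)) = V * (s t * (R * U))" by (simp add: left)
  show ?thesis
    unfolding V'[symmetric] left_diff_distrib right_diff_distrib distrib_left distrib_right 1 2 3 by (simp add: mult.assoc)
qed

context Bh
begin

text \<open>Closed subalgebras of the quotient, described by all their representatives; hence the
  ideal is contained in them.\<close>

definition halg :: "qgen fword ser set \<Rightarrow> bool"
  where "halg S \<longleftrightarrow> subring_set S \<and> S \<subseteq> C \<and> range scal \<subseteq> S \<and> closed S \<and> Uh_ideal n \<subseteq> S"

lemma halg_cl:
  assumes "halg S" "f \<in> C" "U.cl f \<in> U.cl ` S"
  shows "f \<in> S"
proof -
  from assms(3) obtain g where g: "g \<in> S" "f - g \<in> Uh_ideal n" by (auto simp: U.cl_eq_iff)
  interpret subring_set S using assms(1) by (simp add: halg_def)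
  have "g + (f - g) \<in> S" using g assms(1) by (intro C_add) (auto simp: halg_def)
  then show ?thesis by simp
qed

lemma h_subalgebra_iff:
  assumes "B \<subseteq> carrier U.Q"
  shows "h_subalgebra n B \<longleftrightarrow> halg {f \<in> C. U.cl f \<in> B}"
proof -
  have "Uh_ideal n \<subseteq> {f \<in> C. U.cl f \<in> B}" if "subring_set {f \<in> C. U.cl f \<in> B}"
    using subring_set.C_zero[OF that] by (auto intro: U.J_C) (metis U.cl_eq_iff diff_zero)
  then show ?thesis
    using U.Union_Q[OF assms] U.subring_Q_iff[OF assms]
    by (auto simp: h_subalgebra_def halg_def Uh_eq Uh_cls_eq scal_C image_subset_iff)
qed

lemma h_subalgebra_carrier: "h_subalgebra n B \<Longrightarrow> B \<subseteq> carrier U.Q"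
  using subringE(1)[of B "U.Q"] by (simp add: h_subalgebra_def Uh_eq)

lemma halg_h_subalgebra:
  assumes "halg S"
  shows "h_subalgebra n (U.cl ` S)"
proof -
  have "S \<subseteq> C" using assms by (simp add: halg_def)
  then have "{f \<in> C. U.cl f \<in> U.cl ` S} = S" using halg_cl[OF assms] by auto
  then show ?thesis using assms \<open>S \<subseteq> C\<close> by (subst h_subalgebra_iff) (auto simp: U.carrier_Q)
qed

lemma halg_Inter:
  assumes "F \<noteq> {}" "\<And>S. S \<in> F \<Longrightarrow> halg S"
  shows "halg (\<Inter>F)"
proof -
  have "subring_set (\<Inter>F)"
  proof
    show "1 \<in> \<Inter>F" using assms(2) by (auto simp: halg_def subring_set_def)
  qed (use assms(2) in \<open>auto simp: halg_def subring_set_def\<close>)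
  moreover have "\<Inter>F \<subseteq> C" using assms unfolding halg_def by blast
  ultimately show ?thesis using assms(2) by (auto simp: halg_def image_subset_iff intro!: closed_Inter)
qed

lemma halg_C: "halg C"
  using C.subring_set_axioms by (auto simp: halg_def scal_C closed_ser_set U.J_C)

section \<open>The subalgebra through its representatives, and the left coideal property\<close>

definition B_gens :: "qgen fword ser set"
  where "B_gens = {K_prod n, K_log n} \<union> vq ` {1..2 * n - 1}"

lemma K_log_C: "K_log n \<in> C"
  unfolding K_log_def by (intro C.C_sum C.C_mult C.C_of_nat gen_C)

lemma K_prod_C: "K_prod n \<in> C"
  unfolding K_prod_def by (intro C.C_prod_list) (auto simp: K_C)

lemma B_gens_C: "B_gens \<subseteq> C"
  by (auto simp: B_gens_def K_log_C K_prod_C vq_C)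

definition B0 :: "qgen fword ser set"
  where "B0 = \<Inter>{S. halg S \<and> B_gens \<subseteq> S}"

lemma halg_B0: "halg B0"
  unfolding B0_def by (rule halg_Inter) (use halg_C B_gens_C in auto)

lemma B_gens_B0: "B_gens \<subseteq> B0"
  by (auto simp: B0_def)

lemma B0_least: "halg S \<Longrightarrow> B_gens \<subseteq> S \<Longrightarrow> B0 \<subseteq> S"
  by (auto simp: B0_def)

sublocale B0: subring_set B0
  using halg_B0 by (simp add: halg_def)

lemma B0_C: "f \<in> B0 \<Longrightarrow> f \<in> C" and B0_scal: "scal c \<in> B0" and B0_I: "f \<in> Uh_ideal n \<Longrightarrow> f \<in> B0"
  using halg_B0 by (auto simp: halg_def)

lemma sub_B_eq: "sub_B n = U.cl ` B0"
proof -
  have "{up_q k | k. 1 \<le> k \<and> k \<le> n - 1} \<union> {down_q n k | k. 1 \<le> k \<and> k \<le> n} = vq ` {1..2 * n - 1}"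
    (is "?A \<union> ?B = ?V")
  proof (intro equalityI subsetI)
    fix x assume "x \<in> ?A \<union> ?B"
    then consider k where "x = up_q k" "1 \<le> k" "k \<le> n - 1" | k where "x = down_q n k" "1 \<le> k" "k \<le> n" by blast
    then show "x \<in> ?V"
    proof cases
      case 1
      then show ?thesis using n1 by (intro image_eqI[of _ _ k]) (auto simp: vq_def)
    next
      case 2
      then show ?thesis by (intro image_eqI[of _ _ "2 * n - k"]) (auto simp: vq_def)
    qed
  next
    fix x assume "x \<in> ?V"
    then obtain i where i: "x = vq i" "1 \<le> i" "i \<le> 2 * n - 1" by auto
    show "x \<in> ?A \<union> ?B"
    proof (cases "i < n")
      case True
      with i have "x = up_q i" "1 \<le> i" "i \<le> n - 1" by (auto simp: vq_def)
      then show ?thesis by blast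
    next
      case False
      with i have "x = down_q n (2 * n - i)" "1 \<le> 2 * n - i" "2 * n - i \<le> n" by (auto simp: vq_def)
      then show ?thesis by blast
    qed
  qed
  then have "{K_prod n, K_log n} \<union> ?A \<union> ?B = B_gens" by (auto simp: B_gens_def)
  then have "sub_B n = \<Inter>{B. h_subalgebra n B \<and> U.cl ` B_gens \<subseteq> B}"
    by (simp add: sub_B_def h_generated_def Uh_cls_eq[abs_def] Un_assoc)
  also have "\<dots> = U.cl ` B0"
  proof (intro equalityI Inter_lower Inter_greatest)
    show "U.cl ` B0 \<in> {B. h_subalgebra n B \<and> U.cl ` B_gens \<subseteq> B}"
      using halg_h_subalgebra[OF halg_B0] B_gens_B0 by auto
    fix B assume B: "B \<in> {B. h_subalgebra n B \<and> U.cl ` B_gens \<subseteq> B}"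
    then have "B0 \<subseteq> {f \<in> C. U.cl f \<in> B}"
      using h_subalgebra_iff[OF h_subalgebra_carrier] B_gens_C by (intro B0_least) auto
    then show "U.cl ` B0 \<subseteq> B" by auto
  qed
  finally show ?thesis .
qed

lemma h_subalgebra_sub_B: "h_subalgebra n (sub_B n)"
  unfolding sub_B_eq by (rule halg_h_subalgebra[OF halg_B0])

text \<open>The submodules intersected in \<open>ctensor\<close>, again described by representatives
  in the algebra of pairs of words.\<close>

definition tmod :: "(qgen fword \<times> qgen fword) ser set \<Rightarrow> bool"
  where "tmod T \<longleftrightarrow> T \<subseteq> C2 \<and> (\<forall>x\<in>T. \<forall>y\<in>T. x - y \<in> T) \<and> (\<forall>c. \<forall>x\<in>T. scal c * x \<in> T) \<and> closed T \<and>
    Uh2_ideal n \<subseteq> T \<and> (\<forall>f\<in>B0. \<forall>g\<in>C. inl f * inr g \<in> T)"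

definition P0 :: "(qgen fword \<times> qgen fword) ser set"
  where "P0 = \<Inter>{T. tmod T}"

lemma tmod_C2: "tmod C2"
  by (auto simp: tmod_def C2.C_closed scal_C2 closed_ser_set U2.J_C inl_C2 inr_C2 B0_C)

lemma tmod_P0: "tmod P0"
proof -
  have "P0 \<subseteq> C2" using tmod_C2 by (auto simp: P0_def)
  then show ?thesis by (auto simp: tmod_def P0_def intro!: closed_Inter)
qed

lemma P0_least: "tmod T \<Longrightarrow> x \<in> P0 \<Longrightarrow> x \<in> T"
  by (auto simp: P0_def)

lemma P0_rules: "x \<in> P0 \<Longrightarrow> x \<in> C2" "x \<in> P0 \<Longrightarrow> y \<in> P0 \<Longrightarrow> x - y \<in> P0" "x \<in> P0 \<Longrightarrow> scal c * x \<in> P0"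
  "closed P0" "x \<in> Uh2_ideal n \<Longrightarrow> x \<in> P0" "f \<in> B0 \<Longrightarrow> g \<in> C \<Longrightarrow> inl f * inr g \<in> P0"
  using tmod_P0 by (auto simp: tmod_def)

lemma P0_ctensor:
  assumes F: "F \<in> P0"
  shows "U2.cl F \<in> ctensor n (sub_B n) (carrier (Uh n))"
  unfolding ctensor_def
proof (rule InterI)
  fix T assume "T \<in> {T. additive_subgroup T (Uh2 n) \<and>
      (\<forall>c. \<forall>t\<in>T. Uh2_cls n (scal c) \<otimes>\<^bsub>Uh2 n\<^esub> t \<in> T) \<and> closed (\<Union>T) \<and>
      (\<forall>f\<in>carrier (Fh n). \<forall>g\<in>carrier (Fh n).
        Uh_cls n f \<in> sub_B n \<longrightarrow> Uh_cls n g \<in> carrier (Uh n) \<longrightarrow> Uh2_cls n (inl f * inr g) \<in> T)}"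
  then have T: "additive_subgroup T U2.Q" "closed (\<Union>T)" "\<And>c t. t \<in> T \<Longrightarrow> U2.cl (scal c) \<otimes>\<^bsub>U2.Q\<^esub> t \<in> T"
    and p: "\<And>f g. f \<in> C \<Longrightarrow> g \<in> C \<Longrightarrow> U.cl f \<in> U.cl ` B0 \<Longrightarrow> U.cl g \<in> carrier U.Q \<Longrightarrow> U2.cl (inl f * inr g) \<in> T"
    by (auto simp: Uh2_eq Uh2_cls_eq Uh_eq Uh_cls_eq sub_B_eq ser_ring_eq ring_on_def)
  interpret Q: ring "U2.Q" by (rule U2.ring_Q)
  interpret T: additive_subgroup T "U2.Q" by (fact T(1))
  let ?T = "{f \<in> C2. U2.cl f \<in> T}"
  have sub: "T \<subseteq> carrier U2.Q" by (rule T.a_subset)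
  have "tmod ?T"
    unfolding tmod_def
  proof (intro conjI ballI allI)
    fix x y assume x: "x \<in> ?T" and y: "y \<in> ?T"
    have "U2.cl (- y) \<in> T"
      using group.subgroupE(3)[OF Q.a_group T.a_subgroup, of "U2.cl y"] y U2.Q_uminus[of y] by (simp add: a_inv_def)
    then have "U2.cl x \<oplus>\<^bsub>U2.Q\<^esub> U2.cl (- y) \<in> T"
      using subgroup.m_closed[OF T.a_subgroup, of "U2.cl x" "U2.cl (- y)"] x by simp
    then have "U2.cl (x + - y) \<in> T"
      using x y by (subst (asm) U2.Q_add) (auto simp: C2.C_closed)
    then show "x - y \<in> ?T" using x y by (simp add: C2.C_closed)
  next
    fix c x assume "x \<in> ?T"
    then show "scal c * x \<in> ?T" using T(3)[of "U2.cl x" c] by (simp add: U2.Q_mult scal_C2 C2.C_closed)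
  next
    show "closed ?T" using T(2) unfolding U2.Union_Q[OF sub] .
    show "Uh2_ideal n \<subseteq> ?T"
    proof
      fix x assume x: "x \<in> Uh2_ideal n"
      then have "U2.cl x = \<zero>\<^bsub>U2.Q\<^esub>" by (simp add: U2.cl_zero_iff)
      then show "x \<in> ?T" using T.zero_closed x U2.J_C by simp
    qed
  next
    fix f g assume "f \<in> B0" "g \<in> C"
    then show "inl f * inr g \<in> ?T" using p[of f g] by (auto simp: U.carrier_Q C2.C_closed inl_C2 inr_C2 B0_C)
  qed auto
  then show "U2.cl F \<in> T" using P0_least[OF _ F] by blast
qed

lemma inl_inr_mult: "inl a * inr b * (inl f * inr g) = inl (a * f) * inr (b * g)"
proof -
  have "inl a * inr b * (inl f * inr g) = inl a * (inr b * inl f) * inr g" by (simp add: mult.assoc)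
  also have "\<dots> = inl (a * f) * inr (b * g)" by (simp add: inl_inr_commute inl_simps inr_simps mult.assoc)
  finally show ?thesis .
qed

lemma P0_mult_pure:
  assumes a: "a \<in> B0" "b \<in> C" and y: "y \<in> P0"
  shows "inl a * inr b * y \<in> P0"
proof -
  have ab: "inl a * inr b \<in> C2" using a by (simp add: C2.C_closed inl_C2 inr_C2 B0_C)
  have "tmod {F \<in> C2. inl a * inr b * F \<in> P0}"
    unfolding tmod_def
  proof (intro conjI ballI allI)
    show "closed {F \<in> C2. inl a * inr b * F \<in> P0}"
      by (rule closed_fps_preimage[OF closed_ser_set P0_rules(4)]) (rule mult_cong_nth(1))
  qed (use a ab in \<open>auto simp: C2.C_closed scal_C2 P0_rules U2.J_C U2.J_l right_diff_distrib scal.left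
       inl_C2 inr_C2 B0_C inl_inr_mult C.C_closed B0.C_closed\<close>)
  from P0_least[OF this y] show ?thesis by simp
qed

text \<open>Multiplicativity one factor at a time: the elements having the required products form a
  \<open>tmod\<close>, first with a pure tensor on the left and then with an arbitrary left
  factor.\<close>

lemma P0_mult:
  assumes x: "x \<in> P0" and y: "y \<in> P0"
  shows "x * y \<in> P0"
proof -
  have "tmod {F \<in> C2. F * y \<in> P0}"
    unfolding tmod_def
  proof (intro conjI ballI allI)
    show "closed {F \<in> C2. F * y \<in> P0}"
      by (rule closed_fps_preimage[OF closed_ser_set P0_rules(4)]) (rule mult_cong_nth(2))
  qed (use y in \<open>auto simp: C2.C_closed scal_C2 P0_rules U2.J_C U2.J_r left_diff_distrib mult.assoc
       inl_C2 inr_C2 B0_C P0_mult_pure[unfolded mult.assoc]\<close>)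
  from P0_least[OF this x] show ?thesis by simp
qed

lemma P0_inl: "f \<in> B0 \<Longrightarrow> inl f \<in> P0" and P0_inr: "g \<in> C \<Longrightarrow> inr g \<in> P0"
  using P0_rules(6)[of f 1] P0_rules(6)[of 1 g] by (simp_all add: inl_simps inr_simps B0.C_closed C.C_closed)

sublocale P0: subring_set P0
  by standard (use P0_inl[of 1] B0.C_one in \<open>auto simp: P0_rules P0_mult inl_simps\<close>)

text \<open>Reduces the coideal property to generators, as \<open>P0\<close> is a closed subring and
  the coproduct is continuous and multiplicative.\<close>

lemma halg_Delta: "halg {f \<in> C. ser_lift (Delta_gen n) f \<in> P0}"
proof -
  have "scal c \<in> P0" for c using P0_inl[OF B0_scal[of c]] by (simp add: inl_simps)
  moreover have "closed {f \<in> C. ser_lift (Delta_gen n) f \<in> P0}"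
    by (rule closed_fps_preimage[OF closed_ser_set P0_rules(4)]) (rule ser_lift_cong_nth)
  ultimately show ?thesis
    unfolding halg_def subring_set_def
    by (auto simp: C.C_closed P0.C_closed ser_lift_diff ser_lift_mult scal_C ser_lift_scal U.J_C P0_rules(5) Delta_I)
qed

lemma Delta_K_log: "ser_lift (Delta_gen n) (K_log n) \<in> P0"
proof -
  have "ser_lift (Delta_gen n) (K_log n) = inl (K_log n) + inr (K_log n)"
    by (simp add: K_log_def ser_lift_sum ser_lift_mult inl_def inr_def sum.distrib distrib_left)
  moreover have "K_log n \<in> B0" using B_gens_B0 by (auto simp: B_gens_def)
  ultimately show ?thesis by (simp add: P0.C_add P0_inl P0_inr K_log_C)
qed

lemma Delta_K_prod: "ser_lift (Delta_gen n) (K_prod n) \<in> P0"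
proof -
  have "ser_lift (Delta_gen n) (prod_list (map (Kgen n) is)) -
      inl (prod_list (map (Kgen n) is)) * inr (prod_list (map (Kgen n) is)) \<in> Uh2_ideal n"
    if "set is \<subseteq> {1..n}" for "is"
    using that
  proof (induction "is")
    case Nil
    then show ?case by (simp add: inl_simps inr_simps U2.J_zero)
  next
    case (Cons i "is")
    let ?p = "prod_list (map (Kgen n) is)"
    have p: "?p \<in> C" using Cons.prems by (auto intro!: C.C_prod_list K_C)
    have K: "Kgen n i \<in> C" using Cons.prems by (auto intro!: K_C)
    have "ser_lift (Delta_gen n) (Kgen n i) * (ser_lift (Delta_gen n) ?p - inl ?p * inr ?p) \<in> Uh2_ideal n"
      using Cons K by (intro U2.J_l Delta_C2) auto
    moreover have "ser_lift (Delta_gen n) (Kgen n i) * (ser_lift (Delta_gen n) ?p - inl ?p * inr ?p) =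
      ser_lift (Delta_gen n) (Kgen n i * ?p) - inl (Kgen n i * ?p) * inr (Kgen n i * ?p)"
      unfolding right_diff_distrib ser_lift_mult Delta_K inl_inr_mult ..
    ultimately show ?case by simp
  qed
  from this[of "[1..<Suc n]"] atLeastLessThanSuc_atLeastAtMost[of 1 n]
  have "ser_lift (Delta_gen n) (K_prod n) - inl (K_prod n) * inr (K_prod n) \<in> Uh2_ideal n"
    by (auto simp: K_prod_def simp del: upt_Suc)
  moreover have "K_prod n \<in> B0" using B_gens_B0 by (auto simp: B_gens_def)
  ultimately show ?thesis
    using P0.C_add[OF P0_rules(5) P0_rules(6)[of "K_prod n" "K_prod n"]] by (fastforce simp: K_prod_C)
qed

text \<open>Homogeneity of the second tensor factor, expressed as q-commutation with the
  \<open>K_l\<close>, l >= 2, which is the form used by the bracket step.\<close>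

definition wgt :: "(nat \<Rightarrow> int) \<Rightarrow> qgen fword ser \<Rightarrow> bool"
  where "wgt c u \<longleftrightarrow> u \<in> C \<and> (\<forall>l\<in>{2..n}. em (Kgen n l) * em u = sc (qpow (c l)) * (em u * em (Kgen n l)))"

interpretation sc: central_hom "sc :: complex fps \<Rightarrow> (qgen fword \<times> qgen fword) qser" by (rule central_hom_sc)
interpretation sc1: central_hom "sc :: complex fps \<Rightarrow> qgen fword qser" by (rule central_hom_sc)

lemma em_rel_iff:
  assumes "f \<in> C" "g \<in> C"
  shows "f * g - scal t * (g * f) \<in> Uh_ideal n \<longleftrightarrow> em f * em g = sc t * (em g * em f)"
proof -
  have "f * g - scal t * (g * f) \<in> C" using assms by (simp add: C.C_closed scal_C)
  from em_0[OF this] show ?thesis using assms by (simp add: em_simps C.C_closed scal_C)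
qed

lemma em_comm_iff:
  assumes "f \<in> C" "g \<in> C"
  shows "f * g - g * f \<in> Uh_ideal n \<longleftrightarrow> em f * em g = em g * em f"
  using em_rel_iff[OF assms, of 1] by (simp add: scal.one sc1.one)

lemma wgt_E:
  assumes "k \<in> {1..n}"
  shows "wgt (al n k) (gen (Xp k))"
  unfolding wgt_def
proof (intro conjI ballI)
  show "gen (Xp k) \<in> C" by (rule gen_C(1)[OF assms])
  fix l assume "l \<in> {2..n}"
  then have l: "l \<in> {1..n}" by auto
  show "em (Kgen n l) * em (gen (Xp k)) = sc (qpow (al n k l)) * (em (gen (Xp k)) * em (Kgen n l))"
    using K_rel(1)[OF l assms] unfolding em_rel_iff[OF K_C(1)[OF l] gen_C(1)[OF assms]] al_def .
qed

lemma wgt_K: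
  assumes "k \<in> {1..n}"
  shows "wgt (\<lambda>l. 0) (Kgen n k)"
  unfolding wgt_def
proof (intro conjI ballI)
  show "Kgen n k \<in> C" by (rule K_C(1)[OF assms])
  fix l assume "l \<in> {2..n}"
  then have l: "l \<in> {1..n}" by auto
  show "em (Kgen n l) * em (Kgen n k) = sc (qpow 0) * (em (Kgen n k) * em (Kgen n l))"
    using KK_comm(1)[OF l assms] unfolding em_comm_iff[OF K_C(1)[OF l] K_C(1)[OF assms]]
    by (simp add: qpow_def sc1.one)
qed

lemma wgt_mult:
  assumes "wgt c u" "wgt d w"
  shows "wgt (\<lambda>l. c l + d l) (u * w)"
  unfolding wgt_def
proof (intro conjI ballI)
  show "u * w \<in> C" using assms by (simp add: wgt_def C.C_mult)
  fix l assume l: "l \<in> {2..n}"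
  then have K: "Kgen n l \<in> C" by (auto intro: K_C)
  let ?K = "em (Kgen n l)"
  have "?K * (em u * em w) = ?K * em u * em w" by (simp add: mult.assoc)
  also have "\<dots> = sc (qpow (c l)) * (em u * (?K * em w))" using assms(1) l by (simp add: wgt_def mult.assoc)
  also have "\<dots> = sc (qpow (c l)) * (em u * (sc (qpow (d l)) * (em w * ?K)))" using assms(2) l by (simp add: wgt_def)
  also have "\<dots> = sc (qpow (c l)) * (sc (qpow (d l)) * (em u * (em w * ?K)))" by (simp only: sc1.left[of "em u"])
  also have "\<dots> = sc (qpow (c l + d l)) * (em u * em w * ?K)" by (simp only: qpow_add sc1.mult mult.assoc)
  finally show "?K * em (u * w) = sc (qpow (c l + d l)) * (em (u * w) * ?K)"
    using assms by (simp add: wgt_def em_def qemb_mult[OF U.ideal_set_axioms range_scal(1)])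
qed

lemma wgt_diff_scale:
  assumes "wgt c u" "wgt c w"
  shows "wgt c (u - scal t * w)"
  unfolding wgt_def
proof (intro conjI ballI)
  have C: "u \<in> C" "w \<in> C" using assms by (auto simp: wgt_def)
  then show "u - scal t * w \<in> C" by (simp add: C.C_closed scal_C)
  fix l assume l: "l \<in> {2..n}"
  let ?K = "em (Kgen n l)" and ?q = "sc (qpow (c l)) :: qgen fword qser" and ?s = "sc t :: qgen fword qser"
  have "?K * em u = ?q * (em u * ?K)" "?K * em w = ?q * (em w * ?K)" using assms l by (auto simp: wgt_def)
  then have "?K * (em u - ?s * em w) = ?q * (em u * ?K) - ?s * (?q * (em w * ?K))"
    by (simp only: right_diff_distrib sc1.left[of ?K])
  also have "\<dots> = ?q * ((em u - ?s * em w) * ?K)"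
    by (simp only: right_diff_distrib left_diff_distrib mult.assoc sc1.left[of ?s "qpow (c l)"])
  finally show "?K * em (u - scal t * w) = ?q * (em (u - scal t * w) * ?K)"
    using C by (simp add: em_simps C.C_closed scal_C)
qed

lemma wgt_cong: "wgt c u \<Longrightarrow> (\<And>l. l \<in> {2..n} \<Longrightarrow> d l = c l) \<Longrightarrow> wgt d u"
  by (simp add: wgt_def)

text \<open>
  The coproduct of \<open>v\<^sub>i\<close> is a sum of terms \<open>v\<^sub>j \<otimes> u\<close> and \<open>1 \<otimes> u\<close> of total weight that of \<open>v\<^sub>i\<close>; the weight of \<open>u\<close> is
  what makes the terms \<open>E\<^sub>k v\<^sub>j \<otimes> u K\<^sub>k\<close> cancel in the next bracket.
\<close>

inductive_set Cop :: "(nat \<Rightarrow> int) \<Rightarrow> (qgen fword \<times> qgen fword) ser set" for c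
  where
    Cop_I: "F \<in> Uh2_ideal n \<Longrightarrow> F \<in> Cop c"
  | Cop_R: "wgt c u \<Longrightarrow> inr u \<in> Cop c"
  | Cop_V: "1 \<le> j \<Longrightarrow> j \<le> 2 * n - 2 \<Longrightarrow> wgt (\<lambda>l. c l - wt n j l) u \<Longrightarrow> inl (vq j) * inr u \<in> Cop c"
  | Cop_add: "F \<in> Cop c \<Longrightarrow> G \<in> Cop c \<Longrightarrow> F + G \<in> Cop c"

lemma vq_B0: "1 \<le> j \<Longrightarrow> j \<le> 2 * n - 1 \<Longrightarrow> vq j \<in> B0"
  using B_gens_B0 by (auto simp: B_gens_def)

lemma Cop_P0: "F \<in> Cop c \<Longrightarrow> F \<in> P0"
  by (induction rule: Cop.induct)
     (auto simp: P0_rules P0.C_add wgt_def vq_B0 intro!: P0_inr)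

lemma Cop_C2: "F \<in> Cop c \<Longrightarrow> F \<in> C2"
  by (rule P0_rules(1)[OF Cop_P0])

lemma Cop_cong: "em2 F = em2 G \<Longrightarrow> F \<in> C2 \<Longrightarrow> G \<in> Cop c \<Longrightarrow> F \<in> Cop c"
  using Cop_add[OF _ Cop_I, of G c "F - G"] em2_eq_iff[of F G] Cop_C2[of G c] by simp

text \<open>On each summand this is \<open>coideal_step\<close>; by \<open>vq_R1\<close> the new
  left factor is \<open>v_(j+1)\<close> or 0, and in both resulting terms the total weight grows by
  that of \<open>E_k\<close>.\<close>

lemma Cop_step:
  assumes F: "F \<in> Cop c" and k: "k \<in> {2..n}"
  shows "F * Delta_gen n (Xp k) - scal (qpow (- c k)) * (Delta_gen n (Xp k) * F) \<in> Cop (\<lambda>l. c l + al n k l)"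
    (is "?br F \<in> Cop ?c")
proof -
  let ?E = "gen (Xp k)" and ?K = "Kgen n k" and ?D = "Delta_gen n (Xp k)" and ?t = "qpow (- c k)"
  have k1: "k \<in> {1..n}" using k by auto
  have mem: "?E \<in> C" "?K \<in> C" using gen_C(1)[OF k1] K_C[OF k1] by auto
  have D: "?D \<in> C2" using mem by (simp add: C2.C_closed inl_C2 inr_C2)
  have brC: "?br G \<in> C2" if "G \<in> C2" for G using that D by (simp add: C2.C_closed scal_C2 del: Delta_gen.simps)
  have emD: "em2 ?D = em2 (inl ?E) * em2 (inr ?K) + em2 (inr ?E)"
    using mem by (simp add: em2_simps C2.C_closed inl_C2 inr_C2)
  have KU: "em2 (inr ?K) * em2 (inr u) = sc (qpow (d k)) * (em2 (inr u) * em2 (inr ?K))" if "wgt d u" for d u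
  proof -
    have "?K * u - scal (qpow (d k)) * (u * ?K) \<in> Uh_ideal n"
      using that k mem by (subst em_rel_iff) (auto simp: wgt_def)
    then show ?thesis using that mem by (intro em2_rel(2)) (auto simp: wgt_def)
  qed
  have UE: "wgt (\<lambda>l. d l + al n k l) (u * ?E - scal ?t * (?E * u))" if "wgt d u" for d u
    by (rule wgt_diff_scale[OF wgt_mult[OF that wgt_E[OF k1]] wgt_cong[OF wgt_mult[OF wgt_E[OF k1] that]]]) simp
  from F show ?thesis
  proof (induction rule: Cop.induct)
    case (Cop_I F)
    then show ?case
      by (intro Cop.Cop_I U2.J_diff U2.J_r U2.J_l U2.J_scal D)
  next
    case (Cop_R u)
    note u = Cop_R.hyps
    let ?w = "u * ?E - scal ?t * (?E * u)"
    have uC: "u \<in> C" using u by (simp add: wgt_def)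
    \<comment> \<open>The factor 1 is inserted in order to apply the step with \<open>V = 1\<close>
      and \<open>a = 1\<close>, for which the new left factor is 0.\<close>
    have "em2 (?br (inr u)) = 1 * em2 (inr u) * (em2 (inl ?E) * em2 (inr ?K) + em2 (inr ?E))
        - sc ?t * ((em2 (inl ?E) * em2 (inr ?K) + em2 (inr ?E)) * (1 * em2 (inr u)))"
      using uC D by (simp add: em2_simps C2.C_closed scal_C2 inr_C2 emD del: Delta_gen.simps)
    also have "\<dots> = 0 * (em2 (inr u) * em2 (inr ?K)) +
        1 * (em2 (inr u) * em2 (inr ?E) - sc ?t * (em2 (inr ?E) * em2 (inr u)))"
      by (rule sc.coideal_step[where a = 1 and w = "qpow (c k)"])
        (use KU[OF u] mem uC in \<open>simp_all add: em2_lr sc.one qpow_add[symmetric] qpow_def[of 0]\<close>)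
    also have "\<dots> = em2 (inr ?w)"
      using uC mem by (simp add: inr_simps em2_simps C2.C_closed scal_C2 inr_C2)
    finally show ?case
      by (rule Cop_cong[OF _ brC[OF inr_C2[OF uC]] Cop.Cop_R[OF UE[OF u]]])
  next
    case (Cop_V j u)
    note u = Cop_V.hyps(3) and j = Cop_V.hyps(1,2)
    let ?w = "u * ?E - scal ?t * (?E * u)"
    let ?v' = "if st n j = k then vq (Suc j) else 0"
    have uC: "u \<in> C" using u by (simp add: wgt_def)
    have vC: "vq j \<in> C" "?v' \<in> C" using j vq_C by (auto simp: C.C_zero)
    have "inl (vq j * ?E - scal (qpow (- wt n j k)) * (?E * vq j) - ?v') \<in> Uh2_ideal n"
      by (rule inl_I[OF vq_R1[OF j]]) (use k in auto)
    then have V': "em2 (inl (vq j)) * em2 (inl ?E) - sc (qpow (- wt n j k)) * (em2 (inl ?E) * em2 (inl (vq j)))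
        = em2 (inl ?v')"
      using vC mem inl_C2[OF vC(2)] by (simp flip: em2_0 add: inl_simps em2_simps C2.C_closed scal_C2 inl_C2)
    have "em2 (?br (inl (vq j) * inr u)) = em2 (inl (vq j)) * em2 (inr u) * (em2 (inl ?E) * em2 (inr ?K) + em2 (inr ?E))
        - sc ?t * ((em2 (inl ?E) * em2 (inr ?K) + em2 (inr ?E)) * (em2 (inl (vq j)) * em2 (inr u)))"
      using uC vC D by (simp add: em2_simps C2.C_closed scal_C2 inl_C2 inr_C2 emD del: Delta_gen.simps)
    also have "\<dots> = em2 (inl ?v') * (em2 (inr u) * em2 (inr ?K)) +
        em2 (inl (vq j)) * (em2 (inr u) * em2 (inr ?E) - sc ?t * (em2 (inr ?E) * em2 (inr u)))"
      by (rule sc.coideal_step[OF _ _ _ KU[OF u] V'])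
        (use mem uC vC in \<open>simp_all add: em2_lr qpow_add[symmetric]\<close>)
    also have "\<dots> = em2 (inl ?v' * inr (u * ?K) + inl (vq j) * inr ?w)"
      using uC mem vC inl_C2[OF vC(2)] by (simp add: inr_simps em2_simps C2.C_closed scal_C2 inl_C2 inr_C2)
    finally have eq: "em2 (?br (inl (vq j) * inr u)) = em2 (inl ?v' * inr (u * ?K) + inl (vq j) * inr ?w)" .
    have "inl ?v' * inr (u * ?K) \<in> Cop ?c"
    proof (cases "st n j = k")
      case True
      \<comment> \<open>The step out of \<open>v_(2n-2)\<close> is along \<open>E_1\<close>, so the
        bound j <= 2n - 2 on left factors survives a bracket with \<open>E_k\<close>, k >=
        2.\<close>
      then have "j \<noteq> 2 * n - 2" using k j by (auto simp: st_def split: if_splits)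
      then have j': "1 \<le> Suc j" "Suc j \<le> 2 * n - 2" using j by auto
      have "wgt (\<lambda>l. ?c l - wt n (Suc j) l) (u * ?K)"
        by (rule wgt_cong[OF wgt_mult[OF u wgt_K[OF k1]]]) (use wt_step[OF j] True in auto)
      then show ?thesis using Cop.Cop_V[OF j'] True by simp
    qed (simp add: inl_simps Cop.Cop_I U2.J_zero)
    moreover have "inl (vq j) * inr ?w \<in> Cop ?c"
      by (rule Cop.Cop_V[OF j wgt_cong[OF UE[OF u]]]) simp
    ultimately show ?case
      by (intro Cop_cong[OF eq brC Cop.Cop_add]) (use uC vC in \<open>simp_all add: C2.C_closed inl_C2 inr_C2\<close>)
  next
    case (Cop_add F G)
    have "?br (F + G) = ?br F + ?br G" by (simp add: algebra_simps del: Delta_gen.simps)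
    then show ?case using Cop.Cop_add[OF Cop_add.IH] by simp
  qed
qed

lemma Delta_vq_Cop: "1 \<le> i \<Longrightarrow> i \<le> 2 * n - 2 \<Longrightarrow> ser_lift (Delta_gen n) (vq i) \<in> Cop (wt n i)"
proof (induction i rule: nat_induct_at_least)
  case base
  have n2: "n \<ge> 2" using base by simp
  then have 1: "1 \<in> {1..n}" by simp
  have "wgt (wt n 1) (gen (Xp 1))"
    by (rule wgt_cong[OF wgt_E[OF 1]]) (use n2 in \<open>auto simp: al_def wt_def symd_def cartan_def\<close>)
  moreover have "wgt (\<lambda>l. wt n 1 l - wt n 1 l) (Kgen n 1)"
    by (rule wgt_cong[OF wgt_K[OF 1]]) simp
  ultimately show ?case
    using Cop_add[OF Cop_V[of 1 "wt n 1"] Cop_R] n2 unfolding vq_1 by (simp add: ser_lift_gen)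
next
  case (Suc i)
  then have i: "1 \<le> i" "i \<le> 2 * n - 2" "Suc i \<le> 2 * n - 2" by auto
  define k where "k = st n i"
  have k: "k \<in> {2..n}" using i by (auto simp: k_def st_def)
  have e: "ex n i = - wt n i k" using i by (auto simp: k_def st_def ex_def wt_def symd_def)
  have "ser_lift (Delta_gen n) (vq (Suc i)) = ser_lift (Delta_gen n) (vq i) * Delta_gen n (Xp k)
      - scal (qpow (- wt n i k)) * (Delta_gen n (Xp k) * ser_lift (Delta_gen n) (vq i))"
    unfolding vq_Suc[OF i(1,2)] ser_lift_diff ser_lift_mult ser_lift_scal ser_lift_gen e k_def[symmetric] ..
  also have "\<dots> \<in> Cop (\<lambda>l. wt n i l + al n k l)"
    by (rule Cop_step[OF Suc.IH[OF i(2)] k])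
  finally have *: "ser_lift (Delta_gen n) (vq (Suc i)) \<in> Cop (\<lambda>l. wt n i l + al n k l)" .
  have "Cop (\<lambda>l. wt n i l + al n k l) \<subseteq> Cop (wt n (Suc i))"
  proof
    fix F assume "F \<in> Cop (\<lambda>l. wt n i l + al n k l)"
    then show "F \<in> Cop (wt n (Suc i))"
    proof induction
      case (Cop_R u)
      then show ?case by (intro Cop.Cop_R) (auto elim!: wgt_cong simp: wt_step[OF i(1,2)] k_def)
    next
      case (Cop_V j u)
      show ?case
        by (rule Cop.Cop_V[OF Cop_V(1,2) wgt_cong[OF Cop_V(3)]]) (simp add: wt_step[OF i(1,2)] k_def)
    qed (auto intro: Cop.Cop_I Cop.Cop_add)
  qed
  with * show ?case by blast
qed

lemma Delta_B0:
  assumes "f \<in> B0"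
  shows "ser_lift (Delta_gen n) f \<in> P0"
proof -
  have "vq i \<in> {f \<in> C. ser_lift (Delta_gen n) f \<in> P0}" if i: "1 \<le> i" "i \<le> 2 * n - 1" for i
  proof -
    interpret D: subring_set "{f \<in> C. ser_lift (Delta_gen n) f \<in> P0}"
      using halg_Delta by (simp add: halg_def)
    have sD: "scal c \<in> {f \<in> C. ser_lift (Delta_gen n) f \<in> P0}" for c
      using halg_Delta by (auto simp: halg_def)
    have 1: "1 \<in> {1..n}" using n1 by simp
    have "inl (gen (Xp 1)) \<in> P0" using vq_B0[of 1] n1 unfolding vq_1 by (intro P0_inl) auto
    then have E1: "gen (Xp 1) \<in> {f \<in> C. ser_lift (Delta_gen n) f \<in> P0}"
      using gen_C(1)[OF 1] K_C[OF 1] by (simp add: ser_lift_gen P0.C_closed P0_inr)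
    consider "i \<le> 2 * n - 2" | "n = 1" "i = 1" | "n \<ge> 2" "i = Suc (2 * n - 2)" using i by linarith
    then show ?thesis
    proof cases
      case 1
      then show ?thesis using Cop_P0[OF Delta_vq_Cop[OF i(1)]] vq_C i by simp
    next
      case 2
      then show ?thesis using E1 vq_1 by simp
    next
      case 3
      \<comment> \<open>The last bracket is with \<open>E_1 = v_1\<close>, whose coproduct is
        already in \<open>P0\<close>, so multiplicativity suffices.\<close>
      have s: "st n (2 * n - 2) = 1" using 3 by (auto simp: st_def)
      have j: "1 \<le> 2 * n - 2" using 3 by simp
      have "vq (2 * n - 2) \<in> {f \<in> C. ser_lift (Delta_gen n) f \<in> P0}"
        using Cop_P0[OF Delta_vq_Cop[OF j]] vq_C 3 by simp
      then show ?thesis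
        unfolding 3(2) vq_Suc[OF j order_refl] s by (intro D.C_diff D.C_mult E1 sD)
    qed
  qed
  then have "B_gens \<subseteq> {f \<in> C. ser_lift (Delta_gen n) f \<in> P0}"
    using Delta_K_log Delta_K_prod K_log_C K_prod_C by (auto simp: B_gens_def)
  from B0_least[OF halg_Delta this] assms show ?thesis by blast
qed

lemma left_coideal_sub_B: "left_coideal n (sub_B n)"
proof -
  have "Delta n (U.cl f) \<in> ctensor n (sub_B n) (carrier (Uh n))" if "f \<in> B0" for f
    unfolding Delta_cl[OF B0_C[OF that]] by (rule P0_ctensor[OF Delta_B0[OF that]])
  then show ?thesis by (auto simp: left_coideal_def sub_B_eq)
qed

end

section \<open>The coisotropic subalgebra\<close>

text \<open>The parabolic subalgebra stabilizing the line of the first basis vector; the condition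
  on row n says that the orthogonal hyperplane of this line is stable too.\<close>

definition hp :: "nat \<Rightarrow> complex mat set"
  where "hp n = {A \<in> sp n. (\<forall>a<2*n. a \<noteq> 0 \<longrightarrow> A $$ (a,0) = 0) \<and> (\<forall>b<2*n. b \<noteq> n \<longrightarrow> A $$ (n,b) = 0)}"

text \<open>The nilradical of \<open>hp\<close>, a Heisenberg algebra whose centre is the root space
  of \<open>2 L_1\<close>: only row 0 and column n may be nonzero.\<close>

definition nh :: "nat \<Rightarrow> complex mat set"
  where "nh n = {A \<in> sp n. A $$ (0,0) = 0 \<and> A $$ (n,n) = 0 \<and>
    (\<forall>a<2*n. \<forall>b<2*n. a \<noteq> 0 \<longrightarrow> b \<noteq> n \<longrightarrow> A $$ (a,b) = 0)}"

lemma nh_sp: "A \<in> nh n \<Longrightarrow> A \<in> sp n" and hp_sp: "A \<in> hp n \<Longrightarrow> A \<in> sp n"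
  by (auto simp: nh_def hp_def)

lemma nh_hp: "A \<in> nh n \<Longrightarrow> A \<in> hp n"
  by (auto simp: nh_def hp_def)

lemma sp_col:
  assumes "A \<in> sp n" "b < 2*n"
  shows "A $$ (dual n b, n) = ep n b * A $$ (0,b)"
proof -
  have "ep n b * A $$ (dual n b, n) = ep n n * A $$ (dual n n, b)"
    using assms unfolding sp_iff by auto
  moreover have "ep n n = 1" "dual n n = 0" "ep n b * ep n b = 1" by (auto simp: ep_def dual_def)
  ultimately show ?thesis by (metis mult.assoc mult_1)
qed

text \<open>Column n is determined by row 0 through the symplectic symmetry
  \<open>sp_col\<close>.\<close>

lemma nh_eqI:
  assumes A: "A \<in> nh n" and B: "B \<in> nh n" and row: "\<And>b. b < 2*n \<Longrightarrow> A $$ (0,b) = B $$ (0,b)"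
  shows "A = B"
proof (rule eq_matI_c)
  show "A \<in> carrier_mat (2*n) (2*n)" "B \<in> carrier_mat (2*n) (2*n)" using A B by (auto simp: nh_sp sp_carrier)
  fix a b assume ab: "a < 2*n" "b < 2*n"
  consider "a = 0" | "a \<noteq> 0" "b \<noteq> n" | "b = n" by blast
  then show "A $$ (a,b) = B $$ (a,b)"
  proof cases
    case 3
    have "X $$ (a,n) = ep n (dual n a) * X $$ (0, dual n a)" if "X \<in> nh n" for X
      using sp_col[OF nh_sp[OF that] dual_less[OF ab(1)]] by (simp add: dual_dual ab)
    then show ?thesis using 3 A B row[OF dual_less[OF ab(1)]] by metis
  qed (use A B ab row in \<open>auto simp: nh_def\<close>)
qed

lemma nh_zero: "n \<ge> 1 \<Longrightarrow> 0\<^sub>m (2*n) (2*n) \<in> nh n"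
  by (auto simp: nh_def sp_zero)

lemma nh_smult: "n \<ge> 1 \<Longrightarrow> A \<in> nh n \<Longrightarrow> c \<cdot>\<^sub>m A \<in> nh n"
  using nh_sp[THEN sp_carrier, of A n] by (auto simp: nh_def intro!: sp_smult)

lemma nh_add:
  assumes "n \<ge> 1" "A \<in> nh n" "B \<in> nh n"
  shows "A + B \<in> nh n"
  using assms nh_sp[THEN sp_carrier, of A n] nh_sp[THEN sp_carrier, of B n] by (auto simp: nh_def intro!: sp_add)

lemma nh_lie:
  assumes n: "n \<ge> 1" and A: "A \<in> nh n" and X: "X \<in> hp n"
  shows "lie A X \<in> nh n"
proof -
  have c: "A \<in> carrier_mat (2*n) (2*n)" "X \<in> carrier_mat (2*n) (2*n)"
    using nh_sp[OF A] hp_sp[OF X] by (auto simp: sp_carrier)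
  have A0: "A $$ (a,b) = 0" if "a < 2*n" "b < 2*n" "a \<noteq> 0 \<and> b \<noteq> n \<or> a = 0 \<and> b = 0 \<or> a = n \<and> b = n" for a b
    using A that by (auto simp: nh_def)
  have X0: "X $$ (a,b) = 0" if "a < 2*n" "b < 2*n" "a \<noteq> 0 \<and> b = 0 \<or> a = n \<and> b \<noteq> n" for a b
    using X that by (auto simp: hp_def)
  have 1: "(A * X) $$ (a,b) = 0" "(X * A) $$ (a,b) = 0"
    if ab: "a < 2*n" "b < 2*n" "a \<noteq> 0 \<and> b \<noteq> n \<or> a = 0 \<and> b = 0 \<or> a = n \<and> b = n" for a b
  proof -
    have "A $$ (a,k) * X $$ (k,b) = 0" "X $$ (a,k) * A $$ (k,b) = 0" if k: "k < 2*n" for k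
    proof -
      have "k \<noteq> 0 \<or> k \<noteq> n" using n by auto
      then show "A $$ (a,k) * X $$ (k,b) = 0"
        using A0[of a k] X0[of k b] ab k n by (cases "k = 0"; cases "k = n"; cases "a = 0"; cases "b = n") auto
      show "X $$ (a,k) * A $$ (k,b) = 0"
        using A0[of k b] X0[of a k] ab k n by (cases "k = 0"; cases "k = n"; cases "a = 0"; cases "b = n") auto
    qed
    then show "(A * X) $$ (a,b) = 0" "(X * A) $$ (a,b) = 0"
      unfolding mult_entry[OF c ab(1,2)] mult_entry[OF c(2,1) ab(1,2)] by (auto intro!: sum.neutral)
  qed
  show ?thesis
    using n c by (auto simp: nh_def lie_entry 1 sp_lie nh_sp[OF A] hp_sp[OF X])
qed

lemma chev_e_hp:
  assumes "i \<in> {1..n}"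
  shows "chev_e n i \<in> hp n"
  unfolding hp_def
proof (intro CollectI conjI allI impI)
  have n: "n \<ge> 1" using assms by simp
  show "chev_e n i \<in> sp n" by (rule chev_e_sp[OF assms])
  fix a assume a: "a < 2*n"
  have "ce n i 0 = 0" using assms by (auto simp: ce_def)
  then show "chev_e n i $$ (a,0) = 0" unfolding chev_e_mono[OF assms] using a n by simp
  have "ce n i a = 0 \<or> n \<noteq> sg n i a" using assms n a by (auto simp: ce_def sg_def)
  then show "chev_e n i $$ (n,a) = 0" unfolding chev_e_mono[OF assms] using a n by auto
qed

definition vcl :: "nat \<Rightarrow> nat \<Rightarrow> complex mat"
  where "vcl n i = (if i < n then up_cl n i else down_cl n (2 * n - i))"

lemma vcl_1: "n \<ge> 1 \<Longrightarrow> vcl n 1 = chev_e n 1"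
  by (cases "n = 1") (auto simp: vcl_def up_cl_def down_cl_def numeral_2_eq_2)

lemma up_cl_Suc: "1 \<le> k \<Longrightarrow> up_cl n (Suc k) = lie (up_cl n k) (chev_e n (Suc k))"
  by (simp add: up_cl_def)

lemma down_cl_step: "k < n \<Longrightarrow> down_cl n k = lie (down_cl n (Suc k)) (chev_e n k)"
  by (simp add: down_cl_def upt_conv_Cons)

lemma vcl_Suc:
  assumes "1 \<le> i" "i \<le> 2 * n - 2"
  shows "vcl n (Suc i) = lie (vcl n i) (chev_e n (st n i))"
proof -
  consider "Suc i < n" | "Suc i = n" | "n \<le> i" by linarith
  then show ?thesis
  proof cases
    case 1
    then have "st n i = Suc i" by (simp add: st_def)
    with 1 show ?thesis using assms by (simp add: vcl_def up_cl_Suc)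
  next
    case 2
    then have "vcl n (Suc i) = up_cl n (Suc i)" by (simp add: vcl_def down_cl_def)
    moreover have "st n i = Suc i" using 2 assms by (simp add: st_def)
    ultimately show ?thesis using 2 assms up_cl_Suc[OF assms(1), of n] by (simp add: vcl_def del: One_nat_def)
  next
    case 3
    define k where "k = 2 * n - 1 - i"
    have k: "2 * n - Suc i = k" "2 * n - i = Suc k" "k < n" using 3 assms by (auto simp: k_def)
    have "st n i = k" using 3 assms by (auto simp: k_def st_def)
    then show ?thesis using 3 k down_cl_step[of k] by (simp add: vcl_def)
  qed
qed

text \<open>The column, counted from 0, of the nonzero entry in the first row of \<open>v_i\<close>:
  the weight \<open>L_1 - L_(i+1)\<close> gives a column in the first half,
  \<open>L_1 + L_(2n-i)\<close> one in the second.\<close>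

definition pp :: "nat \<Rightarrow> nat \<Rightarrow> nat" where "pp n i = (if i < n then i else 3 * n - 1 - i)"

text \<open>Each bracket moves the single nonzero entry of the first row to its next position, so
  the \<open>v_i\<close> are adapted to the coordinates that determine an element of the
  nilradical.\<close>

lemma vcl_row:
  assumes n: "n \<ge> 1"
  shows "1 \<le> i \<Longrightarrow> i \<le> 2 * n - 1 \<Longrightarrow>
    vcl n i \<in> nh n \<and> (\<exists>c. c \<noteq> 0 \<and> (\<forall>b<2*n. vcl n i $$ (0,b) = (if b = pp n i then c else 0)))"
proof (induction i rule: nat_induct_at_least)
  case base
  have 1: "1 \<in> {1..n}" using n by simp
  have "chev_e n 1 $$ (0,b) = (if b = pp n 1 then 1 else 0)" if "b < 2*n" for b
    unfolding chev_e_mono[OF 1] using n that by (auto simp: sg_def ce_def pp_def)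
  moreover have "chev_e n 1 \<in> nh n"
    unfolding nh_def
  proof (intro CollectI conjI allI impI)
    fix a b assume "a < 2*n" "b < 2*n" "a \<noteq> 0" "b \<noteq> n"
    then show "chev_e n 1 $$ (a,b) = 0"
      unfolding chev_e_mono[OF 1] using n by (auto simp: sg_def ce_def)
  next
    show "chev_e n 1 $$ (0,0) = 0" "chev_e n 1 $$ (n,n) = 0"
      unfolding chev_e_mono[OF 1] using n by (auto simp: sg_def ce_def)
  qed (rule chev_e_sp[OF 1])
  ultimately show ?case unfolding vcl_1[OF n] by (metis one_neq_zero)
next
  case (Suc i)
  then have i: "1 \<le> i" "i \<le> 2 * n - 2" by auto
  define k where "k = st n i"
  have k: "k \<in> {1..n}" using i by (auto simp: k_def st_def)
  obtain c where A: "vcl n i \<in> nh n" and c: "c \<noteq> 0" "\<And>b. b < 2*n \<Longrightarrow> vcl n i $$ (0,b) = (if b = pp n i then c else 0)"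
  proof -
    have "vcl n i \<in> nh n \<and> (\<exists>c. c \<noteq> 0 \<and> (\<forall>b<2*n. vcl n i $$ (0,b) = (if b = pp n i then c else 0)))"
      using Suc.IH i by simp
    then show ?thesis using that by blast
  qed
  have v: "vcl n (Suc i) = lie (vcl n i) (monom_mx n (sg n k) (ce n k))"
    using vcl_Suc[OF i] unfolding k_def[symmetric] chev_e_mono[OF k] .
  have mem: "vcl n (Suc i) \<in> nh n"
    using nh_lie[OF n A chev_e_hp[OF k]] vcl_Suc[OF i] by (simp add: k_def)
  have row: "vcl n (Suc i) $$ (0,b) = vcl n i $$ (0, sg n k b) * ce n k b - ce n k (sg n k 0) * vcl n i $$ (sg n k 0, b)"
    if "b < 2*n" for b
    unfolding v using lie_mono[OF sp_carrier[OF nh_sp[OF A]] _ that k] n by simp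
  show ?case
  proof (cases "k = 1")
    case False
    then have k2: "k \<ge> 2" using k by simp
    then have "ce n k (sg n k 0) = 0" using k by (auto simp: sg_def ce_def)
    then have row': "vcl n (Suc i) $$ (0,b) = (if sg n k b = pp n i then c else 0) * ce n k b" if "b < 2*n" for b
      using row[OF that] c(2)[OF sg_less[OF k that]] by simp
    have "vcl n (Suc i) $$ (0,b) = (if b = pp n (Suc i) then (if i < n then c else - c) else 0)" if b: "b < 2*n" for b
    proof -
      consider "Suc i < n" | "Suc i = n" | "n \<le> i" by linarith
      then show ?thesis
      proof cases
        case 1
        then have *: "k = Suc i" "pp n i = i" "pp n (Suc i) = Suc i" by (auto simp: k_def st_def pp_def)
        consider "b = Suc i" | "b + 1 = n + Suc i" | "b \<noteq> Suc i" "b + 1 \<noteq> n + Suc i" by blast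
        then show ?thesis unfolding row'[OF b] * using 1 by cases (auto simp: sg_def ce_def)
      next
        case 2
        then have *: "k = n" "pp n i = n - 1" "pp n (Suc i) = 2 * n - 1" using i by (auto simp: k_def st_def pp_def)
        show ?thesis unfolding row'[OF b] * using 2 b by (cases "b + 1 = 2 * n") (auto simp: sg_def ce_def)
      next
        case 3
        then have *: "k < n" "pp n i = n + k" "pp n (Suc i) = n + k - 1" using i k2 by (auto simp: k_def st_def pp_def)
        consider "b = k" | "b + 1 = n + k" | "b \<noteq> k" "b + 1 \<noteq> n + k" by blast
        then show ?thesis unfolding row'[OF b] *(2,3) using 3 k2 *(1) by cases (auto simp: sg_def ce_def)
      qed
    qed
    then show ?thesis using mem c(1) by (metis neg_equal_0_iff_equal)
  next
    case True
    then have i': "i = 2 * n - 2" "n \<ge> 2" using i by (auto simp: k_def st_def split: if_splits)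
    have s: "sg n 1 0 = 1" "ce n 1 1 = 1" using i' by (auto simp: sg_def ce_def)
    have p: "pp n i = Suc n" "pp n (Suc i) = n" using i' by (auto simp: pp_def)
    have "dual n (Suc n) = 1" by (simp add: dual_def)
    then have col: "vcl n i $$ (1,n) = c"
      using sp_col[OF nh_sp[OF A], of "Suc n"] c(2)[of "Suc n"] i'(2) p by (simp add: ep_def)
    \<comment> \<open>Only in the last step, along \<open>e_1\<close>, does the second term of the
      commutator reach the first row; both terms contribute -c.\<close>
    have "vcl n (Suc i) $$ (0,b) = (if b = pp n (Suc i) then - (2 * c) else 0)" if b: "b < 2*n" for b
    proof -
      have "vcl n i $$ (1,b) = (if b = n then c else 0)"
        using col A b i' by (auto simp: nh_def)
      moreover have "vcl n i $$ (0, sg n k b) * ce n k b = (if b = n then - c else 0)"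
        using c(2)[OF sg_less[OF k b]] i'(2) b unfolding p True by (auto simp: sg_def ce_def)
      ultimately show ?thesis unfolding row[OF b] True s p by simp
    qed
    then show ?thesis using mem c(1) by (metis mult_eq_0_iff neg_equal_0_iff_equal zero_neq_numeral)
  qed
qed

section \<open>The Cartan element and its sum with the nilradical\<close>

definition DD :: "nat \<Rightarrow> complex mat"
  where "DD n = mat (2*n) (2*n) (\<lambda>ij. \<Sum>i=1..n. chev_h n i $$ ij)"

definition dd :: "nat \<Rightarrow> nat \<Rightarrow> complex"
  where "dd n b = (\<Sum>i=1..n. of_nat (symd n i) * hh n i b)"

lemma DD_mono: "DD n = monom_mx n (\<lambda>b. b) (dd n)"
proof (rule eq_matI_c)
  fix a b assume ab: "a < 2*n" "b < 2*n"
  have "chev_h n i $$ (a,b) = of_nat (symd n i) * (if a = b then hh n i b else 0)" if "i \<in> {1..n}" for i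
    unfolding chev_h_def coroot_mono[OF that] using ab by simp
  then show "DD n $$ (a,b) = monom_mx n (\<lambda>b. b) (dd n) $$ (a,b)"
    using ab by (simp add: DD_def dd_def)
qed (auto simp: DD_def)

lemma DD_carrier [simp]: "DD n \<in> carrier_mat (2*n) (2*n)"
  by (simp add: DD_def)

lemma DD_dim [simp]: "dim_row (DD n) = 2*n" "dim_col (DD n) = 2*n"
  by (simp_all add: DD_def)

lemma dd_dual:
  assumes "b < 2*n"
  shows "dd n (dual n b) = - dd n b"
proof -
  have "hh n i (dual n b) = - hh n i b" if "i \<in> {1..n}" for i
  proof (cases "b < n")
    case True
    then show ?thesis using that by (cases "i < n") (simp_all add: hh_def dual_def)
  next
    case False
    define d where "d = b - n"
    have d: "b = n + d" "d < n" using False assms by (auto simp: d_def)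
    then show ?thesis using that unfolding d(1) by (cases "i < n") (simp_all add: hh_def dual_def)
  qed
  then show ?thesis unfolding dd_def sum_negf[symmetric] by (intro sum.cong) auto
qed

lemma dd_0:
  assumes "n \<ge> 1"
  shows "dd n 0 = of_nat (symd n 1)"
proof -
  have "hh n i 0 = (if i = 1 then 1 else 0)" if "i \<in> {1..n}" for i
    using that by (auto simp: hh_def)
  then have "dd n 0 = (\<Sum>i=1..n. if i = 1 then of_nat (symd n i) else 0)"
    unfolding dd_def by (intro sum.cong) auto
  then show ?thesis using assms by simp
qed

lemma DD_hp:
  assumes "n \<ge> 1"
  shows "DD n \<in> hp n"
proof -
  have "DD n \<in> sp n"
    unfolding sp_iff DD_mono by (auto simp: dual_less dual_dual dd_dual) (auto simp: dual_def ep_def split: if_splits)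
  then show ?thesis using assms by (auto simp: hp_def DD_mono)
qed

lemma lie_dim: "dim_row (lie A B) = dim_row B" "dim_col (lie A B) = dim_col A"
  by (simp_all add: lie_def)

lemma lie_lin:
  assumes "A \<in> carrier_mat N N" "B \<in> carrier_mat N N" "X \<in> carrier_mat N N"
  shows "lie (A + B) X = lie A X + lie B X" "lie X (A + B) = lie X A + lie X B"
  using assms by (auto simp: lie_def add_mult_distrib_mat[of _ N N] mult_add_distrib_mat[of _ N N] intro!: eq_matI_c[of _ N])

text \<open>An explicit upper bound for \<open>sub_h n\<close>; together with the lower bound
  \<open>nh_sub_h\<close> it gives the structure used for coisotropy.\<close>

definition Lh :: "nat \<Rightarrow> complex mat set"
  where "Lh n = {c \<cdot>\<^sub>m DD n + B | c B. B \<in> nh n}"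

lemma lie_subalgebra_Lh:
  assumes n: "n \<ge> 1"
  shows "lie_subalgebra n (Lh n)"
proof -
  note D = DD_hp[OF n]
  have c[simp]: "B \<in> carrier_mat (2*n) (2*n)" if "B \<in> nh n" for B using nh_sp[OF that] by (rule sp_carrier)
  have hpL: "c \<cdot>\<^sub>m DD n + B \<in> hp n" if "B \<in> nh n" for c B
    using D nh_hp[OF that] n c[OF that] by (auto simp: hp_def sp_add sp_smult)
  have z: "0 \<cdot>\<^sub>m DD n = 0\<^sub>m (2*n) (2*n)" by (rule eq_matI_c) auto
  have nL: "B \<in> Lh n" if "B \<in> nh n" for B
    unfolding Lh_def by (rule CollectI, rule exI[of _ 0], rule exI[of _ B]) (use that in \<open>simp add: z\<close>)
  show ?thesis
    unfolding lie_subalgebra_def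
  proof (intro conjI allI ballI)
    show "Lh n \<subseteq> sp n" using hpL hp_sp by (auto simp: Lh_def)
    show "0\<^sub>m (2*n) (2*n) \<in> Lh n" by (rule nL[OF nh_zero[OF n]])
    fix x assume "x \<in> Lh n"
    then obtain cx B where x: "x = cx \<cdot>\<^sub>m DD n + B" "B \<in> nh n" by (auto simp: Lh_def)
    show "d \<cdot>\<^sub>m x \<in> Lh n" for d
      unfolding Lh_def
      by (rule CollectI, rule exI[of _ "d * cx"], rule exI[of _ "d \<cdot>\<^sub>m B"])
        (use x carrier_matD[OF c[OF x(2)]] in \<open>auto simp: nh_smult[OF n] distrib_left intro!: eq_matI_c[of _ "2*n"]\<close>)
    fix y assume "y \<in> Lh n"
    then obtain d B' where y: "y = d \<cdot>\<^sub>m DD n + B'" "B' \<in> nh n" by (auto simp: Lh_def)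
    show "x + y \<in> Lh n"
      unfolding Lh_def
      by (rule CollectI, rule exI[of _ "cx + d"], rule exI[of _ "B + B'"])
        (use x y carrier_matD[OF c[OF x(2)]] carrier_matD[OF c[OF y(2)]] in \<open>auto simp: nh_add[OF n] distrib_right intro!: eq_matI_c[of _ "2*n"]\<close>)
    have "lie (DD n) (DD n) = 0\<^sub>m (2*n) (2*n)" by (rule eq_matI_c) (auto simp: lie_def)
    then have "lie (DD n) y = lie (DD n) B'"
      using y c[OF y(2)] by (simp add: lie_lin(2)[of _ "2*n"] lie_smult[of _ "2*n"] lie_carrier[of _ "2*n"])
    then have "lie (DD n) y = (-1) \<cdot>\<^sub>m lie B' (DD n)"
      using lie_antisym[OF DD_carrier c[OF y(2)]] by simp
    then have "lie (DD n) y \<in> nh n" using nh_lie[OF n y(2) D] by (simp add: nh_smult[OF n])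
    moreover have "lie B y \<in> nh n" using nh_lie[OF n x(2)] hpL[OF y(2)] y(1) by simp
    moreover have "lie x y = cx \<cdot>\<^sub>m lie (DD n) y + lie B y"
      using x y c[OF y(2)] c[OF x(2)] by (simp add: lie_lin(1)[of _ "2*n"] lie_smult[of _ "2*n"])
    ultimately show "lie x y \<in> Lh n" by (intro nL) (simp add: nh_add[OF n] nh_smult[OF n])
  qed
qed

definition h_gens :: "nat \<Rightarrow> complex mat set"
  where "h_gens n = insert (DD n) (vcl n ` {1..2 * n - 1})"

lemma sub_h_eq:
  assumes n: "n \<ge> 1"
  shows "sub_h n = lie_generated n (h_gens n)"
proof -
  have "{up_cl n k | k. 1 \<le> k \<and> k \<le> n - 1} \<union> {down_cl n k | k. 1 \<le> k \<and> k \<le> n} = vcl n ` {1..2 * n - 1}"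
    (is "?A \<union> ?B = ?V")
  proof (intro equalityI subsetI)
    fix x assume "x \<in> ?A \<union> ?B"
    then consider k where "x = up_cl n k" "1 \<le> k" "k \<le> n - 1" | k where "x = down_cl n k" "1 \<le> k" "k \<le> n" by blast
    then show "x \<in> ?V"
    proof cases
      case 1
      then show ?thesis using n by (intro image_eqI[of _ _ k]) (auto simp: vcl_def)
    next
      case 2
      then show ?thesis by (intro image_eqI[of _ _ "2 * n - k"]) (auto simp: vcl_def)
    qed
  next
    fix x assume "x \<in> ?V"
    then obtain i where i: "x = vcl n i" "1 \<le> i" "i \<le> 2 * n - 1" by auto
    show "x \<in> ?A \<union> ?B"
    proof (cases "i < n")
      case True
      with i have "x = up_cl n i" "1 \<le> i" "i \<le> n - 1" by (auto simp: vcl_def)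
      then show ?thesis by blast
    next
      case False
      with i have "x = down_cl n (2 * n - i)" "1 \<le> 2 * n - i" "2 * n - i \<le> n" by (auto simp: vcl_def)
      then show ?thesis by blast
    qed
  qed
  then show ?thesis by (simp add: sub_h_def h_gens_def DD_def Un_assoc)
qed

lemma sub_h_least: "n \<ge> 1 \<Longrightarrow> lie_subalgebra n L \<Longrightarrow> h_gens n \<subseteq> L \<Longrightarrow> sub_h n \<subseteq> L"
  by (auto simp: sub_h_eq lie_generated_def)

lemma h_gens_sub_h: "n \<ge> 1 \<Longrightarrow> h_gens n \<subseteq> sub_h n"
  by (auto simp: sub_h_eq lie_generated_def)

lemma h_gens_sp:
  assumes "n \<ge> 1"
  shows "h_gens n \<subseteq> sp n"
  using hp_sp[OF DD_hp[OF assms]] vcl_row[OF assms] by (auto simp: h_gens_def nh_sp)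

lemma h_gens_Lh:
  assumes n: "n \<ge> 1"
  shows "h_gens n \<subseteq> Lh n"
proof -
  have "DD n = 1 \<cdot>\<^sub>m DD n + 0\<^sub>m (2*n) (2*n)" by (rule eq_matI) auto
  then have "DD n \<in> Lh n" unfolding Lh_def using nh_zero[OF n] by blast
  moreover have "B \<in> Lh n" if "B \<in> nh n" for B
  proof -
    have "B = 0 \<cdot>\<^sub>m DD n + B" by (rule eq_matI) (use nh_sp[OF that, THEN sp_carrier] in auto)
    then show ?thesis unfolding Lh_def using that by blast
  qed
  ultimately show ?thesis using vcl_row[OF n] by (auto simp: h_gens_def)
qed

lemma sub_h_Lh: "n \<ge> 1 \<Longrightarrow> sub_h n \<subseteq> Lh n"
  by (rule sub_h_least[OF _ lie_subalgebra_Lh h_gens_Lh])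

lemma lie_subalgebra_sub_h:
  assumes n: "n \<ge> 1"
  shows "lie_subalgebra n (sub_h n)"
proof -
  have "sub_h n \<subseteq> sp n" using sub_h_Lh[OF n] lie_subalgebra_Lh[OF n] by (auto simp: lie_subalgebra_def)
  then show ?thesis
    unfolding sub_h_eq[OF n] lie_generated_def lie_subalgebra_def by auto
qed

text \<open>A is rebuilt from the generators by matching the entries of its first row in the columns
  \<open>pp n 1\<close>, ..., \<open>pp n m\<close>, one generator at a time.\<close>

lemma nh_sub_h:
  assumes n: "n \<ge> 1" and A: "A \<in> nh n"
  shows "A \<in> sub_h n"
proof -
  have L: "lie_subalgebra n (sub_h n)" by (rule lie_subalgebra_sub_h[OF n])
  have v: "vcl n i \<in> sub_h n \<inter> nh n" if "1 \<le> i" "i \<le> 2 * n - 1" for i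
    using h_gens_sub_h[OF n] vcl_row[OF n] that by (auto simp: h_gens_def)
  have "\<exists>B\<in>sub_h n \<inter> nh n. \<forall>b<2*n. B $$ (0,b) = (if b \<in> pp n ` {1..m} then A $$ (0,b) else 0)"
    if "m \<le> 2 * n - 1" for m
    using that
  proof (induction m)
    case 0
    show ?case
      by (rule bexI[of _ "0\<^sub>m (2*n) (2*n)"]) (use n L nh_zero[OF n] in \<open>auto simp: lie_subalgebra_def\<close>)
  next
    case (Suc m)
    then obtain B where B: "B \<in> sub_h n \<inter> nh n"
      "\<And>b. b < 2*n \<Longrightarrow> B $$ (0,b) = (if b \<in> pp n ` {1..m} then A $$ (0,b) else 0)"
      by auto
    obtain c where c: "c \<noteq> 0" "\<And>b. b < 2*n \<Longrightarrow> vcl n (Suc m) $$ (0,b) = (if b = pp n (Suc m) then c else 0)"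
      using vcl_row[OF n, of "Suc m"] Suc.prems by auto
    have vm: "vcl n (Suc m) \<in> sub_h n \<inter> nh n" using v[of "Suc m"] Suc.prems by simp
    let ?p = "pp n (Suc m)"
    let ?B = "B + (A $$ (0,?p) / c) \<cdot>\<^sub>m vcl n (Suc m)"
    have ne: "?p \<notin> pp n ` {1..m}" using Suc.prems by (auto simp: pp_def split: if_splits)
    have "?B \<in> sub_h n \<inter> nh n"
      using L B(1) vm by (auto simp: lie_subalgebra_def nh_add[OF n] nh_smult[OF n])
    moreover have "?B $$ (0,b) = (if b \<in> pp n ` {1..Suc m} then A $$ (0,b) else 0)" if b: "b < 2*n" for b
    proof -
      have "?B $$ (0,b) = B $$ (0,b) + A $$ (0,?p) / c * vcl n (Suc m) $$ (0,b)"
        using b vm nh_sp[THEN sp_carrier, of "vcl n (Suc m)" n] by auto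
      then show ?thesis using B(2)[OF b] c b ne by (auto simp: atLeastAtMostSuc_conv)
    qed
    ultimately show ?case by blast
  qed
  from this[of "2 * n - 1"] obtain B where B: "B \<in> sub_h n \<inter> nh n"
    "\<And>b. b < 2*n \<Longrightarrow> B $$ (0,b) = (if b \<in> pp n ` {1..2 * n - 1} then A $$ (0,b) else 0)" by auto
  have "A = B"
  proof (rule nh_eqI[OF A])
    fix b assume b: "b < 2*n"
    show "A $$ (0,b) = B $$ (0,b)"
    proof (cases "b = 0")
      case True
      then show ?thesis using A B(1) by (auto simp: nh_def)
    next
      case False
      have "b = pp n (if b < n then b else 3 * n - 1 - b)" "(if b < n then b else 3 * n - 1 - b) \<in> {1..2 * n - 1}"
        using False b n by (auto simp: pp_def)
      then show ?thesis using B(2)[OF b] by auto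
    qed
  qed (use B in auto)
  then show ?thesis using B by simp
qed

section \<open>The cobracket on the subalgebra\<close>

lemma wedge_space_zero: "(\<lambda>t. 0) \<in> wedge_space N A B"
  unfolding wedge_space_def by (rule CollectI, rule exI[of _ 0]) auto

lemma sum_lessThan_add: "(\<Sum>r<m + k. f r) = (\<Sum>r<m. f r) + (\<Sum>r<(k::nat). f (m + r) :: 'a::comm_monoid_add)"
  by (induction k) (simp_all add: add.assoc)

lemma wedge_space_add:
  assumes "F \<in> wedge_space N A B" "G \<in> wedge_space N A B"
  shows "(\<lambda>t. F t + G t) \<in> wedge_space N A B"
proof -
  from assms obtain m a b m' a' b' where F: "F = (\<lambda>t. \<Sum>r<(m::nat). wedge N (a r) (b r) t)" "\<forall>r<m. a r \<in> A \<and> b r \<in> B"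
    and G: "G = (\<lambda>t. \<Sum>r<(m'::nat). wedge N (a' r) (b' r) t)" "\<forall>r<m'. a' r \<in> A \<and> b' r \<in> B"
    unfolding wedge_space_def by blast
  let ?a = "\<lambda>r. if r < m then a r else a' (r - m)" and ?b = "\<lambda>r. if r < m then b r else b' (r - m)"
  have "(\<Sum>r<m + m'. wedge N (?a r) (?b r) t) = F t + G t" for t
  proof -
    have "(\<Sum>r<m + m'. wedge N (?a r) (?b r) t) =
        (\<Sum>r<m. wedge N (?a r) (?b r) t) + (\<Sum>r<m'. wedge N (?a (m + r)) (?b (m + r)) t)"
      by (rule sum_lessThan_add)
    then show ?thesis by (simp add: F(1) G(1))
  qed
  then have "(\<lambda>t. F t + G t) = (\<lambda>t. \<Sum>r<m + m'. wedge N (?a r) (?b r) t)" by presburger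
  moreover have "\<forall>r<m + m'. ?a r \<in> A \<and> ?b r \<in> B" using F(2) G(2) by auto
  ultimately show ?thesis
    unfolding wedge_space_def by (intro CollectI exI[of _ "m + m'"] exI[of _ ?a] exI[of _ ?b] conjI)
qed

lemma wedge_space_sum:
  assumes "\<And>e. e \<in> S \<Longrightarrow> F e \<in> wedge_space N A B"
  shows "(\<lambda>t. \<Sum>e\<in>S. F e t) \<in> wedge_space N A B"
proof (cases "finite S")
  case True
  then show ?thesis using assms
    by (induction S) (auto simp: wedge_space_zero wedge_space_add)
qed (simp add: wedge_space_zero)

lemma wedge_space_1: "a \<in> A \<Longrightarrow> b \<in> B \<Longrightarrow> wedge N a b \<in> wedge_space N A B"
  unfolding wedge_space_def
  by (rule CollectI, rule exI[of _ 1], rule exI[of _ "\<lambda>_. a"], rule exI[of _ "\<lambda>_. b"]) auto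

lemma wedge_lin:
  assumes "a \<in> carrier_mat N N" "a' \<in> carrier_mat N N" "b \<in> carrier_mat N N"
  shows "wedge N (a + a') b t = wedge N a b t + wedge N a' b t" "wedge N b (a + a') t = wedge N b a t + wedge N b a' t"
    "wedge N (c \<cdot>\<^sub>m a) b t = c * wedge N a b t" "wedge N b (c \<cdot>\<^sub>m a) t = c * wedge N b a t"
  using assms by (cases t; auto simp: wedge_def tens_def algebra_simps)+

lemma wedge_swap: "wedge N a b t = - wedge N b a t"
  by (simp add: wedge_def)

lemma sp_blockI:
  assumes "A \<in> carrier_mat (2*n) (2*n)"
    and 1: "\<And>i j. i < n \<Longrightarrow> j < n \<Longrightarrow> A $$ (i,j) = - A $$ (n + j, n + i)"
    and 2: "\<And>i j. i < n \<Longrightarrow> j < n \<Longrightarrow> A $$ (i, n + j) = A $$ (j, n + i)"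
    and 3: "\<And>i j. i < n \<Longrightarrow> j < n \<Longrightarrow> A $$ (n + i, j) = A $$ (n + j, i)"
  shows "A \<in> sp n"
  unfolding sp_iff
proof (intro conjI allI impI)
  have up: "ep n i = -1" "dual n i = n + i" if "i < n" for i using that by (auto simp: ep_def dual_def)
  have dn: "ep n (n + i) = 1" "dual n (n + i) = i" for i by (auto simp: ep_def dual_def)
  fix a b assume ab: "a < 2*n" "b < 2*n"
  consider "a < n" "b < n" | b' where "a < n" "b = n + b'" "b' < n" | a' where "a = n + a'" "a' < n" "b < n"
    | a' b' where "a = n + a'" "a' < n" "b = n + b'" "b' < n"
    using ab by (metis add_less_cancel_left le_Suc_ex mult_2 not_le)
  then show "ep n b * A $$ (dual n b, a) = ep n a * A $$ (dual n a, b)"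
    by cases (simp_all add: up dn 1 2 3)
qed (fact assms(1))

lemma pos_root_vectors_sp: "e \<in> pos_root_vectors n \<Longrightarrow> e \<in> sp n"
  by (rule sp_blockI) (auto simp: pos_root_vectors_def unit_mx_def)

lemma pos_root_vectors_hp: "e \<in> pos_root_vectors n \<Longrightarrow> e \<in> hp n"
  using pos_root_vectors_sp[of e n] by (auto simp: hp_def pos_root_vectors_def unit_mx_def)

text \<open>Positive roots involving \<open>L_1\<close> have their root vectors in the nilradical;
  all other roots belong to the Levi part of the parabolic, which also contains the negative root
  vectors.\<close>

lemma pos_root_vectors_cases:
  assumes "e \<in> pos_root_vectors n"
  shows "e \<in> nh n \<or> transpose_mat e \<in> hp n"
proof -
  note s = pos_root_vectors_sp[OF assms] sp_transpose[OF pos_root_vectors_sp[OF assms]]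
  from assms consider (1) i j where "e = unit_mx n i j - unit_mx n (n+j) (n+i)" "1 \<le> i" "i < j" "j \<le> n"
    | (2) i j where "e = unit_mx n i (n+j) + unit_mx n j (n+i)" "1 \<le> i" "i < j" "j \<le> n"
    | (3) i where "e = unit_mx n i (n+i)" "1 \<le> i" "i \<le> n"
    unfolding pos_root_vectors_def by blast
  then show ?thesis
  proof cases
    case (1 i j)
    show ?thesis
    proof (cases "i = 1")
      case True
      then have "e \<in> nh n" using 1 s(1) by (auto simp: nh_def unit_mx_def)
      then show ?thesis ..
    next
      case False
      then have "transpose_mat e \<in> hp n" using 1 s(2) by (auto simp: hp_def unit_mx_def)
      then show ?thesis ..
    qed
  next
    case (2 i j)
    show ?thesis
    proof (cases "i = 1")
      case True
      then have "e \<in> nh n" using 2 s(1) by (auto simp: nh_def unit_mx_def)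
      then show ?thesis ..
    next
      case False
      then have "transpose_mat e \<in> hp n" using 2 s(2) by (auto simp: hp_def unit_mx_def)
      then show ?thesis ..
    qed
  next
    case (3 i)
    show ?thesis
    proof (cases "i = 1")
      case True
      then have "e \<in> nh n" using 3 s(1) by (auto simp: nh_def unit_mx_def)
      then show ?thesis ..
    next
      case False
      then have "transpose_mat e \<in> hp n" using 3 s(2) by (auto simp: hp_def unit_mx_def)
      then show ?thesis ..
    qed
  qed
qed

text \<open>The root vectors are eigenvectors of the Cartan element, hence its contributions cancel.\<close>

lemma pos_root_vectors_DD:
  assumes "e \<in> pos_root_vectors n"
  shows "\<exists>c. lie (DD n) e = c \<cdot>\<^sub>m e \<and> lie (DD n) (transpose_mat e) = (- c) \<cdot>\<^sub>m transpose_mat e"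
proof -
  note e = sp_carrier[OF pos_root_vectors_sp[OF assms]]
  have "\<exists>c. \<forall>a<2*n. \<forall>b<2*n. e $$ (a,b) \<noteq> 0 \<longrightarrow> dd n a - dd n b = c"
  proof -
    have dn: "dd n (n + i) = - dd n i" if "i < n" for i using dd_dual[of i n] that by (simp add: dual_def add.commute)
    from assms consider (1) i j where "e = unit_mx n i j - unit_mx n (n+j) (n+i)" "1 \<le> i" "i < j" "j \<le> n"
      | (2) i j where "e = unit_mx n i (n+j) + unit_mx n j (n+i)" "1 \<le> i" "i < j" "j \<le> n"
      | (3) i where "e = unit_mx n i (n+i)" "1 \<le> i" "i \<le> n"
      unfolding pos_root_vectors_def by blast
    then show ?thesis
    proof cases
      case (1 i j)
      obtain i' j' where ij: "i = Suc i'" "j = Suc j'" using 1 by (cases i; cases j) auto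
      show ?thesis
        by (rule exI[of _ "dd n i' - dd n j'"]) (use 1 ij dn[of i'] dn[of j'] in \<open>auto simp: unit_mx_def split: if_splits\<close>)
    next
      case (2 i j)
      obtain i' j' where ij: "i = Suc i'" "j = Suc j'" using 2 by (cases i; cases j) auto
      show ?thesis
        by (rule exI[of _ "dd n i' + dd n j'"]) (use 2 ij dn[of i'] dn[of j'] in \<open>auto simp: unit_mx_def split: if_splits\<close>)
    next
      case (3 i)
      obtain i' where ij: "i = Suc i'" using 3 by (cases i) auto
      show ?thesis
        by (rule exI[of _ "dd n i' + dd n i'"]) (use 3 ij dn[of i'] in \<open>auto simp: unit_mx_def split: if_splits\<close>)
    qed
  qed
  then obtain c where c: "\<And>a b. a < 2*n \<Longrightarrow> b < 2*n \<Longrightarrow> e $$ (a,b) \<noteq> 0 \<Longrightarrow> dd n a - dd n b = c" by blast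
  have "lie (DD n) e = c \<cdot>\<^sub>m e"
  proof (rule eq_matI_c)
    fix a b assume ab: "a < 2*n" "b < 2*n"
    show "lie (DD n) e $$ (a,b) = (c \<cdot>\<^sub>m e) $$ (a,b)"
      unfolding DD_mono lie_diag[OF e ab] using ab e c[OF ab] by auto
  qed (use e in auto)
  moreover have "lie (DD n) (transpose_mat e) = (- c) \<cdot>\<^sub>m transpose_mat e"
  proof (rule eq_matI_c)
    fix a b assume ab: "a < 2*n" "b < 2*n"
    have et: "transpose_mat e \<in> carrier_mat (2*n) (2*n)" using e by simp
    have "transpose_mat e $$ (a,b) \<noteq> 0 \<Longrightarrow> dd n a - dd n b = - c" using c[OF ab(2,1)] e ab by fastforce
    then show "lie (DD n) (transpose_mat e) $$ (a,b) = ((- c) \<cdot>\<^sub>m transpose_mat e) $$ (a,b)"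
      unfolding DD_mono lie_diag[OF et ab] using ab e by (cases "e $$ (b,a) = 0") auto
  qed (use e in auto)
  ultimately show ?thesis by blast
qed

lemma coisotropic_sub_h:
  assumes n: "n \<ge> 1"
  shows "coisotropic n (sub_h n)"
  unfolding coisotropic_def
proof (intro conjI ballI)
  show "lie_subalgebra n (sub_h n)" by (rule lie_subalgebra_sub_h[OF n])
  fix x assume "x \<in> sub_h n"
  then obtain c B where x: "x = c \<cdot>\<^sub>m DD n + B" and B: "B \<in> nh n" using sub_h_Lh[OF n] by (auto simp: Lh_def)
  let ?N = "2*n"
  have Bc: "B \<in> carrier_mat ?N ?N" using nh_sp[OF B] by (rule sp_carrier)
  have "(\<lambda>t. 1 / killing n e (transpose_mat e) *
      (wedge ?N (lie x e) (transpose_mat e) t + wedge ?N e (lie x (transpose_mat e)) t)) \<in> wedge_space ?N (sub_h n) (sp n)"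
    if e: "e \<in> pos_root_vectors n" for e
  proof -
    let ?k = "1 / killing n e (transpose_mat e)" and ?f = "transpose_mat e"
    have f: "?f \<in> sp n" by (rule sp_transpose[OF pos_root_vectors_sp[OF e]])
    have ec: "e \<in> carrier_mat ?N ?N" and fc: "?f \<in> carrier_mat ?N ?N"
      using sp_carrier[OF pos_root_vectors_sp[OF e]] by auto
    have Be: "lie B e \<in> nh n" by (rule nh_lie[OF n B pos_root_vectors_hp[OF e]])
    have cc: "lie B e \<in> carrier_mat ?N ?N" "lie B ?f \<in> carrier_mat ?N ?N" using Bc ec fc by auto
    obtain l where l: "lie (DD n) e = l \<cdot>\<^sub>m e" "lie (DD n) ?f = (- l) \<cdot>\<^sub>m ?f"
      using pos_root_vectors_DD[OF e] by blast
    have "lie x e = (c * l) \<cdot>\<^sub>m e + lie B e"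
      unfolding x using Bc ec l cc by (simp add: lie_lin(1)[of _ ?N] lie_smult[of _ ?N]) (auto simp: lie_dim intro!: eq_matI_c[of _ ?N])
    moreover have "lie x ?f = (- (c * l)) \<cdot>\<^sub>m ?f + lie B ?f"
      unfolding x using Bc fc l cc by (simp add: lie_lin(1)[of _ ?N] lie_smult[of _ ?N]) (auto simp: lie_dim intro!: eq_matI_c[of _ ?N])
    ultimately have eq: "wedge ?N (lie x e) ?f t + wedge ?N e (lie x ?f) t = wedge ?N (lie B e) ?f t + wedge ?N e (lie B ?f) t" for t
      using ec fc cc by (simp add: wedge_lin)
    have 1: "wedge ?N (?k \<cdot>\<^sub>m lie B e) ?f \<in> wedge_space ?N (sub_h n) (sp n)"
      by (intro wedge_space_1 nh_sub_h[OF n] nh_smult[OF n] Be f)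
    \<comment> \<open>If e is in the nilradical, it is the left factor itself. Otherwise f
      normalizes the nilradical, and \<open>e \<and> [B, f]\<close> is rewritten as
      \<open>-[B, f] \<and> e\<close>. The scalar is absorbed into the left factor.\<close>
    obtain a b where ab: "a \<in> sub_h n" "b \<in> sp n" "\<And>t. ?k * wedge ?N e (lie B ?f) t = wedge ?N a b t"
    proof (cases "e \<in> nh n")
      case True
      show ?thesis
        by (rule that[of "?k \<cdot>\<^sub>m e" "lie B ?f"])
          (use ec cc in \<open>auto intro!: nh_sub_h[OF n] nh_smult[OF n] True sp_lie nh_sp[OF B] f simp: wedge_lin\<close>)
    next
      case False
      then have fp: "?f \<in> hp n" using pos_root_vectors_cases[OF e] by simp
      show ?thesis
        by (rule that[of "(- ?k) \<cdot>\<^sub>m lie B ?f" e])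
          (use ec cc wedge_swap[of ?N e "lie B ?f"] in \<open>auto intro!: nh_sub_h[OF n] nh_smult[OF n] nh_lie[OF n B fp]
            pos_root_vectors_sp[OF e] simp: wedge_lin\<close>)
    qed
    have "(\<lambda>t. wedge ?N (?k \<cdot>\<^sub>m lie B e) ?f t + wedge ?N a b t) \<in> wedge_space ?N (sub_h n) (sp n)"
      by (rule wedge_space_add[OF 1 wedge_space_1[OF ab(1,2)]])
    moreover have "?k * (wedge ?N (lie x e) ?f t + wedge ?N e (lie x ?f) t) =
        wedge ?N (?k \<cdot>\<^sub>m lie B e) ?f t + wedge ?N a b t" for t
      unfolding eq ab(3)[symmetric] using wedge_lin(3)[OF cc(1) cc(1) fc] by (simp add: distrib_left)
    ultimately show ?thesis by presburger
  qed
  then show "cobracket n x \<in> wedge_space ?N (sub_h n) (sp n)"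
    unfolding cobracket_def by (rule wedge_space_sum)
qed

section \<open>Linear functionals\<close>

definition pair0 :: "('m \<Rightarrow> complex) \<Rightarrow> ('m \<Rightarrow>\<^sub>0 complex) \<Rightarrow> complex"
  where "pair0 l p = pm_lin (\<lambda>c. c) l p"

lemma pair0_simps: "pair0 l (p + q) = pair0 l p + pair0 l q" "pair0 l (Poly_Mapping.single w c) = c * l w"
  "pair0 l 0 = 0" "pair0 l (p - q) = pair0 l p - pair0 l q" "pair0 l (sum f S) = (\<Sum>x\<in>S. pair0 l (f x))"
proof -
  have a: "pair0 l (p + q) = pair0 l p + pair0 l q" for p q by (simp add: pair0_def pm_lin_add[OF central_hom_id])
  then show "pair0 l (p + q) = pair0 l p + pair0 l q" .
  show "pair0 l (Poly_Mapping.single w c) = c * l w" by (simp add: pair0_def pm_lin_single[OF central_hom_id])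
  show z: "pair0 l 0 = 0" by (simp add: pair0_def)
  show "pair0 l (p - q) = pair0 l p - pair0 l q" using a[of "p - q" q] by simp
  show "pair0 l (sum f S) = (\<Sum>x\<in>S. pair0 l (f x))" by (induction S rule: infinite_finite_induct) (simp_all add: z a)
qed

lemma pair0_cst:
  fixes p :: "'m::monoid_add \<Rightarrow>\<^sub>0 complex"
  shows "pair0 l (cst c * p) = c * pair0 l p"
  by (simp add: pair0_def pm_lin_cst_mult[OF central_hom_id])

definition pairh :: "('m \<Rightarrow> complex fps) \<Rightarrow> ('m::monoid_add) ser \<Rightarrow> complex fps"
  where "pairh L f = ser_ext (pm_lin fps_const L) f"

lemma pairh_add: "pairh L (f + g) = pairh L f + pairh L g"
  by (simp add: pairh_def ser_ext_add pm_lin_add[OF central_hom_complex_fps])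

lemma pairh_scal: "pairh L (scal c * f) = c * pairh L f"
proof -
  have "Abs_fps (\<lambda>k. c $ k) = c" by (rule fps_ext) simp
  then show ?thesis
    by (simp add: pairh_def ser_ext_scal_mult[OF central_hom_id] pm_lin_add[OF central_hom_complex_fps]
      pm_lin_cst_mult[OF central_hom_complex_fps] del: Abs_fps_inverse)
qed

lemma pairh_X: "pairh L (fps_X * f) = fps_X * pairh L f"
  using pairh_scal[of L fps_X f] by (simp add: scal_X)

lemma pairh_X_power: "pairh L (fps_X ^ m * f) = fps_X ^ m * pairh L f"
  by (induction m) (simp_all add: pairh_X mult.assoc)

lemma pairh_diff: "pairh L (f - g) = pairh L f - pairh L g"
  using pairh_add[of L "f - g" g] by simp

lemma pairh_zero: "pairh L 0 = 0"
  using pairh_diff[of L 0 0] by simp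

lemma pairh_single: "pairh L (fps_const (Poly_Mapping.single w c)) = fps_const c * L w"
  by (simp add: pairh_def ser_ext_const pm_lin_single[OF central_hom_complex_fps])

lemma pairh_nth_0: "pairh L f $ 0 = pair0 (\<lambda>w. L w $ 0) (f $ 0)"
proof -
  have "pm_lin fps_const L p $ 0 = pair0 (\<lambda>w. L w $ 0) p" for p
    by (induction p rule: pm_induct[OF subset_UNIV])
       (simp_all add: pm_lin_add[OF central_hom_complex_fps] pm_lin_single[OF central_hom_complex_fps] pair0_simps)
  then show ?thesis by (simp add: pairh_def ser_ext_nth0)
qed

lemma pairh_cong_nth: "\<forall>k<m. g $ k = f $ k \<Longrightarrow> \<forall>k<m. pairh L g $ k = pairh L f $ k"
  by (auto simp: pairh_def ser_ext_def)

lemma pairh_const: "pairh (\<lambda>w. fps_const (l w)) f $ k = pair0 l (f $ k)"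
proof -
  have 1: "pm_lin fps_const (\<lambda>w. fps_const (l w)) p = fps_const (pair0 l p)" for p
    by (induction p rule: pm_induct[OF subset_UNIV])
       (simp_all add: pm_lin_add[OF central_hom_complex_fps] pm_lin_single[OF central_hom_complex_fps] pair0_simps
         fps_const_add fps_const_mult)
  have "(\<Sum>m\<le>k. fps_const (pair0 l (f $ m)) $ (k - m)) = (\<Sum>m\<le>k. if m = k then pair0 l (f $ k) else 0)"
    by (intro sum.cong) auto
  then show ?thesis by (simp add: pairh_def ser_ext_def 1)
qed

lemma pairh_hlinear_eq:
  assumes "\<And>f g. T (f + g) = T f + T g" "\<And>f. T (fps_X * f) = fps_X * T f"
    and "\<And>w c. w \<in> M \<Longrightarrow> T (fps_const (Poly_Mapping.single w c)) = fps_const c * L w"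
    and "f \<in> ser_set M"
  shows "T f = pairh L f"
  by (rule hlinear_eq[of T "pairh L" M])
     (use assms in \<open>auto simp: pairh_add pairh_X pairh_single\<close>)

lemma pairh_lin: "pairh (\<lambda>w. a * L w + b * L' w) f = a * pairh L f + b * pairh L' f"
  by (rule pairh_hlinear_eq[where M = UNIV, symmetric])
     (auto simp: pairh_add pairh_X pairh_single ser_set_def algebra_simps)

subsection \<open>Functionals on words in matrices\<close>

text \<open>The conditions under which a functional on words of matrices descends to the enveloping
  algebra.\<close>

definition lie_functional :: "nat \<Rightarrow> (complex mat list \<Rightarrow> complex) \<Rightarrow> bool"
  where "lie_functional n \<kappa> \<longleftrightarrow> (\<forall>us ws. \<forall>x\<in>sp n. \<forall>y\<in>sp n.
    (\<forall>a b. \<kappa> (us @ (a \<cdot>\<^sub>m x + b \<cdot>\<^sub>m y) # ws) = a * \<kappa> (us @ x # ws) + b * \<kappa> (us @ y # ws)) \<and>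
    \<kappa> (us @ x # y # ws) - \<kappa> (us @ y # x # ws) = \<kappa> (us @ lie x y # ws))"

lemma lie_functionalD:
  assumes "lie_functional n \<kappa>" "x \<in> sp n" "y \<in> sp n"
  shows "\<kappa> (us @ (a \<cdot>\<^sub>m x + b \<cdot>\<^sub>m y) # ws) = a * \<kappa> (us @ x # ws) + b * \<kappa> (us @ y # ws)"
    and "\<kappa> (us @ x # y # ws) - \<kappa> (us @ y # x # ws) = \<kappa> (us @ lie x y # ws)"
  using assms unfolding lie_functional_def by blast+

lemma lie_functional_shift:
  assumes "lie_functional n \<kappa>"
  shows "lie_functional n (\<lambda>ws. \<kappa> (u # ws))"
  unfolding lie_functional_def using lie_functionalD[OF assms, of _ _ "u # _"] by auto

text \<open>Matrix coefficients of the vector representation.\<close>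

fun ent :: "nat \<Rightarrow> nat \<Rightarrow> nat \<Rightarrow> complex mat list \<Rightarrow> complex"
  where
    "ent n i j [] = (if i = j then 1 else 0)"
  | "ent n i j (x # xs) = (\<Sum>k<2*n. x $$ (i,k) * ent n k j xs)"

lemma ent_append: "i < 2*n \<Longrightarrow> ent n i j (us @ ws) = (\<Sum>k<2*n. ent n i k us * ent n k j ws)"
proof (induction us arbitrary: i)
  case Nil
  have "(\<Sum>k<2*n. ent n i k [] * ent n k j ws) = (\<Sum>k<2*n. if k = i then ent n k j ws else 0)"
    by (intro sum.cong) auto
  with Nil show ?case by simp
next
  case (Cons u us)
  have "ent n i j ((u # us) @ ws) = (\<Sum>l<2*n. \<Sum>k<2*n. u $$ (i,l) * (ent n l k us * ent n k j ws))"
    using Cons.IH by (simp add: sum_distrib_left)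
  also have "\<dots> = (\<Sum>k<2*n. ent n i k (u # us) * ent n k j ws)"
    by (subst sum.swap) (simp add: sum_distrib_right mult.assoc)
  finally show ?case .
qed

lemma lie_functional_ent:
  assumes "i < 2*n"
  shows "lie_functional n (ent n i j)"
  unfolding lie_functional_def
proof (intro allI ballI conjI)
  fix us ws x y and a b :: complex assume "x \<in> sp n" "y \<in> sp n"
  then have c: "x \<in> carrier_mat (2*n) (2*n)" "y \<in> carrier_mat (2*n) (2*n)" by (auto simp: sp_carrier)
  have 1: "ent n k j ((a \<cdot>\<^sub>m x + b \<cdot>\<^sub>m y) # ws) = a * ent n k j (x # ws) + b * ent n k j (y # ws)" if "k < 2*n" for k
    using c that by (simp add: sum_distrib_left sum.distrib[symmetric] distrib_right mult.assoc)
  show "ent n i j (us @ (a \<cdot>\<^sub>m x + b \<cdot>\<^sub>m y) # ws) = a * ent n i j (us @ x # ws) + b * ent n i j (us @ y # ws)"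
    unfolding ent_append[OF assms] sum_distrib_left sum.distrib[symmetric]
    by (intro sum.cong refl) (simp add: 1 distrib_left mult.left_commute del: ent.simps)
  have 2: "ent n k j (p # q # ws) = (\<Sum>m<2*n. (p * q) $$ (k,m) * ent n m j ws)"
    if "k < 2*n" "p \<in> carrier_mat (2*n) (2*n)" "q \<in> carrier_mat (2*n) (2*n)" for k p q
  proof -
    have "ent n k j (p # q # ws) = (\<Sum>l<2*n. \<Sum>m<2*n. p $$ (k,l) * q $$ (l,m) * ent n m j ws)"
      by (simp add: sum_distrib_left mult.assoc)
    also have "\<dots> = (\<Sum>m<2*n. (\<Sum>l<2*n. p $$ (k,l) * q $$ (l,m)) * ent n m j ws)"
      by (subst sum.swap) (simp add: sum_distrib_right)
    also have "\<dots> = (\<Sum>m<2*n. (p * q) $$ (k,m) * ent n m j ws)"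
      by (intro sum.cong refl) (simp add: mult_entry[OF that(2,3,1)])
    finally show ?thesis .
  qed
  have 3: "ent n k j (x # y # ws) - ent n k j (y # x # ws) = ent n k j (lie x y # ws)" if "k < 2*n" for k
    unfolding 2[OF that c] 2[OF that c(2,1)] sum_subtractf[symmetric] ent.simps(2)[of n k j "lie x y"]
    by (intro sum.cong refl) (use c that in \<open>simp add: lie_entry left_diff_distrib\<close>)
  show "ent n i j (us @ x # y # ws) - ent n i j (us @ y # x # ws) = ent n i j (us @ lie x y # ws)"
    unfolding ent_append[OF assms] sum_subtractf[symmetric]
    by (intro sum.cong refl) (simp add: 3[symmetric] right_diff_distrib del: ent.simps)
qed

lemma pair0_bilinear_0:
  fixes r :: "'g falg"
  assumes "\<And>us vs. pair0 l (Poly_Mapping.single (FWord us) 1 * r * Poly_Mapping.single (FWord vs) 1) = 0"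
  shows "pair0 l (u * r * v) = 0"
proof -
  have s: "Poly_Mapping.single w c = cst c * Poly_Mapping.single (FWord (letters w)) 1" for w :: "'g fword" and c
    by (simp add: mult_single)
  have 1: "pair0 l (Poly_Mapping.single w c * r * Poly_Mapping.single w' c') = 0" for w w' c c'
  proof -
    have "Poly_Mapping.single w c * r * Poly_Mapping.single w' c' = cst c * (cst c' *
        (Poly_Mapping.single (FWord (letters w)) 1 * r * Poly_Mapping.single (FWord (letters w')) 1))"
      (is "_ = cst c * (cst c' * (?S * r * ?S'))")
    proof -
      have "?S * r * (cst c' * ?S') = cst c' * (?S * r * ?S')" by (rule central_hom.left[OF central_hom_cst])
      then show ?thesis unfolding s[of w c] s[of w' c'] by (simp only: mult.assoc)
    qed
    then show ?thesis using assms by (simp only: pair0_cst mult_zero_right)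
  qed
  have 2: "pair0 l (Poly_Mapping.single w c * r * v) = 0" for w c
    by (induction v rule: pm_induct[OF subset_UNIV]) (simp_all add: 1 pair0_simps distrib_left)
  show ?thesis
    by (induction u rule: pm_induct[OF subset_UNIV]) (simp_all add: 2 pair0_simps distrib_right)
qed

text \<open>The elements killed together with all their two-sided multiples form an ideal. It
  contains the relators because the defining conditions allow arbitrary words on both sides.\<close>

lemma (in Uh_loc) lie_functional_env:
  assumes l: "lie_functional n \<kappa>" and p: "p \<in> env_ideal n"
  shows "pair0 (\<lambda>w. \<kappa> (letters w)) p = 0"
proof -
  let ?l = "\<lambda>w. \<kappa> (letters w)"
  let ?J = "{p \<in> EA. \<forall>u v. pair0 ?l (u * p * v) = 0}"
  have "ideal_set EA ?J"
  proof
    fix c x assume c: "c \<in> EA" and x: "x \<in> ?J"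
    have "u * (c * x) * v = (u * c) * x * v" "u * (x * c) * v = u * x * (c * v)" for u v
      by (simp_all add: mult.assoc)
    with c x show "c * x \<in> ?J" "x * c \<in> ?J" by (auto simp: EA.C_mult)
  qed (auto simp: EA.C_closed left_diff_distrib right_diff_distrib pair0_simps)
  moreover have "env_relators n \<subseteq> ?J"
  proof
    fix r assume r: "r \<in> env_relators n"
    have s: "Poly_Mapping.single (FWord us) 1 * letter z * Poly_Mapping.single (FWord ws) 1 =
        Poly_Mapping.single (FWord (us @ z # ws)) 1"
      "Poly_Mapping.single (FWord us) 1 * (letter z * letter z') * Poly_Mapping.single (FWord ws) 1 =
        Poly_Mapping.single (FWord (us @ z # z' # ws)) 1"
      "Poly_Mapping.single (FWord us) 1 * (cst c * letter z) * Poly_Mapping.single (FWord ws) 1 =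
        Poly_Mapping.single (FWord (us @ z # ws)) c"
      for us ws z z' c by (simp_all add: mult_single plus_fword_def zero_fword_def)
    have "pair0 ?l (Poly_Mapping.single (FWord us) 1 * r * Poly_Mapping.single (FWord ws) 1) = 0" for us ws
    proof -
      from r consider (1) a b x y where "r = letter (a \<cdot>\<^sub>m x + b \<cdot>\<^sub>m y) - cst a * letter x - cst b * letter y" "x \<in> sp n" "y \<in> sp n"
        | (2) x y where "r = letter x * letter y - letter y * letter x - letter (lie x y)" "x \<in> sp n" "y \<in> sp n"
        unfolding env_relators_def by blast
      then show ?thesis
      proof cases
        case (1 a b x y)
        show ?thesis
          unfolding 1(1) right_diff_distrib left_diff_distrib s
          using lie_functionalD(1)[OF l 1(2,3)] by (simp add: pair0_simps)
      next
        case (2 x y)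
        show ?thesis
          unfolding 2(1) right_diff_distrib left_diff_distrib s
          using lie_functionalD(2)[OF l 2(2,3)] by (simp add: pair0_simps)
      qed
    qed
    then show "r \<in> ?J" using pair0_bilinear_0[of ?l r] r env_relators_EA by blast
  qed
  ultimately have "p \<in> ?J" using env_ideal_least p by blast
  then have "pair0 ?l (1 * p * 1) = 0" by blast
  then show ?thesis by simp
qed

text \<open>The convolution product, for the coproduct in which letters are primitive.\<close>

fun conv :: "('g list \<Rightarrow> complex) \<Rightarrow> ('g list \<Rightarrow> complex) \<Rightarrow> 'g list \<Rightarrow> complex"
  where
    "conv l l' [] = l [] * l' []"
  | "conv l l' (x # xs) = conv (\<lambda>w. l (x # w)) l' xs + conv l (\<lambda>w. l' (x # w)) xs"

lemma conv_lin: "conv (\<lambda>w. a * l w + b * l1 w) l' ws = a * conv l l' ws + b * conv l1 l' ws"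
  "conv l' (\<lambda>w. a * l w + b * l1 w) ws = a * conv l' l ws + b * conv l' l1 ws"
  by (induction ws arbitrary: l l1 l') (simp_all add: algebra_simps)

lemma conv_diff: "conv (\<lambda>w. l w - l1 w) l' ws = conv l l' ws - conv l1 l' ws"
  "conv l' (\<lambda>w. l w - l1 w) ws = conv l' l ws - conv l' l1 ws"
  using conv_lin(1)[of 1 l "-1" l1 l' ws] conv_lin(2)[of l' 1 l "-1" l1 ws] by simp_all

lemma conv_map: "conv (\<lambda>w. l (map f w)) (\<lambda>w. l' (map f w)) ws = conv l l' (map f ws)"
proof (induction ws arbitrary: l l')
  case (Cons x ws)
  then show ?case using Cons.IH[of "\<lambda>w. l (f x # w)" l'] Cons.IH[of l "\<lambda>w. l' (f x # w)"] by simp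
qed simp

lemma lie_functional_conv:
  assumes "lie_functional n l" "lie_functional n l'"
  shows "lie_functional n (conv l l')"
proof -
  have "(\<forall>a b. conv l l' (us @ (a \<cdot>\<^sub>m x + b \<cdot>\<^sub>m y) # ws) = a * conv l l' (us @ x # ws) + b * conv l l' (us @ y # ws)) \<and>
    conv l l' (us @ x # y # ws) - conv l l' (us @ y # x # ws) = conv l l' (us @ lie x y # ws)"
    if "x \<in> sp n" "y \<in> sp n" for us ws x y
    using assms
  proof (induction us arbitrary: l l')
    case Nil
    note l = lie_functionalD[OF Nil(1) that, of "[]", simplified] and l' = lie_functionalD[OF Nil(2) that, of "[]", simplified]
    have "conv l l' ((a \<cdot>\<^sub>m x + b \<cdot>\<^sub>m y) # ws) = a * conv l l' (x # ws) + b * conv l l' (y # ws)" for a b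
      by (simp add: l(1) l'(1) conv_lin algebra_simps)
    moreover have "conv l l' (x # y # ws) - conv l l' (y # x # ws) = conv l l' (lie x y # ws)"
      by (simp add: l(2)[symmetric] l'(2)[symmetric] conv_diff)
    ultimately show ?case by simp
  next
    case (Cons u us)
    note s = lie_functional_shift[OF Cons.prems(1), of u] lie_functional_shift[OF Cons.prems(2), of u]
    show ?case using Cons.IH[OF s(1) Cons.prems(2)] Cons.IH[OF Cons.prems(1) s(2)] by (simp add: algebra_simps)
  qed
  then show ?thesis by (simp add: lie_functional_def)
qed

lemma lie_functional_lin:
  assumes "lie_functional n l" "lie_functional n l'"
  shows "lie_functional n (\<lambda>w. a * l w + b * l' w)"
  unfolding lie_functional_def
  by (auto simp: lie_functionalD(1)[OF assms(1)] lie_functionalD(1)[OF assms(2)] algebra_simps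
      lie_functionalD(2)[OF assms(1), symmetric] lie_functionalD(2)[OF assms(2), symmetric])

lemma conv_low:
  "\<lbrakk>\<And>v. length v < d \<Longrightarrow> l' v = 0; length ws < d\<rbrakk> \<Longrightarrow> conv l l' ws = 0"
proof (induction ws arbitrary: d l l')
  case (Cons x xs)
  have "conv (\<lambda>w. l (x # w)) l' xs = 0" by (rule Cons.IH[of d]) (use Cons.prems in auto)
  moreover have "conv l (\<lambda>w. l' (x # w)) xs = 0" by (rule Cons.IH[of "d - 1"]) (use Cons.prems in auto)
  ultimately show ?case by simp
qed simp

lemma conv_eq:
  "\<lbrakk>\<And>v. length v < d \<Longrightarrow> l' v = 0; length ws = d\<rbrakk> \<Longrightarrow> conv l l' ws = l [] * l' ws"
proof (induction ws arbitrary: d l l')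
  case (Cons x xs)
  have "conv (\<lambda>w. l (x # w)) l' xs = 0" by (rule conv_low[of d]) (use Cons.prems in auto)
  moreover have "conv l (\<lambda>w. l' (x # w)) xs = l [] * l' (x # xs)"
    by (rule Cons.IH[of "d - 1"]) (use Cons.prems in auto)
  ultimately show ?case by simp
qed simp

text \<open>The factor l receives at least one letter and l' at least d, so l receives exactly one;
  the d + 1 choices of this letter contribute the same product.\<close>

lemma conv_top:
  "\<lbrakk>l [] = 0; \<And>v. length v < d \<Longrightarrow> l' v = 0; \<And>v. length v = d \<Longrightarrow> l' v = c * prod_list (map (\<lambda>x. l [x]) v);
    length ws = Suc d\<rbrakk> \<Longrightarrow> conv l l' ws = c * of_nat (Suc d) * prod_list (map (\<lambda>x. l [x]) ws)"
proof (induction ws arbitrary: d l' c)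
  case (Cons x xs)
  have 1: "conv (\<lambda>w. l (x # w)) l' xs = l [x] * l' xs"
    by (rule conv_eq[of d]) (use Cons.prems in auto)
  have 2: "conv l (\<lambda>w. l' (x # w)) xs = c * l [x] * of_nat d * prod_list (map (\<lambda>x. l [x]) xs)"
  proof (cases d)
    case 0
    then show ?thesis using Cons.prems by simp
  next
    case (Suc d')
    show ?thesis unfolding Suc by (rule Cons.IH) (use Cons.prems Suc in auto)
  qed
  show ?case using Cons.prems(3)[of xs] Cons.prems(4) by (simp add: 1 2 algebra_simps)
qed simp

subsection \<open>Functionals on the quantum group\<close>

fun mx :: "nat \<Rightarrow> qgen \<Rightarrow> complex mat"
  where
    "mx n (Xp i) = chev_e n i"
  | "mx n (Xm i) = chev_f n i"
  | "mx n (Hh i) = coroot n i"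

lemma spec_gen_mx: "spec_gen n x = letter (mx n x)"
  by (cases x) auto

lemma spl_single: "falg_lift cst (spec_gen n) (Poly_Mapping.single w c) = Poly_Mapping.single (FWord (map (mx n) (letters w))) c"
proof -
  have "prod_list (map (spec_gen n) ws) = Poly_Mapping.single (FWord (map (mx n) ws)) 1" for ws
  proof (induction ws)
    case (Cons x xs)
    then show ?case by (simp add: spec_gen_mx mult_single plus_fword_def)
  qed (simp add: FWord_Nil)
  then show ?thesis by (simp add: falg_lift_simps(3)[OF central_hom_cst] mult_single)
qed

context Uh_loc
begin

text \<open>A functional on the quantum algebra with values in power series, paired with its
  classical limit. That the limit is a \<open>lie_functional\<close> is what connects values at
  \<open>h = 0\<close> with the enveloping algebra.\<close>

definition adm :: "(qgen fword \<Rightarrow> complex fps) \<Rightarrow> (complex mat list \<Rightarrow> complex) \<Rightarrow> bool"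
  where "adm L \<kappa> \<longleftrightarrow> (\<forall>f\<in>Uh_ideal n. pairh L f = 0) \<and> (\<forall>w. L w $ 0 = \<kappa> (map (mx n) (letters w))) \<and>
    lie_functional n \<kappa>"

lemma adm_nth_0:
  assumes "adm L \<kappa>"
  shows "pairh L f $ 0 = pair0 (\<lambda>w. \<kappa> (letters w)) (spl (f $ 0))"
proof -
  have L: "L w $ 0 = \<kappa> (map (mx n) (letters w))" for w using assms by (simp add: adm_def)
  have "pair0 (\<lambda>w. \<kappa> (map (mx n) (letters w))) p = pair0 (\<lambda>w. \<kappa> (letters w)) (spl p)" for p
    by (induction p rule: pm_induct[OF subset_UNIV])
       (simp_all add: pair0_simps falg_lift_rules spl_single)
  then show ?thesis by (simp add: pairh_nth_0 L)
qed

lemma adm_lin: "adm L \<kappa> \<Longrightarrow> adm L' \<mu> \<Longrightarrow> adm (\<lambda>w. fps_const a * L w + fps_const b * L' w) (\<lambda>w. a * \<kappa> w + b * \<mu> w)"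
  by (simp add: adm_def pairh_lin lie_functional_lin)

definition rm :: "qgen falg \<Rightarrow> complex mat"
  where "rm p = mat (2*n) (2*n) (\<lambda>(i,j). pair0 (\<lambda>w. ent n i j (map (mx n) (letters w))) p)"

lemma rm_carrier [simp]: "rm p \<in> carrier_mat (2*n) (2*n)" "dim_row (rm p) = 2*n" "dim_col (rm p) = 2*n"
  by (simp_all add: rm_def)

lemma rm_entry: "i < 2*n \<Longrightarrow> j < 2*n \<Longrightarrow> rm p $$ (i,j) = pair0 (\<lambda>w. ent n i j (map (mx n) (letters w))) p"
  by (simp add: rm_def)

lemma rm_add: "rm (p + q) = rm p + rm q" and rm_diff: "rm (p - q) = rm p - rm q"
  and rm_cst: "rm (cst c * p) = c \<cdot>\<^sub>m rm p" and rm_0: "rm 0 = 0\<^sub>m (2*n) (2*n)"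
  by (rule eq_matI; simp add: rm_entry pair0_simps pair0_cst)+

lemma rm_uminus_0: "rm p = 0\<^sub>m (2*n) (2*n) \<Longrightarrow> rm (- p) = 0\<^sub>m (2*n) (2*n)"
  using rm_diff[of 0 p] by (simp add: rm_0 eq_matI)

lemma rm_mult: "rm (p * q) = rm p * rm q"
proof (rule eq_matI_c)
  fix i j assume ij: "i < 2*n" "j < 2*n"
  let ?l = "\<lambda>i j w. ent n i j (map (mx n) (letters w))"
  have 1: "pair0 (?l i j) (Poly_Mapping.single u c * Poly_Mapping.single v d) =
      (\<Sum>k<2*n. pair0 (?l i k) (Poly_Mapping.single u c) * pair0 (?l k j) (Poly_Mapping.single v d))" for u v c d
    using ij by (simp add: mult_single pair0_simps plus_fword_def ent_append sum_distrib_left mult.assoc mult.left_commute)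
  have 2: "pair0 (?l i j) (Poly_Mapping.single u c * q) = (\<Sum>k<2*n. pair0 (?l i k) (Poly_Mapping.single u c) * pair0 (?l k j) q)" for u c
  proof (induction q rule: pm_induct[OF subset_UNIV])
    case (3 p q)
    then show ?case by (simp add: pair0_simps distrib_left sum.distrib)
  qed (simp_all only: 1, simp add: pair0_simps)
  have "pair0 (?l i j) (p * q) = (\<Sum>k<2*n. pair0 (?l i k) p * pair0 (?l k j) q)"
  proof (induction p rule: pm_induct[OF subset_UNIV])
    case (3 p q)
    then show ?case by (simp add: pair0_simps distrib_right sum.distrib)
  qed (simp_all only: 2, simp add: pair0_simps)
  then show "rm (p * q) $$ (i,j) = (rm p * rm q) $$ (i,j)"
    using ij by (simp add: rm_entry mult_entry[of _ "2*n"])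
qed auto

lemma rm_letter:
  assumes "mx n x \<in> carrier_mat (2*n) (2*n)"
  shows "rm (letter x) = mx n x"
proof (rule eq_matI_c[OF rm_carrier(1) assms])
  fix i j assume ij: "i < 2*n" "j < 2*n"
  have "(\<Sum>k<2*n. mx n x $$ (i,k) * (if k = j then 1 else 0)) = (\<Sum>k<2*n. if k = j then mx n x $$ (i,k) else 0)"
    by (intro sum.cong) auto
  then show "rm (letter x) $$ (i,j) = mx n x $$ (i,j)" using ij by (simp add: rm_entry pair0_simps)
qed

lemma rm_gens: "rm (letter (Xp i)) = chev_e n i" "rm (letter (Xm i)) = chev_f n i" "rm (letter (Hh i)) = coroot n i"
  by (simp_all add: rm_letter)

lemma rm_env:
  assumes "spl p \<in> env_ideal n"
  shows "rm p = 0\<^sub>m (2*n) (2*n)"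
proof (rule eq_matI_c)
  fix i j assume ij: "i < 2*n" "j < 2*n"
  have "pair0 (\<lambda>w. ent n i j (map (mx n) (letters w))) p = pair0 (\<lambda>w. ent n i j (letters w)) (spl p)"
    by (induction p rule: pm_induct[OF subset_UNIV]) (simp_all add: pair0_simps falg_lift_rules spl_single)
  also have "\<dots> = 0" by (rule lie_functional_env[OF lie_functional_ent[OF ij(1)] assms])
  finally show "rm p $$ (i,j) = 0\<^sub>m (2*n) (2*n) $$ (i,j)" using ij by (simp add: rm_entry)
qed auto

lemma rm_H_power:
  assumes "i \<in> {1..n}"
  shows "rm (letter (Hh i) ^ Suc (2 * k)) = coroot n i"
proof (induction k)
  case (Suc k)
  let ?H = "coroot n i"
  have "letter (Hh i) ^ Suc (2 * Suc k) = letter (Hh i) * (letter (Hh i) * letter (Hh i) ^ Suc (2 * k))" by simp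
  then have "rm (letter (Hh i) ^ Suc (2 * Suc k)) = ?H * (?H * ?H)" by (simp only: rm_mult rm_gens Suc)
  also have "\<dots> = ?H * ?H * ?H"
    by (rule assoc_mult_mat[OF coroot_carrier coroot_carrier coroot_carrier, symmetric])
  finally show ?case using coroot_cube[OF assms] by simp
qed (simp add: rm_gens)

text \<open>Odd powers of a coroot equal the coroot and even powers cancel in
  \<open>K - K^-1\<close>. So this difference acts as \<open>(q^d - q^-d) H\<close>, and the
  quotient as H without any dependence on h.\<close>

lemma rm_Kquot:
  assumes i: "i \<in> {1..n}"
  shows "rm (Kquot n i $ k) = (if k = 0 then coroot n i else 0\<^sub>m (2*n) (2*n))"
proof -
  let ?d = "of_nat (symd n i) :: complex" and ?H = "coroot n i"
  let ?b = "qpow (int (symd n i)) - qpow (- int (symd n i))"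
  have KK: "rm ((Kgen n i - Kinv n i) $ k) = (?b $ k) \<cdot>\<^sub>m ?H" for k
  proof -
    have "(Kgen n i - Kinv n i) $ k = cst (?d ^ k / fact k) * letter (Hh i) ^ k - cst ((- ?d) ^ k / fact k) * letter (Hh i) ^ k"
      by (simp add: Kgen_def Kinv_def exp_h_def)
    also have "\<dots> = cst (?b $ k) * letter (Hh i) ^ k"
      unfolding left_diff_distrib[symmetric] by (simp add: single_diff[symmetric] qpow_def)
    finally have e: "rm ((Kgen n i - Kinv n i) $ k) = (?b $ k) \<cdot>\<^sub>m rm (letter (Hh i) ^ k)" by (simp add: rm_cst)
    show ?thesis
    proof (cases "even k")
      case True
      then have "?b $ k = 0" by (simp add: qpow_def)
      then show ?thesis unfolding e using carrier_matD[OF coroot_carrier[of n i]]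
        by (intro eq_matI_c[of _ "2*n"]) auto
    next
      case False
      then obtain m where "k = Suc (2 * m)" by (metis oddE Suc_eq_plus1)
      then show ?thesis unfolding e using rm_H_power[OF i, of m] by simp
    qed
  qed
  define a where "a = fps_X / ?b"
  define c where "c = fps_shift 1 ?b"
  have ac: "a * c = 1"
  proof -
    have b: "?b = fps_X * c" unfolding c_def by (rule fps_X_eq_shift) simp
    have "c $ 0 = 2 * ?d" by (simp add: c_def qpow_def)
    then have c0: "c $ 0 \<noteq> 0" using symd_pos[of n i] by simp
    then have "c \<noteq> 0" by auto
    then have "fps_X / (fps_X * c) = 1 / c" using div_mult_mult1[of "fps_X :: complex fps" 1 c] by simp
    then have "a = inverse c" unfolding a_def b using fps_divide_unit[OF c0, of 1] by simp
    then show ?thesis using inverse_mult_eq_1[OF c0] by simp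
  qed
  have "Kquot n i $ k = (\<Sum>m=0..k. cst (a $ m) * fps_shift 1 (Kgen n i - Kinv n i) $ (k - m))"
    by (simp add: Kquot_def fps_mult_nth a_def)
  moreover have rs: "rm (sum F S) $$ (p,q) = (\<Sum>m\<in>S. rm (F m) $$ (p,q))" if "p < 2*n" "q < 2*n" for F p q and S :: "nat set"
    using that by (simp add: rm_entry pair0_simps)
  ultimately have "rm (Kquot n i $ k) $$ (p,q) = (a * c) $ k * ?H $$ (p,q)" if "p < 2*n" "q < 2*n" for p q
    using that KK carrier_matD[OF coroot_carrier[of n i]]
    by (simp add: rs rm_cst fps_mult_nth c_def sum_distrib_right mult.assoc del: fps_sub_nth)
  then show ?thesis unfolding ac by (intro eq_matI_c[of _ "2*n"]) auto
qed

text \<open>Order zero is the classical case. In higher orders only the coefficients of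
  \<open>Kquot\<close> and the Serre monomials with q-dependent coefficients remain, and each of
  them acts by zero.\<close>

lemma rm_relator:
  assumes r: "r \<in> Uh_relators n"
  shows "rm (r $ k) = 0\<^sub>m (2*n) (2*n)"
proof (cases "k = 0")
  case True
  then show ?thesis using rm_env[OF spec_relator[OF r]] by simp
next
  case k: False
  have const: "rm (r $ k) = 0\<^sub>m (2*n) (2*n)" if "r = fps_const p" for p using that k by (simp add: rm_0)
  have gc: "gen a * gen b = fps_const (letter a * letter b)" "of_int m * gen a = fps_const (of_int m * letter a)" for a b m
    by (simp_all add: fps_const_mult fps_of_int[symmetric])
  from r consider
      (HH) i j where "i \<in> {1..n}" "j \<in> {1..n}" "r = gen (Hh i) * gen (Hh j) - gen (Hh j) * gen (Hh i)"
    | (HE) i j where "i \<in> {1..n}" "j \<in> {1..n}"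
        "r = gen (Hh i) * gen (Xp j) - gen (Xp j) * gen (Hh i) - of_int (cartan n i j) * gen (Xp j)"
    | (HF) i j where "i \<in> {1..n}" "j \<in> {1..n}"
        "r = gen (Hh i) * gen (Xm j) - gen (Xm j) * gen (Hh i) + of_int (cartan n i j) * gen (Xm j)"
    | (EF) i j where "i \<in> {1..n}" "j \<in> {1..n}"
        "r = gen (Xp i) * gen (Xm j) - gen (Xm j) * gen (Xp i) - (if i = j then Kquot n i else 0)"
    | (S) X i j where "X \<in> {Xp, Xm}" "i \<in> {1..n}" "j \<in> {1..n}" "i \<noteq> j" "r = serre n X i j"
    unfolding Uh_relators_def by blast
  then show ?thesis
  proof cases
    case HH
    then show ?thesis by (intro const) (simp only: gc fps_const_sub)
  next
    case HE
    then show ?thesis by (intro const) (simp only: gc fps_const_sub)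
  next
    case HF
    then show ?thesis by (intro const) (simp only: gc fps_const_sub fps_const_add)
  next
    case EF
    have "r $ k = (if i = j then 0 - Kquot n i $ k else 0)"
      unfolding EF(3) gc using k by simp
    moreover have "rm (0 - Kquot n i $ k) = 0\<^sub>m (2*n) (2*n)"
      unfolding rm_diff rm_0 rm_Kquot[OF EF(1)] using k by (simp add: eq_matI)
    ultimately show ?thesis by (cases "i = j") (simp_all add: rm_0 del: diff_0)
  next
    case S
    let ?x = "letter (X i)" and ?y = "letter (X j)"
    define e where "e = (\<lambda>i. mx n (X i))"
    have ec: "e m \<in> carrier_mat (2*n) (2*n)" for m using S(1) by (auto simp: e_def)
    have re: "rm (letter (X m)) = e m" for m unfolding e_def by (rule rm_letter[OF ec[unfolded e_def]])
    have sq: "e i * e i = 0\<^sub>m (2*n) (2*n)" using S by (auto simp: e_def chev_sq chev_f_sq)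
    have eee: "e i * e j * e i = 0\<^sub>m (2*n) (2*n)" if "cartan n i j = -1"
    proof -
      have "\<not> (i + 1 = n \<and> j = n)" using that S(4) by (auto simp: cartan_def split: if_splits)
      then show ?thesis using S by (auto simp: e_def intro!: chev_eee chev_fff)
    qed
    have z: "A * 0\<^sub>m (2*n) (2*n) = 0\<^sub>m (2*n) (2*n)" "0\<^sub>m (2*n) (2*n) * A = 0\<^sub>m (2*n) (2*n)"
      if "A \<in> carrier_mat (2*n) (2*n)" for A :: "complex mat" using that by auto
    have gg: "gen (X i) * gen (X j) * gen (X i) = fps_const (?x * ?y * ?x)"
      "gen (X i) * gen (X i) * gen (X j) * gen (X i) = fps_const (?x * ?x * ?y * ?x)"
      "gen (X i) * gen (X j) * gen (X i) * gen (X i) = fps_const (?x * ?y * ?x * ?x)"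
      by (simp_all add: fps_const_mult)
    have smult0: "c \<cdot>\<^sub>m 0\<^sub>m (2*n) (2*n) = (0\<^sub>m (2*n) (2*n) :: complex mat)" for c by (rule eq_matI) auto
    have m0: "0\<^sub>m (2*n) (2*n) - 0\<^sub>m (2*n) (2*n) = (0\<^sub>m (2*n) (2*n) :: complex mat)" by (rule eq_matI) auto
    consider "cartan n i j = 0" | "cartan n i j = -1" | "cartan n i j = -2"
      using cartan_cases[OF S(4)] by auto
    then show ?thesis
    proof cases
      case 1
      then show ?thesis
        by (intro const) (simp only: S(5) serre_eq1[OF 1] gc fps_const_sub)
    next
      case 2
      define t where "t = qpow (int (symd n i)) + qpow (- int (symd n i))"
      have "r = gen (X i) * gen (X i) * gen (X j) - scal t * fps_const (?x * ?y * ?x) + gen (X j) * gen (X i) * gen (X i)"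
        unfolding S(5) serre_eq2[OF 2 refl] gg t_def scal.add ..
      then have "r $ k = 0 - cst (t $ k) * (?x * ?y * ?x)" using k by (simp add: fps_const_mult)
      then show ?thesis
        using eee[OF 2] rm_uminus_0[of "cst (t $ k) * (?x * ?y * ?x)"] by (simp add: rm_cst rm_mult re smult0)
    next
      case 3
      define t where "t = qpow (2 * int (symd n i)) + 1 + qpow (- (2 * int (symd n i)))"
      have "r = gen (X i) * gen (X i) * gen (X i) * gen (X j) - scal t * fps_const (?x * ?x * ?y * ?x)
          + scal t * fps_const (?x * ?y * ?x * ?x) - gen (X j) * gen (X i) * gen (X i) * gen (X i)"
        unfolding S(5) serre_eq3[OF 3 refl] gg(2,3) t_def scal.add scal.one ..
      then have rk: "r $ k = cst (t $ k) * (?x * ?y * (?x * ?x)) - cst (t $ k) * (?x * ?x * ?y * ?x)"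
        using k by (simp add: fps_const_mult mult.assoc)
      have "rm (?x * ?y * (?x * ?x)) = 0\<^sub>m (2*n) (2*n)" "rm (?x * ?x * ?y * ?x) = 0\<^sub>m (2*n) (2*n)"
        unfolding rm_mult re sq z(1)[OF mult_carrier_mat[OF ec ec]] z(2)[OF ec] by (rule refl)+
      then show ?thesis unfolding rk rm_diff rm_cst by (simp add: smult0 m0)
    qed
  qed
qed

lemma rm_I:
  assumes "f \<in> Uh_ideal n"
  shows "rm (f $ k) = 0\<^sub>m (2*n) (2*n)"
proof -
  let ?S = "{f \<in> C. \<forall>k. rm (f $ k) = 0\<^sub>m (2*n) (2*n)}"
  have rs: "rm (sum F S) = 0\<^sub>m (2*n) (2*n)" if "\<And>m. m \<in> S \<Longrightarrow> rm (F m) = 0\<^sub>m (2*n) (2*n)" for F and S :: "nat set"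
    using that by (induction S rule: infinite_finite_induct) (auto simp: rm_0 rm_add)
  have "closed_ideal_set M ?S"
  proof (rule closed_ideal_set.intro)
    show "ideal_set C ?S"
    proof
      fix x y assume "x \<in> ?S" "y \<in> ?S"
      moreover have "0\<^sub>m (2*n) (2*n) - 0\<^sub>m (2*n) (2*n) = (0\<^sub>m (2*n) (2*n) :: complex mat)" by (rule eq_matI) auto
      ultimately show "x - y \<in> ?S" by (auto simp: C.C_diff rm_diff)
    next
      fix c x assume "c \<in> C" "x \<in> ?S"
      then show "c * x \<in> ?S" "x * c \<in> ?S"
        by (auto simp: C.C_mult fps_mult_nth intro!: rs)
           (auto simp: rm_mult right_mult_zero_mat[of _ "2*n"] left_mult_zero_mat[of _ "2*n"])
    qed (auto simp: C.C_closed rm_0)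
    show "closed ?S"
      unfolding closed_fps_iff
    proof (intro allI impI)
      fix f assume *: "\<forall>m. \<exists>g\<in>?S. \<forall>k<m. g $ k = f $ k"
      have "f \<in> C" by (rule closed_fpsD[OF closed_ser_set]) (use * in blast)
      moreover have "rm (f $ k) = 0\<^sub>m (2*n) (2*n)" for k
      proof -
        from * obtain g where "g \<in> ?S" "\<forall>j<Suc k. g $ j = f $ j" by blast
        then have "rm (g $ k) = 0\<^sub>m (2*n) (2*n)" and eq: "g $ k = f $ k" by blast+
        then show ?thesis unfolding eq by simp
      qed
      ultimately show "f \<in> ?S" by simp
    qed
  qed (rule submon_words_over)
  then have "Uh_ideal n \<subseteq> ?S"
    unfolding Uh_ideal_def by (rule closed_ideal_least) (use relators_C rm_relator in auto)
  with assms show ?thesis by blast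
qed

lemma adm_ent:
  assumes ij: "i < 2*n" "j < 2*n"
  shows "adm (\<lambda>w. fps_const (ent n i j (map (mx n) (letters w)))) (ent n i j)"
proof -
  have "pairh (\<lambda>w. fps_const (ent n i j (map (mx n) (letters w)))) f = 0" if "f \<in> Uh_ideal n" for f
  proof (rule fps_ext)
    fix k
    show "pairh (\<lambda>w. fps_const (ent n i j (map (mx n) (letters w)))) f $ k = 0 $ k"
      unfolding pairh_const using rm_I[OF that, of k] rm_entry[OF ij, of "f $ k"] ij by simp
  qed
  then show ?thesis by (simp add: adm_def lie_functional_ent[OF ij(1)])
qed

definition tfun :: "(qgen fword \<Rightarrow> complex fps) \<Rightarrow> (qgen fword \<Rightarrow> complex fps) \<Rightarrow> qgen fword \<times> qgen fword \<Rightarrow> complex fps"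
  where "tfun L L' = (\<lambda>(u,v). L u * L' v)"

lemma pairh_tfun: "pairh (tfun L L') (inl f * inr g) = pairh L f * pairh L' g"
proof -
  have 1: "pairh (tfun L L') (inl (fps_const (Poly_Mapping.single u c)) * inr g) =
      pairh L (fps_const (Poly_Mapping.single u c)) * pairh L' g" for u c
  proof (rule hlinear_eq[where M = UNIV and f = g])
    fix v d
    have "inl (fps_const (Poly_Mapping.single u c)) * inr (fps_const (Poly_Mapping.single v d)) =
      fps_const (Poly_Mapping.single (u, v) (c * d))"
      by (simp add: inl_single inr_single mult_single fps_const_mult)
    then show "pairh (tfun L L') (inl (fps_const (Poly_Mapping.single u c)) * inr (fps_const (Poly_Mapping.single v d))) =
      pairh L (fps_const (Poly_Mapping.single u c)) * pairh L' (fps_const (Poly_Mapping.single v d))"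
      by (simp add: pairh_single tfun_def fps_const_mult[symmetric])
  qed (auto simp: inr_simps distrib_left X_left pairh_add pairh_X ser_set_def)
  show ?thesis
    by (rule hlinear_eq[where M = UNIV and f = f])
       (auto simp: 1 inl_simps distrib_right mult.assoc pairh_add pairh_X ser_set_def)
qed

text \<open>The tested ideal consists of the elements killed together with all two-sided multiples.
  For a generator \<open>inl i\<close> or \<open>inr i\<close> flanked by words, the value is a
  product in which one factor is a functional applied to the ideal.\<close>

lemma pairh_tfun_I2:
  assumes L: "\<And>f. f \<in> Uh_ideal n \<Longrightarrow> pairh L f = 0" and L': "\<And>f. f \<in> Uh_ideal n \<Longrightarrow> pairh L' f = 0"
    and F: "F \<in> Uh2_ideal n"
  shows "pairh (tfun L L') F = 0"
proof -
  let ?T = "pairh (tfun L L')"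
  let ?J = "{F \<in> C2. \<forall>A\<in>C2. \<forall>B\<in>C2. ?T (A * F * B) = 0}"
  have single: "fps_const (Poly_Mapping.single (u, v) c) = inl (fps_const (Poly_Mapping.single u c)) * inr (fps_const (Poly_Mapping.single v 1))" for u v c
    by (simp add: inl_single inr_single mult_single fps_const_mult)
  have sC: "fps_const (Poly_Mapping.single u c) \<in> C" if "u \<in> M" for u c
    using that by (intro const_ser_set) (auto simp: falg_set_def)
  have ext: "F \<in> ?J" if FC: "F \<in> C2"
    and s: "\<And>u v u' v' c c'. u \<in> M \<Longrightarrow> v \<in> M \<Longrightarrow> u' \<in> M \<Longrightarrow> v' \<in> M \<Longrightarrow>
      ?T (fps_const (Poly_Mapping.single (u, v) c) * F * fps_const (Poly_Mapping.single (u', v') c')) = 0" for F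
  proof -
    have 1: "?T (fps_const (Poly_Mapping.single (u, v) c) * F * B) = 0" if "u \<in> M" "v \<in> M" "B \<in> C2" for u v c B
      by (rule hlinear_eq[where M = "M \<times> M" and f = B and T' = "\<lambda>_. 0"])
         (use that s in \<open>auto simp: distrib_left X_left pairh_add pairh_X\<close>)
    have "?T (A * F * B) = 0" if "A \<in> C2" "B \<in> C2" for A B
      by (rule hlinear_eq[where M = "M \<times> M" and f = A and T' = "\<lambda>_. 0"])
         (use that 1 in \<open>auto simp: distrib_right mult.assoc pairh_add pairh_X\<close>)
    with FC show ?thesis by simp
  qed
  have "closed_ideal_set (M \<times> M) ?J"
  proof (rule closed_ideal_set.intro)
    show "ideal_set C2 ?J"
    proof
      fix c x assume c: "c \<in> C2" and x: "x \<in> ?J"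
      have "A * (c * x) * B = (A * c) * x * B" "A * (x * c) * B = A * x * (c * B)" for A B by (simp_all add: mult.assoc)
      with c x show "c * x \<in> ?J" "x * c \<in> ?J" by (auto simp: C2.C_mult)
    qed (auto simp: C2.C_closed left_diff_distrib right_diff_distrib pairh_diff pairh_zero)
    have "closed {F \<in> C2. ?T (A * F * B) \<in> {0}}" for A B
      by (rule closed_fps_preimage[OF closed_ser_set closed_singleton])
         (intro pairh_cong_nth mult_cong_nth)
    then have "closed (\<Inter>A\<in>C2. \<Inter>B\<in>C2. {F \<in> C2. ?T (A * F * B) \<in> {0}})" by (intro closed_INT ballI)
    moreover have "(\<Inter>A\<in>C2. \<Inter>B\<in>C2. {F \<in> C2. ?T (A * F * B) \<in> {0}}) = ?J"
      using C2.C_one by auto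
    ultimately show "closed ?J" by simp
  qed (intro submon_Times submon_words_over)
  moreover have "inl ` Uh_ideal n \<union> inr ` Uh_ideal n \<subseteq> ?J"
  proof (intro Un_least image_subsetI)
    fix i assume i: "i \<in> Uh_ideal n"
    show "inl i \<in> ?J"
    proof (rule ext)
      fix u v u' v' :: "qgen fword" and c c' :: complex assume m: "u \<in> M" "v \<in> M" "u' \<in> M" "v' \<in> M"
      let ?u = "fps_const (Poly_Mapping.single u c)" and ?u' = "fps_const (Poly_Mapping.single u' c')"
      let ?v = "fps_const (Poly_Mapping.single v 1)" and ?v' = "fps_const (Poly_Mapping.single v' 1)"
      have "inl ?u * inr ?v * inl i * (inl ?u' * inr ?v') = inl (?u * i * ?u') * inr (?v * ?v')"
        by (simp add: inl_simps inr_simps mult.assoc inl_inr_commute2)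
      moreover have "?u * i * ?u' \<in> Uh_ideal n" by (intro U.J_l U.J_r sC m i)
      ultimately show "?T (fps_const (Poly_Mapping.single (u, v) c) * inl i * fps_const (Poly_Mapping.single (u', v') c')) = 0"
        unfolding single by (simp add: pairh_tfun L)
    qed (use i inl_C2 U.J_C in auto)
    show "inr i \<in> ?J"
    proof (rule ext)
      fix u v u' v' :: "qgen fword" and c c' :: complex assume m: "u \<in> M" "v \<in> M" "u' \<in> M" "v' \<in> M"
      let ?u = "fps_const (Poly_Mapping.single u c)" and ?u' = "fps_const (Poly_Mapping.single u' c')"
      let ?v = "fps_const (Poly_Mapping.single v 1)" and ?v' = "fps_const (Poly_Mapping.single v' 1)"
      have "inl ?u * inr ?v * inr i * (inl ?u' * inr ?v') = inl (?u * ?u') * inr (?v * i * ?v')"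
        by (simp add: inl_simps inr_simps mult.assoc inl_inr_commute2)
      moreover have "?v * i * ?v' \<in> Uh_ideal n" by (intro U.J_l U.J_r sC m i)
      ultimately show "?T (fps_const (Poly_Mapping.single (u, v) c) * inr i * fps_const (Poly_Mapping.single (u', v') c')) = 0"
        unfolding single by (simp add: pairh_tfun L')
    qed (use i inr_C2 U.J_C in auto)
  qed
  ultimately have "F \<in> ?J" using F closed_ideal_least[of "M \<times> M" ?J] unfolding Uh2_ideal_def by blast
  then have "?T (1 * F * 1) = 0" using C2.C_one by blast
  then show ?thesis by simp
qed

text \<open>The convolution for the actual coproduct; at \<open>h = 0\<close> it becomes
  \<open>conv\<close>, because all \<open>K_i\<close> specialize to 1.\<close>

definition convq :: "(qgen fword \<Rightarrow> complex fps) \<Rightarrow> (qgen fword \<Rightarrow> complex fps) \<Rightarrow> qgen fword \<Rightarrow> complex fps"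
  where "convq L L' w = pairh (tfun L L') (ser_lift (Delta_gen n) (fps_const (Poly_Mapping.single w 1)))"

lemma pairh_convq: "pairh (convq L L') f = pairh (tfun L L') (ser_lift (Delta_gen n) f)"
proof (rule pairh_hlinear_eq[where M = UNIV, symmetric])
  fix w :: "qgen fword" and c
  have "fps_const (Poly_Mapping.single w c) = scal (fps_const c) * fps_const (Poly_Mapping.single w 1)"
    by (simp add: scal_const fps_const_mult mult_single)
  then show "pairh (tfun L L') (ser_lift (Delta_gen n) (fps_const (Poly_Mapping.single w c))) = fps_const c * convq L L' w"
    by (simp only: ser_lift_mult ser_lift_scal pairh_scal convq_def)
qed (auto simp: ser_lift_add ser_lift_mult ser_lift_X pairh_add pairh_X ser_set_def)

lemma K_nth_0_inr: "inr (Kgen n i) $ 0 = 1" "inl (Kinv n i) $ 0 = 1"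
  unfolding inl_def inr_def
  by (simp_all add: ser_lift_ext ser_ext_nth0 K_nth_0 falg_lift_simps[OF central_hom_fps_cst])

lemma convq_nth_0: "convq L L' w $ 0 = conv (\<lambda>v. L (FWord v) $ 0) (\<lambda>v. L' (FWord v) $ 0) (letters w)"
proof -
  let ?D = "\<lambda>x. Poly_Mapping.single (FWord [x], 0) 1 + Poly_Mapping.single (0, FWord [x]) 1 :: qgen fword \<times> qgen fword \<Rightarrow>\<^sub>0 complex"
  have D: "Delta_gen n x $ 0 = ?D x" for x by (cases x) (simp_all add: inl_single inr_single K_nth_0_inr)
  have "ser_lift (Delta_gen n) (fps_const (Poly_Mapping.single w 1)) = prod_list (map (Delta_gen n) (letters w))"
    by (simp add: ser_lift_const falg_lift_simps[OF central_hom_fps_cst])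
  moreover have "prod_list (map (Delta_gen n) ws) $ 0 = prod_list (map ?D ws)" for ws
    by (induction ws) (simp_all add: D)
  ultimately have 0: "convq L L' w $ 0 = pair0 (\<lambda>w. tfun L L' w $ 0) (prod_list (map ?D (letters w)))"
    by (simp add: convq_def pairh_nth_0)
  have s: "pair0 l (Poly_Mapping.single w 1 * p) = pair0 (\<lambda>v. l (w + v)) p" for l w and p :: "qgen fword \<times> qgen fword \<Rightarrow>\<^sub>0 complex"
    by (induction p rule: pm_induct[OF subset_UNIV]) (simp_all add: pair0_simps distrib_left mult_single)
  have "pair0 (\<lambda>(u,v). l (letters u) * l' (letters v)) (prod_list (map ?D ws)) = conv l l' ws" for l l' ws
  proof (induction ws arbitrary: l l')
    case Nil
    have "pair0 F 1 = F 0" for F :: "qgen fword \<times> qgen fword \<Rightarrow> complex" by (metis mult_1 pair0_simps(2) single_one)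
    then show ?case by (simp add: zero_prod_def)
  next
    case (Cons x ws)
    have "pair0 (\<lambda>(u,v). l (letters u) * l' (letters v)) (prod_list (map ?D (x # ws))) =
      pair0 (\<lambda>(u,v). l (x # letters u) * l' (letters v)) (prod_list (map ?D ws)) +
      pair0 (\<lambda>(u,v). l (letters u) * l' (x # letters v)) (prod_list (map ?D ws))"
      by (simp add: distrib_right pair0_simps s case_prod_beta' plus_fword_def zero_fword_def)
    also have "\<dots> = conv l l' (x # ws)"
      using Cons.IH[of "\<lambda>w. l (x # w)" l'] Cons.IH[of l "\<lambda>w. l' (x # w)"] by simp
    finally show ?case .
  qed
  from this[of "\<lambda>v. L (FWord v) $ 0" "\<lambda>v. L' (FWord v) $ 0" "letters w"] show ?thesis
    unfolding 0 by (simp add: tfun_def case_prod_beta')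
qed

lemma adm_conv:
  assumes L: "adm L l" and L': "adm L' l'"
  shows "adm (convq L L') (conv l l')"
  unfolding adm_def
proof (intro conjI ballI allI)
  fix f assume "f \<in> Uh_ideal n"
  then show "pairh (convq L L') f = 0"
    unfolding pairh_convq using L L' by (intro pairh_tfun_I2 Delta_I) (auto simp: adm_def)
next
  fix w
  have "(\<lambda>v. L (FWord v) $ 0) = (\<lambda>v. l (map (mx n) v))" "(\<lambda>v. L' (FWord v) $ 0) = (\<lambda>v. l' (map (mx n) v))"
    using L L' by (auto simp: adm_def)
  then show "convq L L' w $ 0 = conv l l' (map (mx n) (letters w))"
    unfolding convq_nth_0 by (simp add: conv_map)
next
  show "lie_functional n (conv l l')" using L L' by (auto simp: adm_def lie_functional_conv)
qed

end

section \<open>Ordered monomials\<close>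

text \<open>The exponents of the Kronecker substitution \<open>t\<^sub>a \<mapsto> z\<close> to the power \<open>B ^ (N - a)\<close>.\<close>

definition kexp :: "nat \<Rightarrow> nat \<Rightarrow> nat list \<Rightarrow> nat"
  where "kexp B N xs = sum_list (map (\<lambda>a. B ^ (N - a)) xs)"

text \<open>Fewer than B summands, each at most \<open>B ^ (N - y)\<close>, stay below
  \<open>B ^ (N - y + 1)\<close>, which is at most \<open>B ^ (N - x)\<close>.\<close>

lemma kexp_less:
  assumes "sorted (y # ys)" "x < y" "y \<le> N" "length (y # ys) < B"
  shows "kexp B N (y # ys) < kexp B N (x # xs)"
proof -
  have "B \<ge> 1" using assms by simp
  then have *: "kexp B N zs \<le> length zs * B ^ (N - y)" if "\<forall>z\<in>set zs. y \<le> z" for zs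
    using that
  proof (induction zs)
    case (Cons z zs)
    then have "B ^ (N - z) \<le> B ^ (N - y)" by (intro power_increasing) auto
    with Cons show ?case unfolding kexp_def by (simp add: add_mono)
  qed (simp add: kexp_def)
  then have "kexp B N (y # ys) \<le> length (y # ys) * B ^ (N - y)" using assms(1) by (intro *) auto
  also have "\<dots> < B * B ^ (N - y)" using assms(4) \<open>B \<ge> 1\<close> by (intro mult_strict_right_mono) auto
  also have "\<dots> = B ^ Suc (N - y)" by simp
  also have "\<dots> \<le> B ^ (N - x)" using assms \<open>B \<ge> 1\<close> by (intro power_increasing) auto
  also have "\<dots> \<le> kexp B N (x # xs)" by (simp add: kexp_def)
  finally show ?thesis .
qed

lemma kexp_inj:
  "\<lbrakk>sorted xs; sorted ys; length xs = length ys; length xs < B; set xs \<subseteq> {..N}; set ys \<subseteq> {..N}; kexp B N xs = kexp B N ys\<rbrakk>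
    \<Longrightarrow> xs = ys"
proof (induction xs arbitrary: ys)
  case (Cons x xs)
  then obtain y ys' where ys: "ys = y # ys'" by (cases ys) auto
  have "\<not> x < y" using kexp_less[of y ys' x N B xs] Cons.prems unfolding ys by auto
  moreover have "\<not> y < x" using kexp_less[of x xs y N B ys'] Cons.prems unfolding ys by auto
  ultimately have "x = y" by simp
  moreover have "xs = ys'"
    using Cons.prems \<open>x = y\<close> unfolding ys by (intro Cons.IH) (auto simp: kexp_def)
  ultimately show ?case by (simp add: ys)
qed simp

text \<open>Substituting the powers \<open>z ^ ((D + 1) ^ (N - a))\<close> turns p into a polynomial
  in z in which different sorted words of length D have different exponents.\<close>

lemma sorted_words_independent:
  fixes p :: "nat falg"
  assumes keys: "\<And>w. w \<in> Poly_Mapping.keys p \<Longrightarrow> sorted (letters w) \<and> length (letters w) = D \<and> set (letters w) \<subseteq> {..N}"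
    and zero: "\<And>t :: nat \<Rightarrow> complex. (\<Sum>w\<in>Poly_Mapping.keys p. Poly_Mapping.lookup p w * prod_list (map t (letters w))) = 0"
  shows "p = 0"
proof -
  let ?e = "\<lambda>w. kexp (Suc D) N (letters w)"
  have inj: "inj_on ?e (Poly_Mapping.keys p)"
  proof (rule inj_onI)
    fix u v assume "u \<in> Poly_Mapping.keys p" "v \<in> Poly_Mapping.keys p" "?e u = ?e v"
    then have "letters u = letters v" using keys[of u] keys[of v] by (intro kexp_inj[of _ _ "Suc D" N]) auto
    then show "u = v" by (rule fword.expand)
  qed
  define P where "P = (\<Sum>w\<in>Poly_Mapping.keys p. monom (Poly_Mapping.lookup p w) (?e w))"
  have pw: "prod_list (map (\<lambda>a. z ^ (Suc D ^ (N - a))) xs) = z ^ kexp (Suc D) N xs" for z :: complex and xs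
    by (induction xs) (simp_all add: kexp_def power_add)
  have "poly P z = 0" for z
    using zero[of "\<lambda>a. z ^ (Suc D ^ (N - a))"] by (simp add: P_def poly_sum poly_monom pw del: power_Suc)
  then have "P = 0" using poly_all_0_iff_0 by blast
  have "Poly_Mapping.lookup p w = 0" if w: "w \<in> Poly_Mapping.keys p" for w
  proof -
    have "coeff P (?e w) = (\<Sum>v\<in>Poly_Mapping.keys p. if v = w then Poly_Mapping.lookup p v else 0)"
      unfolding P_def coeff_sum using inj w by (intro sum.cong) (auto simp: inj_on_def)
    then show ?thesis using \<open>P = 0\<close> w by simp
  qed
  then show ?thesis by (metis in_keys_iff poly_mapping_eqI lookup_zero)
qed

lemma pair0_zero: "(\<And>w. w \<in> Poly_Mapping.keys p \<Longrightarrow> l w = 0) \<Longrightarrow> pair0 l p = 0"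
  by (simp add: pair0_def pm_lin_def)

lemma (in central_hom) bracket_eigen_mult:
  assumes "D * a - a * D = s p * a" "D * b - b * D = s q * b"
  shows "D * (a * b) - (a * b) * D = s (p + q) * (a * b)"
proof -
  have "D * (a * b) - (a * b) * D = (D * a - a * D) * b + a * (D * b - b * D)" by (simp add: algebra_simps)
  also have "\<dots> = s p * (a * b) + s q * (a * b)" unfolding assms by (simp add: left mult.assoc)
  finally show ?thesis by (simp add: add distrib_right)
qed

context Bh
begin

interpretation sc1: central_hom "sc :: complex fps \<Rightarrow> qgen fword qser" by (rule central_hom_sc)

abbreviation Wd :: "nat fword set" where "Wd \<equiv> words_over {..<2*n}"
abbreviation Ser where "Ser \<equiv> ser_set Wd"

sublocale Ser: subring_set Ser by (rule subring_ser_set[OF submon_words_over])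
sublocale FW: subring_set "falg_set Wd" by (rule subring_falg_set[OF submon_words_over])

text \<open>Letter 0 stands for D and letter i for \<open>v_i\<close>, so sorted words are the
  ordered monomials with D in front. The classical limits are collected in
  \<open>xm\<close>.\<close>

definition yq :: "nat \<Rightarrow> qgen fword ser" where "yq a = (if a = 0 then K_log n else vq a)"
definition xm :: "nat \<Rightarrow> complex mat" where "xm a = (if a = 0 then DD n else vcl n a)"

abbreviation th where "th \<equiv> ser_lift yq"
abbreviation thc where "thc p \<equiv> th (fps_const p)"

lemma yq_C: "a < 2*n \<Longrightarrow> yq a \<in> C"
  using vq_C[of a] K_log_C by (auto simp: yq_def)

lemma th_C: "g \<in> Ser \<Longrightarrow> th g \<in> C"
  by (rule ser_lift_closed[OF submon_words_over]) (auto intro: yq_C)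

lemma thc_simps: "thc (p + q) = thc p + thc q" "thc (p - q) = thc p - thc q" "thc (p * q) = thc p * thc q"
  "thc (cst c * p) = scal (fps_const c) * thc p" "thc (letter a) = yq a" "thc 0 = 0"
  by (simp_all add: fps_const_add[symmetric] fps_const_sub[symmetric] fps_const_mult[symmetric] ser_lift_add
      ser_lift_diff ser_lift_mult scal_const[symmetric] ser_lift_scal)

lemma SerC: "scal c \<in> Ser" "fps_X \<in> Ser" "p \<in> falg_set Wd \<Longrightarrow> fps_const p \<in> Ser"
  by (auto intro: scal_ser_set X_ser_set const_ser_set submon_words_over)

lemma X_C: "fps_X \<in> C"
  by (rule X_ser_set[OF submon_words_over])

lemma em_times: "f \<in> C \<Longrightarrow> g \<in> C \<Longrightarrow> em (f * g) = em f * em g"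
  by (simp add: em_def qemb_mult[OF U.ideal_set_axioms range_scal(1)])

lemma em_scal: "f \<in> C \<Longrightarrow> em (scal c * f) = sc c * em f"
  by (simp add: em_simps)

text \<open>Carries the quotients by h that occur in commutators back to series in the
  generators.\<close>

lemma W_th: "N.W c z \<Longrightarrow> \<exists>g\<in>Ser. z = em (th g)"
proof (induction rule: N.W.induct)
  case (W_v i)
  have "fps_const (letter i) \<in> Ser" if "i < 2*n" for i using that by (intro gen_ser_set) auto
  then show ?case using W_v em_vq[of i] by (intro bexI[of _ "fps_const (letter i)"]) (auto simp: yq_def)
next
  case (W_zero c)
  show ?case using Ser.C_zero by (intro bexI[of _ 0]) (auto simp: em_simps ser_lift_0)
next
  case (W_add c x y)
  then obtain g h where "g \<in> Ser" "h \<in> Ser" "x = em (th g)" "y = em (th h)" by blast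
  then show ?case by (intro bexI[of _ "g + h"]) (auto simp: Ser.C_add ser_lift_add em_simps th_C)
next
  case (W_mult a x b y)
  then obtain g h where "g \<in> Ser" "h \<in> Ser" "x = em (th g)" "y = em (th h)" by blast
  then show ?case by (intro bexI[of _ "g * h"]) (auto simp: Ser.C_mult ser_lift_mult em_times th_C)
next
  case (W_scale c x t)
  then obtain g where "g \<in> Ser" "x = em (th g)" by blast
  then show ?case
    by (intro bexI[of _ "scal t * g"]) (auto simp: Ser.C_mult SerC ser_lift_mult ser_lift_scal em_scal th_C)
qed

lemma K_log_E:
  assumes j: "j \<in> {1..n}"
  shows "\<exists>c. em (K_log n) * em (gen (Xp j)) - em (gen (Xp j)) * em (K_log n) = sc (fps_const c) * em (gen (Xp j))"
proof -
  let ?E = "gen (Xp j)"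
  let ?c = "\<Sum>i=1..n. int (symd n i) * cartan n i j"
  have "(\<Sum>i=1..n. of_nat (symd n i) * (gen (Hh i) * ?E - ?E * gen (Hh i) - of_int (cartan n i j) * ?E)) \<in> Uh_ideal n"
    using j by (intro U.J_sum U.J_l C.C_of_nat HX_rel(2)) auto
  moreover have "(\<Sum>i=1..n. of_nat (symd n i) * (gen (Hh i) * ?E - ?E * gen (Hh i) - of_int (cartan n i j) * ?E)) =
      K_log n * ?E - ?E * K_log n - of_int ?c * ?E"
  proof -
    have c: "?E * (of_nat d * H) = of_nat d * (?E * H)" for d :: nat and H by (metis mult.assoc mult_of_nat_commute)
    have "of_nat d * (H * ?E - ?E * H - of_int a * ?E) = of_nat d * H * ?E - ?E * (of_nat d * H) - of_int (int d * a) * ?E"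
      for d :: nat and H a unfolding c by (simp add: right_diff_distrib mult.assoc)
    then show ?thesis by (simp only: K_log_def sum_distrib_left sum_distrib_right sum_subtractf of_int_sum)
  qed
  ultimately have 1: "K_log n * ?E - ?E * K_log n - of_int ?c * ?E \<in> Uh_ideal n" by simp
  have mem: "?E \<in> C" "K_log n \<in> C" using gen_C(1)[OF j] K_log_C by auto
  then have "em (K_log n * ?E - ?E * K_log n - of_int ?c * ?E) = 0"
    using 1 by (simp add: em_0 C.C_closed)
  then have "em (K_log n) * em ?E - em ?E * em (K_log n) - sc (of_int ?c) * em ?E = 0"
    using mem by (simp add: em_simps em_of_int C.C_closed del: of_int_sum)
  then show ?thesis by (intro exI[of _ "of_int ?c"]) (simp add: fps_of_int del: of_int_sum)
qed

lemma K_log_vq: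
  "1 \<le> i \<Longrightarrow> i \<le> 2*n - 1 \<Longrightarrow>
    \<exists>c. em (K_log n) * em (vq i) - em (vq i) * em (K_log n) = sc (fps_const c) * em (vq i)"
proof (induction i rule: nat_induct_at_least)
  case base
  show ?case unfolding vq_1 using K_log_E[of 1] n1 by simp
next
  case (Suc i)
  then have i: "1 \<le> i" "i \<le> 2*n - 2" by auto
  let ?D = "em (K_log n)" and ?v = "em (vq i)" and ?E = "em (gen (Xp (st n i)))"
  have mem: "vq i \<in> C" "gen (Xp (st n i)) \<in> C" using vq_C[of i] gen_C(1)[OF st_mem[OF i]] i by auto
  obtain c where c: "?D * ?v - ?v * ?D = sc (fps_const c) * ?v" proof -
    have "i \<le> 2*n - 1" using i by simp
    then show ?thesis using Suc.IH that by blast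
  qed
  obtain d where d: "?D * ?E - ?E * ?D = sc (fps_const d) * ?E" using K_log_E[OF st_mem[OF i]] by blast
  let ?t = "sc (qpow (ex n i)) :: qgen fword qser" and ?s = "sc (fps_const (c + d)) :: qgen fword qser"
  have 1: "?D * (?v * ?E) - ?v * ?E * ?D = ?s * (?v * ?E)"
    using sc1.bracket_eigen_mult[OF c d] by (simp add: fps_const_add)
  have 2: "?D * (?E * ?v) - ?E * ?v * ?D = ?s * (?E * ?v)"
    using sc1.bracket_eigen_mult[OF d c] by (simp add: fps_const_add add.commute)
  have v: "em (vq (Suc i)) = ?v * ?E - ?t * (?E * ?v)"
    unfolding vq_Suc[OF i] using mem by (simp add: em_simps C.C_closed scal_C)
  have "?D * (?v * ?E - ?t * (?E * ?v)) - (?v * ?E - ?t * (?E * ?v)) * ?D =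
      (?D * (?v * ?E) - ?v * ?E * ?D) - ?t * (?D * (?E * ?v) - ?E * ?v * ?D)"
    by (simp only: right_diff_distrib left_diff_distrib sc1.left[of ?D] mult.assoc) simp
  also have "\<dots> = ?s * (?v * ?E - ?t * (?E * ?v))"
    unfolding 1 2 by (simp only: right_diff_distrib sc1.left[of ?t "fps_const (c + d)"])
  finally show ?case unfolding v by blast
qed

text \<open>The filtration by word length; the strict bound makes \<open>Lw 0\<close> zero, the
  start of the induction for saturation.\<close>

definition Lw :: "nat \<Rightarrow> nat falg set"
  where "Lw d = falg_set {w \<in> Wd. length (letters w) < d}"

lemma Lw_FW: "p \<in> Lw d \<Longrightarrow> p \<in> falg_set Wd"
  by (auto simp: Lw_def falg_set_def)

lemma Lw_add: "p \<in> Lw d \<Longrightarrow> q \<in> Lw d \<Longrightarrow> p + q \<in> Lw d"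
  unfolding Lw_def falg_set_def using keys_add[of p q] by blast

lemma Lw_single: "w \<in> Wd \<Longrightarrow> length (letters w) < d \<Longrightarrow> Poly_Mapping.single w c \<in> Lw d"
  by (simp add: Lw_def falg_set_def)

lemma Lw_zero: "0 \<in> Lw d"
  by (simp add: Lw_def falg_set_def)

lemma Lw_mult:
  assumes "p \<in> Lw (Suc d)" "q \<in> Lw e"
  shows "p * q \<in> Lw (d + e)"
proof -
  have "p * q \<in> falg_set {w \<in> Wd. length (letters w) < d + e}"
    unfolding falg_set_def
  proof (rule CollectI, rule subsetI)
    fix w assume "w \<in> Poly_Mapping.keys (p * q)"
    then obtain u v where "w = u + v" "u \<in> Poly_Mapping.keys p" "v \<in> Poly_Mapping.keys q"
      using keys_mult[of p q] by blast
    then show "w \<in> {w \<in> Wd. length (letters w) < d + e}"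
      using assms by (fastforce simp: Lw_def falg_set_def words_over_def plus_fword_def)
  qed
  then show ?thesis by (simp add: Lw_def)
qed

lemma yq_commute:
  assumes ab: "a < 2*n" "b < 2*n"
  shows "\<exists>p\<in>Lw 2. \<exists>g\<in>Ser. yq a * yq b - yq b * yq a - thc p - fps_X * th g \<in> Uh_ideal n"
proof -
  \<comment> \<open>In every case the commutator is a scalar multiple of a single generator plus h
    times an element of the algebra.\<close>
  have fin: "\<exists>p\<in>Lw 2. \<exists>g\<in>Ser. yq a * yq b - yq b * yq a - thc p - fps_X * th g \<in> Uh_ideal n"
    if ab: "a < 2*n" "b < 2*n" "d < 2*n" and g: "g \<in> Ser"
      and e: "em (yq a) * em (yq b) - em (yq b) * em (yq a) = sc (fps_const c) * em (yq d) + sc fps_X * em (th g)"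
    for a b d c g
  proof -
    have mem: "yq a \<in> C" "yq b \<in> C" "yq d \<in> C" "th g \<in> C" using ab g by (auto simp: yq_C th_C)
    have "em (yq a * yq b - yq b * yq a - scal (fps_const c) * yq d - scal fps_X * th g) = 0"
      using mem e by (simp add: em_simps C.C_closed scal_C)
    then have "yq a * yq b - yq b * yq a - scal (fps_const c) * yq d - scal fps_X * th g \<in> Uh_ideal n"
      by (subst (asm) em_0) (use mem in \<open>auto simp: C.C_closed scal_C\<close>)
    moreover have "cst c * letter d \<in> Lw 2"
      using ab by (auto simp: mult_single words_over_def intro!: Lw_single)
    ultimately show ?thesis
      using g by (intro bexI[of _ "cst c * letter d"] bexI[of _ g]) (simp_all only: thc_simps(4,5) scal_X)
  qed
  consider "a = 0" "b = 0" | "a = 0" "b \<noteq> 0" | "a \<noteq> 0" "b = 0" | "a \<noteq> 0" "b \<noteq> 0" by blast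
  then show ?thesis
  proof cases
    case 1
    then show ?thesis
      using fin[OF ab ab(1) Ser.C_zero, of 0] by (simp add: sc1.zero em_simps ser_lift_0)
  next
    case 2
    have "1 \<le> b" "b \<le> 2*n - 1" using 2 ab by auto
    from K_log_vq[OF this] 2 obtain c where "em (yq a) * em (yq b) - em (yq b) * em (yq a) = sc (fps_const c) * em (yq b)"
      by (auto simp: yq_def)
    then show ?thesis
      by (intro fin[OF ab ab(2) Ser.C_zero]) (simp add: em_simps ser_lift_0)
  next
    case 3
    have "1 \<le> a" "a \<le> 2*n - 1" using 3 ab by auto
    from K_log_vq[OF this] 3 obtain c where "em (yq b) * em (yq a) - em (yq a) * em (yq b) = sc (fps_const c) * em (yq a)"
      by (auto simp: yq_def)
    then have "em (yq a) * em (yq b) - em (yq b) * em (yq a) = - (sc (fps_const c) * em (yq a))" by (metis minus_diff_eq)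
    also have "\<dots> = sc (fps_const (- c)) * em (yq a)" by (simp add: sc1.uminus fps_const_neg[symmetric])
    finally show ?thesis
      by (intro fin[OF ab ab(1) Ser.C_zero]) (simp add: em_simps ser_lift_0)
  next
    case 4
    then have ij: "1 \<le> a" "a \<le> 2*n - 1" "1 \<le> b" "b \<le> 2*n - 1" using ab by auto
    obtain c0 c y where y: "N.W c y" "N.br (N.v a) (N.v b) = sc (fps_const c0) * N.v (2*n - 1) + sc fps_X * y"
      using N.v_commute[OF ij] by blast
    obtain g where g: "g \<in> Ser" "y = em (th g)" using W_th[OF y(1)] by blast
    have "em (yq a) = N.v a" "em (yq b) = N.v b" "em (yq (2*n - 1)) = N.v (2*n - 1)"
      using 4 ij n1 em_vq by (auto simp: yq_def)
    then show ?thesis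
      using y(2) g by (intro fin[OF ab _ g(1), of "2*n - 1" c0]) (use n1 in \<open>auto simp: N.br_def\<close>)
  qed
qed

text \<open>
  Modulo \<open>XS\<close> the letters of a word commute up to shorter words; \<open>Ed d\<close> collects what is congruent to a
  combination of words of length less than \<open>d\<close>.
\<close>

definition XS :: "qgen fword ser set"
  where "XS = {f \<in> C. \<exists>g\<in>Ser. f - fps_X * th g \<in> Uh_ideal n}"

lemma XS_I: "f \<in> Uh_ideal n \<Longrightarrow> f \<in> XS"
  using Ser.C_zero by (auto simp: XS_def U.J_C ser_lift_0 intro!: bexI[of _ 0])

lemma XS_X: "g \<in> Ser \<Longrightarrow> fps_X * th g \<in> XS"
  by (auto simp: XS_def U.J_zero C.C_mult X_C th_C intro!: bexI[of _ g])

lemma XS_diff: "f \<in> XS \<Longrightarrow> f' \<in> XS \<Longrightarrow> f - f' \<in> XS"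
proof -
  assume "f \<in> XS" "f' \<in> XS"
  then obtain g g' where g: "f \<in> C" "f' \<in> C" "g \<in> Ser" "g' \<in> Ser" "f - fps_X * th g \<in> Uh_ideal n" "f' - fps_X * th g' \<in> Uh_ideal n"
    by (auto simp: XS_def)
  have "f - f' - fps_X * th (g - g') = (f - fps_X * th g) - (f' - fps_X * th g')"
    by (simp add: ser_lift_diff algebra_simps)
  then have "f - f' - fps_X * th (g - g') \<in> Uh_ideal n" using U.J_diff[OF g(5,6)] by (simp only:)
  then show ?thesis using g by (auto simp: XS_def C.C_diff Ser.C_diff intro!: bexI[of _ "g - g'"])
qed

lemma XS_zero: "0 \<in> XS"
  by (rule XS_I[OF U.J_zero])

lemma XS_add: "f \<in> XS \<Longrightarrow> f' \<in> XS \<Longrightarrow> f + f' \<in> XS"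
  using XS_diff[of f "0 - f'"] XS_diff[OF XS_zero, of f'] by simp

lemma XS_mult:
  assumes "f \<in> XS" "u \<in> Ser"
  shows "th u * f \<in> XS" "f * th u \<in> XS"
proof -
  obtain g where g: "f \<in> C" "g \<in> Ser" "f - fps_X * th g \<in> Uh_ideal n" using assms(1) by (auto simp: XS_def)
  have "th u * (f - fps_X * th g) = th u * f - fps_X * th (u * g)" "(f - fps_X * th g) * th u = f * th u - fps_X * th (g * u)"
    by (simp_all add: right_diff_distrib left_diff_distrib X_left ser_lift_mult mult.assoc)
  then have "th u * f - fps_X * th (u * g) \<in> Uh_ideal n" "f * th u - fps_X * th (g * u) \<in> Uh_ideal n"
    using U.J_l[OF th_C[OF assms(2)] g(3)] U.J_r[OF th_C[OF assms(2)] g(3)] by simp_all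
  then show "th u * f \<in> XS" "f * th u \<in> XS"
    using g assms(2) by (auto simp: XS_def C.C_mult th_C Ser.C_mult intro!: bexI)
qed

lemma XS_scal: "f \<in> XS \<Longrightarrow> scal c * f \<in> XS"
  using XS_mult(1)[of f "scal c"] SerC(1) by (simp add: ser_lift_scal)

definition Ed :: "nat \<Rightarrow> nat falg set"
  where "Ed d = {p \<in> falg_set Wd. \<exists>r\<in>Lw d. thc (p - r) \<in> XS}"

lemma Ed_Lw: "p \<in> Lw d \<Longrightarrow> p \<in> Ed d"
  by (auto simp: Ed_def Lw_FW thc_simps XS_zero intro!: bexI[of _ p])

lemma Ed_add: "p \<in> Ed d \<Longrightarrow> q \<in> Ed d \<Longrightarrow> p + q \<in> Ed d"
proof -
  assume "p \<in> Ed d" "q \<in> Ed d"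
  then obtain r s where r: "p \<in> falg_set Wd" "q \<in> falg_set Wd" "r \<in> Lw d" "s \<in> Lw d" "thc (p - r) \<in> XS" "thc (q - s) \<in> XS"
    by (auto simp: Ed_def)
  have "p + q - (r + s) = (p - r) + (q - s)" by simp
  then have "thc (p + q - (r + s)) \<in> XS" using XS_add[OF r(5,6)] by (simp only: thc_simps(1))
  then show ?thesis using r by (auto simp: Ed_def FW.C_add Lw_add intro!: bexI[of _ "r + s"])
qed

lemma Ed_sum: "(\<And>x. x \<in> S \<Longrightarrow> f x \<in> Ed d) \<Longrightarrow> sum f S \<in> Ed d"
  by (induction S rule: infinite_finite_induct) (auto simp: Ed_add Ed_Lw Lw_zero)

lemma Ed_cst: "p \<in> Ed d \<Longrightarrow> cst c * p \<in> Ed d"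
proof -
  assume "p \<in> Ed d"
  then obtain r where r: "p \<in> falg_set Wd" "r \<in> Lw d" "thc (p - r) \<in> XS" by (auto simp: Ed_def)
  have "cst c \<in> Lw (Suc 0)" by (rule Lw_single) (auto simp: words_over_def zero_fword_def)
  then have "cst c * r \<in> Lw d" using Lw_mult[of "cst c" 0 r d] r by simp
  moreover have "thc (cst c * p - cst c * r) \<in> XS"
    using XS_scal[OF r(3), of "fps_const c"] by (simp only: right_diff_distrib[symmetric] thc_simps(4))
  ultimately show ?thesis using r FW.C_mult[OF cst_falg_set[OF submon_words_over] r(1)] by (auto simp: Ed_def)
qed

lemma Ed_letter: "p \<in> Ed d \<Longrightarrow> a < 2*n \<Longrightarrow> letter a * p \<in> Ed (Suc d)"
proof -
  assume "p \<in> Ed d" and a: "a < 2*n"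
  then obtain r where r: "p \<in> falg_set Wd" "r \<in> Lw d" "thc (p - r) \<in> XS" by (auto simp: Ed_def)
  have l: "letter a \<in> falg_set Wd" using a by (intro letter_falg_set) auto
  have "letter a \<in> Lw (Suc (Suc 0))" using a by (intro Lw_single) (auto simp: words_over_def)
  then have "letter a * r \<in> Lw (Suc d)" using Lw_mult[of "letter a" "Suc 0" r d] r by simp
  moreover have "thc (letter a * p - letter a * r) \<in> XS"
    using XS_mult(1)[OF r(3) SerC(3)[OF l]] by (simp only: right_diff_distrib[symmetric] thc_simps(3))
  ultimately show ?thesis using r FW.C_mult[OF l r(1)] by (auto simp: Ed_def)
qed

section \<open>Sorting of words modulo shorter words and h\<close>

abbreviation word :: "nat list \<Rightarrow> nat falg" where "word ws \<equiv> Poly_Mapping.single (FWord ws) 1"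

lemma word_FW: "set ws \<subseteq> {..<2*n} \<Longrightarrow> word ws \<in> falg_set Wd"
  by (simp add: falg_set_def words_over_def)

lemma word_Cons: "word (a # ws) = letter a * word ws"
  by (simp add: mult_single plus_fword_def)

lemma Ed_swap:
  assumes "a < 2*n" "b < 2*n" "set ws \<subseteq> {..<2*n}"
  shows "word (a # b # ws) - word (b # a # ws) \<in> Ed (Suc (Suc (length ws)))"
proof -
  obtain p g where p: "p \<in> Lw 2" "g \<in> Ser" "yq a * yq b - yq b * yq a - thc p - fps_X * th g \<in> Uh_ideal n"
    using yq_commute[OF assms(1,2)] by blast
  let ?w = "word ws"
  have w: "?w \<in> falg_set Wd" by (rule word_FW[OF assms(3)])
  have "(yq a * yq b - yq b * yq a - thc p - fps_X * th g) + fps_X * th g \<in> XS"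
    by (rule XS_add[OF XS_I[OF p(3)] XS_X[OF p(2)]])
  then have 1: "(yq a * yq b - yq b * yq a - thc p) * thc ?w \<in> XS"
    using XS_mult(2)[OF _ SerC(3)[OF w]] by simp
  have "p * ?w \<in> Lw (Suc 0 + Suc (length ws))"
    by (rule Lw_mult) (use p assms in \<open>auto simp: numeral_2_eq_2 words_over_def intro!: Lw_single\<close>)
  then have "p * ?w \<in> Lw (Suc (Suc (length ws)))" by simp
  moreover have "word (a # b # ws) - word (b # a # ws) - p * ?w = (letter a * letter b - letter b * letter a - p) * ?w"
    by (simp only: word_Cons[of a "b # ws"] word_Cons[of b "a # ws"] word_Cons[of a ws] word_Cons[of b ws]
        left_diff_distrib mult.assoc)
  then have "thc (word (a # b # ws) - word (b # a # ws) - p * ?w) \<in> XS"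
    using 1 by (simp only: thc_simps)
  ultimately show ?thesis
    using assms by (auto simp: Ed_def intro!: FW.C_diff word_FW)
qed

lemma Ed_insort:
  "\<lbrakk>a < 2*n; set ws \<subseteq> {..<2*n}\<rbrakk> \<Longrightarrow> word (a # ws) - word (insort a ws) \<in> Ed (Suc (length ws))"
proof (induction ws)
  case Nil
  show ?case by (simp add: Ed_Lw Lw_zero)
next
  case (Cons b ws)
  show ?case
  proof (cases "a \<le> b")
    case True
    then show ?thesis by (simp add: Ed_Lw Lw_zero)
  next
    case False
    have "letter b * (word (a # ws) - word (insort a ws)) \<in> Ed (Suc (Suc (length ws)))"
      using Cons by (intro Ed_letter) auto
    then have 1: "word (b # a # ws) - word (b # insort a ws) \<in> Ed (Suc (Suc (length ws)))"
      by (simp add: word_Cons[of b "a # ws"] word_Cons[of b "insort a ws"] right_diff_distrib)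
    have 2: "word (a # b # ws) - word (b # a # ws) \<in> Ed (Suc (Suc (length ws)))"
      using Cons.prems by (intro Ed_swap) auto
    show ?thesis using Ed_add[OF 2 1] False by simp
  qed
qed

text \<open>Insertion sort: each exchange of neighbours costs a commutator, which by
  \<open>yq_commute\<close> consists of shorter words and a multiple of h.\<close>

lemma Ed_sort: "set ws \<subseteq> {..<2*n} \<Longrightarrow> word ws - word (sort ws) \<in> Ed (length ws)"
proof (induction ws)
  case (Cons a ws)
  have "letter a * (word ws - word (sort ws)) \<in> Ed (Suc (length ws))"
    using Cons by (intro Ed_letter) auto
  then have 1: "word (a # ws) - word (a # sort ws) \<in> Ed (Suc (length ws))"
    by (simp only: word_Cons[of a ws] word_Cons[of a "sort ws"] right_diff_distrib)
  have 2: "word (a # sort ws) - word (insort a (sort ws)) \<in> Ed (Suc (length ws))"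
    using Ed_insort[of a "sort ws"] Cons.prems by simp
  show ?case using Ed_add[OF 1 2] by simp
qed (simp add: Ed_Lw Lw_zero)

end

section \<open>Saturation\<close>

context Bh
begin

lemma vq_spec: "1 \<le> i \<Longrightarrow> i \<le> 2*n - 1 \<Longrightarrow> spl (vq i $ 0) - letter (vcl n i) \<in> env_ideal n"
proof (induction i rule: nat_induct_at_least)
  case base
  show ?case unfolding vq_1 vcl_1[OF n1] by (simp add: falg_lift_rules E.J_zero)
next
  case (Suc i)
  then have i: "1 \<le> i" "i \<le> 2*n - 2" "i \<le> 2*n - 1" by auto
  let ?e = "chev_e n (st n i)" and ?v = "vcl n i" and ?p = "spl (vq i $ 0)"
  have e: "?e \<in> sp n" by (rule chev_e_sp[OF st_mem[OF i(1,2)]])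
  have v: "?v \<in> sp n" using vcl_row[OF n1 i(1,3)] nh_sp by blast
  have p: "?p \<in> EA" using vq_C[OF i(1,3)] by (intro spl_EA) (auto simp: ser_set_iff)
  have "qpow (ex n i) $ 0 = 1" by (simp add: qpow_def)
  then have eq: "spl (vq (Suc i) $ 0) = ?p * letter ?e - letter ?e * ?p"
    unfolding vq_Suc[OF i(1,2)] by (simp add: falg_lift_rules)
  have "letter (lie ?v ?e) - cst (-1) * letter (lie ?e ?v) \<in> env_ideal n"
    using env_smult[OF sp_lie[OF e v], of "-1"] lie_antisym[OF sp_carrier[OF v] sp_carrier[OF e]] by simp
  from E.J_add[OF ad_env[OF e v Suc.IH[OF i(3)] p] this]
  have "letter ?e * ?p - ?p * letter ?e + letter (lie ?v ?e) \<in> env_ideal n"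
    by (simp add: mult_single single_uminus)
  from E.J_uminus[OF this] show ?case
    unfolding eq vcl_Suc[OF i(1,2)] by (simp add: algebra_simps)
qed

lemma K_log_spec: "spl (K_log n $ 0) - letter (DD n) \<in> env_ideal n"
proof -
  let ?D = "\<lambda>k. mat (2*n) (2*n) (\<lambda>ij. \<Sum>i=1..k. chev_h n i $$ ij)"
  have "?D k \<in> sp n \<and> (\<Sum>i=1..k. cst (of_nat (symd n i)) * letter (coroot n i)) - letter (?D k) \<in> env_ideal n" if "k \<le> n" for k
    using that
  proof (induction k)
    case 0
    have "?D 0 = 0\<^sub>m (2*n) (2*n)" by (rule eq_matI) auto
    then show ?case using env_zero E.J_uminus by (simp add: sp_zero)
  next
    case (Suc k)
    let ?d = "of_nat (symd n (Suc k)) :: complex" and ?H = "coroot n (Suc k)"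
    let ?S = "\<Sum>i=1..k. cst (of_nat (symd n i)) * letter (coroot n i)"
    have H: "?H \<in> sp n" using Suc.prems by (intro coroot_sp) auto
    have IH: "?D k \<in> sp n" "?S - letter (?D k) \<in> env_ideal n" using Suc by auto
    have D: "?D (Suc k) = ?d \<cdot>\<^sub>m ?H + ?D k"
      by (rule eq_matI) (use carrier_matD[OF coroot_carrier[of n "Suc k"]] in \<open>auto simp: chev_h_def\<close>)
    have "(?S - letter (?D k)) - ((letter (?d \<cdot>\<^sub>m ?H + ?D k) - letter (?d \<cdot>\<^sub>m ?H) - letter (?D k)) +
        (letter (?d \<cdot>\<^sub>m ?H) - cst ?d * letter ?H)) \<in> env_ideal n"
      by (intro E.J_diff E.J_add IH(2) env_add env_smult sp_smult H IH(1))
    then have "?S + cst ?d * letter ?H - letter (?d \<cdot>\<^sub>m ?H + ?D k) \<in> env_ideal n" by (simp add: algebra_simps)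
    then show ?case unfolding D using IH(1) H by (simp add: sp_add sp_smult del: single_of_nat)
  qed
  from this[of n] have "(\<Sum>i=1..n. cst (of_nat (symd n i)) * letter (coroot n i)) - letter (DD n) \<in> env_ideal n"
    by (simp add: DD_def)
  moreover have "spl (K_log n $ 0) = (\<Sum>i=1..n. cst (of_nat (symd n i)) * letter (coroot n i))"
  proof -
    have sum: "spl (sum F S) = (\<Sum>x\<in>S. spl (F x))" for F and S :: "nat set"
      by (induction S rule: infinite_finite_induct) (simp_all add: falg_lift_rules)
    have "(of_nat d * gen x) $ 0 = cst (of_nat d) * letter x" for d :: nat and x :: qgen
      by (simp add: fps_of_nat[symmetric])
    then show ?thesis by (simp add: K_log_def fps_sum_nth sum falg_lift_rules del: single_of_nat)
  qed
  ultimately show ?thesis by simp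
qed

lemma yq_spec: "a < 2*n \<Longrightarrow> spl (yq a $ 0) - letter (xm a) \<in> env_ideal n"
  using vq_spec[of a] K_log_spec by (auto simp: yq_def xm_def)

lemma xm_sp: "a < 2*n \<Longrightarrow> xm a \<in> sp n"
  using h_gens_sp[OF n1] by (auto simp: xm_def h_gens_def)

lemma thc_single: "thc (Poly_Mapping.single w c) = fps_const (cst c) * prod_list (map yq (letters w))"
  by (simp add: ser_lift_const falg_lift_simps[OF central_hom_fps_cst])

text \<open>Replacing the specialization of a generator by the letter of its classical limit changes
  it only within the enveloping ideal, which the limit functional does not see.\<close>

lemma adm_thc:
  assumes L: "adm L \<kappa>" and p: "p \<in> falg_set Wd"
  shows "pairh L (thc p) $ 0 = pair0 (\<lambda>w. \<kappa> (map xm (letters w))) p"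
proof -
  have lf: "lie_functional n \<kappa>" using L by (simp add: adm_def)
  have "Poly_Mapping.keys p \<subseteq> Wd" using p by (simp add: falg_set_def)
  then show ?thesis
  proof (induction p rule: pm_induct)
    case (single w c)
    have "spl (prod_list (map yq ws) $ 0) - Poly_Mapping.single (FWord (map xm ws)) 1 \<in> env_ideal n \<and>
        spl (prod_list (map yq ws) $ 0) \<in> EA" if "set ws \<subseteq> {..<2*n}" for ws
      using that
    proof (induction ws)
      case Nil
      show ?case by (simp add: falg_lift_rules FWord_Nil E.J_zero EA.C_one)
    next
      case (Cons a ws)
      have ya: "spl (yq a $ 0) \<in> EA" using Cons.prems yq_C[of a] by (intro spl_EA) (auto simp: ser_set_iff)
      have wE: "Poly_Mapping.single (FWord (map xm ws)) 1 \<in> EA"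
        using Cons.prems xm_sp by (auto simp: falg_set_def words_over_def)
      have m: "spl (prod_list (map yq (a # ws)) $ 0) = spl (yq a $ 0) * spl (prod_list (map yq ws) $ 0)"
        by (simp add: falg_lift_rules)
      have s: "Poly_Mapping.single (FWord (map xm (a # ws))) 1 = letter (xm a) * Poly_Mapping.single (FWord (map xm ws)) 1"
        by (simp add: mult_single plus_fword_def)
      show ?case
        unfolding m s using Cons ya wE by (auto intro!: E.J_mult_cong yq_spec EA.C_mult)
    qed
    from this[of "letters w"] single
    have "spl (prod_list (map yq (letters w)) $ 0) - Poly_Mapping.single (FWord (map xm (letters w))) 1 \<in> env_ideal n"
      by (simp add: words_over_def)
    from lie_functional_env[OF lf this]
    have "pair0 (\<lambda>w. \<kappa> (letters w)) (spl (prod_list (map yq (letters w)) $ 0)) = \<kappa> (map xm (letters w))"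
      by (simp add: pair0_simps)
    then show ?case
      unfolding adm_nth_0[OF L] thc_single by (simp add: falg_lift_rules pair0_simps pair0_cst)
  qed (simp_all add: thc_simps pairh_add pairh_zero pair0_simps)
qed

lemma ent_1: "j < 2*n \<Longrightarrow> ent n i j [x] = x $$ (i,j)"
proof -
  assume j: "j < 2*n"
  have "ent n i j [x] = (\<Sum>k<2*n. if k = j then x $$ (i,k) else 0)" unfolding ent.simps by (intro sum.cong) auto
  then show ?thesis using j by simp
qed

text \<open>First-row entries separate the \<open>v_i\<close> by \<open>vcl_row\<close> and vanish
  on D away from the diagonal, so the values are adjusted one by one after D has been taken care
  of.\<close>

lemma adm_coordinates:
  fixes t :: "nat \<Rightarrow> complex"
  shows "\<exists>L \<kappa>. adm L \<kappa> \<and> \<kappa> [] = 0 \<and> (\<forall>a<2*n. \<kappa> [xm a] = t a)"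
proof -
  have pp: "pp n i < 2*n" "pp n i \<noteq> 0" "pp n i = pp n j \<longleftrightarrow> i = j"
    if "1 \<le> i" "i \<le> 2*n - 1" "1 \<le> j" "j \<le> 2*n - 1" for i j using that by (auto simp: pp_def split: if_splits)
  have "\<exists>L \<kappa>. adm L \<kappa> \<and> \<kappa> [] = 0 \<and> \<kappa> [DD n] = t 0 \<and> (\<forall>i. 1 \<le> i \<longrightarrow> i \<le> 2*n - 1 \<longrightarrow> \<kappa> [vcl n i] = (if i \<le> m then t i else 0))"
    if "m \<le> 2*n - 1" for m
    using that
  proof (induction m)
    case 0
    have d0: "dd n 0 \<noteq> 0" using dd_0[OF n1] symd_pos[of n 1] by simp
    have dn: "dd n n = - dd n 0" using dd_dual[of 0 n] n1 by (simp add: dual_def)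
    \<comment> \<open>The diagonal entries 0 and n of D are opposite, so their difference is twice
      the first one. On the empty word the two entries cancel, and on the nilradical both are
      zero.\<close>
    let ?c = "t 0 / (2 * dd n 0)"
    have n2: "0 < 2*n" "n < 2*n" using n1 by auto
    let ?k = "\<lambda>w. ?c * ent n 0 0 w + (- ?c) * ent n n n w"
    have "adm (\<lambda>w. fps_const ?c * fps_const (ent n 0 0 (map (mx n) (letters w))) +
        fps_const (- ?c) * fps_const (ent n n n (map (mx n) (letters w)))) ?k"
      by (rule adm_lin[OF adm_ent[OF n2(1,1)] adm_ent[OF n2(2,2)]])
    moreover have "?k [] = 0" by simp
    moreover have "?k [DD n] = t 0"
      using n2 d0 unfolding ent_1[OF n2(1)] ent_1[OF n2(2)] DD_mono by (simp add: dn field_simps)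
    moreover have "\<forall>i. 1 \<le> i \<longrightarrow> i \<le> 2*n - 1 \<longrightarrow> ?k [vcl n i] = (if i \<le> 0 then t i else 0)"
      using vcl_row[OF n1] unfolding ent_1[OF n2(1)] ent_1[OF n2(2)] by (simp add: nh_def)
    ultimately show ?case by (intro exI conjI)
  next
    case (Suc m)
    then obtain L \<kappa> where L: "adm L \<kappa>" "\<kappa> [] = 0" "\<kappa> [DD n] = t 0"
      "\<And>i. 1 \<le> i \<Longrightarrow> i \<le> 2*n - 1 \<Longrightarrow> \<kappa> [vcl n i] = (if i \<le> m then t i else 0)" by auto
    let ?j = "pp n (Suc m)"
    have m: "1 \<le> Suc m" "Suc m \<le> 2*n - 1" using Suc.prems by auto
    note pm = pp(1,2)[OF m m]
    have n2: "0 < 2*n" using n1 by simp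
    obtain c where c: "c \<noteq> 0" "\<And>b. b < 2*n \<Longrightarrow> vcl n (Suc m) $$ (0,b) = (if b = ?j then c else 0)"
      using vcl_row[OF n1 m] by blast
    let ?k = "\<lambda>w. 1 * \<kappa> w + (t (Suc m) / c) * ent n 0 ?j w"
    have "adm (\<lambda>w. fps_const 1 * L w + fps_const (t (Suc m) / c) * fps_const (ent n 0 ?j (map (mx n) (letters w)))) ?k"
      by (rule adm_lin[OF L(1) adm_ent[OF n2 pm(1)]])
    moreover have "?k [] = 0" using L(2) pm(2) by simp
    moreover have "?k [DD n] = t 0" using L(3) pm n2 unfolding ent_1[OF pm(1)] DD_mono by simp
    moreover have "?k [vcl n i] = (if i \<le> Suc m then t i else 0)" if i: "1 \<le> i" "i \<le> 2*n - 1" for i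
    proof (cases "i = Suc m")
      case True
      then show ?thesis using L(4)[OF i] c pm unfolding ent_1[OF pm(1)] by simp
    next
      case False
      then have "vcl n i $$ (0, ?j) = 0" using vcl_row[OF n1 i] pp(3)[OF i m] pm(1) by auto
      then show ?thesis using L(4)[OF i] False unfolding ent_1[OF pm(1)] by auto
    qed
    ultimately show ?case by (intro exI[of _ ?k] exI conjI allI impI)
  qed
  from this[of "2*n - 1"] obtain L \<kappa> where L: "adm L \<kappa>" "\<kappa> [] = 0" "\<kappa> [DD n] = t 0"
    "\<And>i. 1 \<le> i \<Longrightarrow> i \<le> 2*n - 1 \<Longrightarrow> \<kappa> [vcl n i] = t i" by auto
  then have "\<forall>a<2*n. \<kappa> [xm a] = t a" by (auto simp: xm_def)
  with L show ?thesis by blast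
qed

lemma adm_top:
  fixes t :: "nat \<Rightarrow> complex"
  shows "\<exists>L \<kappa>. adm L \<kappa> \<and> (\<forall>ws. length ws < d \<longrightarrow> \<kappa> ws = 0) \<and>
    (\<forall>ws. set ws \<subseteq> {..<2*n} \<longrightarrow> length ws = d \<longrightarrow> \<kappa> (map xm ws) = fact d * prod_list (map t ws))"
proof -
  obtain L1 \<phi> where p: "adm L1 \<phi>" "\<phi> [] = 0" "\<And>a. a < 2*n \<Longrightarrow> \<phi> [xm a] = t a"
    using adm_coordinates[of t] by blast
  have "\<exists>L \<kappa>. adm L \<kappa> \<and> (\<forall>ws. length ws < d \<longrightarrow> \<kappa> ws = 0) \<and>
    (\<forall>ws. length ws = d \<longrightarrow> \<kappa> ws = fact d * prod_list (map (\<lambda>x. \<phi> [x]) ws))"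
  proof (induction d)
    case 0
    \<comment> \<open>For d = 0 a functional with value 1 on the empty word is required; a diagonal
      matrix coefficient has it.\<close>
    have "0 < 2*n" using n1 by simp
    then show ?case
      using adm_ent[of 0 0]
      by (intro exI[of _ "\<lambda>w. fps_const (ent n 0 0 (map (mx n) (letters w)))"] exI[of _ "ent n 0 0"]) auto
  next
    case (Suc d)
    then obtain L \<kappa> where L: "adm L \<kappa>" "\<And>ws. length ws < d \<Longrightarrow> \<kappa> ws = 0"
      "\<And>ws. length ws = d \<Longrightarrow> \<kappa> ws = fact d * prod_list (map (\<lambda>x. \<phi> [x]) ws)" by blast
    have "conv \<phi> \<kappa> ws = 0" if "length ws < Suc d" for ws
      using conv_low[of d \<kappa> ws \<phi>] conv_eq[of d \<kappa> ws \<phi>] L(2) p(2) that by (cases "length ws < d") auto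
    moreover have "conv \<phi> \<kappa> ws = fact (Suc d) * prod_list (map (\<lambda>x. \<phi> [x]) ws)" if "length ws = Suc d" for ws
      using conv_top[of \<phi> d \<kappa> "fact d" ws] L p(2) that by (simp add: mult.commute)
    ultimately show ?case using adm_conv[OF p(1) L(1)] by blast
  qed
  then obtain L \<kappa> where L: "adm L \<kappa>" "\<And>ws. length ws < d \<Longrightarrow> \<kappa> ws = 0"
    "\<And>ws. length ws = d \<Longrightarrow> \<kappa> ws = fact d * prod_list (map (\<lambda>x. \<phi> [x]) ws)" by blast
  have eq: "map (\<lambda>x. \<phi> [x]) (map xm ws) = map t ws" if "set ws \<subseteq> {..<2*n}" for ws
    using that p(3) by (auto simp: subset_iff)
  then have "\<kappa> (map xm ws) = fact d * prod_list (map t ws)" if "set ws \<subseteq> {..<2*n}" "length ws = d" for ws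
    using L(3)[of "map xm ws"] that(2) eq[OF that(1)] by (simp only: length_map)
  with L show ?thesis by blast
qed

lemma adm_XS:
  assumes "adm L \<kappa>" "f \<in> XS"
  shows "pairh L f $ 0 = 0"
proof -
  obtain g where "f - fps_X * th g \<in> Uh_ideal n" using assms(2) by (auto simp: XS_def)
  then have "pairh L (f - fps_X * th g) = 0" using assms(1) by (auto simp: adm_def)
  then have "pairh L f = fps_X * pairh L (th g)" by (simp add: pairh_diff pairh_X)
  then show ?thesis by simp
qed

text \<open>Induction on the length: modulo h the top layer is sorted at the cost of shorter words,
  functionals that ignore shorter words show that the sorted layer vanishes, and the rest is covered
  by the induction hypothesis.\<close>

lemma saturation_words:
  "\<lbrakk>p \<in> Lw d; \<And>L \<kappa>. adm L \<kappa> \<Longrightarrow> pairh L (thc p) $ 0 = 0\<rbrakk> \<Longrightarrow> thc p \<in> XS"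
proof (induction d arbitrary: p)
  case 0
  then have "p = 0" by (simp add: Lw_def falg_set_def)
  then show ?case by (simp add: XS_zero)
next
  case (Suc d)
  let ?K = "{w \<in> Poly_Mapping.keys p. length (letters w) = d}"
  \<comment> \<open>Different words may have the same sorted form; their coefficients add up here,
    which is why s is a sum of singles.\<close>
  define s where "s = (\<Sum>w\<in>?K. Poly_Mapping.single (FWord (sort (letters w))) (Poly_Mapping.lookup p w))"
  have keys: "set (letters w) \<subseteq> {..<2*n}" "length (letters w) < Suc d" if "w \<in> Poly_Mapping.keys p" for w
    using Suc.prems(1) that by (auto simp: Lw_def falg_set_def words_over_def)
  have skeys: "\<exists>v\<in>?K. w = FWord (sort (letters v))" if "w \<in> Poly_Mapping.keys s" for w
  proof -
    have "w \<in> (\<Union>v\<in>?K. Poly_Mapping.keys (Poly_Mapping.single (FWord (sort (letters v))) (Poly_Mapping.lookup p v)))"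
      using that keys_sum[of "\<lambda>v. Poly_Mapping.single (FWord (sort (letters v))) (Poly_Mapping.lookup p v)" ?K]
      unfolding s_def by (rule rev_subsetD)
    then show ?thesis by (auto split: if_splits)
  qed
  have sFW: "s \<in> falg_set Wd"
    unfolding s_def by (intro FW.C_sum) (use keys in \<open>auto simp: falg_set_def words_over_def\<close>)
  have "p - s \<in> Ed d"
  proof -
    have ps: "p = (\<Sum>w\<in>Poly_Mapping.keys p. Poly_Mapping.single w (Poly_Mapping.lookup p w))" by (rule pm_sum_singles)
    have "s = (\<Sum>w\<in>Poly_Mapping.keys p. if length (letters w) = d then Poly_Mapping.single (FWord (sort (letters w))) (Poly_Mapping.lookup p w) else 0)"
      unfolding s_def by (simp add: sum.inter_filter)
    then have "p - s = (\<Sum>w\<in>Poly_Mapping.keys p. Poly_Mapping.single w (Poly_Mapping.lookup p w) -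
        (if length (letters w) = d then Poly_Mapping.single (FWord (sort (letters w))) (Poly_Mapping.lookup p w) else 0))"
      using ps by (simp add: sum_subtractf)
    also have "\<dots> \<in> Ed d"
    proof (rule Ed_sum)
      fix w assume w: "w \<in> Poly_Mapping.keys p"
      show "Poly_Mapping.single w (Poly_Mapping.lookup p w) -
        (if length (letters w) = d then Poly_Mapping.single (FWord (sort (letters w))) (Poly_Mapping.lookup p w) else 0) \<in> Ed d"
      proof (cases "length (letters w) = d")
        case True
        have "cst (Poly_Mapping.lookup p w) * (word (letters w) - word (sort (letters w))) \<in> Ed (length (letters w))"
          by (rule Ed_cst[OF Ed_sort[OF keys(1)[OF w]]])
        then show ?thesis using True by (simp add: right_diff_distrib mult_single)
      next
        case False
        then show ?thesis using keys[OF w] by (auto intro!: Ed_Lw Lw_single simp: words_over_def)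
      qed
    qed
    finally show ?thesis .
  qed
  then obtain r where r: "r \<in> Lw d" "thc (p - s - r) \<in> XS" by (auto simp: Ed_def)
  have van: "pairh L (thc s) $ 0 + pairh L (thc r) $ 0 = 0" if "adm L \<kappa>" for L \<kappa>
  proof -
    have "pairh L (thc (p - s - r)) $ 0 = pairh L (thc p) $ 0 - (pairh L (thc s) $ 0 + pairh L (thc r) $ 0)"
      by (simp add: thc_simps pairh_diff)
    then show ?thesis using adm_XS[OF that r(2)] Suc.prems(2)[OF that] by (metis diff_0 neg_0_equal_iff_equal)
  qed
  have "s = 0"
  proof (rule sorted_words_independent[where D = d and N = "2*n"])
    fix w assume "w \<in> Poly_Mapping.keys s"
    then obtain v where "v \<in> ?K" "w = FWord (sort (letters v))" using skeys by blast
    then show "sorted (letters w) \<and> length (letters w) = d \<and> set (letters w) \<subseteq> {..2*n}"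
      using keys(1)[of v] by (auto split: if_splits)
  next
    fix t :: "nat \<Rightarrow> complex"
    obtain L \<kappa> where L: "adm L \<kappa>" "\<And>ws. length ws < d \<Longrightarrow> \<kappa> ws = 0"
      "\<And>ws. set ws \<subseteq> {..<2*n} \<Longrightarrow> length ws = d \<Longrightarrow> \<kappa> (map xm ws) = fact d * prod_list (map t ws)"
      using adm_top[of d t] by blast
    \<comment> \<open>All words of r are shorter than d, so the functional only sees the sorted
      layer.\<close>
    have "pair0 (\<lambda>w. \<kappa> (map xm (letters w))) r = 0"
      using r(1) L(2) by (intro pair0_zero) (auto simp: Lw_def falg_set_def)
    then have "pair0 (\<lambda>w. \<kappa> (map xm (letters w))) s = 0"
      using van[OF L(1)] adm_thc[OF L(1) sFW] adm_thc[OF L(1) Lw_FW[OF r(1)]] by simp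
    moreover have "\<kappa> (map xm (letters w)) = fact d * prod_list (map t (letters w))" if "w \<in> Poly_Mapping.keys s" for w
    proof -
      obtain v where "v \<in> ?K" "w = FWord (sort (letters v))" using skeys[OF \<open>w \<in> Poly_Mapping.keys s\<close>] by blast
      then show ?thesis using keys(1)[of v] by (intro L(3)) (auto split: if_splits)
    qed
    ultimately have "(\<Sum>w\<in>Poly_Mapping.keys s. Poly_Mapping.lookup s w * (fact d * prod_list (map t (letters w)))) = 0"
      by (simp add: pair0_def pm_lin_def)
    then have "fact d * (\<Sum>w\<in>Poly_Mapping.keys s. Poly_Mapping.lookup s w * prod_list (map t (letters w))) = 0"
      by (simp add: sum_distrib_left mult.left_commute)
    then show "(\<Sum>w\<in>Poly_Mapping.keys s. Poly_Mapping.lookup s w * prod_list (map t (letters w))) = 0" by simp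
  qed
  then have "thc r \<in> XS" using van by (intro Suc.IH[OF r(1)]) (auto simp: pairh_zero)
  then show ?case using XS_add[OF r(2)] \<open>s = 0\<close> by (fastforce simp: thc_simps)
qed

text \<open>Everything beyond the constant term of g is already h times an element of the algebra,
  so finite combinations of words suffice.\<close>

lemma saturation:
  assumes g: "g \<in> Ser" and van: "\<And>L \<kappa>. adm L \<kappa> \<Longrightarrow> pairh L (th g) $ 0 = 0"
  shows "\<exists>g'\<in>Ser. th g - fps_X * th g' \<in> Uh_ideal n"
proof -
  let ?p = "g $ 0" and ?q = "fps_shift 1 g"
  have q: "?q \<in> Ser" using g by (simp add: ser_set_def)
  have gq: "g = fps_const ?p + fps_X * ?q"
  proof -
    have "(g - fps_const ?p) $ 0 = 0" by simp
    then have "g - fps_const ?p = fps_X * fps_shift 1 (g - fps_const ?p)" by (rule fps_X_eq_shift)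
    moreover have "fps_shift 1 (g - fps_const ?p) = ?q" by (rule fps_ext) simp
    ultimately show ?thesis by (simp add: algebra_simps)
  qed
  then have t: "th g = thc ?p + fps_X * th ?q" by (metis ser_lift_X ser_lift_add ser_lift_mult)
  obtain d where d: "\<forall>w\<in>Poly_Mapping.keys ?p. length (letters w) < d"
    using finite_nat_set_iff_bounded[of "(\<lambda>w. length (letters w)) ` Poly_Mapping.keys ?p"] by auto
  have "?p \<in> Lw d" using g d by (auto simp: Lw_def ser_set_def falg_set_def)
  moreover have "pairh L (thc ?p) $ 0 = 0" if "adm L \<kappa>" for L \<kappa>
    using van[OF that] unfolding t by (simp add: pairh_add pairh_X)
  ultimately have "thc ?p \<in> XS" by (rule saturation_words)
  then have "th g \<in> XS" unfolding t by (rule XS_add[OF _ XS_X[OF q]])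
  then show ?thesis by (auto simp: XS_def)
qed

lemma saturation_power:
  "\<lbrakk>g \<in> Ser; \<And>L \<kappa> k. adm L \<kappa> \<Longrightarrow> k < m \<Longrightarrow> pairh L (th g) $ k = 0\<rbrakk>
    \<Longrightarrow> \<exists>g'\<in>Ser. th g - fps_X ^ m * th g' \<in> Uh_ideal n"
proof (induction m arbitrary: g)
  case 0
  then show ?case using U.J_zero by (intro bexI[of _ g]) auto
next
  case (Suc m)
  obtain g1 where g1: "g1 \<in> Ser" "th g - fps_X * th g1 \<in> Uh_ideal n"
    using saturation[OF Suc.prems(1)] Suc.prems(2) by blast
  have "pairh L (th g1) $ k = 0" if "adm L \<kappa>" "k < m" for L \<kappa> k
  proof -
    have "pairh L (th g - fps_X * th g1) = 0" using that(1) g1(2) by (auto simp: adm_def)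
    then have "pairh L (th g) = fps_X * pairh L (th g1)" by (simp add: pairh_diff pairh_X)
    then have "pairh L (th g) $ Suc k = pairh L (th g1) $ k" by simp
    then show ?thesis using Suc.prems(2)[OF that(1), of "Suc k"] that(2) by simp
  qed
  then obtain g' where g': "g' \<in> Ser" "th g1 - fps_X ^ m * th g' \<in> Uh_ideal n"
    using Suc.IH[OF g1(1)] by blast
  have "(th g - fps_X * th g1) + fps_X * (th g1 - fps_X ^ m * th g') \<in> Uh_ideal n"
    by (intro U.J_add g1 U.J_l X_C g')
  then have "th g - fps_X ^ Suc m * th g' \<in> Uh_ideal n" by (simp add: algebra_simps)
  then show ?case using g'(1) by blast
qed

text \<open>All representatives of the image of the complete free algebra on D and the
  \<open>v_i\<close>. Unlike \<open>B0\<close> it is explicit; its closedness is what has to be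
  proved.\<close>

definition S0 :: "qgen fword ser set"
  where "S0 = {f \<in> C. \<exists>g\<in>Ser. f - th g \<in> Uh_ideal n}"

text \<open>
  Two approximations of a limit agree modulo \<open>h\<^sup>m\<close>, and saturation allows dividing their difference by \<open>h\<^sup>m\<close>
  within the algebra; hence they can be corrected to a convergent sequence of preimages.
\<close>

lemma closed_S0: "closed S0"
  unfolding closed_fps_iff
proof (intro allI impI)
  fix f assume lim: "\<forall>m. \<exists>h\<in>S0. \<forall>k<m. h $ k = f $ k"
  have fC: "f \<in> C"
    by (rule closed_fpsD[OF closed_ser_set]) (use lim in \<open>unfold S0_def; blast\<close>)
  define near where "near m g \<longleftrightarrow> g \<in> Ser \<and> (\<exists>i\<in>Uh_ideal n. \<exists>r. f - th g - i = fps_X ^ m * r)" for m g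
  have ex: "\<exists>g. near m g" for m
  proof -
    obtain h where h: "h \<in> S0" "\<forall>k<m. h $ k = f $ k" using lim by blast
    then obtain g where g: "g \<in> Ser" "h - th g \<in> Uh_ideal n" by (auto simp: S0_def)
    have "f - h = fps_X ^ m * fps_shift m (f - h)"
      by (rule fps_ext) (use h(2) in \<open>auto simp: fps_X_power_mult_nth\<close>)
    then have "f - th g - (h - th g) = fps_X ^ m * fps_shift m (f - h)" by simp
    with g show ?thesis unfolding near_def by blast
  qed
  have step: "\<exists>g'. near (Suc m) g' \<and> (\<forall>k<m. g' $ k = g $ k)" if g: "near m g" for m g
  proof -
    obtain g1 where g1: "near (Suc m) g1" using ex by blast
    obtain i r where i: "i \<in> Uh_ideal n" "f - th g - i = fps_X ^ m * r" using g by (auto simp: near_def)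
    obtain i1 r1 where i1: "i1 \<in> Uh_ideal n" "f - th g1 - i1 = fps_X ^ Suc m * r1" using g1 by (auto simp: near_def)
    have gS: "g \<in> Ser" "g1 \<in> Ser" using g g1 by (auto simp: near_def)
    \<comment> \<open>The images of two approximations differ by a multiple of \<open>h^m\<close>
      modulo the ideal, so every admissible functional vanishes on the difference to order
      m.\<close>
    have "th (g1 - g) = (f - th g - i) - (f - th g1 - i1) + (i - i1)" by (simp add: ser_lift_diff)
    also have "\<dots> = fps_X ^ m * (r - fps_X * r1) + (i - i1)"
      unfolding i(2) i1(2) by (simp add: right_diff_distrib mult.assoc power_commutes[symmetric])
    finally have e: "th (g1 - g) = fps_X ^ m * (r - fps_X * r1) + (i - i1)" .
    have "pairh L (th (g1 - g)) $ k = 0" if "adm L \<kappa>" "k < m" for L \<kappa> k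
    proof -
      have "pairh L (i - i1) = 0" using that(1) U.J_diff[OF i(1) i1(1)] by (auto simp: adm_def)
      then show ?thesis unfolding e using that(2) by (simp add: pairh_add pairh_X_power fps_X_power_mult_nth)
    qed
    then obtain d where d: "d \<in> Ser" "th (g1 - g) - fps_X ^ m * th d \<in> Uh_ideal n"
      using saturation_power[of "g1 - g" m] Ser.C_diff[OF gS(2,1)] by blast
    \<comment> \<open>The correction begins at order m: lower coefficients stay fixed, which makes
      the sequence converge, and the image now has the quality of \<open>g1\<close>.\<close>
    let ?g = "g + fps_X ^ m * d"
    have thX: "th (fps_X ^ m * d) = fps_X ^ m * th d" by (simp add: ser_lift_mult ser_lift_power)
    have "f - th ?g - (i1 + (th (g1 - g) - fps_X ^ m * th d)) = f - th g1 - i1"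
      by (simp add: ser_lift_add ser_lift_diff thX)
    then have "f - th ?g - (i1 + (th (g1 - g) - fps_X ^ m * th d)) = fps_X ^ Suc m * r1" using i1(2) by simp
    moreover have "i1 + (th (g1 - g) - fps_X ^ m * th d) \<in> Uh_ideal n" by (rule U.J_add[OF i1(1) d(2)])
    moreover have "?g \<in> Ser" by (intro Ser.C_add Ser.C_mult Ser.C_power SerC gS d)
    ultimately have "near (Suc m) ?g" unfolding near_def by blast
    moreover have "\<forall>k<m. ?g $ k = g $ k" by (simp add: fps_X_power_mult_nth)
    ultimately show ?thesis by blast
  qed
  obtain G where G: "\<And>m. near m (G m)" "\<And>m k. k < m \<Longrightarrow> G (Suc m) $ k = G m $ k"
    using dependent_nat_choice[of near "\<lambda>m g g'. \<forall>k<m. g' $ k = g $ k"] ex[of 0] step by metis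
  have mono: "G (m + j) $ k = G m $ k" if "k < m" for m j k
    using that by (induction j) (simp_all add: G(2))
  define g where "g = Abs_fps (\<lambda>k. G (Suc k) $ k)"
  have gG: "g $ k = G m $ k" if "k < m" for k m
    using mono[of k "Suc k" "m - Suc k"] that by (simp add: g_def)
  have gS: "g \<in> Ser" using G(1) by (auto simp: g_def near_def ser_set_iff)
  have "f - th g \<in> Uh_ideal n"
  proof (rule U.J_limit)
    fix m
    obtain i r where i: "i \<in> Uh_ideal n" "f - th (G m) - i = fps_X ^ m * r" using G(1)[of m] by (auto simp: near_def)
    have "G m - g = fps_X ^ m * fps_shift m (G m - g)"
      by (rule fps_ext) (use gG in \<open>auto simp: fps_X_power_mult_nth\<close>)
    then have "th (G m) - th g = fps_X ^ m * th (fps_shift m (G m - g))"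
      by (metis ser_lift_X ser_lift_diff ser_lift_mult ser_lift_power)
    then have "f - th g - i = fps_X ^ m * (r + th (fps_shift m (G m - g)))"
      using i(2) by (simp add: distrib_left algebra_simps)
    with i(1) show "\<exists>h\<in>Uh_ideal n. \<exists>r. f - th g - h = fps_X ^ m * r" by blast
  qed
  with gS fC show "f \<in> S0" by (auto simp: S0_def)
qed

lemma th_S0: "g \<in> Ser \<Longrightarrow> th g \<in> S0"
  by (auto simp: S0_def th_C U.J_zero intro!: bexI[of _ g])

lemma I_S0: "f \<in> Uh_ideal n \<Longrightarrow> f \<in> S0"
  by (auto simp: S0_def U.J_C Ser.C_zero intro!: bexI[of _ 0])

lemma halg_S0: "halg S0"
proof -
  have "subring_set S0"
  proof
    show "1 \<in> S0" using th_S0[OF Ser.C_one] by simp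
    fix f f' assume "f \<in> S0" "f' \<in> S0"
    then obtain g g' where g: "f \<in> C" "f' \<in> C" "g \<in> Ser" "g' \<in> Ser" "f - th g \<in> Uh_ideal n" "f' - th g' \<in> Uh_ideal n"
      by (auto simp: S0_def)
    have "f - f' - th (g - g') = (f - th g) - (f' - th g')" by (simp add: ser_lift_diff)
    then have "f - f' - th (g - g') \<in> Uh_ideal n" using U.J_diff[OF g(5,6)] by (simp only:)
    then show "f - f' \<in> S0" using g by (auto simp: S0_def C.C_diff Ser.C_diff)
    have "f * f' - th (g * g') \<in> Uh_ideal n"
      unfolding ser_lift_mult by (rule U.J_mult_cong[OF g(5,6,1) th_C[OF g(4)]])
    then show "f * f' \<in> S0" using g by (auto simp: S0_def C.C_mult Ser.C_mult)
  qed
  moreover have "scal c \<in> S0" for c using th_S0[OF SerC(1)[of c]] by (simp add: ser_lift_scal)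
  ultimately show ?thesis by (auto simp: halg_def closed_S0 I_S0) (simp add: S0_def)
qed

text \<open>The \<open>H_i\<close> commute modulo the ideal, so the product of the
  \<open>K_i\<close> is \<open>e^(hD)\<close>, the image of an exponential of letter 0.\<close>

lemma K_prod_S0: "K_prod n \<in> S0"
proof -
  let ?x = "\<lambda>i. cst (of_nat (symd n i)) * letter (Hh i) :: qgen falg"
  have FC: "subring_set (falg_set M)" by (rule subring_falg_set[OF submon_words_over])
  have xF: "?x i \<in> falg_set M" if "i \<in> {1..n}" for i
    using that by (intro subring_set.C_mult[OF FC] cst_falg_set letter_falg_set submon_words_over qgens_mem)
  have comm: "fps_const (?x i * y - y * ?x i) \<in> Uh_ideal n" if "i \<in> {1..n}" and y: "y = (\<Sum>j\<in>set js. ?x j)" "set js \<subseteq> {1..n}" for i y js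
  proof -
    have "fps_const (?x i * ?x j - ?x j * ?x i) \<in> Uh_ideal n" if j: "j \<in> {1..n}" for j
    proof -
      let ?a = "of_nat (symd n i) :: complex" and ?b = "of_nat (symd n j) :: complex"
      have "?x i * ?x j - ?x j * ?x i = cst (?a * ?b) * (letter (Hh i) * letter (Hh j) - letter (Hh j) * letter (Hh i))"
        by (simp add: mult_single right_diff_distrib mult.commute del: single_of_nat)
      moreover have "fps_const (letter (Hh i) * letter (Hh j) - letter (Hh j) * letter (Hh i)) \<in> Uh_ideal n"
        using HX_rel(1)[OF \<open>i \<in> {1..n}\<close> j] by (simp add: fps_const_mult fps_const_sub)
      moreover have "fps_const (cst (?a * ?b) * z) = scal (fps_const (?a * ?b)) * fps_const z" for z :: "qgen falg"
        by (simp add: scal_const fps_const_mult)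
      ultimately show ?thesis
        using U.J_scal[of _ "fps_const (?a * ?b)"] by (simp only:)
    qed
    moreover have "fps_const (?x i * y - y * ?x i) = (\<Sum>j\<in>set js. fps_const (?x i * ?x j - ?x j * ?x i))"
      unfolding y by (rule fps_ext) (simp add: fps_sum_nth sum_distrib_left sum_distrib_right sum_subtractf)
    ultimately show ?thesis using y(2) by (auto intro!: U.J_sum)
  qed
  have K: "Kgen n i = exp_ser 1 (?x i)" for i
  proof (rule fps_ext)
    fix k
    let ?d = "of_nat (symd n i) :: complex"
    have "(cst ?d * letter (Hh i)) ^ k = cst (?d ^ k) * letter (Hh i) ^ k"
    proof (induction k)
      case (Suc k)
      have "cst ?d * letter (Hh i) * (cst (?d ^ k) * letter (Hh i) ^ k) =
          cst ?d * (cst (?d ^ k) * (letter (Hh i) * letter (Hh i) ^ k))"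
        by (simp only: mult.assoc central_hom.left[OF central_hom_cst, of "letter (Hh i)"])
      then show ?case using Suc by (simp add: mult.assoc[symmetric] mult_single[of 0 _ 0] del: single_of_nat)
    qed (simp add: single_one)
    then show "Kgen n i $ k = exp_ser 1 (?x i) $ k"
      by (simp add: Kgen_def exp_h_def exp_ser_def mult.assoc[symmetric] mult_single[of 0 _ 0] del: single_of_nat)
  qed
  have "prod_list (map (Kgen n) js) - exp_ser 1 (\<Sum>j\<in>set js. ?x j) \<in> Uh_ideal n"
    if "set js \<subseteq> {1..n}" "distinct js" for js
    using that
  proof (induction js)
    case Nil
    have "exp_ser 1 0 = (1 :: qgen fword ser)" using exp_ser_cst[of 1 0] by (simp add: scal.one)
    then show ?case by (simp add: U.J_zero)
  next
    case (Cons j js)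
    let ?y = "\<Sum>j\<in>set js. ?x j"
    have j: "j \<in> {1..n}" and js: "set js \<subseteq> {1..n}" using Cons.prems by auto
    have yF: "?y \<in> falg_set M" using js xF by (intro subring_set.C_sum[OF FC]) auto
    have 1: "exp_ser 1 (?x j + ?y) - exp_ser 1 (?x j) * exp_ser 1 ?y \<in> Uh_ideal n"
      by (rule U.exp_ser_add[OF const_ser_set[OF xF[OF j]] const_ser_set[OF yF] comm[OF j refl js]])
    have 2: "Kgen n j * (prod_list (map (Kgen n) js) - exp_ser 1 ?y) \<in> Uh_ideal n"
      using Cons js K_C[OF j] by (intro U.J_l) auto
    have s: "(\<Sum>j\<in>set (j # js). ?x j) = ?x j + ?y" using Cons.prems by simp
    have "prod_list (map (Kgen n) (j # js)) - exp_ser 1 (?x j + ?y) =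
        Kgen n j * (prod_list (map (Kgen n) js) - exp_ser 1 ?y) - (exp_ser 1 (?x j + ?y) - exp_ser 1 (?x j) * exp_ser 1 ?y)"
      unfolding K[of j, symmetric] by (simp add: right_diff_distrib)
    then show ?case unfolding s using U.J_diff[OF 2 1] by (simp only:)
  qed
  from this[of "[1..<Suc n]"] have 1: "K_prod n - exp_ser 1 (\<Sum>j=1..n. ?x j) \<in> Uh_ideal n"
    unfolding K_prod_def set_upt atLeastLessThanSuc_atLeastAtMost by (simp del: upt_Suc)
  have y0: "yq 0 = fps_const (\<Sum>j=1..n. ?x j)"
  proof (rule fps_ext)
    fix k
    have "(of_nat d * gen x) $ k = (if k = 0 then cst (of_nat d) * letter x else 0)" for d :: nat and x :: qgen
      by (simp add: fps_of_nat[symmetric])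
    then show "yq 0 $ k = fps_const (\<Sum>j=1..n. ?x j) $ k"
      by (simp add: yq_def K_log_def fps_sum_nth del: single_of_nat)
  qed
  have "exp_h 1 (letter 0) \<in> Ser"
  proof -
    have "letter 0 \<in> falg_set Wd" using n1 by (intro letter_falg_set) auto
    then show ?thesis
      by (auto simp: ser_set_iff exp_h_def intro!: FW.C_mult FW.C_power cst_falg_set submon_words_over)
  qed
  moreover have "th (exp_h 1 (letter 0)) = exp_ser 1 (\<Sum>j=1..n. ?x j)"
    by (rule ser_lift_exp_h) (simp add: falg_lift_simps[OF central_hom_fps_cst] y0)
  ultimately show ?thesis
    unfolding S0_def using 1 K_prod_C
    by (intro CollectI conjI bexI[of _ "exp_h 1 (letter 0)"]) (simp_all del: single_of_nat)
qed

lemma yq_S0: "a < 2*n \<Longrightarrow> yq a \<in> S0"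
  using th_S0[of "fps_const (letter a)"] gen_ser_set[of a "{..<2*n}"] by simp

text \<open>Truncations of g in h give polynomials in the generators, and \<open>B0\<close> is
  closed.\<close>

lemma th_B0:
  assumes "g \<in> Ser"
  shows "th g \<in> B0"
proof -
  have y: "yq a \<in> B0" if "a < 2*n" for a using that B_gens_B0 by (auto simp: yq_def B_gens_def)
  have c: "thc p \<in> B0" if "p \<in> falg_set Wd" for p
  proof -
    have "Poly_Mapping.keys p \<subseteq> Wd" using that by (simp add: falg_set_def)
    then show ?thesis
    proof (induction p rule: pm_induct)
      case (single w c)
      then show ?case
        unfolding thc_single scal_const[symmetric]
        by (intro B0.C_mult B0_scal B0.C_prod_list) (auto simp: words_over_def intro!: y)
    qed (simp_all add: B0.C_zero B0.C_add thc_simps)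
  qed
  have "closed B0" using halg_B0 by (simp add: halg_def)
  then show ?thesis
  proof (rule closed_fpsD)
    fix m
    let ?g = "\<Sum>k<m. fps_X ^ k * fps_const (g $ k)"
    have "?g $ j = g $ j" if "j < m" for j
    proof -
      have "?g $ j = (\<Sum>k<m. if k = j then g $ j else 0)"
        unfolding fps_sum_nth by (intro sum.cong) (auto simp: fps_X_power_mult_nth)
      with that show ?thesis by simp
    qed
    then have "\<forall>j<m. th ?g $ j = th g $ j" by (intro ser_lift_cong_nth) simp
    moreover have "th ?g \<in> B0"
      unfolding ser_lift_sum ser_lift_mult ser_lift_power ser_lift_X
      using assms B0_scal[of fps_X] by (intro B0.C_sum B0.C_mult B0.C_power c) (auto simp: ser_set_iff scal_X)
    ultimately show "\<exists>h\<in>B0. \<forall>k<m. h $ k = th g $ k" by blast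
  qed
qed

lemma B0_eq: "B0 = S0"
proof
  have "vq i \<in> S0" if "1 \<le> i" "i \<le> 2*n - 1" for i using yq_S0[of i] that by (simp add: yq_def split: if_splits)
  moreover have "K_log n \<in> S0" using yq_S0[of 0] n1 by (simp add: yq_def)
  ultimately show "B0 \<subseteq> S0" using K_prod_S0 by (intro B0_least[OF halg_S0]) (auto simp: B_gens_def)
  show "S0 \<subseteq> B0"
  proof
    fix f assume "f \<in> S0"
    then obtain g where g: "g \<in> Ser" "f - th g \<in> Uh_ideal n" by (auto simp: S0_def)
    have "th g + (f - th g) \<in> B0" by (intro B0.C_add th_B0 B0_I g)
    then show "f \<in> B0" by simp
  qed
qed

section \<open>The quantization\<close>

text \<open>The values of admissible functionals at \<open>h = 0\<close> factor through the
  enveloping algebra, so they vanish on an element of zero specialization, and saturation divides it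
  by h inside the algebra.\<close>

lemma kernel_sub_B: "{b \<in> sub_B n. specialization n b = \<zero>\<^bsub>Uenv n\<^esub>} = (\<lambda>b. Uh_cls n (scal fps_X) \<otimes>\<^bsub>Uh n\<^esub> b) ` sub_B n"
proof (intro equalityI subsetI)
  fix b assume "b \<in> {b \<in> sub_B n. specialization n b = \<zero>\<^bsub>Uenv n\<^esub>}"
  then obtain f where f: "b = U.cl f" "f \<in> B0" "specialization n (U.cl f) = \<zero>\<^bsub>E.Q\<^esub>"
    by (auto simp: sub_B_eq Uenv_eq)
  have fC: "f \<in> C" by (rule B0_C[OF f(2)])
  have "spl (f $ 0) \<in> env_ideal n" using f(3) unfolding specialization_cl[OF fC] by (simp add: E.cl_zero_iff)
  then have z: "pairh L f $ 0 = 0" if "adm L \<kappa>" for L \<kappa>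
    unfolding adm_nth_0[OF that] using that by (auto simp: adm_def intro: lie_functional_env)
  obtain g where g: "g \<in> Ser" "f - th g \<in> Uh_ideal n" using f(2) unfolding B0_eq S0_def by blast
  have "pairh L (th g) $ 0 = 0" if "adm L \<kappa>" for L \<kappa>
  proof -
    have "pairh L (f - th g) = 0" using that g(2) by (auto simp: adm_def)
    then show ?thesis using z[OF that] by (simp add: pairh_diff)
  qed
  then obtain g' where g': "g' \<in> Ser" "th g - fps_X * th g' \<in> Uh_ideal n" using saturation[OF g(1)] by blast
  have "f - fps_X * th g' \<in> Uh_ideal n" by (rule U.J_trans[OF g(2) g'(2)])
  then have "b = U.cl (scal fps_X * th g')" unfolding f(1) by (simp add: U.cl_eq_iff scal_X)
  also have "\<dots> = U.cl (scal fps_X) \<otimes>\<^bsub>U.Q\<^esub> U.cl (th g')" by (rule U.Q_mult[OF scal_C th_C[OF g'(1)], symmetric])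
  finally show "b \<in> (\<lambda>b. Uh_cls n (scal fps_X) \<otimes>\<^bsub>Uh n\<^esub> b) ` sub_B n"
    using th_B0[OF g'(1)] by (auto simp: sub_B_eq Uh_eq Uh_cls_eq)
next
  fix b assume "b \<in> (\<lambda>b. Uh_cls n (scal fps_X) \<otimes>\<^bsub>Uh n\<^esub> b) ` sub_B n"
  then obtain f where f: "f \<in> B0" "b = U.cl (scal fps_X) \<otimes>\<^bsub>U.Q\<^esub> U.cl f" by (auto simp: sub_B_eq Uh_eq Uh_cls_eq)
  have fC: "f \<in> C" by (rule B0_C[OF f(1)])
  have b: "b = U.cl (scal fps_X * f)" unfolding f(2) by (rule U.Q_mult[OF scal_C fC])
  have m: "scal fps_X * f \<in> B0" by (intro B0.C_mult B0_scal f)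
  have "specialization n b = E.cl 0"
    unfolding b specialization_cl[OF B0_C[OF m]] by (simp add: falg_lift_rules)
  then show "b \<in> {b \<in> sub_B n. specialization n b = \<zero>\<^bsub>Uenv n\<^esub>}"
    using b m by (auto simp: sub_B_eq Uenv_eq E.Q_zero)
qed

text \<open>Both inclusions are minimality arguments: series specializing into a given subalgebra
  form an \<open>halg\<close>, and the matrices whose letters lie in the image form a Lie
  subalgebra. In either case the generators decide.\<close>

lemma image_sub_B: "specialization n ` sub_B n = Uenv_sub n (sub_h n)"
proof
  have hs: "x \<in> sp n" if "x \<in> sub_h n" for x using lie_subalgebra_sub_h[OF n1] that by (auto simp: lie_subalgebra_def)
  have xh: "xm a \<in> sub_h n" if "a < 2*n" for a
    using h_gens_sub_h[OF n1] that by (auto simp: xm_def h_gens_def)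
  show "specialization n ` sub_B n \<subseteq> Uenv_sub n (sub_h n)"
    unfolding Uenv_sub_def
  proof (rule Inter_greatest)
    fix A assume "A \<in> {A. subring A (Uenv n) \<and> (\<forall>c. env_cls n (cst c) \<in> A) \<and> (\<forall>x\<in>sub_h n. env_cls n (letter x) \<in> A)}"
    then have A: "subring A E.Q" "\<And>c. E.cl (cst c) \<in> A" "\<And>x. x \<in> sub_h n \<Longrightarrow> E.cl (letter x) \<in> A"
      by (auto simp: Uenv_eq env_cls_eq)
    have Ac: "A \<subseteq> carrier E.Q" by (rule subringE(1)[OF A(1)])
    interpret A: subring_set "{p \<in> EA. E.cl p \<in> A}" using A(1) E.subring_Q_iff[OF Ac] by blast
    have zA: "p \<in> env_ideal n \<Longrightarrow> E.cl p \<in> A" for p using A.C_zero E.cl_eq_iff[of p 0] by simp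
    let ?T = "{f \<in> C. E.cl (spl (f $ 0)) \<in> A}"
    have spE: "spl (f $ 0) \<in> EA" if "f \<in> C" for f using that by (intro spl_EA) (auto simp: ser_set_iff)
    have AA: "E.cl (p - q) \<in> A" "E.cl (p * q) \<in> A" if "p \<in> EA" "q \<in> EA" "E.cl p \<in> A" "E.cl q \<in> A" for p q
      using A.C_diff[of p q] A.C_mult[of p q] that by auto
    have "halg ?T"
      unfolding halg_def
    proof (intro conjI)
      show "subring_set ?T"
        by standard (use A.C_one AA spE in \<open>auto simp: C.C_closed falg_lift_rules\<close>)
      show "range scal \<subseteq> ?T" using A(2) by (auto simp: scal_C falg_lift_rules)
      show "Uh_ideal n \<subseteq> ?T" using zA spec_I U.J_C by auto
      show "closed ?T"
        unfolding closed_fps_iff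
      proof (intro allI impI)
        fix f assume *: "\<forall>m. \<exists>g\<in>?T. \<forall>k<m. g $ k = f $ k"
        have "f \<in> C" by (rule closed_fpsD[OF closed_ser_set]) (use * in blast)
        moreover obtain g where "g \<in> ?T" "\<forall>k<1. g $ k = f $ k" using * by blast
        ultimately show "f \<in> ?T" by auto
      qed
    qed auto
    moreover have "B_gens \<subseteq> ?T"
    proof -
      have y: "yq a \<in> ?T" if "a < 2*n" for a
        using yq_spec[OF that] A(3)[OF xh[OF that]] yq_C[OF that] by (auto simp: E.cl_eq_iff[symmetric])
      have "prod_list (map (Kgen n) js) $ 0 = 1" for js
        by (induction js) (simp_all add: K_nth_0)
      then have "K_prod n \<in> ?T"
        using A.C_one K_prod_C by (simp add: K_prod_def falg_lift_rules del: upt_Suc)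
      moreover have "vq i \<in> ?T" if "1 \<le> i" "i \<le> 2*n - 1" for i using y[of i] that by (simp add: yq_def split: if_splits)
      moreover have "K_log n \<in> ?T" using y[of 0] n1 by (simp add: yq_def)
      ultimately show ?thesis by (auto simp: B_gens_def)
    qed
    ultimately have "B0 \<subseteq> ?T" by (rule B0_least)
    then show "specialization n ` sub_B n \<subseteq> A"
      by (auto simp: sub_B_eq specialization_cl B0_C)
  qed
  let ?A = "specialization n ` sub_B n"
  have Aeq: "?A = (\<lambda>f. E.cl (spl (f $ 0))) ` B0"
    unfolding sub_B_eq image_image by (intro image_cong refl specialization_cl B0_C)
  have spE: "spl (f $ 0) \<in> EA" if "f \<in> B0" for f using B0_C[OF that] by (intro spl_EA) (auto simp: ser_set_iff)
  have Ac: "?A \<subseteq> carrier E.Q" unfolding Aeq E.carrier_Q using spE by auto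
  have in_A: "E.cl p \<in> ?A \<longleftrightarrow> (\<exists>f\<in>B0. p - spl (f $ 0) \<in> env_ideal n)" for p
    unfolding Aeq by (auto simp: E.cl_eq_iff[symmetric])
  have A_diff: "E.cl (p - q) \<in> ?A" if pq: "E.cl p \<in> ?A" "E.cl q \<in> ?A" for p q
  proof -
    obtain f g where f: "f \<in> B0" "p - spl (f $ 0) \<in> env_ideal n" "g \<in> B0" "q - spl (g $ 0) \<in> env_ideal n"
      using pq(1,2) unfolding in_A by blast
    have "p - q - spl ((f - g) $ 0) = (p - spl (f $ 0)) - (q - spl (g $ 0))" by (simp add: falg_lift_rules)
    then show ?thesis unfolding in_A using E.J_diff[OF f(2,4)] B0.C_diff[OF f(1,3)] by metis
  qed
  have A_mult: "E.cl (p * q) \<in> ?A" if pq: "E.cl p \<in> ?A" "E.cl q \<in> ?A" "p \<in> EA" "q \<in> EA" for p q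
  proof -
    obtain f g where f: "f \<in> B0" "p - spl (f $ 0) \<in> env_ideal n" "g \<in> B0" "q - spl (g $ 0) \<in> env_ideal n"
      using pq(1,2) unfolding in_A by blast
    have "p * q - spl ((f * g) $ 0) \<in> env_ideal n"
      using E.J_mult_cong[OF f(2,4) pq(3) spE[OF f(3)]] by (simp add: falg_lift_rules)
    then show ?thesis unfolding in_A using B0.C_mult[OF f(1,3)] by blast
  qed
  have A_cst: "E.cl (cst c) \<in> ?A" for c
    unfolding in_A using B0_scal[of "fps_const c"] by (intro bexI[of _ "scal (fps_const c)"]) (auto simp: falg_lift_rules E.J_zero)
  have A_cong: "E.cl q \<in> ?A" if "E.cl p \<in> ?A" "p - q \<in> env_ideal n" for p q
    using that by (metis E.cl_eq_iff)
  have "subring ?A E.Q"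
    unfolding E.subring_Q_iff[OF Ac]
    by standard (use A_cst[of 1] A_diff A_mult in \<open>auto simp: EA.C_closed single_one\<close>)
  moreover have "E.cl (letter x) \<in> ?A" if x: "x \<in> sub_h n" for x
  proof -
    let ?L = "{x \<in> sp n. E.cl (letter x) \<in> ?A}"
    have lE: "letter x \<in> EA" if "x \<in> sp n" for x using that by (rule letter_EA)
    have lin: "E.cl (letter (a \<cdot>\<^sub>m x + b \<cdot>\<^sub>m y)) \<in> ?A" if "x \<in> ?L" "y \<in> ?L" for a b x y
    proof -
      have x: "x \<in> sp n" "y \<in> sp n" using that by auto
      have m: "E.cl (cst a * letter x) \<in> ?A" "E.cl (cst b * letter y) \<in> ?A"
        using that by (intro A_mult A_cst lE cst_EA; simp)+
      have z: "E.cl 0 \<in> ?A" using A_cst[of 0] by simp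
      have "E.cl (cst a * letter x - (0 - cst b * letter y)) \<in> ?A" by (rule A_diff[OF m(1) A_diff[OF z m(2)]])
      then show ?thesis
      proof (rule A_cong)
        show "cst a * letter x - (0 - cst b * letter y) - letter (a \<cdot>\<^sub>m x + b \<cdot>\<^sub>m y) \<in> env_ideal n"
          using E.J_uminus[OF env_lin[OF x, of a b]] by (simp add: algebra_simps)
      qed
    qed
    have "lie_subalgebra n ?L"
      unfolding lie_subalgebra_def
    proof (intro conjI allI ballI)
      have "E.cl 0 \<in> ?A" using A_cst[of 0] by simp
      then show z: "0\<^sub>m (2*n) (2*n) \<in> ?L"
        using A_cong[of 0 "letter (0\<^sub>m (2*n) (2*n))"] E.J_uminus[OF env_zero] by (simp add: sp_zero)
      fix x assume x: "x \<in> ?L"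
      show "c \<cdot>\<^sub>m x \<in> ?L" for c
      proof -
        have "c \<cdot>\<^sub>m x + 0 \<cdot>\<^sub>m x = c \<cdot>\<^sub>m x" by (rule eq_matI) auto
        then show ?thesis using lin[OF x x, of c 0] x by (simp add: sp_smult)
      qed
      fix y assume y: "y \<in> ?L"
      have "1 \<cdot>\<^sub>m z = z" for z :: "complex mat" by (rule eq_matI) auto
      then show "x + y \<in> ?L" using lin[OF x y, of 1 1] x y by (simp add: sp_add)
      have xy: "x \<in> sp n" "y \<in> sp n" using x y by auto
      have "E.cl (letter x * letter y - letter y * letter x) \<in> ?A"
        using x y by (intro A_diff A_mult lE) auto
      then have "E.cl (letter (lie x y)) \<in> ?A" by (rule A_cong[OF _ env_lie[OF xy]])
      then show "lie x y \<in> ?L" using xy by (simp add: sp_lie)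
    qed auto
    moreover have "h_gens n \<subseteq> ?L"
    proof -
      have "xm a \<in> ?L" if a: "a < 2*n" for a
      proof -
        have "yq a \<in> B0" using yq_S0[OF a] by (simp add: B0_eq)
        then have "E.cl (letter (xm a)) \<in> ?A" unfolding in_A using E.J_uminus[OF yq_spec[OF a]] by (intro bexI[of _ "yq a"]) auto
        then show ?thesis using xm_sp[OF a] by simp
      qed
      note xmL = this
      have D: "DD n \<in> ?L" using xmL[of 0] n1 by (simp only: xm_def) simp
      have "vcl n ` {1..2 * n - 1} \<subseteq> ?L"
      proof (rule image_subsetI)
        fix i assume "i \<in> {1..2 * n - 1}"
        then have "i < 2*n" "i \<noteq> 0" by auto
        then show "vcl n i \<in> ?L" using xmL[of i] by (simp only: xm_def if_False)
      qed
      with D show ?thesis unfolding h_gens_def by blast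
    qed
    ultimately show ?thesis using sub_h_least[OF n1] x by blast
  qed
  ultimately show "Uenv_sub n (sub_h n) \<subseteq> ?A"
    unfolding Uenv_sub_def Uenv_eq env_cls_eq using A_cst by (intro Inter_lower) auto
qed

end

theorem theorem5p3:
  fixes n :: nat
  assumes "n \<ge> 1"
  shows "quantization n (sub_h n) (sub_B n)"
proof -
  interpret Bh n by standard (rule assms)
  show ?thesis
    unfolding quantization_def
    using coisotropic_sub_h[OF assms] h_subalgebra_sub_B left_coideal_sub_B kernel_sub_B image_sub_B by blast
qed

end
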